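(* Let $A$ be a real symmetric $n\times n$ matrix with eigenvalues $\lambda^A_1,\dots,\lambda^A_n$ ordered so that $|\lambda^A_1|\le|\lambda^A_2|\le\dots\le|\lambda^A_n|$. For every constant $c>0$ there exists a randomized algorithm that, given $\varepsilon\in(0,1)$, $\delta\ge n^{-c}$, and a real symmetric matrix $A$ with $\mathrm{nnz}$ nonzero integer entries in $[-U,U]$, with success probability at least $1-n^{-c}$ computes $\tilde\lambda\ge0$ such that $$\tilde\lambda\approx_\varepsilon\max\{\delta,|\lambda^A_1|\},$$ and runs in $\tilde O(n^2(\mathrm{nnz}+n)/\varepsilon)$ bit operations using $O(n\log(nU/\varepsilon))$ bits of working space, where $\tilde O$ hides factors $\log^{O(1)}(nU/\varepsilon)$.
   Context: For real $x,y$, $x\approx_\varepsilon y$ means $\mathrm{sgn}(x)=\mathrm{sgn}(y)$ and $e^{-\varepsilon}|y|\le|x|\le e^{\varepsilon}|y|$. Computational model: RAM with read-only input; time in bit operations, space in bits of working space excluding the input.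
   Formalization: In the time and space bounds log(nU/ε) is replaced by log₂(2+nU/ε+δ), because for unbounded δ (or nU/ε near 1) the stated bounds cannot hold; for δ polynomial in nU/ε they agree up to constants. A is given as a list of its nonzero entries, and U≥1. *)

theory Defs
  imports
    "HOL-Probability.Probability"
    "HOL-Library.Log_Nat"
    "Jordan_Normal_Form.Char_Poly"
begin

definition approx_eps :: "real \<Rightarrow> real \<Rightarrow> real \<Rightarrow> bool" where
  "approx_eps \<epsilon> x y \<longleftrightarrow>
     sgn x = sgn y \<and> exp (- \<epsilon>) * \<bar>y\<bar> \<le> \<bar>x\<bar> \<and> \<bar>x\<bar> \<le> exp \<epsilon> * \<bar>y\<bar>"

text \<open>All eigenvalues, repeated according to multiplicity. A real symmetric matrix has such a
  list by the spectral theorem; the list is unique up to reordering entries of equal modulus.\<close>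

definition eigenvalues_by_modulus :: "real mat \<Rightarrow> real list \<Rightarrow> bool" where
  "eigenvalues_by_modulus A ls \<longleftrightarrow>
     char_poly A = (\<Prod>l\<leftarrow>ls. [:- l, 1:]) \<and> sorted (map abs ls)"

definition nonzero_positions :: "real mat \<Rightarrow> (nat \<times> nat) set" where
  "nonzero_positions A = {(i, j). i < dim_row A \<and> j < dim_col A \<and> A $$ (i, j) \<noteq> 0}"

definition nnz :: "real mat \<Rightarrow> nat" where
  "nnz A = card (nonzero_positions A)"

text \<open>Coordinate-list format: each nonzero entry occurs exactly once, in arbitrary order.\<close>

definition sparse_rep :: "real mat \<Rightarrow> (nat \<times> nat \<times> int) list \<Rightarrow> bool" where
  "sparse_rep A es \<longleftrightarrow> distinct es \<and>
     set es = {(i, j, a). (i, j) \<in> nonzero_positions A \<and> A $$ (i, j) = of_int a}"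

text \<open>A random access machine with integer registers, finitely many of which are nonzero at any
  time, a family of read-only input arrays with random access, and fair coin tosses. Direct
  operands are register numbers fixed in the program. \<open>Load r s\<close> is
  \<open>r := mem[mem[s]]\<close>, \<open>Store r s\<close> is \<open>mem[mem[r]] := mem[s]\<close>, and \<open>ReadIn r d s\<close>
  copies cell \<open>mem[s]\<close> of the input array \<open>d\<close> to register \<open>r\<close>. The machine halts
  when the program counter leaves the program.\<close>

datatype instr =
    Const nat int
  | Load nat nat
  | Store nat nat
  | ReadIn nat nat nat
  | Add nat nat nat
  | Sub nat nat nat
  | Mul nat nat nat
  | Quot nat nat nat
  | Toss nat
  | JumpPos nat nat

type_synonym input = "nat \<Rightarrow> nat \<Rightarrow> int"
type_synonym memory = "nat \<Rightarrow> int"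
type_synonym config = "nat \<times> memory"

definition halted :: "instr list \<Rightarrow> config \<Rightarrow> bool" where
  "halted P s \<longleftrightarrow> length P \<le> fst s"

fun exec :: "input \<Rightarrow> bool \<Rightarrow> instr \<Rightarrow> config \<Rightarrow> config" where
  "exec X b (Const r k) (pc, m) = (Suc pc, m(r := k))"
| "exec X b (Load r s) (pc, m) = (Suc pc, m(r := m (nat (m s))))"
| "exec X b (Store r s) (pc, m) = (Suc pc, m(nat (m r) := m s))"
| "exec X b (ReadIn r d s) (pc, m) = (Suc pc, m(r := X d (nat (m s))))"
| "exec X b (Add r s t) (pc, m) = (Suc pc, m(r := m s + m t))"
| "exec X b (Sub r s t) (pc, m) = (Suc pc, m(r := m s - m t))"
| "exec X b (Mul r s t) (pc, m) = (Suc pc, m(r := m s * m t))"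
| "exec X b (Quot r s t) (pc, m) = (Suc pc, m(r := m s div m t))"
| "exec X b (Toss r) (pc, m) = (Suc pc, m(r := of_bool b))"
| "exec X b (JumpPos r l) (pc, m) = (if m r > 0 then l else Suc pc, m)"

text \<open>Length of the signed binary representation.\<close>

definition bits :: "int \<Rightarrow> nat" where
  "bits x = Suc (nat (bitlen \<bar>x\<bar>))"

text \<open>Bit operations per instruction: the lengths of all contents and indirect addresses that are
  handled; for products and quotients, the quadratic cost of the schoolbook procedures.\<close>

fun instr_cost :: "input \<Rightarrow> instr \<Rightarrow> memory \<Rightarrow> nat" where
  "instr_cost X (Const r k) m = bits k"
| "instr_cost X (Load r s) m = bits (m s) + bits (m (nat (m s)))"
| "instr_cost X (Store r s) m = bits (m r) + bits (m s)"
| "instr_cost X (ReadIn r d s) m = bits (m s) + bits (X d (nat (m s)))"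
| "instr_cost X (Add r s t) m = bits (m s) + bits (m t)"
| "instr_cost X (Sub r s t) m = bits (m s) + bits (m t)"
| "instr_cost X (Mul r s t) m = bits (m s) * bits (m t)"
| "instr_cost X (Quot r s t) m = bits (m s) * bits (m t)"
| "instr_cost X (Toss r) m = 1"
| "instr_cost X (JumpPos r l) m = bits (m r)"

text \<open>The coin \<open>\<omega> t\<close> is available in step \<open>t\<close> only, so past coins can be recalled
  only if they were stored in registers.\<close>

primrec run :: "instr list \<Rightarrow> input \<Rightarrow> (nat \<Rightarrow> bool) \<Rightarrow> nat \<Rightarrow> config" where
  "run P X \<omega> 0 = (0, \<lambda>_. 0)"
| "run P X \<omega> (Suc t) =
     (let s = run P X \<omega> t in if halted P s then s else exec X (\<omega> t) (P ! fst s) s)"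

definition step_cost :: "instr list \<Rightarrow> input \<Rightarrow> config \<Rightarrow> nat" where
  "step_cost P X s = (if halted P s then 0 else instr_cost X (P ! fst s) (snd s))"

text \<open>A register holding 0 is free; every other register is charged for its content and for its
  address, as in a table of address-content pairs.\<close>

definition memory_bits :: "memory \<Rightarrow> nat" where
  "memory_bits m = (\<Sum>r | m r \<noteq> 0. bits (int r) + bits (m r))"

definition runs_within ::
  "instr list \<Rightarrow> input \<Rightarrow> (nat \<Rightarrow> bool) \<Rightarrow> real \<Rightarrow> real \<Rightarrow> bool" where
  "runs_within P X \<omega> T S \<longleftrightarrow>
     (\<exists>t. halted P (run P X \<omega> t) \<and>
          real (\<Sum>i<t. step_cost P X (run P X \<omega> i)) \<le> T \<and>
          (\<forall>i\<le>t. real (memory_bits (snd (run P X \<omega> i))) \<le> S))"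

text \<open>The output is the fraction held in registers 0 and 1 on halting.\<close>

definition outputs :: "instr list \<Rightarrow> input \<Rightarrow> (nat \<Rightarrow> bool) \<Rightarrow> real \<Rightarrow> bool" where
  "outputs P X \<omega> v \<longleftrightarrow>
     (\<exists>t. halted P (run P X \<omega> t) \<and> snd (run P X \<omega> t) 1 > 0 \<and>
          v = of_int (snd (run P X \<omega> t) 0) / of_int (snd (run P X \<omega> t) 1))"

definition coins :: "(nat \<Rightarrow> bool) measure" where
  "coins = Pi\<^sub>M UNIV (\<lambda>_. measure_pmf (bernoulli_pmf (1 / 2)))"

text \<open>The digit of weight \<open>2 ^ -(j + 1)\<close> in the binary expansion of \<open>x\<close>.\<close>

definition frac_bit :: "real \<Rightarrow> nat \<Rightarrow> int" where
  "frac_bit x j = \<lfloor>x * 2 ^ Suc j\<rfloor> mod 2"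

text \<open>Input arrays: 0 is the header (dimension, number of nonzero entries, integer part of
  \<open>\<delta>\<close>); 1, 2, 3 are the row indices, column indices and values of the nonzero entries; 4 and 5
  are the fractional binary digits of \<open>\<epsilon>\<close> and \<open>\<delta>\<close>. Thus arbitrary real parameters are
  admitted and the machine inspects as many digits as it needs. The bound on the entries of the
  matrix is not part of the input.\<close>

definition encode_input ::
  "nat \<Rightarrow> real \<Rightarrow> real \<Rightarrow> (nat \<times> nat \<times> int) list \<Rightarrow> input" where
  "encode_input n \<epsilon> \<delta> es d k =
     (if d = 0 then
        (if k = 0 then int n else if k = 1 then int (length es)
         else if k = 2 then \<lfloor>\<delta>\<rfloor> else 0)
      else if d = 1 then (if k < length es then int (fst (es ! k)) else 0)
      else if d = 2 then (if k < length es then int (fst (snd (es ! k))) else 0)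
      else if d = 3 then (if k < length es then snd (snd (es ! k)) else 0)
      else if d = 4 then frac_bit \<epsilon> k
      else if d = 5 then frac_bit \<delta> k
      else 0)"

text \<open>The quantity \<open>log (n U / \<epsilon>)\<close> of the resource bounds. The summand 2 keeps it away from 0
  when \<open>n U / \<epsilon>\<close> is close to 1. The summand \<open>\<delta>\<close> matters only if \<open>\<delta>\<close> is not
  polynomially bounded in \<open>n U / \<epsilon>\<close>: then \<open>\<delta>\<close>, and hence the output, does not fit
  into \<open>O(log (n U / \<epsilon>))\<close> bits.\<close>

definition log_size :: "nat \<Rightarrow> real \<Rightarrow> real \<Rightarrow> real \<Rightarrow> real" where
  "log_size n U \<epsilon> \<delta> = log 2 (2 + real n * U / \<epsilon> + \<delta>)"

end

theory Submission
 imports Defs "HOL-Computational_Algebra.Primes" "HOL-Number_Theory.Residues"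
  "Jordan_Normal_Form.Determinant" "Jordan_Normal_Form.Schur_Decomposition" "Berlekamp_Zassenhaus.Factor_Bound"
begin

text \<open>The squared eigenvalues of the integer matrix \<open>4 ^ s A ^ 2\<close> are approximated from below by an integer
 \<open>y\<close> that starts at \<open>-1\<close> and advances by powers of two. Whether the gap between \<open>y\<close> and the smallest
 root exceeds a step \<open>t\<close> is read off the \<open>b\<close>-th finite difference of \<open>log Q (y - j t)\<close>, where
 \<open>Q z\<close> is the product of \<open>\<mu> - z\<close> over the distinct eigenvalues \<open>\<mu>\<close>. The integer \<open>Q z\<close> is
 computed exactly by the Lanczos recurrence modulo random integers, started at a random vector, and Chinese
 remaindering: a modulus that is prime and divides no Gram determinant gives \<open>Q z\<close>, other moduli either
 are detected (an inversion fails or the recurrence stops early) or still give a correct residue.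
 The bound on \<open>Q z\<close> divided by the modulus collected so far serves as a potential for the failure probability.\<close>

section \<open>Soundness of cost and failure bounds\<close>

text \<open>Squaring makes all roots nonnegative, so with \<open>y\<close> starting at -1 every
  point \<open>y - j t\<close> lies strictly below the spectrum, even for a singular matrix; there
  \<open>Q\<close> is a positive integer. The \<open>b\<close>-th difference of
  \<open>ln (\<mu> - y)\<close> has the order of \<open>(t / (\<mu> - y)) ^ b\<close>. With fewer
  than \<open>2 ^ b\<close> roots the smallest gap decides the sum up to a factor
  \<open>O(b)\<close> in \<open>t\<close>, which suffices for a search over scales. Scaling by
  \<open>4 ^ s\<close> makes the final additive error \<open>256 b\<close> small relative to
  \<delta>. The obstacle is space: a value of \<open>Q\<close> has about \<open>n log\<close> bits
  and fits into a few long registers, but factorisations and exact Krylov vectors do not fit.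
  Residues of a few vectors do, at the price of about \<open>n log\<close> moduli with up to
  \<open>n\<close> sparse products each. Neither the number of distinct eigenvalues nor the
  primality of a modulus is known. Instead the recurrence certifies its own divisors: an invertible
  residue proves that the exact norm is nonzero, so a run whose inversions all succeed is never
  longer than the number of distinct eigenvalues, and the longest runs are the right ones.\<close>

lemma coins_prefix:
 "measure coins {\<omega>. Q (map \<omega> [0..<k])} = real (card {bs. length bs = k & Q bs}) / 2 ^ k"
proof -
 interpret product_prob_space "%_::nat. measure_pmf (bernoulli_pmf (1 / 2))" UNIV
  by unfold_locales
 define E where "E bs = {\<omega> :: nat => bool. map \<omega> [0..<k] = bs}" for bs
 \<comment> \<open>Fixing the first \<open>k\<close> coins is a cylinder set, which supplies both
   measurability and the probability \<open>1 / 2 ^ k\<close>.\<close>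
 have emb: "E bs = prod_emb UNIV (%_. measure_pmf (bernoulli_pmf (1 / 2))) {..<k}
   (Pi\<^sub>E {..<k} (%i. {bs ! i}))" if "length bs = k" for bs
  using that by (auto simp: E_def prod_emb_def space_PiM list_eq_iff_nth_eq PiE_iff restrict_def
    extensional_def)
 have meas: "E bs \<in> sets coins" if "length bs = k" for bs
  unfolding emb[OF that] coins_def by (rule sets_PiM_I) auto
 have half: "measure coins (E bs) = 1 / 2 ^ k" if "length bs = k" for bs
 proof -
  have "measure coins (E bs) =
    (\<Prod>i\<in>{..<k}. measure (measure_pmf (bernoulli_pmf (1 / 2))) {bs ! i})"
   unfolding emb[OF that] coins_def by (rule measure_PiM_emb) auto
  also have "... = (\<Prod>i\<in>{..<k}. 1 / 2)"
  proof (intro prod.cong refl)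
   fix i show "measure (measure_pmf (bernoulli_pmf (1 / 2))) {bs ! i} = 1 / 2"
    by (cases "bs ! i") (simp_all add: measure_pmf_single)
  qed
  finally show ?thesis by (simp add: power_divide)
 qed
 let ?S = "{bs. length bs = k & Q bs}"
 have fin: "finite ?S"
  by (rule finite_subset[OF _ finite_lists_length_eq[of "UNIV :: bool set" k]]) auto
 have "{\<omega>. Q (map \<omega> [0..<k])} = (\<Union>bs\<in>?S. E bs)" by (auto simp: E_def)
 moreover have "measure coins (\<Union>bs\<in>?S. E bs) = (\<Sum>bs\<in>?S. measure coins (E bs))"
  by (rule measure_finite_Union[OF fin])
   (use meas half in \<open>auto simp: disjoint_family_on_def E_def coins_def\<close>)
 ultimately show ?thesis using half by simp
qed

section \<open>Decision trees over the coin tosses\<close>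

definition stp :: "instr list => input => config => bool => config" where
 "stp P X s b = (if halted P s then s else exec X b (P ! fst s) s)"

definition steps :: "instr list => input => config => bool list => config" where
 "steps P X s bs = foldl (stp P X) s bs"

lemma steps_simps [simp]:
 "steps P X s [] = s" "steps P X s (b # bs) = steps P X (stp P X s b) bs"
 by (simp_all add: steps_def)

lemma run_eq_steps: "run P X \<omega> t = steps P X (0, %_. 0) (map \<omega> [0..<t])"
 by (induction t) (auto simp: steps_def stp_def Let_def)

lemma steps_halted: "halted P s ==> steps P X s bs = s"
 by (induction bs) (auto simp: stp_def)

text \<open>A finite decision tree below a configuration: \<open>t\<close> bounds the remaining
  cost, \<open>mk\<close> holds along every branch, and \<open>p\<close> bounds the probability of
  halting outside \<open>gd\<close>. Every instruction consumes one coin, so the tree branches at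
  each step and a deterministic step has two equal subtrees. Inductiveness forces termination on
  every coin sequence; a bound of at least 1 lets a branch end in any state.\<close>

inductive ok ::
 "instr list => input => (memory => bool) => (memory => bool) => config => nat => real => bool"
 for P X mk gd where
 halt: "halted P s ==> mk (snd s) ==> 0 <= p ==> gd (snd s) \<or> 1 <= p ==> ok P X mk gd s t p"
| step: "~ halted P s ==> mk (snd s) ==> (!!b. ok P X mk gd (exec X b (P ! fst s) s) t (q b)) ==>
  (q True + q False) / 2 <= p ==> step_cost P X s + t <= t' ==> ok P X mk gd s t' p"

lemma ok_mono:
 assumes "ok P X mk gd s t p" "t <= t'" "p <= p'"
 shows "ok P X mk gd s t' p'"
 using assms(1)
proof cases
 case halt
 thus ?thesis using assms by (intro ok.halt) auto
next
 case (step t0 q)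
 show ?thesis by (rule ok.step[where q = q and t = t0]) (use step assms in auto)
qed

definition safe_from ::
 "instr list => input => (memory => bool) => config => nat => bool list => bool" where
 "safe_from P X mk s t bs \<longleftrightarrow> halted P (steps P X s bs) &
  (\<Sum>i<length bs. step_cost P X (steps P X s (take i bs))) <= t &
  (\<forall>i\<le>length bs. mk (snd (steps P X s (take i bs))))"

lemma finite_bool_lists: "finite {bs :: bool list. length bs = N & R bs}"
 by (rule finite_subset[OF _ finite_lists_length_eq[of "UNIV :: bool set" N]]) auto

lemma card_bool_lists_Suc:
 "card {bs :: bool list. length bs = Suc N & R bs} =
  card {bs. length bs = N & R (True # bs)} + card {bs. length bs = N & R (False # bs)}"
proof -
 have eq: "{bs :: bool list. length bs = Suc N & R bs} =
   (#) True ` {bs. length bs = N & R (True # bs)} \<union> (#) False ` {bs. length bs = N & R (False # bs)}"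
  (is "?L = ?R")
 proof
  show "?L \<subseteq> ?R"
  proof
   fix bs assume bs: "bs \<in> ?L"
   then obtain b bs' where "bs = b # bs'" by (cases bs) auto
   with bs show "bs \<in> ?R" by (cases b) auto
  qed
 qed auto
 show ?thesis unfolding eq
  by (subst card_Un_disjoint) (auto simp: finite_bool_lists card_image)
qed

text \<open>The tree has finite depth, so from some \<open>N0\<close> on every coin list of length
  \<open>N\<close> drives the machine to a halt. Failing lists are counted by splitting on the first
  coin, which averages the two bounds.\<close>

lemma ok_counting:
 assumes "ok P X mk gd s t p"
 shows "\<exists>N0. \<forall>N\<ge>N0. (\<forall>bs. length bs = N --> safe_from P X mk s t bs) &
  real (card {bs. length bs = N & ~ gd (snd (steps P X s bs))}) <= p * 2 ^ N"
 using assms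
proof induction
 case (halt s p t)
 have "safe_from P X mk s t bs" for bs
  using halt by (auto simp: safe_from_def steps_halted step_cost_def)
 moreover have "real (card {bs. length bs = N & ~ gd (snd (steps P X s bs))}) <= p * 2 ^ N" for N
 proof (cases "gd (snd s)")
  case True thus ?thesis using halt by (simp add: steps_halted)
 next
  case False
  hence p: "p >= 1" using halt by simp
  have "real (card {bs. length bs = N & ~ gd (snd (steps P X s bs))}) <=
    real (card {bs. set bs \<subseteq> (UNIV :: bool set) & length bs = N})"
   by (intro of_nat_mono card_mono finite_lists_length_eq) auto
  also have "... = 2 ^ N" by (subst card_lists_length_eq) (auto simp: card_UNIV_bool)
  also have "... <= p * 2 ^ N" using p by simp
  finally show ?thesis .
 qed
 ultimately show ?case by blast
next
 case (step s t q p t')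
 obtain NT where NT: "\<forall>N\<ge>NT. (\<forall>bs. length bs = N --> safe_from P X mk (exec X True (P ! fst s) s) t bs) &
  real (card {bs. length bs = N & ~ gd (snd (steps P X (exec X True (P ! fst s) s) bs))}) <= q True * 2 ^ N"
  using step.IH[of True] by blast
 obtain NF where NF: "\<forall>N\<ge>NF. (\<forall>bs. length bs = N --> safe_from P X mk (exec X False (P ! fst s) s) t bs) &
  real (card {bs. length bs = N & ~ gd (snd (steps P X (exec X False (P ! fst s) s) bs))}) <= q False * 2 ^ N"
  using step.IH[of False] by blast
 show ?case
 proof (intro exI allI impI conjI)
  fix N assume N: "Suc (max NT NF) <= N"
  then obtain K where K: "N = Suc K" "K >= NT" "K >= NF" by (cases N) auto
  {
   fix bs :: "bool list" assume "length bs = N"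
   then obtain b bs' where bs: "bs = b # bs'" "length bs' = K" using K by (cases bs) auto
   have sf: "safe_from P X mk (exec X b (P ! fst s) s) t bs'"
    using NT NF K bs by (cases b) auto
   have "(\<Sum>i<length bs. step_cost P X (steps P X s (take i bs))) =
    step_cost P X s + (\<Sum>i<length bs'. step_cost P X (steps P X (exec X b (P ! fst s) s) (take i bs')))"
    using step(1) bs by (simp add: sum.lessThan_Suc_shift stp_def del: sum.lessThan_Suc)
   moreover have "mk (snd (steps P X s (take i bs)))" if "i <= length bs" for i
    using that step(1,2) sf bs by (cases i) (auto simp: safe_from_def stp_def)
   ultimately show "safe_from P X mk s t' bs"
    using sf step bs by (auto simp: safe_from_def stp_def)
  }
  have "real (card {bs. length bs = N & ~ gd (snd (steps P X s bs))}) =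
   real (card {bs. length bs = K & ~ gd (snd (steps P X (exec X True (P ! fst s) s) bs))}) +
   real (card {bs. length bs = K & ~ gd (snd (steps P X (exec X False (P ! fst s) s) bs))})"
   using step(1) K by (simp add: card_bool_lists_Suc stp_def)
  also have "... <= q True * 2 ^ K + q False * 2 ^ K" using NT NF K by (intro add_mono) auto
  also have "... = (q True + q False) / 2 * 2 ^ N" using K by (simp add: field_simps)
  also have "... <= p * 2 ^ N" using step by (intro mult_right_mono) auto
  finally show "real (card {bs. length bs = N & ~ gd (snd (steps P X s bs))}) <= p * 2 ^ N" .
 qed
qed

text \<open>A common depth bound \<open>N\<close> makes the success event depend on the first
  \<open>N\<close> coins only, so counting lists of coins becomes a statement about the measure on
  infinite sequences.\<close>

theorem ok_sound:
 assumes "ok P X mk gd (0, %_. 0) t p"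
  and S: "!!m. mk m ==> real (memory_bits m) <= S" and T: "real t <= T"
 shows "runs_within P X \<omega> T S"
  and "measure coins {\<omega>. \<exists>\<tau>. halted P (run P X \<omega> \<tau>) & gd (snd (run P X \<omega> \<tau>))} >= 1 - p"
proof -
 let ?i = "(0, %_. 0) :: config"
 obtain N where N: "!!bs. length bs = N ==> safe_from P X mk ?i t bs"
  and cnt: "real (card {bs. length bs = N & ~ gd (snd (steps P X ?i bs))}) <= p * 2 ^ N"
  using ok_counting[OF assms(1)] by blast
 have tk: "take i (map \<omega> [0..<N]) = map \<omega> [0..<i]" if "i <= N" for i and \<omega> :: "nat => bool"
  using that by (simp add: take_map min_def)
 have sf: "safe_from P X mk ?i t (map \<omega> [0..<N])" for \<omega> using N by simp
 have h: "halted P (run P X \<omega> N)" for \<omega>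
  using sf[of \<omega>] by (simp add: safe_from_def run_eq_steps)
 have "(\<Sum>i<N. step_cost P X (run P X \<omega> i)) =
   (\<Sum>i<length (map \<omega> [0..<N]). step_cost P X (steps P X ?i (take i (map \<omega> [0..<N]))))"
  by (intro sum.cong) (auto simp: run_eq_steps tk)
 hence "(\<Sum>i<N. step_cost P X (run P X \<omega> i)) <= t"
  using sf[of \<omega>] by (simp add: safe_from_def)
 hence "real (\<Sum>i<N. step_cost P X (run P X \<omega> i)) <= T" using T by linarith
 moreover have "mk (snd (run P X \<omega> i))" if "i <= N" for i
  using sf[of \<omega>] that by (auto simp: safe_from_def run_eq_steps tk)
 ultimately show "runs_within P X \<omega> T S"
  unfolding runs_within_def using h S by blast
 \<comment> \<open>Halted configurations are fixed points, so any two halting times yield the same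
   final state.\<close>
 have same: "run P X \<omega> \<tau> = run P X \<omega> \<tau>'"
  if "halted P (run P X \<omega> \<tau>)" "halted P (run P X \<omega> \<tau>')" for \<omega> \<tau> \<tau>'
 proof -
  have *: "run P X \<omega> (\<tau> + k) = run P X \<omega> \<tau>" if "halted P (run P X \<omega> \<tau>)" for \<tau> k
   using that by (induction k) (auto simp: Let_def)
  show ?thesis
  proof (cases "\<tau> <= \<tau>'")
   case True thus ?thesis using *[OF that(1), of "\<tau>' - \<tau>"] by simp
  next
   case False thus ?thesis using *[OF that(2), of "\<tau> - \<tau>'"] by simp
  qed
 qed
 have "{\<omega>. \<exists>\<tau>. halted P (run P X \<omega> \<tau>) & gd (snd (run P X \<omega> \<tau>))} =
   {\<omega>. gd (snd (steps P X ?i (map \<omega> [0..<N])))}"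
  (is "?L = ?R")
 proof (intro equalityI subsetI)
  fix \<omega> assume "\<omega> \<in> ?L"
  then obtain \<tau> where \<tau>: "halted P (run P X \<omega> \<tau>)" "gd (snd (run P X \<omega> \<tau>))" by blast
  have "gd (snd (run P X \<omega> N))" using \<tau>(2) unfolding same[OF \<tau>(1) h] .
  thus "\<omega> \<in> ?R" unfolding run_eq_steps by simp
 next
  fix \<omega> assume "\<omega> \<in> ?R"
  hence "gd (snd (run P X \<omega> N))" unfolding run_eq_steps by simp
  thus "\<omega> \<in> ?L" using h[of \<omega>] by blast
 qed
 hence "measure coins {\<omega>. \<exists>\<tau>. halted P (run P X \<omega> \<tau>) & gd (snd (run P X \<omega> \<tau>))} =
   real (card {bs. length bs = N & gd (snd (steps P X ?i bs))}) / 2 ^ N"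
  using coins_prefix[of "%bs. gd (snd (steps P X ?i bs))" N] by simp
 moreover have "real (card {bs. length bs = N & gd (snd (steps P X ?i bs))}) +
   real (card {bs. length bs = N & ~ gd (snd (steps P X ?i bs))}) = 2 ^ N"
 proof -
  have "card ({bs. length bs = N & gd (snd (steps P X ?i bs))} \<union>
    {bs. length bs = N & ~ gd (snd (steps P X ?i bs))}) =
    card {bs. set bs \<subseteq> (UNIV :: bool set) & length bs = N}"
   by (rule arg_cong[where f = card]) auto
  also have "... = 2 ^ N" by (subst card_lists_length_eq) (auto simp: card_UNIV_bool)
  finally have "card {bs. length bs = N & gd (snd (steps P X ?i bs))} +
   card {bs. length bs = N & ~ gd (snd (steps P X ?i bs))} = 2 ^ N"
   by (subst (asm) card_Un_disjoint) (auto simp: finite_bool_lists)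
  from arg_cong[OF this, of real] show ?thesis by simp
 qed
 ultimately show "measure coins {\<omega>. \<exists>\<tau>. halted P (run P X \<omega> \<tau>) & gd (snd (run P X \<omega> \<tau>))} >= 1 - p"
  using cnt by (simp add: pos_le_divide_eq left_diff_distrib)
qed

section \<open>A structured language over the machine\<close>

text \<open>Registers below 8 may hold long integers, all others only short ones. Register 8 is
  reserved for the modulus of \<open>OMod\<close>; 7 and 59 to 63 are scratch registers of the
  compiled code and of loops.\<close>

datatype op =
  OC nat int
 | OAdd nat nat nat
 | OSub nat nat nat
 | OMul nat nat nat
 | OQuot nat nat nat
 | OIn nat nat nat
 | OMod nat nat
 | OLd nat nat nat
 | OSt nat nat nat

text \<open>The quotient formed by \<open>OMod\<close> is as long as the reduced operand, so its
  scratch register must lie in the same length class.\<close>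

definition tmp :: "nat => nat" where "tmp s = (if s < 8 then 7 else 63)"

fun ocomp :: "op => instr list" where
 "ocomp (OC r k) = [Const r k]"
| "ocomp (OAdd r s t) = [Add r s t]"
| "ocomp (OSub r s t) = [Sub r s t]"
| "ocomp (OMul r s t) = [Mul r s t]"
| "ocomp (OQuot r s t) = [Quot r s t]"
| "ocomp (OIn r d s) = [ReadIn r d s]"
| "ocomp (OMod r s) = [Quot (tmp s) s 8, Mul (tmp s) (tmp s) 8, Sub r s (tmp s)]"
| "ocomp (OLd r a s) = [Const 62 8, Mul 62 62 s, Const 61 (64 + int a), Add 62 62 61, Load r 62]"
| "ocomp (OSt a s r) = [Const 62 8, Mul 62 62 s, Const 61 (64 + int a), Add 62 62 61, Store 62 r]"

datatype com = Ops "op list" | Flip nat | Seq com com | If nat com com | While nat com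

abbreviation Seqs :: "com => com => com" (infixr ";;" 60) where "a ;; b \<equiv> Seq a b"

text \<open>The machine has conditional jumps only; setting register 59 to 1 produces an
  unconditional one. A loop is tested at its end, so that one jump per iteration suffices.\<close>

fun comp :: "nat => com => instr list" where
 "comp pc (Ops os) = concat (map ocomp os)"
| "comp pc (Flip r) = [Toss r]"
| "comp pc (Seq a b) = comp pc a @ comp (pc + length (comp pc a)) b"
| "comp pc (If r a b) =
  (let cb = comp (pc + 1) b; ca = comp (pc + 3 + length cb) a
  in [JumpPos r (pc + 3 + length cb)] @ cb @
    [Const 59 1, JumpPos 59 (pc + 3 + length cb + length ca)] @ ca)"
| "comp pc (While r a) =
  (let ca = comp (pc + 2) a
  in [Const 59 1, JumpPos 59 (pc + 2 + length ca)] @ ca @ [JumpPos r (pc + 2)])"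

definition loaded :: "instr list => nat => instr list => bool" where
 "loaded P pc is \<longleftrightarrow> pc + length is <= length P & (\<forall>i<length is. P ! (pc + i) = is ! i)"

lemma loaded_append:
 "loaded P pc (xs @ ys) \<longleftrightarrow> loaded P pc xs & loaded P (pc + length xs) ys"
proof -
 have "(\<forall>i<length xs + length ys. P ! (pc + i) = (xs @ ys) ! i) \<longleftrightarrow>
  (\<forall>i<length xs. P ! (pc + i) = xs ! i) & (\<forall>i<length ys. P ! (pc + length xs + i) = ys ! i)"
  (is "?L \<longleftrightarrow> ?R")
 proof
  assume L: ?L
  have "P ! (pc + i) = xs ! i" if "i < length xs" for i
   using L[rule_format, of i] that by (simp add: nth_append)
  moreover have "P ! (pc + length xs + i) = ys ! i" if "i < length ys" for i
   using L[rule_format, of "length xs + i"] that by (simp add: nth_append add.assoc)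
  ultimately show ?R by blast
 next
  assume R: ?R
  show ?L
  proof (intro allI impI)
   fix i assume i: "i < length xs + length ys"
   show "P ! (pc + i) = (xs @ ys) ! i"
   proof (cases "i < length xs")
    case True thus ?thesis using R by (simp add: nth_append)
   next
    case False
    hence "i - length xs < length ys" and eq: "pc + length xs + (i - length xs) = pc + i"
     using i by auto
    hence "P ! (pc + length xs + (i - length xs)) = ys ! (i - length xs)" using R by blast
    with False show ?thesis unfolding eq by (simp add: nth_append)
   qed
  qed
 qed
 thus ?thesis by (auto simp: loaded_def)
qed

lemma loaded_Cons: "loaded P pc (i # is) \<longleftrightarrow> pc < length P & P ! pc = i & loaded P (Suc pc) is"
proof -
 have "loaded P pc [i] \<longleftrightarrow> pc < length P & P ! pc = i" by (auto simp: loaded_def)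
 with loaded_append[of P pc "[i]" "is"] show ?thesis by simp
qed

lemma loaded_Nil: "loaded P pc [] \<longleftrightarrow> pc <= length P"
 by (simp add: loaded_def)

text \<open>Eight arrays are interleaved above the 64 registers. An address is then an affine
  function of the index with constant coefficients, and no array base depends on
  \<open>n\<close>.\<close>

definition ar :: "memory => nat => nat => int" where
 "ar m a i = m (64 + 8 * i + a)"

definition aw :: "memory => nat => nat => int => memory" where
 "aw m a i v = m(64 + 8 * i + a := v)"

lemma ar_upd [simp]: "r < 64 ==> ar (m(r := v)) a i = ar m a i"
 by (simp add: ar_def)

lemma aw_reg [simp]: "r < 64 ==> aw m a i v r = m r"
 by (simp add: aw_def)

lemma ar_aw [simp]:
 assumes "a < 8" "b < 8"
 shows "ar (aw m a i v) b j = (if a = b & i = j then v else ar m b j)"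
proof -
 have "64 + 8 * j + b = 64 + 8 * i + a \<longleftrightarrow> a = b & i = j" using assms by presburger
 thus ?thesis by (auto simp: ar_def aw_def)
qed

definition eqx :: "nat set => nat set => memory => memory => bool" where
 "eqx S A m m' \<longleftrightarrow> (\<forall>r<64. r \<notin> S --> m' r = m r) & (\<forall>a<8. a \<notin> A --> (\<forall>i. ar m' a i = ar m a i))"

lemma eqx_refl [simp]: "eqx S A m m" by (simp add: eqx_def)

lemma eqx_trans: "eqx S A m m' ==> eqx S A m' m'' ==> eqx S A m m''"
 by (simp add: eqx_def)

lemma eqx_mono: "eqx S A m m' ==> S \<subseteq> S' ==> A \<subseteq> A' ==> eqx S' A' m m'"
 by (auto simp: eqx_def)

lemma eqx_upd [simp]: "r \<in> S ==> r < 64 ==> eqx S A m (m'(r := v)) \<longleftrightarrow> eqx S A m m'"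
 by (auto simp: eqx_def)

lemma eqx_aw [simp]: "a \<in> A ==> a < 8 ==> eqx S A m (aw m' a i v) \<longleftrightarrow> eqx S A m m'"
 by (auto simp: eqx_def)

lemma eqx_reg: "eqx S A m m' ==> r < 64 ==> r \<notin> S ==> m' r = m r"
 by (simp add: eqx_def)

lemma eqx_ar: "eqx S A m m' ==> a < 8 ==> a \<notin> A ==> ar m' a i = ar m a i"
 by (simp add: eqx_def)

lemma bits_le: "\<bar>x\<bar> < 2 ^ k ==> bits x <= Suc k"
 by (simp add: bits_def bitlen_le_iff_power nat_le_iff)

section \<open>Bounded semantics and Hoare rules with a failure budget\<close>

locale ram =
 fixes X :: input and SB BB n :: nat and gd :: "memory => bool"
 assumes SB: "8 <= SB" "SB <= BB" "64 + 8 * int n < 2 ^ SB"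
begin

text \<open>The space invariant: eight registers of \<open>BB\<close> bits, short contents
  elsewhere, nothing beyond the arrays. With \<open>BB\<close> chosen as \<open>n * SB\<close> this
  is space linear in \<open>n * SB\<close>.\<close>

definition bok :: "memory => bool" where
 "bok m \<longleftrightarrow> (\<forall>r<8. \<bar>m r\<bar> < 2 ^ BB) & (\<forall>r\<ge>8. \<bar>m r\<bar> < 2 ^ SB) & (\<forall>r\<ge>64 + 8 * n. m r = 0)"

text \<open>One quadratic bound for every kind of instruction on short operands; it is the unit in
  which costs are counted, with \<open>qB\<close> as its counterpart for long operands.\<close>

definition qS :: nat where "qS = (2 * SB + 4)\<^sup>2"
definition qB :: nat where "qB = (2 * BB + 4)\<^sup>2"

definition wok :: "nat => int => bool" where
 "wok r v \<longleftrightarrow> r < 64 & \<bar>v\<bar> < 2 ^ (if r < 8 then BB else SB)"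

fun osem :: "op => memory => memory" where
 "osem (OC r k) m = m(r := k)"
| "osem (OAdd r s t) m = m(r := m s + m t)"
| "osem (OSub r s t) m = m(r := m s - m t)"
| "osem (OMul r s t) m = m(r := m s * m t)"
| "osem (OQuot r s t) m = m(r := m s div m t)"
| "osem (OIn r d s) m = m(r := X d (nat (m s)))"
| "osem (OMod r s) m = m(tmp s := m s div m 8 * m 8, r := m s mod m 8)"
| "osem (OLd r a s) m = m(62 := 8 * m s + (64 + int a), 61 := 64 + int a,
   r := ar m a (nat (m s)))"
| "osem (OSt a s r) m = aw (m(62 := 8 * m s + (64 + int a), 61 := 64 + int a)) a (nat (m s)) (m r)"

fun ochk :: "op => memory => bool" where
 "ochk (OC r k) m \<longleftrightarrow> wok r k & \<bar>k\<bar> < 2 ^ SB"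
| "ochk (OAdd r s t) m \<longleftrightarrow> s < 64 & t < 64 & wok r (m s + m t)"
| "ochk (OSub r s t) m \<longleftrightarrow> s < 64 & t < 64 & wok r (m s - m t)"
| "ochk (OMul r s t) m \<longleftrightarrow> s < 64 & t < 64 & wok r (m s * m t)"
| "ochk (OQuot r s t) m \<longleftrightarrow> s < 64 & t < 64 & wok r (m s div m t)"
| "ochk (OIn r d s) m \<longleftrightarrow> s < 64 & wok r (X d (nat (m s))) & \<bar>X d (nat (m s))\<bar> < 2 ^ SB"
| "ochk (OMod r s) m \<longleftrightarrow> s < 64 & r < 64 & 0 < m 8 & s ~= 7 & s ~= 63 & 8 <= r &
   \<bar>m s\<bar> + m 8 < 2 ^ (if s < 8 then BB else SB)"
| "ochk (OLd r a s) m \<longleftrightarrow> 8 <= r & r < 64 & 8 <= s & s < 64 & s ~= 61 & s ~= 62 & 0 <= m s & m s < int n & a < 8"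
| "ochk (OSt a s r) m \<longleftrightarrow> 8 <= r & r < 64 & r ~= 61 & r ~= 62 & 8 <= s & s < 64 & s ~= 61 & s ~= 62 &
   0 <= m s & m s < int n & a < 8"

definition rq :: "nat => nat" where "rq r = (if r < 8 then qB else qS)"
definition rq2 :: "nat => nat => nat" where "rq2 r s = (if r < 8 \<or> s < 8 then qB else qS)"

fun ocost :: "op => nat" where
 "ocost (OC r k) = qS"
| "ocost (OAdd r s t) = rq2 s t"
| "ocost (OSub r s t) = rq2 s t"
| "ocost (OMul r s t) = rq2 s t"
| "ocost (OQuot r s t) = rq2 s t"
| "ocost (OIn r d s) = rq s"
| "ocost (OMod r s) = 3 * rq s"
| "ocost (OLd r a s) = 5 * qS"
| "ocost (OSt a s r) = 5 * qS"

lemma qS_qB: "qS <= qB"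
 using SB by (simp add: qS_def qB_def power2_eq_square mult_le_mono)

lemma bok_bits: assumes "bok m" shows "r >= 8 ==> bits (m r) <= Suc SB" "bits (m r) <= Suc BB"
proof -
 show 1: "bits (m r) <= Suc SB" if "r >= 8" using assms that by (intro bits_le) (auto simp: bok_def)
 show "bits (m r) <= Suc BB"
 proof (cases "r < 8")
  case True thus ?thesis using assms by (intro bits_le) (auto simp: bok_def)
 next
  case False thus ?thesis using 1 SB by simp
 qed
qed

lemma mul_le_q: "a <= Suc k ==> b <= Suc k ==> a * b <= (2 * k + 4)\<^sup>2"
 by (simp add: power2_eq_square mult_le_mono)

lemma add_le_q: "a <= Suc k ==> b <= Suc k ==> a + b <= (2 * k + 4)\<^sup>2"
 by (rule order_trans[of _ "(2 * k + 4) * 1"]) (simp_all only: power2_eq_square, auto)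

lemma one_le_q: "a <= Suc k ==> a <= (2 * k + 4)\<^sup>2"
 using add_le_q[of a k 0] by simp

lemma cost2: assumes "bok m"
 shows "bits (m s) * bits (m t) <= rq2 s t" "bits (m s) + bits (m t) <= rq2 s t"
 using bok_bits[OF assms] by (auto simp: rq2_def qS_def qB_def intro!: mul_le_q add_le_q)

lemma bok_upd: "bok m ==> wok r v ==> bok (m(r := v))"
 by (auto simp: bok_def wok_def)

lemma bok_upd_arr: "bok m ==> 64 <= r ==> r < 64 + 8 * n ==> \<bar>v\<bar> < 2 ^ SB ==> bok (m(r := v))"
 by (auto simp: bok_def)

abbreviation "OK P s t p \<equiv> ok P X bok gd s t p"

lemma ok_ins:
 assumes "pc < length P" "P ! pc = i" "bok m" "exec X True i (pc, m) = s'" "exec X False i (pc, m) = s'"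
  "OK P s' t0 p" "instr_cost X i m <= k"
 shows "OK P (pc, m) (t0 + k) p"
proof (rule ok.step[where q = "%_. p" and t = t0])
 show "OK P (exec X b (P ! fst (pc, m)) (pc, m)) t0 p" for b
  using assms by (cases b) simp_all
qed (use assms in \<open>simp_all add: halted_def step_cost_def\<close>)

lemma bok_osem: "bok m ==> ochk opr m ==> bok (osem opr m)"
proof (cases opr)
 case (OMod r s)
 assume a: "bok m" "ochk opr m"
 define q where "q = m s div m 8"
 have pos: "0 < m 8" and bnd: "\<bar>m s\<bar> + m 8 < 2 ^ (if s < 8 then BB else SB)"
  and s: "s < 64" "s ~= 7" "s ~= 63" and r: "r < 64" "8 <= r" using a OMod by auto
 have md: "0 <= m s mod m 8" "m s mod m 8 < m 8" using pos by auto
 have eq: "m s = q * m 8 + m s mod m 8" by (simp add: q_def)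
 have b1: "\<bar>q * m 8\<bar> <= \<bar>m s\<bar> + m 8" using md eq by linarith
 have m8: "\<bar>m 8\<bar> < 2 ^ SB" using a by (auto simp: bok_def)
 have w1: "wok (tmp s) (q * m 8)" using b1 bnd by (auto simp: wok_def tmp_def)
 have w2: "wok r (m s mod m 8)" using md m8 r by (auto simp: wok_def)
 show ?thesis using bok_upd[OF bok_upd[OF a(1) w1] w2] OMod by (simp add: q_def)
next
 case (OLd r aa s)
 assume a: "bok m" "ochk opr m"
 have w: "wok 62 (8 * m s + (64 + int aa))" "wok 61 (64 + int aa)" "wok r (ar m aa (nat (m s)))"
  using a OLd SB(3) by (auto simp: wok_def ar_def bok_def)
 show ?thesis using bok_upd[OF bok_upd[OF bok_upd[OF a(1) w(1)] w(2)] w(3)] OLd by simp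
next
 case (OSt aa s r)
 assume a: "bok m" "ochk opr m"
 have w: "wok 62 (8 * m s + (64 + int aa))" "wok 61 (64 + int aa)"
  using a OSt SB(3) by (auto simp: wok_def)
 have v: "\<bar>m r\<bar> < 2 ^ SB" "64 + 8 * nat (m s) + aa < 64 + 8 * n"
  using a OSt by (auto simp: bok_def)
 show ?thesis using bok_upd_arr[OF bok_upd[OF bok_upd[OF a(1) w(1)] w(2)] _ v(2,1)] OSt
  by (simp add: aw_def)
qed (auto intro: bok_upd)

lemma ok_op:
 assumes "loaded P pc (ocomp opr)" "bok m" "ochk opr m" "OK P (pc + length (ocomp opr), osem opr m) t0 p"
 shows "OK P (pc, m) (t0 + ocost opr) p"
proof -
 have c1: "bits (m s) + bits (m t) <= rq2 s t" "bits (m s) * bits (m t) <= rq2 s t" for s t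
  using cost2[OF assms(2)] by auto
 have wk: "\<bar>k\<bar> < 2 ^ SB ==> bits k <= qS" for k :: int
  unfolding qS_def by (rule one_le_q, rule bits_le)
 show ?thesis
 proof (cases opr)
  case (OC r k)
  thus ?thesis using assms wk
   by (auto simp: loaded_Cons intro!: ok_ins bok_upd)
 next
  case (OAdd r s t)
  thus ?thesis using assms c1 by (auto simp: loaded_Cons intro!: ok_ins bok_upd)
 next
  case (OSub r s t)
  thus ?thesis using assms c1 by (auto simp: loaded_Cons intro!: ok_ins bok_upd)
 next
  case (OMul r s t)
  thus ?thesis using assms c1 by (auto simp: loaded_Cons intro!: ok_ins bok_upd)
 next
  case (OQuot r s t)
  thus ?thesis using assms c1 by (auto simp: loaded_Cons intro!: ok_ins bok_upd)
 next
  case (OIn r d s)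
  have "bits (m s) + bits (X d (nat (m s))) <= rq s"
  proof (cases "s < 8")
   case True
   have "bits (X d (nat (m s))) <= Suc BB" using bits_le[of "X d (nat (m s))" SB] assms OIn SB by auto
   thus ?thesis using True bok_bits[OF assms(2)] by (simp add: rq_def qB_def add_le_q)
  next
   case False
   have "bits (X d (nat (m s))) <= Suc SB" using bits_le[of "X d (nat (m s))" SB] assms OIn SB by auto
   thus ?thesis using False bok_bits[OF assms(2)] by (simp add: rq_def qS_def add_le_q)
  qed
  thus ?thesis using assms OIn by (auto simp: loaded_Cons intro!: ok_ins bok_upd)
 next
  case (OMod r s)
  define q where "q = m s div m 8"
  let ?t = "tmp s"
  have pos: "0 < m 8" and bnd: "\<bar>m s\<bar> + m 8 < 2 ^ (if s < 8 then BB else SB)"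
   and s: "s < 64" "s ~= 7" "s ~= 63" and r: "r < 64" "8 <= r" using assms OMod by auto
  have tt: "?t < 64" "?t ~= s" "?t ~= 8" "?t < 8 \<longleftrightarrow> s < 8" using s by (auto simp: tmp_def)
  have md: "0 <= m s mod m 8" "m s mod m 8 < m 8" using pos by auto
  have eq: "m s = q * m 8 + m s mod m 8" by (simp add: q_def)
  have b1: "\<bar>q * m 8\<bar> <= \<bar>m s\<bar> + m 8" using md eq by linarith
  have b2: "\<bar>q\<bar> <= \<bar>q * m 8\<bar>" using pos by (simp add: abs_mult mult_le_cancel_left1)
  have w1: "wok ?t q" "wok ?t (q * m 8)" using b1 b2 bnd tt by (auto simp: wok_def)
  have m8: "\<bar>m 8\<bar> < 2 ^ SB" using assms(2) by (auto simp: bok_def)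
  have w2: "wok r (m s mod m 8)" using md m8 r by (auto simp: wok_def)
  let ?m1 = "m(?t := q)" and ?m2 = "m(?t := q * m 8)"
  have bk: "bok ?m1" "bok ?m2" using w1 assms(2) by (auto intro: bok_upd)
  have res: "osem opr m = ?m2(r := m s mod m 8)" using OMod by (simp add: q_def)
  have rr: "rq2 s 8 = rq s" "rq2 ?t 8 = rq s" "rq2 s ?t = rq s"
   using tt by (auto simp: rq2_def rq_def)
  have P: "pc < length P" "P ! pc = Quot ?t s 8" "Suc pc < length P" "P ! Suc pc = Mul ?t ?t 8"
   "Suc (Suc pc) < length P" "P ! Suc (Suc pc) = Sub r s ?t"
   using assms(1) OMod by (auto simp: loaded_Cons)
  have e3: "?m2 s - ?m2 ?t = m s mod m 8" using tt eq by simp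
  have k3: "OK P (Suc (Suc pc), ?m2) (t0 + rq s) p"
   by (rule ok_ins[OF P(5,6) bk(2) refl])
   (use assms(4) OMod res e3 cost2(2)[OF bk(2), of s ?t] rr in \<open>auto simp: numeral_3_eq_3\<close>)
  have k2: "OK P (Suc pc, ?m1) (t0 + rq s + rq s) p"
   by (rule ok_ins[OF P(3,4) bk(1) refl])
   (use k3 tt cost2(1)[OF bk(1), of ?t 8] rr in auto)
  have k1: "OK P (pc, m) (t0 + rq s + rq s + rq s) p"
   by (rule ok_ins[OF P(1,2) assms(2) refl])
   (use k2 cost2(1)[OF assms(2), of s 8] rr in \<open>auto simp: q_def\<close>)
  thus ?thesis by (rule ok_mono) (use OMod in auto)
 next
  case (OLd r a s)
  have s: "0 <= m s" "m s < int n" "s ~= 61" "s ~= 62" "a < 8" "8 <= r" "r < 64" "8 <= s"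
   using assms OLd by auto
  let ?A = "8 * m s + (64 + int a)"
  have a8: "int a < 8" using s by simp
  have A: "\<bar>?A\<bar> < 2 ^ SB" "\<bar>8 * m s\<bar> < 2 ^ SB" "\<bar>64 + int a\<bar> < 2 ^ SB" "\<bar>8::int\<bar> < 2 ^ SB"
   unfolding abs_less_iff using s(1,2) a8 SB(3) by (linarith+)
  define adr where "adr = 64 + 8 * nat (m s) + a"
  have nA: "nat ?A = adr" "adr >= 64" using s by (simp_all add: adr_def nat_add_distrib nat_mult_distrib)
  let ?m1 = "m(62 := 8)" and ?m2 = "m(62 := 8 * m s)"
  let ?m3 = "?m2(61 := 64 + int a)" and ?m4 = "m(62 := ?A, 61 := 64 + int a)"
  have w62: "wok 62 v" "wok 61 v" if "\<bar>v\<bar> < 2 ^ SB" for v using that by (auto simp: wok_def)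
  have bk: "bok ?m1" "bok ?m2"
   by (rule bok_upd[OF assms(2) w62(1)[OF A(4)]], rule bok_upd[OF assms(2) w62(1)[OF A(2)]])
  have bk3: "bok ?m3" by (rule bok_upd[OF bk(2) w62(2)[OF A(3)]])
  have bk4: "bok ?m4" by (rule bok_upd[OF bok_upd[OF assms(2) w62(1)[OF A(1)]] w62(2)[OF A(3)]])
  have vb: "\<bar>m (64 + 8 * nat (m s) + a)\<bar> < 2 ^ SB" using assms(2) by (auto simp: bok_def)
  have res: "osem opr m = ?m4(r := m (64 + 8 * nat (m s) + a))" using OLd by (simp add: ar_def)
  have P: "pc < length P" "P ! pc = Const 62 8" "Suc pc < length P" "P ! Suc pc = Mul 62 62 s"
   "Suc (Suc pc) < length P" "P ! Suc (Suc pc) = Const 61 (64 + int a)"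
   "Suc (Suc (Suc pc)) < length P" "P ! Suc (Suc (Suc pc)) = Add 62 62 61"
   "Suc (Suc (Suc (Suc pc))) < length P" "P ! Suc (Suc (Suc (Suc pc))) = Load r 62"
   using assms(1) OLd by (auto simp: loaded_Cons)
  have q: "rq2 62 s = qS" "rq2 62 61 = qS" using s by (auto simp: rq2_def)
  have len: "pc + length (ocomp opr) = Suc (Suc (Suc (Suc (Suc pc))))" using OLd by simp
  have ex: "exec X b (Load r 62) (Suc (Suc (Suc (Suc pc))), ?m4) =
    (Suc (Suc (Suc (Suc (Suc pc)))), osem opr m)" for b
   unfolding exec.simps res adr_def[symmetric] using nA by (simp add: nA(1))
  have "bits (?m4 62) + bits (?m4 (nat (?m4 62))) <= qS"
   unfolding qS_def using bok_bits(1)[OF bk4, of 62] bok_bits(1)[OF bk4, of "nat (?m4 62)"] nA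
   by (intro add_le_q) (auto simp: nA(1))
  hence k5: "OK P (Suc (Suc (Suc (Suc pc))), ?m4) (t0 + qS) p"
   by (intro ok_ins[OF P(9,10) bk4 ex ex assms(4)[unfolded len]]) simp
  have k4: "OK P (Suc (Suc (Suc pc)), ?m3) (t0 + qS + qS) p"
  proof -
   have ex4: "exec X b (Add 62 62 61) (Suc (Suc (Suc pc)), ?m3) = (Suc (Suc (Suc (Suc pc))), ?m4)" for b
    by (auto simp: fun_eq_iff)
   show ?thesis by (rule ok_ins[OF P(7,8) bk3 ex4 ex4 k5]) (use cost2(2)[OF bk3, of 62 61] q in simp)
  qed
  have k3: "OK P (Suc (Suc pc), ?m2) (t0 + qS + qS + qS) p"
   by (rule ok_ins[OF P(5,6) bk(2) refl]) (use k4 wk A in auto)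
  have k2: "OK P (Suc pc, ?m1) (t0 + qS + qS + qS + qS) p"
   by (rule ok_ins[OF P(3,4) bk(1) refl]) (use k3 s cost2(1)[OF bk(1), of 62 s] q in auto)
  have k1: "OK P (pc, m) (t0 + qS + qS + qS + qS + qS) p"
   by (rule ok_ins[OF P(1,2) assms(2) refl]) (use k2 wk A in auto)
  thus ?thesis by (rule ok_mono) (use OLd in auto)
 next
  case (OSt a s r)
  have s: "0 <= m s" "m s < int n" "s ~= 61" "s ~= 62" "a < 8" "8 <= r" "r < 64" "r ~= 61" "r ~= 62" "8 <= s"
   using assms OSt by auto
  let ?A = "8 * m s + (64 + int a)"
  have a8: "int a < 8" using s by simp
  have A: "\<bar>?A\<bar> < 2 ^ SB" "\<bar>8 * m s\<bar> < 2 ^ SB" "\<bar>64 + int a\<bar> < 2 ^ SB" "\<bar>8::int\<bar> < 2 ^ SB"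
   unfolding abs_less_iff using s(1,2) a8 SB(3) by (linarith+)
  define adr where "adr = 64 + 8 * nat (m s) + a"
  have nA: "nat ?A = adr" "adr >= 64" using s by (simp_all add: adr_def nat_add_distrib nat_mult_distrib)
  have lt: "64 + 8 * nat (m s) + a < 64 + 8 * n" using s by linarith
  let ?m1 = "m(62 := 8)" and ?m2 = "m(62 := 8 * m s)"
  let ?m3 = "?m2(61 := 64 + int a)" and ?m4 = "m(62 := ?A, 61 := 64 + int a)"
  have w62: "wok 62 v" "wok 61 v" if "\<bar>v\<bar> < 2 ^ SB" for v using that by (auto simp: wok_def)
  have bk: "bok ?m1" "bok ?m2"
   by (rule bok_upd[OF assms(2) w62(1)[OF A(4)]], rule bok_upd[OF assms(2) w62(1)[OF A(2)]])
  have bk3: "bok ?m3" by (rule bok_upd[OF bk(2) w62(2)[OF A(3)]])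
  have bk4: "bok ?m4" by (rule bok_upd[OF bok_upd[OF assms(2) w62(1)[OF A(1)]] w62(2)[OF A(3)]])
  have vb: "\<bar>m r\<bar> < 2 ^ SB" using assms(2) s by (auto simp: bok_def)
  have res: "osem opr m = ?m4(64 + 8 * nat (m s) + a := m r)" using OSt by (simp add: aw_def)
  have P: "pc < length P" "P ! pc = Const 62 8" "Suc pc < length P" "P ! Suc pc = Mul 62 62 s"
   "Suc (Suc pc) < length P" "P ! Suc (Suc pc) = Const 61 (64 + int a)"
   "Suc (Suc (Suc pc)) < length P" "P ! Suc (Suc (Suc pc)) = Add 62 62 61"
   "Suc (Suc (Suc (Suc pc))) < length P" "P ! Suc (Suc (Suc (Suc pc))) = Store 62 r"
   using assms(1) OSt by (auto simp: loaded_Cons)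
  have q: "rq2 62 s = qS" "rq2 62 61 = qS" "rq2 62 r = qS" using s by (auto simp: rq2_def)
  have len: "pc + length (ocomp opr) = Suc (Suc (Suc (Suc (Suc pc))))" using OSt by simp
  have ex: "exec X b (Store 62 r) (Suc (Suc (Suc (Suc pc))), ?m4) =
    (Suc (Suc (Suc (Suc (Suc pc)))), osem opr m)" for b
   unfolding exec.simps res adr_def[symmetric] using nA s by (simp add: nA(1))
  have k5: "OK P (Suc (Suc (Suc (Suc pc))), ?m4) (t0 + qS) p"
   by (rule ok_ins[OF P(9,10) bk4 ex ex assms(4)[unfolded len]])
    (use cost2(2)[OF bk4, of 62 r] q in simp)
  have k4: "OK P (Suc (Suc (Suc pc)), ?m3) (t0 + qS + qS) p"
  proof -
   have ex4: "exec X b (Add 62 62 61) (Suc (Suc (Suc pc)), ?m3) = (Suc (Suc (Suc (Suc pc))), ?m4)" for b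
    by (auto simp: fun_eq_iff)
   show ?thesis by (rule ok_ins[OF P(7,8) bk3 ex4 ex4 k5]) (use cost2(2)[OF bk3, of 62 61] q in simp)
  qed
  have k3: "OK P (Suc (Suc pc), ?m2) (t0 + qS + qS + qS) p"
   by (rule ok_ins[OF P(5,6) bk(2) refl]) (use k4 wk A in auto)
  have k2: "OK P (Suc pc, ?m1) (t0 + qS + qS + qS + qS) p"
   by (rule ok_ins[OF P(3,4) bk(1) refl]) (use k3 s cost2(1)[OF bk(1), of 62 s] q in auto)
  have k1: "OK P (pc, m) (t0 + qS + qS + qS + qS + qS) p"
   by (rule ok_ins[OF P(1,2) assms(2) refl]) (use k2 wk A in auto)
  thus ?thesis by (rule ok_mono) (use OSt in auto)
 qed
qed

text \<open>Weakest preconditions with an arbitrary continuation after \<open>c\<close>. The number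
  \<open>p\<close> is a budget of failure probability: a random command may leave different budgets
  \<open>q\<close> on its branches as long as their mean is at most \<open>p\<close>. Probabilistic
  reasoning thus becomes arithmetic on budgets.\<close>

definition hoare :: "com => memory => nat => real => (memory => real => bool) => bool" where
 "hoare c m t p Q \<longleftrightarrow> (bok m --> (\<forall>P pc t0. loaded P pc (comp pc c) -->
  (\<forall>m' q. bok m' --> Q m' q --> OK P (pc + length (comp pc c), m') t0 q) -->
  OK P (pc, m) (t0 + t) p))"

lemma hoareI:
 assumes "!!P pc t0. bok m ==> loaded P pc (comp pc c) ==>
  (!!m' q. bok m' ==> Q m' q ==> OK P (pc + length (comp pc c), m') t0 q) ==> OK P (pc, m) (t0 + t) p"
 shows "hoare c m t p Q"
 using assms unfolding hoare_def by blast

lemma hoareD: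
 assumes "hoare c m t p Q" "bok m" "loaded P pc (comp pc c)"
  "!!m' q. bok m' ==> Q m' q ==> OK P (pc + length (comp pc c), m') t0 q"
 shows "OK P (pc, m) (t0 + t) p"
 using assms unfolding hoare_def by blast

lemma hoare_bok: "(bok m ==> hoare c m t p Q) ==> hoare c m t p Q"
 unfolding hoare_def by blast

lemma hoare_mono:
 assumes "hoare c m t p Q" "t <= t'" "p <= p'" "!!m' q. bok m' ==> Q m' q ==> Q' m' q"
 shows "hoare c m t' p' Q'"
proof (rule hoareI)
 fix P pc t0
 assume a: "bok m" "loaded P pc (comp pc c)"
  "!!m' q. bok m' ==> Q' m' q ==> OK P (pc + length (comp pc c), m') t0 q"
 have "OK P (pc, m) (t0 + t) p" by (rule hoareD[OF assms(1) a(1,2)]) (use a(3) assms(4) in blast)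
 thus "OK P (pc, m) (t0 + t') p'" by (rule ok_mono) (use assms in auto)
qed

lemma hoare_seq:
 assumes "hoare a m ta p Q" "!!m' q. bok m' ==> Q m' q ==> hoare b m' tb q R"
 shows "hoare (a ;; b) m (ta + tb) p R"
proof (rule hoareI)
 fix P pc t0
 assume h: "bok m" "loaded P pc (comp pc (a ;; b))"
  "!!m' q. bok m' ==> R m' q ==> OK P (pc + length (comp pc (a ;; b)), m') t0 q"
 have l: "loaded P pc (comp pc a)" "loaded P (pc + length (comp pc a)) (comp (pc + length (comp pc a)) b)"
  using h(2) by (auto simp: loaded_append)
 have "OK P (pc, m) (t0 + tb + ta) p"
 proof (rule hoareD[OF assms(1) h(1) l(1)])
  fix m' q assume q: "bok m'" "Q m' q"
  show "OK P (pc + length (comp pc a), m') (t0 + tb) q"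
   by (rule hoareD[OF assms(2)[OF q] q(1) l(2)]) (use h(3) in \<open>simp add: add.assoc\<close>)
 qed
 thus "OK P (pc, m) (t0 + (ta + tb)) p" by (simp add: ac_simps)
qed

fun osems :: "op list => memory => memory" where
 "osems [] m = m"
| "osems (x # xs) m = osems xs (osem x m)"

fun ochks :: "op list => memory => bool" where
 "ochks [] m = True"
| "ochks (x # xs) m \<longleftrightarrow> ochk x m & ochks xs (osem x m)"

fun ocosts :: "op list => nat" where
 "ocosts [] = 0"
| "ocosts (x # xs) = ocost x + ocosts xs"

lemma hoare_ops:
 assumes "bok m ==> ochks os m" "ocosts os <= t" "bok m ==> bok (osems os m) ==> Q (osems os m) p"
 shows "hoare (Ops os) m t p Q"
proof -
 have "hoare (Ops os) m (ocosts os) p (%m' q. m' = osems os m & q = p)" if "bok m" "ochks os m"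
  using that
 proof (induction os arbitrary: m)
  case Nil
  show ?case by (rule hoareI) auto
 next
  case (Cons x xs)
  have b: "bok (osem x m)" using Cons.prems bok_osem by auto
  have IH: "hoare (Ops xs) (osem x m) (ocosts xs) p (%m' q. m' = osems xs (osem x m) & q = p)"
   by (rule Cons.IH[OF b]) (use Cons.prems in auto)
  show ?case
  proof (rule hoareI)
   fix P pc t0
   assume h: "bok m" "loaded P pc (comp pc (Ops (x # xs)))" "!!m' q. bok m' ==> m' = osems (x # xs) m & q = p ==>
    OK P (pc + length (comp pc (Ops (x # xs))), m') t0 q"
   have l: "loaded P pc (ocomp x)" "loaded P (pc + length (ocomp x)) (comp (pc + length (ocomp x)) (Ops xs))"
    using h(2) by (auto simp: loaded_append)
   have "OK P (pc + length (ocomp x), osem x m) (t0 + ocosts xs) p"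
    by (rule hoareD[OF IH b l(2)]) (use h(3) in \<open>simp add: add.assoc\<close>)
   from ok_op[OF l(1) h(1) _ this] Cons.prems
   show "OK P (pc, m) (t0 + ocosts (x # xs)) p" by (simp add: ac_simps)
  qed
 qed
 note main = this
 show ?thesis
 proof (rule hoare_bok)
  assume b: "bok m"
  show ?thesis
   by (rule hoare_mono[OF main[OF b assms(1)[OF b]] assms(2) order_refl]) (use assms(3) b in simp)
 qed
qed

lemma jump_cost: "bok m ==> bits (m r) <= rq r"
 using bok_bits[of m r] by (auto simp: rq_def qS_def qB_def intro!: one_le_q)

lemma one_small [simp]: "(1::int) < 2 ^ SB" "k <= 255 ==> k < (2::int) ^ SB"
proof -
 have *: "(2::int) ^ 8 <= 2 ^ SB" using SB by (intro power_increasing) auto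
 thus "(1::int) < 2 ^ SB" by simp
 show "k <= 255 ==> k < (2::int) ^ SB" using * by simp
qed

lemma bok59: "bok m ==> bok (m(59 := 1))"
 by (rule bok_upd) (auto simp: wok_def)

lemma const_cost: "bits 1 <= qS"
 unfolding qS_def by (rule one_le_q, rule bits_le) simp

lemma ok_jump:
 assumes "pc < length P" "P ! pc = JumpPos r l" "bok m"
  "OK P (if m r > 0 then l else Suc pc, m) t0 p"
 shows "OK P (pc, m) (t0 + rq r) p"
 by (rule ok_ins[OF assms(1-3) refl]) (use assms jump_cost[OF assms(3)] in auto)

text \<open>The second branch ends with the jump over the first one and thereby overwrites register
  59, hence the updated memory in its postcondition.\<close>

lemma hoare_if:
 assumes "bok m ==> m r > 0 ==> hoare a m t p Q"
  "bok m ==> m r <= 0 ==> hoare b m t p (%m' q. Q (m'(59 := 1)) q)"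
 shows "hoare (If r a b) m (rq r + 2 * qS + t) p Q"
proof (rule hoareI)
 fix P pc t0
 define cb where "cb = comp (pc + 1) b"
 define ca where "ca = comp (pc + 3 + length cb) a"
 assume h: "bok m" "loaded P pc (comp pc (If r a b))"
  "!!m' q. bok m' ==> Q m' q ==> OK P (pc + length (comp pc (If r a b)), m') t0 q"
 have c: "comp pc (If r a b) = [JumpPos r (pc + 3 + length cb)] @ cb @
    [Const 59 1, JumpPos 59 (pc + 3 + length cb + length ca)] @ ca"
  by (simp add: cb_def ca_def Let_def)
 note l = h(2)[unfolded c loaded_append loaded_Cons loaded_Nil, simplified]
 have fin: "OK P (pc + 3 + length cb + length ca, m') t0 q" if "bok m'" "Q m' q" for m' q
  using h(3)[OF that] unfolding c by (simp add: algebra_simps numeral_2_eq_2 numeral_3_eq_3)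
 show "OK P (pc, m) (t0 + (rq r + 2 * qS + t)) p"
 proof (cases "m r > 0")
  case True
  have "OK P (pc + 3 + length cb, m) (t0 + t) p"
  proof (rule hoareD[OF assms(1)[OF h(1) True] h(1)])
   show "loaded P (pc + 3 + length cb) (comp (pc + 3 + length cb) a)"
    using l by (simp add: ca_def numeral_2_eq_2 numeral_3_eq_3)
   show "OK P (pc + 3 + length cb + length (comp (pc + 3 + length cb) a), m') t0 q" if "bok m'" "Q m' q" for m' q
    using fin[OF that] by (simp add: ca_def)
  qed
  hence "OK P (pc, m) (t0 + t + rq r) p"
   by (intro ok_jump) (use True l h in auto)
  thus ?thesis by (rule ok_mono) auto
 next
  case False
  hence F: "m r <= 0" by simp
  have "OK P (Suc pc, m) (t0 + rq 59 + qS + t) p"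
  proof (rule hoareD[OF assms(2)[OF h(1) F] h(1)])
   show "loaded P (Suc pc) (comp (Suc pc) b)" using l by (simp add: cb_def)
   fix m' q assume q: "bok m'" "Q (m'(59 := 1)) q"
   have b: "bok (m'(59 := 1))" by (rule bok59[OF q(1)])
   have "OK P (Suc (Suc pc + length cb), m'(59 := 1)) (t0 + rq 59) q"
    by (rule ok_jump[where l = "pc + 3 + length cb + length ca"])
     (use l b fin[OF b q(2)] in auto)
   hence "OK P (Suc pc + length cb, m') (t0 + rq 59 + qS) q"
    by (intro ok_ins[where i = "Const 59 1"]) (use l q const_cost in auto)
   thus "OK P (Suc pc + length (comp (Suc pc) b), m') (t0 + rq 59 + qS) q"
    by (simp add: cb_def)
  qed
  hence "OK P (pc, m) (t0 + rq 59 + qS + t + rq r) p"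
   by (intro ok_jump) (use False l h in auto)
  thus ?thesis by (rule ok_mono) (auto simp: rq_def)
 qed
qed

text \<open>The rule that redistributes the budget: one outcome may receive more than
  \<open>p\<close> if the other receives correspondingly less.\<close>

lemma hoare_flip:
 assumes "8 <= r" "r < 64" "Q (m(r := 0)) p0" "Q (m(r := 1)) p1" "(p0 + p1) / 2 <= p"
 shows "hoare (Flip r) m qS p Q"
proof (rule hoareI)
 fix P pc t0
 assume h: "bok m" "loaded P pc (comp pc (Flip r))"
  "!!m' q. bok m' ==> Q m' q ==> OK P (pc + length (comp pc (Flip r)), m') t0 q"
 have P: "pc < length P" "P ! pc = Toss r" using h(2) by (auto simp: loaded_Cons)
 have b: "bok (m(r := 0))" "bok (m(r := 1))" using h(1) assms by (auto intro!: bok_upd simp: wok_def)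
 have q: "1 <= qS" by (simp add: qS_def power2_eq_square)
 show "OK P (pc, m) (t0 + qS) p"
 proof (rule ok.step[where q = "%b. if b then p1 else p0" and t = t0])
  fix bb
  show "OK P (exec X bb (P ! fst (pc, m)) (pc, m)) t0 (if bb then p1 else p0)"
   using P h(3)[OF b(1) assms(3)] h(3)[OF b(2) assms(4)] by (cases bb) auto
 qed (use P h assms q in \<open>auto simp: halted_def step_cost_def\<close>)
qed

text \<open>The index of \<open>I\<close> bounds the remaining iterations and so pays for the
  running time; the loop may be left early. Entering it sets register 59, which the initial
  invariant has to tolerate.\<close>

lemma hoare_while:
 assumes r: "8 <= r" "r < 64"
  and body: "!!j m p. bok m ==> I (Suc j) m p ==> m r > 0 ==> hoare c m tb p (I j)"
  and zero: "!!m p. bok m ==> I 0 m p ==> m r <= 0"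
  and post: "!!j m p. bok m ==> I j m p ==> m r <= 0 ==> Q m p"
  and start: "I N (m(59 := 1)) p"
 shows "hoare (While r c) m (N * (tb + qS) + 3 * qS) p Q"
proof (rule hoareI)
 fix P pc t0
 define ca where "ca = comp (pc + 2) c"
 assume h: "bok m" "loaded P pc (comp pc (While r c))"
  "!!m' q. bok m' ==> Q m' q ==> OK P (pc + length (comp pc (While r c)), m') t0 q"
 have cc: "comp pc (While r c) = [Const 59 1, JumpPos 59 (pc + 2 + length ca)] @ ca @ [JumpPos r (pc + 2)]"
  by (simp add: ca_def Let_def)
 note l = h(2)[unfolded cc loaded_append loaded_Cons loaded_Nil, simplified]
 have rqr: "rq r = qS" "rq 59 = qS" using r by (auto simp: rq_def)
 have loop: "OK P (pc + 2 + length ca, m') (t0 + qS + j * (tb + qS)) q" if "bok m'" "I j m' q" for j m' q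
  using that
 proof (induction j arbitrary: m' q)
  case 0
  have "OK P (pc + 3 + length ca, m') t0 q"
   using h(3)[OF 0(1) post[OF 0 zero[OF 0]]] unfolding cc by (simp add: algebra_simps numeral_2_eq_2 numeral_3_eq_3)
  hence "OK P (pc + 2 + length ca, m') (t0 + rq r) q"
   by (intro ok_jump) (use l 0 zero[OF 0] in \<open>auto simp: numeral_2_eq_2 numeral_3_eq_3\<close>)
  thus ?case using rqr by simp
 next
  case (Suc j)
  show ?case
  proof (cases "m' r > 0")
   case False
   hence F: "m' r <= 0" by simp
   have "OK P (pc + 3 + length ca, m') t0 q"
    using h(3)[OF Suc.prems(1) post[OF Suc.prems F]] unfolding cc
    by (simp add: algebra_simps numeral_2_eq_2 numeral_3_eq_3)
   hence "OK P (pc + 2 + length ca, m') (t0 + rq r) q"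
    by (intro ok_jump) (use l Suc.prems F in \<open>auto simp: numeral_2_eq_2 numeral_3_eq_3\<close>)
   thus ?thesis using rqr by (elim ok_mono) auto
  next
   case True
   have "OK P (pc + 2, m') (t0 + qS + j * (tb + qS) + tb) q"
   proof (rule hoareD[OF body[OF Suc.prems True] Suc.prems(1)])
    show "loaded P (pc + 2) (comp (pc + 2) c)" using l by (simp add: ca_def numeral_2_eq_2 numeral_3_eq_3)
    fix m'' q' assume "bok m''" "I j m'' q'"
    thus "OK P (pc + 2 + length (comp (pc + 2) c), m'') (t0 + qS + j * (tb + qS)) q'"
     using Suc.IH by (simp add: ca_def)
   qed
   hence "OK P (pc + 2 + length ca, m') (t0 + qS + j * (tb + qS) + tb + rq r) q"
    by (intro ok_jump) (use l Suc.prems True in \<open>auto simp: numeral_2_eq_2 numeral_3_eq_3\<close>)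
   thus ?thesis using rqr by (elim ok_mono) auto
  qed
 qed
 have b: "bok (m(59 := 1))" by (rule bok59[OF h(1)])
 have "OK P (Suc pc, m(59 := 1)) (t0 + qS + N * (tb + qS) + rq 59) p"
  by (rule ok_jump[where l = "pc + 2 + length ca"]) (use l b loop[OF b start] in auto)
 hence "OK P (pc, m) (t0 + qS + N * (tb + qS) + rq 59 + qS) p"
  by (intro ok_ins[where i = "Const 59 1"]) (use l h(1) const_cost in auto)
 thus "OK P (pc, m) (t0 + (N * (tb + qS) + 3 * qS)) p" using rqr by (elim ok_mono) auto
qed

definition For :: "nat => nat => nat => com => com" where
 "For i t cnt c = Ops [OC i 0, OSub t cnt i] ;;
  While t (c ;; Ops [OC 60 1, OAdd i i 60, OSub t cnt i])"

text \<open>The test register holds \<open>cnt - i\<close>, since jumps only compare with 0. The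
  hypothesis \<open>stab\<close> says that the administration of the loop is invisible to the
  invariant.\<close>

lemma hoare_for:
 assumes regs: "8 <= i" "i < 59" "8 <= t" "t < 59" "8 <= cnt" "cnt < 59" "i ~= t" "i ~= cnt" "t ~= cnt"
  and stab: "!!k m p v w x y. I k m p ==> I k (m(i := v, t := w, 60 := x, 59 := y)) p"
  and cnt: "!!k m p. I k m p ==> m cnt = int N"
  and start: "bok m ==> I 0 m p"
  and body: "!!k m p. bok m ==> k < N ==> I k m p ==> m i = int k ==>
   hoare c m tb p (%m' q. m' i = int k & I (Suc k) m' q)"
  and post: "!!m p. bok m ==> I N m p ==> Q m p"
 shows "hoare (For i t cnt c) m (N * (tb + 4 * qS) + 5 * qS) p Q"
proof -
 define J where "J = (%j m p. j <= N & I (N - j) m p & m i = int (N - j) & m t = int j)"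
 have q: "rq2 cnt i = qS" "rq2 i 60 = qS" using regs by (auto simp: rq2_def)
 \<comment> \<open>Each single update is an instance of \<open>stab\<close> in which the other three
   registers are rewritten with their present values.\<close>
 have st: "I k (m(i := v)) p" "I k (m(t := v)) p" "I k (m(60 := v)) p" "I k (m(59 := v)) p" if "I k m p" for k m p v
 proof -
  have e: "m(i := v, t := m t, 60 := m 60, 59 := m 59) = m(i := v)"
   "m(i := m i, t := v, 60 := m 60, 59 := m 59) = m(t := v)"
   "m(i := m i, t := m t, 60 := v, 59 := m 59) = m(60 := v)"
   "m(i := m i, t := m t, 60 := m 60, 59 := v) = m(59 := v)"
   using regs by (auto simp: fun_eq_iff)
  show "I k (m(i := v)) p" "I k (m(t := v)) p" "I k (m(60 := v)) p" "I k (m(59 := v)) p"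
   using stab[OF that, of v "m t" "m 60" "m 59"] stab[OF that, of "m i" v "m 60" "m 59"]
    stab[OF that, of "m i" "m t" v "m 59"] stab[OF that, of "m i" "m t" "m 60" v]
   unfolding e by simp_all
 qed
 have nb: "int N < 2 ^ SB" if "bok m" "I k m p" for k m p
  using cnt[OF that(2)] that(1) regs by (auto simp: bok_def dest!: spec[of _ cnt])
 have w: "hoare (While t (c ;; Ops [OC 60 1, OAdd i i 60, OSub t cnt i])) m'
   (N * ((tb + 3 * qS) + qS) + 3 * qS) p Q" if m': "bok m'" "J N m' p" for m'
 proof (rule hoare_while[where I = J])
  fix j m p assume b: "bok m" and J: "J (Suc j) m p"
  have k: "N - Suc j < N" "Suc (N - Suc j) = N - j" using J by (auto simp: J_def)
  show "hoare (c ;; Ops [OC 60 1, OAdd i i 60, OSub t cnt i]) m (tb + 3 * qS) p (J j)"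
  proof (rule hoare_seq)
   show "hoare c m tb p (%m' q. m' i = int (N - Suc j) & I (Suc (N - Suc j)) m' q)"
    by (rule body[OF b k(1)]) (use J in \<open>auto simp: J_def\<close>)
   fix m' q assume b': "bok m'" and h: "m' i = int (N - Suc j) & I (Suc (N - Suc j)) m' q"
   have I': "I (N - j) m' q" using h k by simp
   have jN: "Suc j <= N" using J by (simp add: J_def)
   show "hoare (Ops [OC 60 1, OAdd i i 60, OSub t cnt i]) m' (3 * qS) q (J j)"
   proof (rule hoare_ops)
    show "ochks [OC 60 1, OAdd i i 60, OSub t cnt i] m'"
    proof -
     have "int N - int j < 2 ^ SB" "int j < 2 ^ SB" using nb[OF b' I'] jN by linarith+
     thus ?thesis using regs h cnt[OF I'] jN by (auto simp: wok_def of_nat_diff)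
    qed
    show "J j (osems [OC 60 1, OAdd i i 60, OSub t cnt i] m') q"
     using I' regs h cnt[OF I'] jN by (auto simp: J_def of_nat_diff intro!: st)
   qed (use q in auto)
  qed
 next
  show "J N (m'(59 := 1)) p" using m' regs by (auto simp: J_def intro!: st)
 next
  fix j m p assume "bok m" "J j m p" "m t <= 0"
  thus "Q m p" using post[of m p] by (auto simp: J_def)
 qed (use regs in \<open>auto simp: J_def\<close>)
 have "hoare (For i t cnt c) m (2 * qS + (N * ((tb + 3 * qS) + qS) + 3 * qS)) p Q"
  unfolding For_def
 proof (rule hoare_seq)
  fix m' q assume "bok m'" "J N m' p & q = p"
  thus "hoare (While t (c ;; Ops [OC 60 1, OAdd i i 60, OSub t cnt i])) m'
   (N * ((tb + 3 * qS) + qS) + 3 * qS) q Q" using w by simp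
 next
  show "hoare (Ops [OC i 0, OSub t cnt i]) m (2 * qS) p (%m' q. J N m' p & q = p)"
  proof (rule hoare_ops)
   assume b: "bok m"
   note S = start[OF b]
   show "ochks [OC i 0, OSub t cnt i] m" using nb[OF b S] regs cnt[OF S] by (auto simp: wok_def)
   show "J N (osems [OC i 0, OSub t cnt i] m) p & p = p"
    using S cnt[OF S] regs by (auto simp: J_def intro!: st)
  qed (use q in auto)
 qed
 thus ?thesis by (rule hoare_mono) auto
qed

section \<open>Uniform random integers\<close>

definition RandBits :: "nat => nat => nat => nat => nat => com" where
 "RandBits r cnt c i t = Ops [OC r 0] ;; For i t cnt (Flip c ;; Ops [OAdd r r r, OAdd r r c])"

lemma sum_halves:
 "(\<Sum>w<2 ^ Suc j. f (v * 2 ^ Suc j + w)) =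
 (\<Sum>w<2 ^ j. f (2 * v * 2 ^ j + w)) + (\<Sum>w<2 ^ j. f ((2 * v + 1) * 2 ^ j + w))" for f :: "nat => real"
proof -
 have split: "sum g {..<a + b} = sum g {..<a} + (\<Sum>i<b. g (a + i))" for g :: "nat => real" and a b
  by (induction b) auto
 have "(\<Sum>w<2 ^ Suc j. f (v * 2 ^ Suc j + w)) = (\<Sum>w<2 ^ j + 2 ^ j. f (v * 2 ^ Suc j + w))"
  by (simp add: mult_2)
 also have "... = (\<Sum>w<2 ^ j. f (v * 2 ^ Suc j + w)) + (\<Sum>w<2 ^ j. f (v * 2 ^ Suc j + (2 ^ j + w)))"
  by (rule split)
 finally show ?thesis by (simp add: algebra_simps)
qed

text \<open>Any assignment of budgets \<open>q v\<close> to the \<open>2 ^ K\<close> outcomes with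
  mean at most \<open>p\<close> is admissible. After \<open>k\<close> tosses the budget is the mean
  over all completions of the bits drawn so far, which is a martingale.\<close>

lemma hoare_rand_bits:
 assumes regs: "8 <= i" "i < 59" "8 <= t" "t < 59" "8 <= cnt" "cnt < 59" "i ~= t" "i ~= cnt" "t ~= cnt"
  "8 <= r" "r < 59" "8 <= c" "c < 59" "r ~= c" "r \<notin> {i, t, cnt}" "c \<notin> {i, t, cnt}"
  and cnt: "m cnt = int K" and K: "K < SB"
  and post: "!!v m'. v < 2 ^ K ==> bok m' ==> eqx {i, t, r, c, 59, 60} {} m m' ==> m' r = int v ==> Q m' (q v)"
  and avg: "(\<Sum>v<2 ^ K. q v) / 2 ^ K <= p"
 shows "hoare (RandBits r cnt c i t) m (K * (7 * qS) + 6 * qS) p Q"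
proof -
 define I where "I = (%k m' p'. k <= K & eqx {i, t, r, c, 59, 60} {} m m' &
  (\<exists>v<2 ^ k. m' r = int v & p' = (\<Sum>w<2 ^ (K - k). q (v * 2 ^ (K - k) + w)) / 2 ^ (K - k)))"
 have cn: "m' cnt = int K" if "I k m' p'" for k m' p'
  using that regs cnt by (auto simp: I_def eqx_def)
 have "hoare (RandBits r cnt c i t) m (qS + (K * ((qS + 2 * qS) + 4 * qS) + 5 * qS)) ((\<Sum>v<2 ^ K. q v) / 2 ^ K) Q"
  unfolding RandBits_def
 proof (rule hoare_seq)
  show "hoare (Ops [OC r 0]) m qS ((\<Sum>v<2 ^ K. q v) / 2 ^ K) (I 0)"
   by (rule hoare_ops) (use regs in \<open>auto simp: wok_def I_def\<close>)
 next
  fix m1 p1 assume b1: "bok m1" and I0: "I 0 m1 p1"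
  show "hoare (For i t cnt (Flip c ;; Ops [OAdd r r r, OAdd r r c])) m1
   (K * ((qS + 2 * qS) + 4 * qS) + 5 * qS) p1 Q"
  proof (rule hoare_for[where I = I])
   fix k m' p' assume b: "bok m'" and k: "k < K" and I: "I k m' p'" and ik: "m' i = int k"
   obtain v where v: "v < 2 ^ k" "m' r = int v"
    "p' = (\<Sum>w<2 ^ (K - k). q (v * 2 ^ (K - k) + w)) / 2 ^ (K - k)"
    using I by (auto simp: I_def)
   define j where "j = K - Suc k"
   have Kk: "K - k = Suc j" "K - Suc k = j" using k by (auto simp: j_def)
   define P where "P b = (\<Sum>w<2 ^ j. q ((2 * v + b) * 2 ^ j + w)) / 2 ^ j" for b
   have p': "p' = (P 0 + P 1) / 2"
    unfolding v(3) Kk sum_halves P_def by (simp add: field_simps)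
   show "hoare (Flip c ;; Ops [OAdd r r r, OAdd r r c]) m' (qS + 2 * qS) p'
     (%m'' q. m'' i = int k & I (Suc k) m'' q)"
   proof (rule hoare_seq)
    show "hoare (Flip c) m' qS p' (%m2 q2. \<exists>b\<in>{0,1}. m2 = m'(c := int b) & q2 = P b)"
     by (rule hoare_flip[where ?p0.0 = "P 0" and ?p1.0 = "P 1"]) (use regs p' in auto)
    fix m2 q2 assume b2: "bok m2" and "\<exists>b\<in>{0,1}. m2 = m'(c := int b) & q2 = P b"
    then obtain b where bb: "b <= 1" "m2 = m'(c := int b)" "q2 = P b" by fastforce
    have v2: "2 * v + b < 2 ^ Suc k" using v(1) bb(1) by auto
    have "2 * v + b < 2 ^ SB"
     by (rule less_le_trans[OF v2], rule power_increasing) (use k K in auto)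
    hence "int (2 * v + b) < int (2 ^ SB)" by (simp only: of_nat_less_iff)
    hence bnd: "2 * int v + int b < 2 ^ SB" by simp
    show "hoare (Ops [OAdd r r r, OAdd r r c]) m2 (2 * qS) q2 (%m'' q. m'' i = int k & I (Suc k) m'' q)"
    proof (rule hoare_ops)
     show "ochks [OAdd r r r, OAdd r r c] m2" using bb v bnd regs by (auto simp: wok_def)
     show "osems [OAdd r r r, OAdd r r c] m2 i = int k & I (Suc k) (osems [OAdd r r r, OAdd r r c] m2) q2"
      using bb v regs ik I k v2 unfolding I_def Kk P_def
      by (auto intro!: exI[of _ "2 * v + b"])
    qed (use regs in \<open>auto simp: rq2_def\<close>)
   qed
  next
   fix m' p' assume b: "bok m'" and I: "I K m' p'"
   thus "Q m' p'" using post by (auto simp: I_def)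
  qed (use regs b1 I0 cn in \<open>auto simp: I_def\<close>)
 qed
 thus ?thesis by (rule hoare_mono) (use avg in auto)
qed

end

section \<open>Primes and finite differences\<close>

text \<open>\<open>D\<close> is the least common multiple of \<open>1, ..., N\<close>: each prime
  contributes its largest power up to \<open>N\<close>, which bounds \<open>D\<close> in terms of
  the number of primes.\<close>

lemma prime_power_bound_product:
 fixes N :: nat
 assumes "N >= 1"
 obtains D where "D > 0" "!!j. 1 <= j ==> j <= N ==> j dvd D" "D <= N ^ card {p. prime p & p <= N}"
proof -
 define S where "S = {p. prime p & p <= N}"
 define e where "e p = (GREATEST k. p ^ k <= N)" for p
 have fin: "finite S" by (rule finite_subset[of _ "{..N}"]) (auto simp: S_def)
 have bd: "k <= N" if "p >= 2" "p ^ k <= N" for p k :: nat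
 proof -
  have "k < 2 ^ k" by (rule less_exp)
  also have "(2::nat) ^ k <= p ^ k" using that by (intro power_mono) auto
  finally show ?thesis using that by simp
 qed
 have e1: "p ^ e p <= N" if "p >= 2" for p
  unfolding e_def by (rule GreatestI_nat[of "%k. p ^ k <= N" 0 N]) (use assms bd[OF that] in auto)
 have e2: "k <= e p" if "p >= 2" "p ^ k <= N" for p k
  unfolding e_def by (rule Greatest_le_nat[of "%k. p ^ k <= N" k N]) (use that bd[OF that(1)] in auto)
 define D where "D = (\<Prod>p\<in>S. p ^ e p)"
 show ?thesis
 proof (rule that)
  show "D > 0" unfolding D_def by (rule prod_pos) (auto simp: S_def prime_gt_0_nat)
  have "D <= (\<Prod>p\<in>S. N)" unfolding D_def
   by (rule prod_mono) (auto simp: S_def intro!: e1 prime_ge_2_nat)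
  thus "D <= N ^ card {p. prime p & p <= N}" by (simp add: S_def)
  fix j :: nat assume j: "1 <= j" "j <= N"
  have sub: "prime_factors j \<subseteq> S"
   using j by (auto simp: S_def prime_factors_dvd dest: dvd_imp_le)
  have "j = (\<Prod>p\<in>prime_factors j. p ^ multiplicity p j)"
   using j by (simp add: prime_factorization_nat)
  also have "... dvd (\<Prod>p\<in>prime_factors j. p ^ e p)"
  proof (rule prod_dvd_prod)
   fix p assume p: "p \<in> prime_factors j"
   have "p ^ multiplicity p j <= j" using j by (intro dvd_imp_le multiplicity_dvd) auto
   hence "multiplicity p j <= e p" using p j by (intro e2) (auto simp: prime_factors_dvd prime_ge_2_nat)
   thus "p ^ multiplicity p j dvd p ^ e p" by (rule le_imp_power_dvd)
  qed
  also have "... dvd D" unfolding D_def by (rule prod_dvd_prod_subset[OF fin sub])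
  finally show "j dvd D" .
 qed
qed

text \<open>Leibniz' harmonic triangle: its entries \<open>1 / (k * (n choose k))\<close> are differences of entries
 of the previous column, hence integral combinations of \<open>1 / 1, ..., 1 / n\<close>.\<close>

lemma leibniz_triangle:
 assumes "!!j. 1 <= j ==> j <= N ==> j dvd D" "n <= N" "1 <= k" "k <= n"
 shows "real D / (real k * real (n choose k)) \<in> \<int>"
 using assms(3,2,4)
proof (induction k arbitrary: n rule: nat_induct_at_least)
 case base
 have "real D / real n \<in> \<int>" using assms(1)[of n] base by (auto elim!: dvdE)
 thus ?case by simp
next
 case (Suc k)
 obtain r where n: "n = Suc r" using Suc by (cases n) auto
 obtain l where k: "k = Suc l" using Suc by (cases k) auto
 have kr: "k <= r" using Suc n by simp
 have a1: "real (Suc k) * real (n choose Suc k) = real n * real (r choose k)"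
  using Suc_times_binomial[of k r] n by (metis of_nat_mult)
 have a2: "real k * real (n choose k) = real n * real (r choose l)"
  using Suc_times_binomial[of l r] n k by (metis of_nat_mult)
 have a3: "real (n choose k) = real (r choose l) + real (r choose k)" using n k by simp
 have pos: "real (r choose k) > 0" "real (n choose k) > 0" "real n > 0" "real k > 0" "real (r choose l) > 0"
  using zero_less_binomial[of k r] zero_less_binomial[of k n] zero_less_binomial[of l r] kr n k
  by (simp_all del: binomial_Suc_Suc)
 have "1 / (real (Suc k) * real (n choose Suc k)) = 1 / (real k * real (r choose k)) - 1 / (real k * real (n choose k))"
 proof -
  have "1 / (real k * real (r choose k)) - 1 / (real k * real (n choose k)) =
   (real (n choose k) - real (r choose k)) / (real (r choose k) * (real k * real (n choose k)))"
   using pos by (simp add: field_simps)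
  also have "... = real (r choose l) / (real (r choose k) * (real n * real (r choose l)))"
   unfolding a2 by (simp add: a3)
  also have "... = 1 / (real n * real (r choose k))" using pos by (simp add: field_simps)
  finally show ?thesis unfolding a1 by simp
 qed
 hence "real D / (real (Suc k) * real (n choose Suc k)) =
   real D / (real k * real (r choose k)) - real D / (real k * real (n choose k))"
  by (metis (no_types, lifting) mult.right_neutral right_diff_distrib times_divide_eq_right)
 moreover have "real D / (real k * real (r choose k)) \<in> \<int>" using Suc n kr by (intro Suc.IH) auto
 moreover have "real D / (real k * real (n choose k)) \<in> \<int>" using Suc n kr by (intro Suc.IH) auto
 ultimately show ?case by simp
qed

text \<open>An entry of the harmonic triangle times the common multiple \<open>D\<close> is a
  positive integer, so \<open>D\<close> is at least \<open>k * (2 k choose k) >= 4 ^ k / 2\<close>,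
  while \<open>D <= N ^ c\<close>. For \<open>N = 2 ^ B\<close> a comparison of exponents bounds the
  number \<open>c\<close> of primes from below.\<close>

lemma prime_count_lower_bound:
 assumes "B >= 1"
 shows "2 ^ B / (2 * real B) <= real (card {p::nat. prime p & p <= 2 ^ B})"
proof -
 define N where "N = (2::nat) ^ B"
 define k where "k = (2::nat) ^ (B - 1)"
 define c where "c = card {p::nat. prime p & p <= N}"
 have N2: "N = 2 * k" using assms by (cases B) (auto simp: N_def k_def)
 have k1: "k >= 1" by (simp add: k_def)
 obtain D where D: "D > 0" "!!j. 1 <= j ==> j <= N ==> j dvd D" "D <= N ^ c"
  using prime_power_bound_product[of N] unfolding c_def N_def by auto
 have "real D / (real k * real (N choose k)) \<in> \<int>"
  by (rule leibniz_triangle[OF D(2)]) (use k1 N2 in auto)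
 moreover have kc: "real k * real (N choose k) > 0" using k1 N2 by simp
 hence "real D / (real k * real (N choose k)) > 0" using D by simp
 ultimately have "1 <= real D / (real k * real (N choose k))"
  by (auto elim!: Ints_cases)
 hence "real k * real (N choose k) <= real D" using kc by (simp add: pos_le_divide_eq)
 moreover have "4 ^ k / (2 * real k) <= real (2 * k choose k)"
  by (rule central_binomial_lower_bound) (use k1 in simp)
 hence "4 ^ k / 2 <= real k * real (N choose k)" using k1 N2 by (simp add: field_simps)
 moreover have "real D <= real (N ^ c)" using D(3) by (simp only: of_nat_le_iff)
 ultimately have "4 ^ k / 2 <= real (N ^ c)" by linarith
 hence "(2::real) ^ N <= 2 * 2 ^ (B * c)"
 proof -
  have "(2::real) ^ N = 4 ^ k" unfolding N2 by (simp add: power_mult)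
  moreover have "real (N ^ c) = 2 ^ (B * c)" by (simp add: N_def power_mult)
  ultimately show ?thesis using \<open>4 ^ k / 2 <= real (N ^ c)\<close> by linarith
 qed
 hence "(2::real) ^ N <= 2 ^ Suc (B * c)" by simp
 hence "N <= Suc (B * c)" by (subst (asm) power_increasing_iff) auto
 hence "real N <= 1 + real B * real c" by (metis of_nat_Suc of_nat_le_iff of_nat_mult add.commute)
 moreover have "real N >= 2" using k1 N2 by simp
 ultimately have "real N / 2 <= real B * real c" by linarith
 hence "real N / (2 * real B) <= real c" using assms by (simp add: field_simps)
 thus ?thesis by (simp add: N_def c_def)
qed

section \<open>Finite differences of the logarithm\<close>

fun dl :: "real => nat => (real => real) => real => real" where
 "dl s 0 f x = f x"
| "dl s (Suc k) f x = dl s k f (x + s) - dl s k f x"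

text \<open>Differencing commutes with differentiation, so the mean value theorem can be applied
  once per order; the induction therefore runs over the whole family of derivatives
  \<open>f i\<close>.\<close>

lemma dl_mean_value:
 assumes "!!i x. x > 0 ==> (f i has_real_derivative f (Suc i) x) (at x)" "s > 0" "x > 0"
 shows "\<exists>\<xi>\<ge>x. \<xi> <= x + real k * s & dl s k (f i) x = s ^ k * f (i + k) \<xi>"
proof -
 have der: "(dl s k (f i) has_real_derivative dl s k (f (Suc i)) x) (at x)" if "x > 0" for k i x
  using that
 proof (induction k arbitrary: x)
  case 0
  thus ?case using assms(1) by simp
 next
  case (Suc k)
  have "((%x. dl s k (f i) (x + s)) has_real_derivative dl s k (f (Suc i)) (x + s) * (1 + 0)) (at x)"
   by (rule DERIV_chain2[OF Suc.IH]) (use Suc.prems assms in \<open>auto intro!: derivative_eq_intros\<close>)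
  from DERIV_diff[OF this Suc.IH[OF Suc.prems]] show ?case by simp
 qed
 show ?thesis using assms(3)
 proof (induction k arbitrary: i x)
  case 0
  thus ?case by auto
 next
  case (Suc k)
  have "\<exists>z. x < z & z < x + s & dl s k (f i) (x + s) - dl s k (f i) x = (x + s - x) * dl s k (f (Suc i)) z"
   by (rule MVT2) (use Suc.prems assms der in auto)
  then obtain z where z: "x < z" "z < x + s" "dl s (Suc k) (f i) x = s * dl s k (f (Suc i)) z" by auto
  obtain \<xi> where "\<xi> >= z" "\<xi> <= z + real k * s" "dl s k (f (Suc i)) z = s ^ k * f (Suc i + k) \<xi>"
   using Suc.IH[of z "Suc i"] z Suc.prems by auto
  thus ?case using z by (intro exI[of _ \<xi>]) (auto simp: algebra_simps)
 qed
qed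

lemma dl_sum: "dl s k f x = (\<Sum>j\<le>k. (-1) ^ (k + j) * real (k choose j) * f (x + real j * s))"
proof (induction k arbitrary: x)
 case (Suc k)
 let ?F = "%j. f (x + real j * s)"
 have "(\<Sum>j\<le>Suc k. (-1) ^ (Suc k + j) * real (Suc k choose j) * ?F j) =
  (-1) ^ Suc k * ?F 0 + (\<Sum>j\<le>k. (-1) ^ (k + j) * real (Suc k choose Suc j) * ?F (Suc j))"
  by (subst sum.atMost_Suc_shift) simp
 also have "(\<Sum>j\<le>k. (-1) ^ (k + j) * real (Suc k choose Suc j) * ?F (Suc j)) =
  (\<Sum>j\<le>k. (-1) ^ (k + j) * real (k choose j) * ?F (Suc j)) +
  (\<Sum>j\<le>k. (-1) ^ (k + j) * real (k choose Suc j) * ?F (Suc j))"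
  unfolding sum.distrib[symmetric] by (rule sum.cong) (simp_all add: distrib_left distrib_right)
 also have "(-1) ^ Suc k * ?F 0 + ((\<Sum>j\<le>k. (-1) ^ (k + j) * real (k choose j) * ?F (Suc j)) +
  (\<Sum>j\<le>k. (-1) ^ (k + j) * real (k choose Suc j) * ?F (Suc j))) =
  (\<Sum>j\<le>k. (-1) ^ (k + j) * real (k choose j) * ?F (Suc j)) -
  ((-1) ^ k * ?F 0 + (\<Sum>j\<le>k. (-1) ^ (k + Suc j) * real (k choose Suc j) * ?F (Suc j)))"
  by (simp add: sum_negf)
 also have "(-1) ^ k * ?F 0 + (\<Sum>j\<le>k. (-1) ^ (k + Suc j) * real (k choose Suc j) * ?F (Suc j)) =
  (\<Sum>j\<le>Suc k. (-1) ^ (k + j) * real (k choose j) * ?F j)"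
  by (subst sum.atMost_Suc_shift) simp
 also have "... = (\<Sum>j\<le>k. (-1) ^ (k + j) * real (k choose j) * ?F j)" by simp
 also have "(\<Sum>j\<le>k. (-1) ^ (k + j) * real (k choose j) * ?F (Suc j)) =
  (\<Sum>j\<le>k. (-1) ^ (k + j) * real (k choose j) * f (x + s + real j * s))"
  by (simp add: algebra_simps)
 finally show ?case by (simp only: dl.simps Suc.IH)
qed simp

text \<open>The \<open>k\<close>-th derivative of \<open>ln\<close> is
  \<open>(-1) ^ (k - 1) * (k - 1)! / x ^ k\<close>, so the signed difference equals
  \<open>(k - 1)! * s ^ k / \<xi> ^ k\<close> for some \<xi> between \<open>g\<close> and
  \<open>g + k s\<close>.\<close>

lemma ln_difference_bounds:
 assumes "g > 0" "s > 0" "k >= 1"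
 defines "E \<equiv> (\<Sum>j\<le>k. (-1) ^ Suc j * real (k choose j) * ln (g + real j * s))"
 shows "fact (k - 1) * s ^ k / (g + real k * s) ^ k <= E" "E <= fact (k - 1) * s ^ k / g ^ k"
proof -
 define f where "f i x = (if i = 0 then ln x else (-1) ^ (i - 1) * fact (i - 1) / x ^ i)" for i and x :: real
 have der: "(f i has_real_derivative f (Suc i) x) (at x)" if "x > 0" for i x
 proof (cases i)
  case 0
  have "f 0 = ln" by (auto simp: f_def)
  thus ?thesis using that 0 by (auto simp: f_def intro!: derivative_eq_intros)
 next
  case (Suc l)
  have eq: "f i = (%x. (-1) ^ l * fact l * inverse (x ^ Suc l))" by (auto simp: f_def Suc field_simps)
  have "((%x. (-1) ^ l * fact l * inverse (x ^ Suc l)) has_real_derivative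
   (-1) ^ l * fact l * - (inverse (x ^ Suc l) * (real (Suc l) * x ^ (Suc l - Suc 0)) * inverse (x ^ Suc l))) (at x)"
   by (rule DERIV_cmult, rule DERIV_inverse', rule DERIV_pow) (use that in simp)
  moreover have "(-1) ^ l * fact l * - (inverse (x ^ Suc l) * (real (Suc l) * x ^ (Suc l - Suc 0)) * inverse (x ^ Suc l)) =
   f (Suc i) x"
   using that by (simp add: f_def Suc field_simps)
  ultimately show ?thesis unfolding eq by simp
 qed
 obtain \<xi> where x: "\<xi> >= g" "\<xi> <= g + real k * s" "dl s k (f 0) g = s ^ k * f (0 + k) \<xi>"
  using dl_mean_value[of f s g k 0] der assms by blast
 have "E = (-1) ^ Suc k * dl s k (f 0) g"
  unfolding E_def dl_sum sum_distrib_left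
 proof (rule sum.cong[OF refl])
  fix j assume "j \<in> {..k}"
  have "(-1::real) ^ Suc k * (-1) ^ (k + j) = (-1) ^ Suc j"
   by (simp add: power_add[symmetric] mult.assoc[symmetric]) (simp add: power_add)
  thus "(-1) ^ Suc j * real (k choose j) * ln (g + real j * s) =
   (-1) ^ Suc k * ((-1) ^ (k + j) * real (k choose j) * f 0 (g + real j * s))"
   by (simp add: f_def mult.assoc[symmetric] del: power_Suc)
 qed
 also have "... = fact (k - 1) * s ^ k / \<xi> ^ k"
 proof -
  have "(-1::real) ^ Suc k * (-1) ^ (k - 1) = 1" using assms(3)
   by (cases k) (auto simp: power_add[symmetric])
  moreover have "- (p * q * r * t / w) = t * q / w" if "p * r = - 1" for p q r t w :: real
  proof -
   have "p * q * r * t = (p * r) * (t * q)" by simp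
   thus ?thesis using that by simp
  qed
  ultimately show ?thesis using x assms by (simp add: f_def mult.assoc[symmetric] del: power_Suc)
 qed
 finally have E: "E = fact (k - 1) * s ^ k / \<xi> ^ k" .
 have "\<xi> > 0" using x assms by linarith
 show "fact (k - 1) * s ^ k / (g + real k * s) ^ k <= E" unfolding E
  by (intro divide_left_mono power_mono mult_pos_pos) (use x \<open>\<xi> > 0\<close> assms in \<open>auto intro: add_pos_nonneg\<close>)
 show "E <= fact (k - 1) * s ^ k / g ^ k" unfolding E
  by (intro divide_left_mono power_mono mult_pos_pos) (use x \<open>\<xi> > 0\<close> assms in auto)
qed

text \<open>Every root contributes a positive term of order \<open>(s / gap) ^ b\<close>. A single
  gap of at most \<open>s\<close> makes the sum large; if all gaps are at least
  \<open>256 b s\<close>, each term is at most \<open>2 / 256 ^ b\<close>, too little for fewer than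
  \<open>2 ^ b\<close> of them to matter.\<close>

lemma gap_test_exact:
 fixes R :: "real set"
 assumes R: "finite R" "R ~= {}" "card R < 2 ^ b" "b >= 2" and y: "y < Min R" and s: "s > 0"
 defines "E \<equiv> (\<Sum>j\<le>b. (-1) ^ Suc j * real (b choose j) * log 2 (\<Prod>\<mu>\<in>R. \<mu> - (y - real j * s)))"
 shows "Min R - y <= s ==> E >= 1 / 2 ^ (3 * b + 2)"
  and "Min R - y >= 256 * real b * s ==> E <= 2 / 2 ^ (7 * b)"
proof -
 define e where "e \<mu> = (\<Sum>j\<le>b. (-1) ^ Suc j * real (b choose j) * ln ((\<mu> - y) + real j * s))" for \<mu>
 have pos: "\<mu> - y > 0" if "\<mu> \<in> R" for \<mu> using that y R by (auto simp: Min_gr_iff)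
 have pos': "\<mu> - (y - real j * s) > 0" if "\<mu> \<in> R" for \<mu> j using pos[OF that] s
  by (smt (verit) mult_nonneg_nonneg of_nat_0_le_iff)
 have "E = (\<Sum>j\<le>b. \<Sum>\<mu>\<in>R. (-1) ^ Suc j * real (b choose j) * ln ((\<mu> - y) + real j * s) / ln 2)"
  unfolding E_def
 proof (rule sum.cong[OF refl])
  fix j
  have "ln (\<Prod>\<mu>\<in>R. \<mu> - (y - real j * s)) = (\<Sum>\<mu>\<in>R. ln (\<mu> - (y - real j * s)))"
   by (rule ln_prod) (use R pos' in auto)
  thus "(-1) ^ Suc j * real (b choose j) * log 2 (\<Prod>\<mu>\<in>R. \<mu> - (y - real j * s)) =
   (\<Sum>\<mu>\<in>R. (-1) ^ Suc j * real (b choose j) * ln ((\<mu> - y) + real j * s) / ln 2)"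
   by (simp add: log_def sum_distrib_left sum_divide_distrib algebra_simps)
 qed
 also have "... = (\<Sum>\<mu>\<in>R. e \<mu> / ln 2)"
  unfolding e_def by (subst sum.swap) (simp add: sum_divide_distrib)
 finally have E: "E = (\<Sum>\<mu>\<in>R. e \<mu> / ln 2)" .
 have b1: "b >= 1" using R by simp
 note bnd = ln_difference_bounds[OF pos s b1, folded e_def]
 have l2: "0 < ln (2::real)" "ln (2::real) <= 1" "ln (2::real) >= 1 / 2"
  using ln_add_one_self_le_self[of 1] ln2_ge_two_thirds by auto
 have e0: "e \<mu> >= 0" if "\<mu> \<in> R" for \<mu>
  by (rule order_trans[OF _ bnd(1)[OF that]]) (use pos[OF that] s in auto)
 {
  assume g: "Min R - y <= s"
  have M: "Min R \<in> R" using R by simp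
  \<comment> \<open>A single term of the exponential series; together with \<open>exp 1 <= 4\<close>
    it takes the place of Stirling's formula in bounding \<open>(b - 1)! / (b + 1) ^ b\<close> from
    below.\<close>
  have eb: "(real b + 1) ^ b / fact b <= exp (real b + 1)"
  proof -
   have "(real b + 1) ^ b /\<^sub>R fact b <= (\<Sum>n. (real b + 1) ^ n /\<^sub>R fact n)"
    using sum_le_suminf[OF summable_exp_generic[of "real b + 1"], of "{b}"] by simp
   thus ?thesis by (simp add: exp_def divide_real_def mult.commute)
  qed
  have "exp (real b + 1) = exp 1 ^ Suc b" using exp_of_nat_mult[of "Suc b" "1::real"] by (simp add: add.commute)
  also have "... <= 4 ^ Suc b" using exp_le by (intro power_mono) auto
  finally have e4: "exp (real b + 1) <= 4 ^ Suc b" .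
  have f: "fact b = real b * fact (b - 1)" using b1 by (simp add: fact_reduce)
  have "(1::real) / 2 ^ (3 * b + 2) = 1 / (4 ^ Suc b * 2 ^ b)"
   by (simp add: power_add power_mult[of 2 3 b] power_mult_distrib[symmetric])
  also have "... <= 1 / (exp (real b + 1) * real b)"
   using e4 b1 of_nat_less_two_power[of b, where ?'a = real]
   by (intro divide_left_mono mult_mono mult_pos_pos) auto
  also have "... <= 1 / ((real b + 1) ^ b / fact b * real b)"
   using eb b1 by (intro divide_left_mono mult_right_mono mult_pos_pos divide_pos_pos) auto
  also have "... = fact (b - 1) / (real b + 1) ^ b" using b1 by (simp add: f)
  also have "... = fact (b - 1) * s ^ b / (s + real b * s) ^ b"
  proof -
   have "(s + real b * s) ^ b = s ^ b * (real b + 1) ^ b"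
    by (simp add: power_mult_distrib[symmetric] algebra_simps)
   thus ?thesis using s by simp
  qed
  also have "... <= fact (b - 1) * s ^ b / ((Min R - y) + real b * s) ^ b"
   using g pos[OF M] s by (intro divide_left_mono power_mono mult_pos_pos zero_less_power add_pos_nonneg) auto
  also have "... <= e (Min R)" by (rule bnd(1)[OF M])
  also have "... <= e (Min R) / ln 2" using e0[OF M] l2 by (simp add: pos_le_divide_eq mult_left_le)
  also have "... <= E" unfolding E using R M e0 l2 by (intro member_le_sum) auto
  finally show "E >= 1 / 2 ^ (3 * b + 2)" .
 }
 {
  assume g: "Min R - y >= 256 * real b * s"
  have "e \<mu> / ln 2 <= 2 / 2 ^ (8 * b)" if m: "\<mu> \<in> R" for \<mu>
  proof -
   have gm: "256 * real b * s <= \<mu> - y" using g Min_le[OF R(1) m] by linarith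
   have fb: "fact (b - 1) <= real b ^ b"
   proof -
    have "fact (b - 1) <= (fact b :: real)" by (rule fact_mono) simp
    also have "... <= real b ^ b" using fact_le_power[of b, where ?'a = real] by simp
    finally show ?thesis .
   qed
   have "e \<mu> <= fact (b - 1) * s ^ b / (\<mu> - y) ^ b" by (rule bnd(2)[OF m])
   also have "... <= real b ^ b * s ^ b / (256 * real b * s) ^ b"
    using fb gm b1 s pos[OF m] by (intro frac_le mult_right_mono power_mono) auto
   also have "... = 1 / 256 ^ b" using b1 s by (simp add: power_mult_distrib)
   also have "(256::real) ^ b = 2 ^ (8 * b)" by (simp add: power_mult)
   finally have "e \<mu> <= 1 / 2 ^ (8 * b)" .
   hence "e \<mu> / ln 2 <= (1 / 2 ^ (8 * b)) / (1 / 2)"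
    using l2 e0[OF m] by (intro frac_le) auto
   thus ?thesis by simp
  qed
  hence "E <= (\<Sum>\<mu>\<in>R. 2 / 2 ^ (8 * b))" unfolding E by (rule sum_mono)
  also have "... = real (card R) * (2 / 2 ^ (8 * b))" by simp
  also have "... <= 2 ^ b * (2 / 2 ^ (8 * b))"
   using R by (intro mult_right_mono) (auto simp: numeral_power_eq_of_nat_cancel_iff
    intro: order.strict_implies_order of_nat_less_numeral_power_cancel_iff[THEN iffD2])
  also have "... = 2 / 2 ^ (7 * b)"
  proof -
   have "(2::real) ^ (8 * b) = 2 ^ b * 2 ^ (7 * b)" by (simp add: power_add[symmetric])
   thus ?thesis by simp
  qed
  finally show "E <= 2 / 2 ^ (7 * b)" .
 }
qed

text \<open>The binomial coefficients amplify the errors \<open>2 / 2 ^ (8 b)\<close> of the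
  logarithms to \<open>2 / 2 ^ (7 b)\<close>. For \<open>b >= 2\<close> the threshold
  \<open>1 / 2 ^ (5 b)\<close> still separates the two cases, with values above
  \<open>1 / 2 ^ (3 b + 2)\<close> and below \<open>2 / 2 ^ (7 b)\<close> before the error.\<close>

lemma gap_test:
 fixes R :: "real set" and L :: "nat => real"
 assumes R: "finite R" "R ~= {}" "card R < 2 ^ b" "b >= 2" and y: "y < Min R" and s: "s > 0"
  and L: "!!j. j <= b ==> \<bar>L j - log 2 (\<Prod>\<mu>\<in>R. \<mu> - (y - real j * s))\<bar> <= 2 / 2 ^ (8 * b)"
 defines "A \<equiv> (\<Sum>j\<le>b. (-1) ^ Suc j * real (b choose j) * L j)"
 shows "A < 1 / 2 ^ (5 * b) ==> s < Min R - y"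
  and "A >= 1 / 2 ^ (5 * b) ==> Min R - y < 256 * real b * s"
proof -
 define E where "E = (\<Sum>j\<le>b. (-1) ^ Suc j * real (b choose j) * log 2 (\<Prod>\<mu>\<in>R. \<mu> - (y - real j * s)))"
 have "\<bar>A - E\<bar> <= (\<Sum>j\<le>b. real (b choose j) * (2 / 2 ^ (8 * b)))"
  unfolding A_def E_def sum_subtractf[symmetric]
 proof (rule order_trans[OF sum_abs], rule sum_mono)
  fix j assume j: "j \<in> {..b}"
  have "\<bar>(-1) ^ Suc j * real (b choose j) * L j - (-1) ^ Suc j * real (b choose j) * log 2 (\<Prod>\<mu>\<in>R. \<mu> - (y - real j * s))\<bar>
   = real (b choose j) * \<bar>L j - log 2 (\<Prod>\<mu>\<in>R. \<mu> - (y - real j * s))\<bar>"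
   unfolding right_diff_distrib[symmetric] abs_mult power_abs by simp
  also have "... <= real (b choose j) * (2 / 2 ^ (8 * b))" using L j by (intro mult_left_mono) auto
  finally show "\<bar>(-1) ^ Suc j * real (b choose j) * L j - (-1) ^ Suc j * real (b choose j) * log 2 (\<Prod>\<mu>\<in>R. \<mu> - (y - real j * s))\<bar>
   <= real (b choose j) * (2 / 2 ^ (8 * b))" .
 qed
 also have "... = real (\<Sum>j\<le>b. b choose j) * (2 / 2 ^ (8 * b))" by (simp only: sum_distrib_right of_nat_sum)
 also have "... = 2 ^ b * (2 / 2 ^ (8 * b))" by (simp only: choose_row_sum) simp
 also have "... = 2 / 2 ^ (7 * b)"
 proof -
  have "(2::real) ^ (8 * b) = 2 ^ b * 2 ^ (7 * b)" by (simp add: power_add[symmetric])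
  thus ?thesis by simp
 qed
 finally have AE: "\<bar>A - E\<bar> <= 2 / 2 ^ (7 * b)" .
 define t where "t = (1::real) / 2 ^ (5 * b)"
 have b4: "(2::real) ^ (2 * b) >= 16" using power_increasing[of 4 "2 * b" "2::real"] R by simp
 have t0: "t > 0" by (simp add: t_def)
 have t7: "2 / 2 ^ (7 * b) = 2 * t / 2 ^ (2 * b)" by (simp add: t_def power_add[symmetric])
 have t7': "2 / 2 ^ (7 * b) <= t / 8" unfolding t7 using b4 t0 by (simp add: field_simps)
 have t3: "1 / 2 ^ (3 * b + 2) = t * 2 ^ (2 * b) / 4"
  by (simp add: t_def power_add[symmetric] field_simps)
 have t3': "1 / 2 ^ (3 * b + 2) >= 4 * t" unfolding t3 using b4 t0 by (simp add: field_simps)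
 show "s < Min R - y" if "A < 1 / 2 ^ (5 * b)"
 proof (rule ccontr)
  assume "~ ?thesis"
  hence "E >= 1 / 2 ^ (3 * b + 2)" using gap_test_exact(1)[OF R y s] unfolding E_def by simp
  thus False using that AE t7' t3' t0 unfolding t_def[symmetric] by linarith
 qed
 show "Min R - y < 256 * real b * s" if "A >= 1 / 2 ^ (5 * b)"
 proof (rule ccontr)
  assume "~ ?thesis"
  hence "E <= 2 / 2 ^ (7 * b)" using gap_test_exact(2)[OF R y s] unfolding E_def by simp
  thus False using that AE t7' t0 unfolding t_def[symmetric] by linarith
 qed
qed

abbreviation cop :: "int => int => bool" where "cop \<equiv> algebraic_semidom_class.coprime"

section \<open>The Lanczos recurrence\<close>

locale lanczos =
 fixes n :: nat and mm :: "nat => nat => real" and u :: "nat => real"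
 assumes sym: "i < n ==> j < n ==> mm i j = mm j i"
begin

definition ip :: "(nat => real) => (nat => real) => real" where
 "ip x y = (\<Sum>i<n. x i * y i)"

definition mv :: "(nat => real) => nat => real" where
 "mv x i = (\<Sum>j<n. mm i j * x j)"

text \<open>The Lanczos vectors, shifted by one index so that the two-term start of the recurrence
 is covered by \<open>x / 0 = 0\<close>.\<close>

fun w :: "nat => nat => real" where
 "w 0 = (%i. 0)"
| "w (Suc 0) = u"
| "w (Suc (Suc k)) = (%i. ip (w (Suc k)) (mv (w (Suc k))) / ip (w (Suc k)) (w (Suc k)) * w (Suc k) i -
  mv (w (Suc k)) i - ip (w (Suc k)) (w (Suc k)) / ip (w k) (w k) * w k i)"

definition h :: "nat => real" where "h k = ip (w k) (w k)"
definition al :: "nat => real" where "al k = ip (w k) (mv (w k)) / h k"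
definition be :: "nat => real" where "be k = h (Suc k) / h k"

text \<open>The vector \<open>w k\<close> is \<open>rp k\<close> evaluated at the matrix and applied
  to \<open>u\<close>. The signs of the recurrence give \<open>rp (Suc k)\<close> the leading
  coefficient \<open>(-1) ^ k\<close>, that of a product of \<open>k\<close> factors
  \<open>\<mu> - z\<close>.\<close>

fun rp :: "nat => real poly" where
 "rp 0 = 0"
| "rp (Suc 0) = 1"
| "rp (Suc (Suc k)) = [:al (Suc k), -1:] * rp (Suc k) - [:be k:] * rp k"

lemma w_rec: "w (Suc (Suc k)) i = al (Suc k) * w (Suc k) i - mv (w (Suc k)) i - be k * w k i"
 by (simp add: al_def be_def h_def)

declare w.simps(3) [simp del]

lemma ip_comm: "ip x y = ip y x" by (simp add: ip_def mult.commute)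

lemma ip_lin: "ip x (%i. a * y i - z i - b * v i) = a * ip x y - ip x z - b * ip x v"
 by (simp add: ip_def sum_distrib_left sum_subtractf[symmetric] algebra_simps)

lemma ip_mv: "ip x (mv y) = ip (mv x) y"
proof -
 have "ip x (mv y) = (\<Sum>i<n. \<Sum>j<n. x i * mm i j * y j)"
  by (simp add: ip_def mv_def sum_distrib_left mult.assoc)
 also have "... = (\<Sum>j<n. \<Sum>i<n. x i * mm i j * y j)" by (rule sum.swap)
 also have "... = ip (mv x) y"
  unfolding ip_def mv_def sum_distrib_right
  by (intro sum.cong refl) (auto simp: sym mult.commute)
 finally show ?thesis .
qed

lemma ip_w_rec: "ip x (w (Suc (Suc k))) = al (Suc k) * ip x (w (Suc k)) - ip x (mv (w (Suc k))) - be k * ip x (w k)"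
proof -
 have "w (Suc (Suc k)) = (%i. al (Suc k) * w (Suc k) i - mv (w (Suc k)) i - be k * w k i)"
  by (rule ext) (rule w_rec)
 thus ?thesis by (simp only: ip_lin)
qed

lemma ip_mv_w: "ip (mv x) (w (Suc k)) = al (Suc k) * ip x (w (Suc k)) - ip x (w (Suc (Suc k))) - be k * ip x (w k)"
 using ip_w_rec[of x k] by (simp add: ip_mv)

lemma ip_self_zero: "ip x x = 0 \<longleftrightarrow> (\<forall>i<n. x i = 0)"
 by (auto simp: ip_def sum_nonneg_eq_0_iff)

lemma ip_zero: "ip x x = 0 ==> ip x y = 0" "ip x x = 0 ==> ip y x = 0"
 unfolding ip_self_zero by (simp_all add: ip_def)

lemma ip_nonneg: "0 <= ip x x" by (simp add: ip_def sum_nonneg)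

lemma w0 [simp]: "ip (%_. 0) x = 0" "ip x (%_. 0) = 0" by (simp_all add: ip_def)

text \<open>No norm is assumed to be nonzero: a vector of norm 0 vanishes, and with it the products
  in which a division by 0 occurs. The new vector is orthogonal to the last two by the choice of
  \<open>al\<close> and \<open>be\<close>, and to earlier ones because \<open>mv\<close> is
  self-adjoint and maps each \<open>w\<close> to a combination of its neighbours.\<close>

lemma orth: "j < k ==> ip (w j) (w k) = 0"
proof (induction k arbitrary: j rule: less_induct)
 case (less k)
 consider "k = 1" | l where "k = Suc (Suc l)" using less.prems by (cases k; cases "k - 1") auto
 thus ?case
 proof cases
  case 1
  thus ?thesis using less by simp
 next
  case (2 l)
  note IH = less.IH
  have sy: "ip (w a) (w b) = 0" if "a < Suc (Suc l)" "b < Suc (Suc l)" "a ~= b" for a b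
   using IH[of b a] IH[of a b] that 2 ip_comm[of "w a"] by (cases "a < b") auto
  consider "j = Suc l" | "j = l" | "j = 0" | i where "j = Suc i" "j < l" using less.prems 2 by (cases j) force+
  thus ?thesis
  proof cases
   case 1
   have "al (Suc l) * ip (w (Suc l)) (w (Suc l)) = ip (w (Suc l)) (mv (w (Suc l)))"
    using ip_zero(1)[of "w (Suc l)" "mv (w (Suc l))"] by (auto simp: al_def h_def)
   thus ?thesis using 1 2 sy[of "Suc l" l] by (simp add: ip_w_rec)
  next
   case jl: 2
   show ?thesis
   proof (cases l)
    case 0 thus ?thesis using jl by simp
   next
    case (Suc i)
    have "ip (w l) (mv (w (Suc l))) = ip (mv (w (Suc l))) (w (Suc i))" unfolding Suc by (rule ip_comm)
    also have "... = al (Suc i) * ip (w (Suc l)) (w (Suc i)) - ip (w (Suc l)) (w (Suc (Suc i))) - be i * ip (w (Suc l)) (w i)"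
     by (rule ip_mv_w)
    also have "... = - h (Suc l)" using Suc sy[of "Suc l" "Suc i"] sy[of "Suc l" i] by (simp add: h_def)
    finally have "ip (w l) (mv (w (Suc l))) = - h (Suc l)" .
    moreover have "be l * ip (w l) (w l) = h (Suc l)" if "h l ~= 0"
     using that by (simp add: be_def h_def)
    ultimately show ?thesis
     using jl 2 sy[of l "Suc l"] ip_zero(1)[of "w l"] by (cases "h l = 0") (auto simp: ip_w_rec h_def)
   qed
  next
   case 3 thus ?thesis by simp
  next
   case (4 i)
   have "ip (w j) (mv (w (Suc l))) = ip (mv (w (Suc l))) (w (Suc i))" unfolding 4(1) by (rule ip_comm)
   also have "... = al (Suc i) * ip (w (Suc l)) (w (Suc i)) - ip (w (Suc l)) (w (Suc (Suc i))) - be i * ip (w (Suc l)) (w i)"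
    by (rule ip_mv_w)
   also have "... = 0" using 4 sy[of "Suc l" "Suc i"] sy[of "Suc l" "Suc (Suc i)"] sy[of "Suc l" i] by simp
   finally show ?thesis using 4 2 sy[of j "Suc l"] sy[of j l] by (simp add: ip_w_rec)
  qed
 qed
qed

text \<open>With all shifts 0 this is the Krylov basis, with the eigenvalues as shifts it is the
  vector that will vanish; a common triangularity lemma serves both.\<close>

fun yv :: "(nat => real) => nat => nat => real" where
 "yv \<nu> 0 = u"
| "yv \<nu> (Suc j) = (%i. mv (yv \<nu> j) i - \<nu> j * yv \<nu> j i)"

lemma ip_yv_Suc: "ip (yv \<nu> (Suc j)) x = ip (mv (yv \<nu> j)) x - \<nu> j * ip (yv \<nu> j) x"
 by (simp add: ip_def sum_distrib_left sum_subtractf[symmetric] algebra_simps)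

text \<open>Whatever the shifts, \<open>yv \<nu> j\<close> agrees with
  \<open>(-1) ^ j * w (Suc j)\<close> up to earlier Lanczos vectors, because the underlying
  polynomials of degree \<open>j\<close> have leading coefficients 1 and
  \<open>(-1) ^ j\<close>.\<close>

lemma yv_ip:
 assumes "!!i. i < j ==> h (Suc i) ~= 0"
 shows "(\<forall>k>Suc j. ip (yv \<nu> j) (w k) = 0) & ip (yv \<nu> j) (w (Suc j)) = (-1) ^ j * h (Suc j)"
 using assms
proof (induction j)
 case 0
 show ?case using orth[of "Suc 0"] by (auto simp: h_def)
next
 case (Suc j)
 hence IH: "!!k. k > Suc j ==> ip (yv \<nu> j) (w k) = 0" "ip (yv \<nu> j) (w (Suc j)) = (-1) ^ j * h (Suc j)" by auto
 have "ip (yv \<nu> (Suc j)) (w k) = 0" if "k > Suc (Suc j)" for k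
 proof -
  obtain l where "k = Suc l" "l > Suc j" using \<open>k > Suc (Suc j)\<close> by (cases k) auto
  thus ?thesis unfolding ip_yv_Suc by (simp add: ip_mv_w IH)
 qed
 moreover have "ip (yv \<nu> (Suc j)) (w (Suc (Suc j))) = (-1) ^ Suc j * h (Suc (Suc j))"
  unfolding ip_yv_Suc ip_mv_w using Suc.prems[of j] by (simp add: IH be_def)
 ultimately show ?case by blast
qed

lemma yv_vanish:
 assumes "!!i. i < n ==> yv \<nu> D i = 0"
 shows "\<exists>k\<le>D. h (Suc k) = 0"
proof (rule ccontr)
 assume "~ ?thesis"
 hence "!!i. i <= D ==> h (Suc i) ~= 0" by auto
 hence "ip (yv \<nu> D) (w (Suc D)) = (-1) ^ D * h (Suc D)" "h (Suc D) ~= 0" using yv_ip[of D \<nu>] by auto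
 moreover have "ip (yv \<nu> D) (w (Suc D)) = 0" using assms by (simp add: ip_def)
 ultimately show False by simp
qed

text \<open>An eigenvector sees the matrix as the scalar \<mu>, which turns the recurrence of the
  vectors into that of the polynomials.\<close>

lemma eigen_ip:
 assumes "!!i. i < n ==> mv x i = \<mu> * x i"
 shows "ip x (w k) = poly (rp k) \<mu> * ip x u"
proof (induction k rule: w.induct)
 case (3 k)
 have "ip x (mv (w (Suc k))) = \<mu> * ip x (w (Suc k))"
  unfolding ip_mv using assms by (simp add: ip_def sum_distrib_left mult.assoc)
 thus ?case using 3 by (simp add: ip_w_rec algebra_simps)
qed auto

lemma coeff_rp_rec: "poly.coeff (rp (Suc (Suc k))) l =
 al (Suc k) * poly.coeff (rp (Suc k)) l - (if l = 0 then 0 else poly.coeff (rp (Suc k)) (l - 1)) - be k * poly.coeff (rp k) l"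
 by (cases l) (simp_all add: coeff_pCons)

declare rp.simps(3) [simp del]

lemma coeff_rp: "(\<forall>l\<ge>k. poly.coeff (rp k) l = 0) & (\<forall>l\<ge>Suc k. poly.coeff (rp (Suc k)) l = 0) & poly.coeff (rp (Suc k)) k = (-1) ^ k"
 by (induction k) (auto simp: coeff_rp_rec)

lemma degree_rp: "degree (rp (Suc k)) = k" "lead_coeff (rp (Suc k)) = (-1) ^ k"
proof -
 have "degree (rp (Suc k)) <= k" by (rule degree_le) (use coeff_rp[of k] in auto)
 moreover have "degree (rp (Suc k)) >= k" by (rule le_degree) (use coeff_rp[of k] in auto)
 ultimately show "degree (rp (Suc k)) = k" by simp
 thus "lead_coeff (rp (Suc k)) = (-1) ^ k" using coeff_rp[of k] by simp
qed

abbreviation kv :: "nat => nat => real" where "kv \<equiv> yv (%_. 0)"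

lemma w_comb: "K >= k ==> w k i = (\<Sum>l<K. poly.coeff (rp k) l * kv l i)"
proof (induction k arbitrary: K i rule: less_induct)
 case (less k0)
 consider "k0 = 0" | "k0 = Suc 0" | k where "k0 = Suc (Suc k)" by (cases k0; cases "k0 - 1") auto
 thus ?case
 proof cases
 case 1
 thus ?thesis by simp
next
 case 2
 have "(\<Sum>l<K. poly.coeff (rp (Suc 0)) l * kv l i) = (\<Sum>l\<in>{0}. poly.coeff (rp (Suc 0)) l * kv l i)"
  by (rule sum.mono_neutral_right) (use 2 less.prems in \<open>auto simp: coeff_1\<close>)
 thus ?thesis using 2 by simp
next
 case (3 k)
 have I1: "w (Suc k) j = (\<Sum>l<L. poly.coeff (rp (Suc k)) l * kv l j)" if "Suc k <= L" for L j
  using less.IH[of "Suc k" L j] 3 that by simp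
 have I2: "w k j = (\<Sum>l<L. poly.coeff (rp k) l * kv l j)" if "k <= L" for L j
  using less.IH[of k L j] 3 that by simp
 have K: "Suc (Suc k) <= K" using less.prems 3 by simp
 have mvw: "mv (w (Suc k)) i = (\<Sum>l<Suc k. poly.coeff (rp (Suc k)) l * kv (Suc l) i)"
 proof -
  have "mv (w (Suc k)) i = (\<Sum>j<n. \<Sum>l<Suc k. mm i j * (poly.coeff (rp (Suc k)) l * kv l j))"
   unfolding mv_def using I1[of "Suc k"] by (simp add: sum_distrib_left del: sum.lessThan_Suc)
  also have "... = (\<Sum>l<Suc k. \<Sum>j<n. mm i j * (poly.coeff (rp (Suc k)) l * kv l j))" by (rule sum.swap)
  finally show ?thesis by (simp add: mv_def sum_distrib_left mult.left_commute del: sum.lessThan_Suc)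
 qed
 have mvw': "mv (w (Suc k)) i = (\<Sum>l<K. (if l = 0 then 0 else poly.coeff (rp (Suc k)) (l - 1)) * kv l i)"
 proof -
  have "(\<Sum>l<K. (if l = 0 then 0 else poly.coeff (rp (Suc k)) (l - 1)) * kv l i) =
   (\<Sum>l<Suc (Suc k). (if l = 0 then 0 else poly.coeff (rp (Suc k)) (l - 1)) * kv l i)"
   by (rule sum.mono_neutral_right) (use K coeff_rp[of "Suc k"] in auto)
  also have "... = (\<Sum>l<Suc k. poly.coeff (rp (Suc k)) l * kv (Suc l) i)"
   by (subst sum.lessThan_Suc_shift) simp
  finally show ?thesis using mvw by simp
 qed
 have "w (Suc (Suc k)) i = al (Suc k) * (\<Sum>l<K. poly.coeff (rp (Suc k)) l * kv l i) -
  (\<Sum>l<K. (if l = 0 then 0 else poly.coeff (rp (Suc k)) (l - 1)) * kv l i) - be k * (\<Sum>l<K. poly.coeff (rp k) l * kv l i)"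
  unfolding w_rec mvw' using I1[of K i] I2[of K i] K by simp
 also have "... = (\<Sum>l<K. poly.coeff (rp (Suc (Suc k))) l * kv l i)"
  by (simp add: coeff_rp_rec sum_distrib_left sum_subtractf[symmetric] algebra_simps)
 finally show ?thesis using 3 by simp
qed
qed

text \<open>The coefficient matrix \<open>E\<close> is upper and the matrix \<open>N\<close> of
  mixed products lower triangular; the signs \<open>(-1) ^ j\<close> on both diagonals cancel. For
  integer data this ties the rational norms to integer determinants.\<close>

lemma gram:
 assumes "!!i. i < k ==> h (Suc i) ~= 0"
 shows "(\<Prod>j<k. h (Suc j)) = det (mat k k (%(i, j). ip (kv i) (kv j)))"
proof -
 define Gm where "Gm = mat k k (%(i, j). ip (kv i) (kv j))"
 define E where "E = mat k k (%(l, j). poly.coeff (rp (Suc j)) l)"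
 define N where "N = mat k k (%(i, j). ip (kv i) (w (Suc j)))"
 have c: "Gm \<in> carrier_mat k k" "E \<in> carrier_mat k k" "N \<in> carrier_mat k k" by (auto simp: Gm_def E_def N_def)
 have "N = Gm * E"
 proof (rule eq_matI)
  fix i j assume ij: "i < dim_row (Gm * E)" "j < dim_col (Gm * E)"
  hence ij': "i < k" "j < k" using c by auto
  have "N $$ (i, j) = (\<Sum>t<n. kv i t * (\<Sum>l<k. poly.coeff (rp (Suc j)) l * kv l t))"
   using ij' w_comb[of "Suc j" k] by (simp add: N_def ip_def)
  also have "... = (\<Sum>l<k. \<Sum>t<n. kv i t * (poly.coeff (rp (Suc j)) l * kv l t))"
   unfolding sum_distrib_left by (rule sum.swap)
  also have "... = (\<Sum>l<k. ip (kv i) (kv l) * poly.coeff (rp (Suc j)) l)"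
   by (simp add: ip_def sum_distrib_left sum_distrib_right mult_ac)
  also have "... = (Gm * E) $$ (i, j)"
   using ij' by (simp add: Gm_def E_def scalar_prod_def atLeast0LessThan)
  finally show "N $$ (i, j) = (Gm * E) $$ (i, j)" .
 qed (use c in auto)
 hence d: "det N = det Gm * det E" using det_mult[OF c(1,2)] by simp
 have "det E = prod_list (diag_mat E)"
  by (rule det_upper_triangular[OF _ c(2)]) (use coeff_rp in \<open>auto simp: E_def\<close>)
 also have "diag_mat E = map (%j. (-1) ^ j) [0..<k]"
  using coeff_rp by (auto simp: diag_mat_def E_def)
 finally have dE: "det E = (\<Prod>j<k. (-1) ^ j)" by (simp add: prod.list_conv_set_nth atLeast0LessThan)
 have "det N = prod_list (diag_mat N)"
  by (rule det_lower_triangular[OF _ c(3)]) (use yv_ip[of _ "%_. 0"] assms in \<open>auto simp: N_def\<close>)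
 also have "diag_mat N = map (%j. (-1) ^ j * h (Suc j)) [0..<k]"
  using yv_ip[of _ "%_. 0"] assms by (auto simp: diag_mat_def N_def)
 finally have dN: "det N = (\<Prod>j<k. (-1) ^ j * h (Suc j))" by (simp add: prod.list_conv_set_nth atLeast0LessThan)
 have "(\<Prod>j<k. (-1) ^ j) * (\<Prod>j<k. h (Suc j)) = det Gm * (\<Prod>j<k. (-1) ^ j)"
  using d unfolding dE dN by (simp add: prod.distrib)
 moreover have "(\<Prod>j<k. (-1::real) ^ j) ~= 0" by simp
 ultimately show ?thesis by (simp add: Gm_def)
qed

text \<open>Cauchy-Schwarz for \<open>kv j\<close> and \<open>w (Suc j)\<close>, whose inner product
  is plus or minus \<open>h (Suc j)\<close>.\<close>

lemma h_le_kv: "(!!i. i < j ==> h (Suc i) ~= 0) ==> h (Suc j) <= ip (kv j) (kv j)"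
proof -
 assume "!!i. i < j ==> h (Suc i) ~= 0"
 hence "(ip (kv j) (w (Suc j)))\<^sup>2 = (h (Suc j))\<^sup>2" using yv_ip[of j "%_. 0"]
  by (simp add: power_mult_distrib flip: power_mult)
 moreover have "(ip (kv j) (w (Suc j)))\<^sup>2 <= ip (kv j) (kv j) * h (Suc j)"
  unfolding h_def using Cauchy_Schwarz_ineq_sum[of "kv j" "w (Suc j)" "{..<n}"]
  by (simp add: ip_def power2_eq_square)
 ultimately have "h (Suc j) * h (Suc j) <= ip (kv j) (kv j) * h (Suc j)" by (simp add: power2_eq_square)
 moreover have "h (Suc j) >= 0" using ip_nonneg by (simp add: h_def)
 ultimately show ?thesis using ip_nonneg[of "kv j"] by (cases "h (Suc j) = 0") auto
qed

text \<open>Let \<open>d\<close> be the first index with vanishing norm. Annihilation by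
  \<open>card S\<close> factors gives \<open>d <= card S\<close>. At \<open>d\<close> the polynomial
  vanishes on all of \<open>S\<close>, since each eigenvalue has an eigenvector that is not
  orthogonal to \<open>u\<close>; hence its degree \<open>d\<close> is at least
  \<open>card S\<close>.\<close>

theorem krylov:
 fixes S :: "real set"
 assumes S: "finite S" "S ~= {}"
  and eig: "!!\<mu>. \<mu> \<in> S ==> \<exists>x. (\<forall>i<n. mv x i = \<mu> * x i) & ip x u ~= 0"
  and ann: "!!i. i < n ==> yv \<nu> (card S) i = 0"
 shows "!!k. k < card S ==> h (Suc k) ~= 0" "h (Suc (card S)) = 0"
  "poly (rp (Suc (card S))) z = (\<Prod>\<mu>\<in>S. \<mu> - z)"
proof -
 define d where "d = (LEAST k. h (Suc k) = 0)"
 obtain k0 where k0: "k0 <= card S" "h (Suc k0) = 0" using yv_vanish[OF ann] by auto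
 have hd: "h (Suc d) = 0" unfolding d_def by (rule LeastI[of _ k0]) (rule k0(2))
 have lt: "h (Suc k) ~= 0" if "k < d" for k using not_less_Least[of k] that unfolding d_def by auto
 have dS: "d <= card S" unfolding d_def using k0 by (meson Least_le order_trans)
 have roots: "poly (rp (Suc d)) \<mu> = 0" if mu: "\<mu> \<in> S" for \<mu>
 proof -
  obtain x where x: "\<forall>i<n. mv x i = \<mu> * x i" "ip x u ~= 0" using eig[OF mu] by auto
  have "ip x (w (Suc d)) = poly (rp (Suc d)) \<mu> * ip x u" by (rule eigen_ip) (use x in auto)
  moreover have "ip x (w (Suc d)) = 0" using ip_zero(2)[of "w (Suc d)"] hd by (simp add: h_def)
  ultimately show ?thesis using x by simp
 qed
 have nz: "rp (Suc d) ~= 0" using degree_rp(2)[of d] by auto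
 have "card S <= card {x. poly (rp (Suc d)) x = 0}"
  by (rule card_mono) (use roots poly_roots_finite[OF nz] in auto)
 also have "... <= d" using card_poly_roots_bound[OF nz] by (simp add: degree_rp)
 finally have dd: "d = card S" using dS by simp
 show "h (Suc k) ~= 0" if "k < card S" for k using lt that dd by simp
 show "h (Suc (card S)) = 0" using hd dd by simp
 define g where "g = (\<Prod>\<mu>\<in>S. [:\<mu>, -1:])"
 have dg: "degree g = card S"
 proof -
  have "degree g = (\<Sum>\<mu>\<in>S. degree [:\<mu>, -1:])" unfolding g_def by (rule degree_prod_eq_sum_degree) auto
  thus ?thesis by simp
 qed
 have lg: "lead_coeff g = (-1) ^ card S" unfolding g_def by (simp add: lead_coeff_prod)
 define f where "f = rp (Suc d) - g"
 \<comment> \<open>The leading terms cancel, so the difference has degree below \<open>d\<close>,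
   yet it vanishes at the \<open>card S = d\<close> points of \<open>S\<close>.\<close>
 have "f = 0"
 proof (rule ccontr)
  assume nf: "f ~= 0"
  have "degree f < d"
  proof (rule degree_lessI)
   show "f ~= 0 \<or> 0 < d" using nf by simp
   show "\<forall>k\<ge>d. poly.coeff f k = 0"
   proof (intro allI impI)
    fix k assume k: "k >= d"
    show "poly.coeff f k = 0"
    proof (cases "k = d")
     case True
     thus ?thesis using degree_rp[of d] dg lg dd by (simp add: f_def)
    next
     case False
     hence "k > degree (rp (Suc d))" "k > degree g" using k degree_rp[of d] dg dd by auto
     thus ?thesis by (simp add: f_def coeff_eq_0)
    qed
   qed
  qed
  moreover have "poly f \<mu> = 0" if "\<mu> \<in> S" for \<mu>
   using roots[OF that] that S by (simp add: f_def g_def poly_prod prod_zero_iff)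
  hence "card S <= card {x. poly f x = 0}"
   by (intro card_mono) (use poly_roots_finite[OF nf] in auto)
  ultimately show False using card_poly_roots_bound[OF nf] dd by simp
 qed
 hence "rp (Suc d) = g" by (simp add: f_def)
 thus "poly (rp (Suc (card S))) z = (\<Prod>\<mu>\<in>S. \<mu> - z)" using dd by (simp add: g_def poly_prod)
qed

end

section \<open>Reduction modulo a prime\<close>

text \<open>Reduction modulo \<open>m\<close> on the fractions whose denominator is coprime to
  \<open>m\<close>, for arbitrary \<open>m\<close>. It is a relation because a real number comes
  without a numerator and denominator to compute with.\<close>

definition rl :: "int => real => int => bool" where
 "rl m q r \<longleftrightarrow> (\<exists>a b. cop b m & b ~= 0 & of_int b * q = of_int a & m dvd b * r - a)"

lemma rl_of_int: "rl m (of_int x) x"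
 unfolding rl_def by (rule exI[of _ x], rule exI[of _ 1]) auto

lemma rl_cong: "rl m q r ==> m dvd r' - r ==> rl m q r'"
 unfolding rl_def
proof (elim exE conjE)
 fix a b assume h: "m dvd r' - r" "cop b m" "b ~= 0" "of_int b * q = of_int a" "m dvd b * r - a"
 have "b * r' - a = b * (r' - r) + (b * r - a)" by (simp add: algebra_simps)
 hence "m dvd b * r' - a" using h by (metis dvd_add dvd_mult)
 thus "\<exists>a b. cop b m & b ~= 0 & of_int b * q = of_int a & m dvd b * r' - a" using h by blast
qed

lemma rl_mod: "rl m q r ==> rl m q (r mod m)"
 by (erule rl_cong) (metis dvd_minus_mod dvd_diff_commute)

lemma rl_add: assumes "rl m q r" "rl m q' r'" shows "rl m (q + q') (r + r')"
proof -
 obtain a b where 1: "cop b m" "b ~= 0" "of_int b * q = of_int a" "m dvd b * r - a"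
  using assms(1) by (auto simp: rl_def)
 obtain a' b' where 2: "cop b' m" "b' ~= 0" "of_int b' * q' = of_int a'" "m dvd b' * r' - a'"
  using assms(2) by (auto simp: rl_def)
 have "of_int (b * b') * (q + q') = of_int (b' * a + b * a')"
  by (simp add: 1(3)[symmetric] 2(3)[symmetric] algebra_simps)
 moreover have "b * b' * (r + r') - (b' * a + b * a') = b' * (b * r - a) + b * (b' * r' - a')"
  by (simp add: algebra_simps)
 hence "m dvd b * b' * (r + r') - (b' * a + b * a')" using 1 2 by (metis dvd_add dvd_mult)
 ultimately show ?thesis unfolding rl_def using 1 2
  by (intro exI[of _ "b' * a + b * a'"] exI[of _ "b * b'"]) auto
qed

lemma rl_mult: assumes "rl m q r" "rl m q' r'" shows "rl m (q * q') (r * r')"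
proof -
 obtain a b where 1: "cop b m" "b ~= 0" "of_int b * q = of_int a" "m dvd b * r - a"
  using assms(1) by (auto simp: rl_def)
 obtain a' b' where 2: "cop b' m" "b' ~= 0" "of_int b' * q' = of_int a'" "m dvd b' * r' - a'"
  using assms(2) by (auto simp: rl_def)
 have "of_int (b * b') * (q * q') = (of_int b * q) * (of_int b' * q')" by (simp add: mult_ac)
 also have "... = of_int (a * a')" by (simp add: 1 2)
 finally have e: "of_int (b * b') * (q * q') = of_int (a * a')" .
 have "b * b' * (r * r') - a * a' = (b * r - a) * (b' * r') + a * (b' * r' - a')"
  by (simp add: algebra_simps)
 hence "m dvd b * b' * (r * r') - a * a'" using 1 2 by (metis dvd_add dvd_mult dvd_mult2)
 with e show ?thesis unfolding rl_def using 1 2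
  by (intro exI[of _ "a * a'"] exI[of _ "b * b'"]) auto
qed

lemma rl_diff: assumes "rl m q r" "rl m q' r'" shows "rl m (q - q') (r - r')"
 using rl_add[OF assms(1) rl_mult[OF rl_of_int[of m "-1"] assms(2)]] by simp

lemma rl_sum: "(!!i. i < (k::nat) ==> rl m (f i) (g i)) ==> rl m (\<Sum>i<k. f i) (\<Sum>i<k. g i)"
 using rl_of_int[of m 0] by (induction k) (auto intro: rl_add)

lemma rl_int: assumes "rl m (of_int x) r" shows "m dvd r - x"
proof -
 obtain a b where 1: "cop b m" "of_int b * real_of_int x = of_int a" "m dvd b * r - a"
  using assms by (auto simp: rl_def)
 have "a = b * x" using 1(2) by (metis of_int_eq_iff of_int_mult)
 hence "m dvd b * (r - x)" using 1(3) by (simp add: algebra_simps)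
 moreover have "cop m b" using 1(1) by (simp add: ac_simps)
 ultimately show ?thesis using coprime_dvd_mult_right_iff[of m b "r - x"] by blast
qed

text \<open>An invertible residue makes the numerator coprime to \<open>m\<close>, so that it can
  serve as the new denominator. This is the certificate that makes untested moduli safe: a
  successful inversion proves that the exact number is nonzero.\<close>

lemma rl_inverse:
 assumes "rl m q r" "m dvd r * r' - 1" "m > 1"
 shows "q ~= 0" "rl m (1 / q) r'"
proof -
 obtain a b where 1: "cop b m" "b ~= 0" "of_int b * q = of_int a" "m dvd b * r - a"
  using assms(1) by (auto simp: rl_def)
 have cr: "cop r m"
 proof (rule algebraic_semidom_class.coprimeI)
  fix c assume c: "c dvd r" "c dvd m"
  hence "c dvd r * r' - (r * r' - 1)" using assms(2) by (metis dvd_diff dvd_mult2 dvd_trans)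
  thus "is_unit c" by simp
 qed
 have ca: "cop a m"
 proof (rule algebraic_semidom_class.coprimeI)
  fix c assume c: "c dvd a" "c dvd m"
  have "c dvd (b * r - a) + a" by (rule dvd_add[OF dvd_trans[OF c(2) 1(4)] c(1)])
  hence "c dvd b * r" by simp
  moreover have "cop (b * r) m" using 1 cr by simp
  ultimately show "is_unit c" using c(2) coprime_common_divisor by blast
 qed
 hence a0: "a ~= 0" using assms(3) by auto
 thus q: "q ~= 0" using 1(3) by auto
 have "of_int a * (1 / q) = of_int b" using q by (simp add: 1(3)[symmetric])
 moreover have "a * r' - b = b * (r * r' - 1) - (b * r - a) * r'" by (simp add: algebra_simps)
 hence "m dvd a * r' - b" using 1(4) assms(2) by (metis dvd_diff dvd_mult dvd_mult2)
 ultimately show "rl m (1 / q) r'" unfolding rl_def using ca a0 by blast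
qed

subsection \<open>Annihilating the Krylov space\<close>

definition TT :: "real mat => real => real vec => real vec" where
 "TT B l y = B *\<^sub>v y - l \<cdot>\<^sub>v y"

primrec ap :: "real mat => real list => real vec => real vec" where
 "ap B [] y = y"
| "ap B (l # ls) y = ap B ls (TT B l y)"

lemma TT_carrier [simp]: "B \<in> carrier_mat n n ==> y \<in> carrier_vec n ==> TT B l y \<in> carrier_vec n"
 by (auto simp: TT_def)

lemma ap_carrier [simp]: "B \<in> carrier_mat n n ==> y \<in> carrier_vec n ==> ap B ls y \<in> carrier_vec n"
 by (induction ls arbitrary: y) auto

lemma ap_append: "ap B (xs @ ys) y = ap B ys (ap B xs y)"
 by (induction xs arbitrary: y) auto

lemma TT_index: "B \<in> carrier_mat n n ==> y \<in> carrier_vec n ==> i < n ==>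
  TT B l y $ i = (\<Sum>j<n. B $$ (i, j) * y $ j) - l * y $ i"
 by (auto simp: TT_def scalar_prod_def atLeast0LessThan)

text \<open>Each factor clears the last coordinate that may still be nonzero, since upper
  triangularity leaves only the diagonal entry to act on it.\<close>

lemma ap_triangular:
 assumes B: "B \<in> carrier_mat n n" "upper_triangular B"
  and "length ls <= n" "!!i. i < length ls ==> B $$ (i, i) = rev ls ! i"
  "y \<in> carrier_vec n" "!!i. i < n ==> length ls <= i ==> y $ i = 0"
 shows "ap B ls y = 0\<^sub>v n"
 using assms(3-)
proof (induction ls arbitrary: y)
 case Nil
 thus ?case by (intro eq_vecI) auto
next
 case (Cons l ls)
 have z: "TT B l y $ i = 0" if i: "i < n" "length ls <= i" for i
 proof -
  have s: "(\<Sum>j<n. B $$ (i, j) * y $ j) = (\<Sum>j\<in>{i}. B $$ (i, j) * y $ j)"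
  proof (rule sum.mono_neutral_right)
   show "\<forall>j\<in>{..<n} - {i}. B $$ (i, j) * y $ j = 0"
   proof
    fix j assume j: "j \<in> {..<n} - {i}"
    show "B $$ (i, j) * y $ j = 0"
    proof (cases "j < i")
     case True
     hence "B $$ (i, j) = 0" using B i by (auto simp: upper_triangular_def)
     thus ?thesis by simp
    next
     case False
     thus ?thesis using j i Cons.prems(4)[of j] by auto
    qed
   qed
  qed (use i in auto)
  have "B $$ (i, i) * y $ i = l * y $ i"
  proof (cases "i = length ls")
   case True
   hence "B $$ (i, i) = l" using Cons.prems(2)[of i] by (simp add: nth_append)
   thus ?thesis by simp
  next
   case False
   thus ?thesis using Cons.prems(4)[of i] i by simp
  qed
  thus ?thesis using TT_index[OF B(1) Cons.prems(3) i(1)] s by simp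
 qed
 have "ap B ls (TT B l y) = 0\<^sub>v n"
 proof (rule Cons.IH)
  show "B $$ (i, i) = rev ls ! i" if "i < length ls" for i
   using Cons.prems(2)[of i] that by (simp add: nth_append)
 qed (use Cons.prems B z in auto)
 thus ?case by simp
qed

lemma ap_zero: "B \<in> carrier_mat n n ==> ap B ls (0\<^sub>v n) = 0\<^sub>v n"
proof (induction ls)
 case (Cons l ls)
 have "TT B l (0\<^sub>v n) = 0\<^sub>v n" using Cons.prems by (intro eq_vecI) (auto simp: TT_def)
 thus ?case using Cons by simp
qed simp

text \<open>Cayley-Hamilton in factored form, carried over from the triangular factor of a Schur
  decomposition by the similarity \<open>P\<close>.\<close>

lemma ap_char_poly:
 assumes A: "A \<in> carrier_mat n n" and c: "char_poly A = (\<Prod>l\<leftarrow>ls. [:- l, 1:])" and y: "y \<in> carrier_vec n"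
 shows "ap A ls y = 0\<^sub>v n"
proof -
 \<comment> \<open>Factors are applied from the head of the list, but a triangular matrix is cleared
   from its last row; the diagonal must therefore list the eigenvalues in reverse.\<close>
 have c': "char_poly A = (\<Prod>l\<leftarrow>rev ls. [:- l, 1:])"
 proof -
  have "prod_list (rev xs) = prod_list xs" for xs :: "real poly list"
   by (induction xs) (auto simp: mult.commute)
  thus ?thesis unfolding c rev_map[symmetric] by simp
 qed
 obtain B P Q where s: "schur_decomposition A (rev ls) = (B, P, Q)" by (cases "schur_decomposition A (rev ls)") auto
 from schur_decomposition[OF A c' s]
 have sim: "similar_mat_wit A B P Q" and tri: "upper_triangular B" and diag: "diag_mat B = rev ls" by auto
 note d = similar_mat_witD2[OF A sim]
 have len: "length ls = n" using arg_cong[OF diag, of length] d(5) by (simp add: diag_mat_def)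
 have step: "TT A l (P *\<^sub>v z) = P *\<^sub>v TT B l z" if z: "z \<in> carrier_vec n" for l z
 proof -
  have "A *\<^sub>v (P *\<^sub>v z) = (A * P) *\<^sub>v z" by (rule assoc_mult_mat_vec[OF A d(6) z, symmetric])
  also have "A * P = P * B * (Q * P)" unfolding d(3) using d by (simp add: assoc_mult_mat[of _ n n _ n _ n])
  also have "... = P * B" using d by simp
  also have "(P * B) *\<^sub>v z = P *\<^sub>v (B *\<^sub>v z)" using d z by (simp add: assoc_mult_mat_vec)
  finally show ?thesis unfolding TT_def using d z
   by (simp add: mult_minus_distrib_mat_vec[of P n n] mult_mat_vec[of P n n])
 qed
 have ap: "ap A xs (P *\<^sub>v z) = P *\<^sub>v ap B xs z" if "z \<in> carrier_vec n" for xs z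
  using that by (induction xs arbitrary: z) (use step d in auto)
 have "y = P *\<^sub>v (Q *\<^sub>v y)" using d y by (simp add: assoc_mult_mat_vec[symmetric])
 hence "ap A ls y = P *\<^sub>v ap B ls (Q *\<^sub>v y)" using ap[of "Q *\<^sub>v y" ls] d y by simp
 also have "ap B ls (Q *\<^sub>v y) = 0\<^sub>v n"
 proof (rule ap_triangular[OF d(5) tri])
  show "B $$ (i, i) = rev ls ! i" if "i < length ls" for i
  proof -
   have "diag_mat B ! i = B $$ (i, i)" using that len d(5) by (simp add: diag_mat_def)
   thus ?thesis unfolding diag by simp
  qed
 qed (use len d y in auto)
 finally show ?thesis using d by auto
qed

lemma TT_commute:
 assumes A: "A \<in> carrier_mat n n" and M: "M \<in> carrier_mat n n" and AM: "A * M = M * A" and y: "y \<in> carrier_vec n"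
 shows "TT M \<mu> (c \<cdot>\<^sub>v TT A \<kappa> y) = c \<cdot>\<^sub>v TT A \<kappa> (TT M \<mu> y)"
proof -
 have 1: "M *\<^sub>v (A *\<^sub>v y) = A *\<^sub>v (M *\<^sub>v y)"
  using A M y AM by (metis assoc_mult_mat_vec)
 have 2: "M *\<^sub>v (c \<cdot>\<^sub>v TT A \<kappa> y) = c \<cdot>\<^sub>v (A *\<^sub>v (M *\<^sub>v y) - \<kappa> \<cdot>\<^sub>v (M *\<^sub>v y))"
  using A M y by (simp add: TT_def mult_mat_vec[of M n n] mult_minus_distrib_mat_vec[of M n n] 1)
 have 3: "A *\<^sub>v TT M \<mu> y = A *\<^sub>v (M *\<^sub>v y) - \<mu> \<cdot>\<^sub>v (A *\<^sub>v y)"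
  using A M y by (simp add: TT_def mult_mat_vec[of A n n] mult_minus_distrib_mat_vec[of A n n])
 have "TT M \<mu> (c \<cdot>\<^sub>v TT A \<kappa> y) = c \<cdot>\<^sub>v (A *\<^sub>v (M *\<^sub>v y) - \<kappa> \<cdot>\<^sub>v (M *\<^sub>v y)) - \<mu> \<cdot>\<^sub>v (c \<cdot>\<^sub>v TT A \<kappa> y)"
  using 2 by (simp add: TT_def[of M])
 also have "... = c \<cdot>\<^sub>v ((A *\<^sub>v (M *\<^sub>v y) - \<mu> \<cdot>\<^sub>v (A *\<^sub>v y)) - \<kappa> \<cdot>\<^sub>v TT M \<mu> y)"
  by (rule eq_vecI) (use A M y in \<open>auto simp: TT_def algebra_simps\<close>)
 also have "... = c \<cdot>\<^sub>v TT A \<kappa> (TT M \<mu> y)" unfolding TT_def[of A] 3 ..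
 finally show ?thesis .
qed

lemma ap_commute:
 assumes A: "A \<in> carrier_mat n n" and M: "M \<in> carrier_mat n n" and AM: "A * M = M * A" and y: "y \<in> carrier_vec n"
 shows "ap M \<mu>s (c \<cdot>\<^sub>v TT A \<kappa> y) = c \<cdot>\<^sub>v TT A \<kappa> (ap M \<mu>s y)"
 using y by (induction \<mu>s arbitrary: y) (use A M AM TT_commute in auto)

lemma ap_commute1:
 assumes M: "M \<in> carrier_mat n n" and y: "y \<in> carrier_vec n"
 shows "ap M \<mu>s (TT M \<kappa> y) = TT M \<kappa> (ap M \<mu>s y)"
 using ap_commute[OF M M refl y, of \<mu>s 1 \<kappa>] by simp

text \<open>From \<open>s A A - s l l = s (A + l) (A - l)\<close>: each factor of the square
  contains a factor of \<open>A\<close>, and the surplus factors commute out of the way.\<close>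

lemma ap_square:
 assumes A: "A \<in> carrier_mat n n" and M: "M = s \<cdot>\<^sub>m (A * A)" and y: "y \<in> carrier_vec n" and z: "ap A ls y = 0\<^sub>v n"
 shows "ap M (map (%l. s * l\<^sup>2) ls) y = 0\<^sub>v n"
 using y z
proof (induction ls arbitrary: y)
 case (Cons l ls)
 have Mc: "M \<in> carrier_mat n n" using A M by auto
 have AM: "A * M = M * A" unfolding M using A
  by (simp add: mult_smult_distrib[of _ n n _ n] mult_smult_assoc_mat[of _ n n _ n] assoc_mult_mat[of _ n n _ n _ n])
 define y' where "y' = TT A l y"
 have y': "y' \<in> carrier_vec n" using A Cons.prems by (simp add: y'_def)
 have AA: "M *\<^sub>v y = s \<cdot>\<^sub>v (A *\<^sub>v (A *\<^sub>v y))" 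
 proof -
  have "(s \<cdot>\<^sub>m C) *\<^sub>v y = s \<cdot>\<^sub>v (C *\<^sub>v y)" if "C \<in> carrier_mat n n" for C using that Cons.prems
   by (intro eq_vecI) (auto simp: scalar_prod_def sum_distrib_left mult.assoc)
  from this[of "A * A"] have "M *\<^sub>v y = s \<cdot>\<^sub>v ((A * A) *\<^sub>v y)" unfolding M using A by simp
  thus ?thesis using assoc_mult_mat_vec[OF A A Cons.prems(1)] by simp
 qed
 have Ay': "A *\<^sub>v y' = A *\<^sub>v (A *\<^sub>v y) - l \<cdot>\<^sub>v (A *\<^sub>v y)"
  using A Cons.prems by (simp add: y'_def TT_def mult_mat_vec[of A n n] mult_minus_distrib_mat_vec[of A n n])
 have "TT M (s * l\<^sup>2) y = s \<cdot>\<^sub>v TT A (- l) y'"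
  unfolding TT_def AA Ay' unfolding y'_def TT_def
  by (rule eq_vecI) (use A Cons.prems in \<open>auto simp: algebra_simps power2_eq_square\<close>)
 hence "ap M (map (%l. s * l\<^sup>2) (l # ls)) y = s \<cdot>\<^sub>v TT A (- l) (ap M (map (%l. s * l\<^sup>2) ls) y')"
  using ap_commute[OF A Mc AM y'] by simp
 also have "ap M (map (%l. s * l\<^sup>2) ls) y' = 0\<^sub>v n"
  by (rule Cons.IH[OF y']) (use Cons.prems in \<open>simp add: y'_def\<close>)
 also have "s \<cdot>\<^sub>v TT A (- l) (0\<^sub>v n) = 0\<^sub>v n" using A by (intro eq_vecI) (auto simp: TT_def)
 finally show ?case .
qed simp

text \<open>For symmetric \<open>M\<close> the square of \<open>M - \<mu>\<close> has the same
  kernel as \<open>M - \<mu>\<close>: for \<open>r = TT M \<mu> t\<close>, the product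
  \<open>r \<bullet> r\<close> equals \<open>TT M \<mu> r \<bullet> t\<close>.\<close>

lemma TT_square_zero:
 assumes M: "M \<in> carrier_mat n n" "transpose_mat M = M" and t: "t \<in> carrier_vec n"
  and z: "TT M \<mu> (TT M \<mu> t) = 0\<^sub>v n"
 shows "TT M \<mu> t = 0\<^sub>v n"
proof -
 define r where "r = TT M \<mu> t"
 have r: "r \<in> carrier_vec n" using M t by (simp add: r_def)
 have sp: "(M *\<^sub>v r) \<bullet> t = r \<bullet> (M *\<^sub>v t)" using transpose_vec_mult_scalar[OF M(1) t r] M(2) by simp
 have "r \<bullet> r = r \<bullet> (M *\<^sub>v t) - r \<bullet> (\<mu> \<cdot>\<^sub>v t)"
  using M t r by (subst (2) r_def) (simp add: TT_def scalar_prod_minus_distrib[of _ n])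
 also have "... = TT M \<mu> r \<bullet> t"
  using M t r sp by (simp add: TT_def minus_scalar_prod_distrib[of _ n])
 also have "... = 0" using z t by (simp add: r_def)
 finally have "r \<bullet> r = 0" .
 hence "(\<Sum>i<n. r $ i * r $ i) = 0" using r by (simp add: scalar_prod_def atLeast0LessThan)
 hence "\<forall>i<n. r $ i = 0" by (subst (asm) sum_nonneg_eq_0_iff) auto
 thus ?thesis unfolding r_def[symmetric] using r by (intro eq_vecI) auto
qed

text \<open>A factor \<open>M - \<mu>\<close> that already occurs in the second list may be dropped,
  so only the set of roots matters. This is what bounds the Krylov dimension by the number of
  distinct eigenvalues.\<close>

lemma ap_remove_duplicates:
 assumes M: "M \<in> carrier_mat n n" "transpose_mat M = M"
  and "y \<in> carrier_vec n" "ap M \<mu>s y = 0\<^sub>v n" "set \<mu>s \<subseteq> set \<mu>s'"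
 shows "ap M \<mu>s' y = 0\<^sub>v n"
 using assms(3-)
proof (induction \<mu>s arbitrary: y)
 case Nil
 thus ?case using ap_zero[OF M(1)] by simp
next
 case (Cons \<mu> \<mu>s)
 have 1: "ap M \<mu>s' (TT M \<mu> y) = 0\<^sub>v n" by (rule Cons.IH) (use Cons.prems M in auto)
 obtain xs ys where sp: "\<mu>s' = xs @ \<mu> # ys" using Cons.prems by (meson list.set_intros(1) split_list subsetD)
 define t where "t = ap M ys (ap M xs y)"
 have t: "t \<in> carrier_vec n" using M Cons.prems by (simp add: t_def)
 have eq: "ap M \<mu>s' y = TT M \<mu> t"
  unfolding sp t_def using M Cons.prems by (simp add: ap_append ap_commute1[of M n])
 have "TT M \<mu> (TT M \<mu> t) = 0\<^sub>v n"
  using 1 ap_commute1[OF M(1) Cons.prems(1), of \<mu>s' \<mu>] eq by simp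
 thus ?case unfolding eq by (rule TT_square_zero[OF M t])
qed

section \<open>Integrality of the minimal polynomial and size of the Gram determinants\<close>

lemma Rats_sum': "(!!i. i \<in> I ==> f i \<in> \<rat>) ==> sum f I \<in> (\<rat> :: real set)"
 by (induction I rule: infinite_finite_induct) auto

lemma (in lanczos) rational:
 assumes mm: "!!i j. i < n ==> j < n ==> mm i j \<in> \<rat>" and u: "!!i. i < n ==> u i \<in> \<rat>"
 shows "poly.coeff (rp k) l \<in> \<rat>"
proof -
 have ipr: "ip x y \<in> \<rat>" if "!!i. i < n ==> x i \<in> \<rat>" "!!i. i < n ==> y i \<in> \<rat>" for x y
  unfolding ip_def using that by (intro Rats_sum') auto
 have mvr: "mv x i \<in> \<rat>" if "!!i. i < n ==> x i \<in> \<rat>" "i < n" for x i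
  unfolding mv_def using that mm by (intro Rats_sum') auto
 have wr: "\<forall>i<n. w k i \<in> \<rat>" for k
 proof (induction k rule: less_induct)
  case (less k)
  consider "k = 0" | "k = Suc 0" | j where "k = Suc (Suc j)" by (cases k; cases "k - 1") auto
  thus ?case
  proof cases
   case 3
   have 1: "\<forall>i<n. w (Suc j) i \<in> \<rat>" "\<forall>i<n. w j i \<in> \<rat>" using less 3 by auto
   thus ?thesis using 3 unfolding 3 w_rec al_def be_def h_def
    by (auto intro!: ipr mvr Rats_diff Rats_mult Rats_divide)
  qed (use u in auto)
 qed
 have "al k \<in> \<rat>" "be k \<in> \<rat>" for k
  unfolding al_def be_def h_def using wr by (auto intro!: ipr mvr Rats_divide)
 hence ab: "al k \<in> \<rat>" "be k \<in> \<rat>" for k by auto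
 show ?thesis
 proof (induction k arbitrary: l rule: less_induct)
  case (less k)
  consider "k = 0" | "k = Suc 0" | j where "k = Suc (Suc j)" by (cases k; cases "k - 1") auto
  thus ?case
  proof cases
   case 3
   have 1: "poly.coeff (rp (Suc j)) i \<in> \<rat>" "poly.coeff (rp j) i \<in> \<rat>" for i using less 3 by auto
   thus ?thesis using ab unfolding 3 coeff_rp_rec by (auto intro!: Rats_diff Rats_mult)
  qed (auto simp: coeff_1)
 qed
qed

lemma prod_linear_dvd:
 fixes S :: "real set"
 assumes "finite S" "!!\<mu>. \<mu> \<in> S ==> poly p \<mu> = 0"
 shows "(\<Prod>\<mu>\<in>S. [:\<mu>, -1:]) dvd p"
 using assms
proof (induction S arbitrary: p rule: finite_induct)
 case (insert \<mu> S)
 have "[:-\<mu>, 1:] dvd p" using insert.prems by (simp add: poly_eq_0_iff_dvd)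
 then obtain q where q: "p = [:-\<mu>, 1:] * q" by (auto elim: dvdE)
 have "poly (- q) \<nu> = 0" if "\<nu> \<in> S" for \<nu>
  using insert.prems[of \<nu>] insert.hyps that unfolding q by auto
 hence "(\<Prod>\<mu>\<in>S. [:\<mu>, -1:]) dvd - q" by (rule insert.IH)
 hence "[:\<mu>, -1:] * (\<Prod>\<mu>\<in>S. [:\<mu>, -1:]) dvd [:\<mu>, -1:] * (- q)" by (rule mult_dvd_mono[OF dvd_refl])
 moreover have "[:\<mu>, -1:] * (- q) = p" unfolding q by (simp add: algebra_simps)
 ultimately show ?case using insert.hyps by simp
qed simp

text \<open>Gauss' lemma: the primitive integer polynomial proportional to a rational factor of a
  monic one has leading coefficient 1 or -1. As the factor has such a leading coefficient too, the
  positive factor of proportionality is 1.\<close>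

lemma int_poly_of_rational_factor:
 fixes f :: "real poly" and c :: "int poly"
 assumes rat: "!!l. poly.coeff f l \<in> \<rat>" and c: "monic c" and dvd: "f dvd map_poly real_of_int c"
  and lc: "lead_coeff f = 1 \<or> lead_coeff f = - 1"
 shows "\<exists>g :: int poly. f = map_poly real_of_int g"
proof -
 \<comment> \<open>Choice inverts the embedding of the rationals, so that the real polynomial
   descends to one over \<open>rat\<close>.\<close>
 define \<phi> where "\<phi> x = (SOME r. x = real_of_rat r)" for x
 have ph: "real_of_rat (\<phi> x) = x" if "x \<in> \<rat>" for x
  using that someI_ex[of "%r. x = real_of_rat r"] unfolding \<phi>_def by (auto elim!: Rats_cases)
 have ph0: "\<phi> 0 = 0" using ph[of 0] by simp
 define q where "q = map_poly \<phi> f"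
 have fq: "map_poly real_of_rat q = f"
  by (rule poly_eqI) (simp add: q_def coeff_map_poly ph0 ph rat)
 have cc: "map_poly real_of_int c = map_poly real_of_rat (map_poly rat_of_int c)"
  by (rule poly_eqI) (simp add: coeff_map_poly)
 have "q dvd map_poly rat_of_int c"
  by (rule of_rat_hom.dvd_map_poly_hom_imp_dvd[where ?'a = real]) (use dvd fq cc in simp)
 then obtain h where h: "map_poly rat_of_int c = q * h" by (auto elim: dvdE)
 obtain r rg where rg: "rat_to_normalized_int_poly q = (r, rg)" by fastforce
 from rat_to_int_factor_explicit[OF h rg] obtain t where t: "c = rg * t" by blast
 have "lead_coeff rg * lead_coeff t = 1" using lead_coeff_mult[of rg t] c unfolding t[symmetric] by simp
 hence lrg: "lead_coeff rg = 1 \<or> lead_coeff rg = - 1" using zmult_eq_1_iff by blast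
 have qr: "q = Polynomial.smult r (map_poly rat_of_int rg)" and r0: "r > 0" using rat_to_normalized_int_poly[OF rg] by auto
 have "lead_coeff f = real_of_rat (lead_coeff q)" unfolding fq[symmetric] by simp
 moreover have "lead_coeff q = r * rat_of_int (lead_coeff rg)" unfolding qr by simp
 ultimately have "real_of_rat r * real_of_int (lead_coeff rg) = 1 \<or> real_of_rat r * real_of_int (lead_coeff rg) = - 1"
  using lc by (simp add: of_rat_mult)
 moreover have "real_of_rat r > 0" using r0 by simp
 moreover have "x = 1" if "x * l = 1 \<or> x * l = - 1" "x > 0" "l = 1 \<or> l = - 1" for x l :: real
  using that by auto
 ultimately have "real_of_rat r = 1" using lrg by (metis of_int_1 of_int_minus)
 hence "r = 1" by simp
 hence "q = map_poly rat_of_int rg" using qr by simp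
 hence "f = map_poly real_of_int rg"
  unfolding fq[symmetric] by (intro poly_eqI) (simp add: coeff_map_poly)
 thus ?thesis by blast
qed

lemma (in lanczos) kv_bound:
 assumes "!!i. i < n ==> (\<Sum>j<n. \<bar>mm i j\<bar>) <= c" "!!i. i < n ==> \<bar>u i\<bar> <= m" "c >= 0" "m >= 0" "i < n"
 shows "\<bar>kv l i\<bar> <= c ^ l * m"
 using assms(5)
proof (induction l arbitrary: i)
 case 0
 thus ?case using assms by simp
next
 case (Suc l)
 have "\<bar>kv (Suc l) i\<bar> <= (\<Sum>j<n. \<bar>mm i j\<bar> * \<bar>kv l j\<bar>)"
  by (simp add: mv_def) (rule order_trans[OF sum_abs], simp add: abs_mult)
 also have "... <= (\<Sum>j<n. \<bar>mm i j\<bar> * (c ^ l * m))"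
  by (intro sum_mono mult_left_mono) (use Suc in auto)
 also have "... = (\<Sum>j<n. \<bar>mm i j\<bar>) * (c ^ l * m)" by (simp add: sum_distrib_right)
 also have "... <= c * (c ^ l * m)" using assms Suc by (intro mult_right_mono) auto
 finally show ?case by simp
qed

lemma (in lanczos) gram_integer:
 assumes mm: "!!i j. i < n ==> j < n ==> mm i j \<in> \<int>" and u: "!!i. i < n ==> u i \<in> \<int>"
  and nz: "!!i. i < k ==> h (Suc i) ~= 0"
 shows "(\<Prod>j<k. h (Suc j)) \<in> \<int>"
proof -
 have kz: "i < n ==> kv l i \<in> \<int>" for l i
  by (induction l arbitrary: i) (auto simp: mv_def u intro!: Ints_sum Ints_mult mm)
 define G where "G = mat k k (%(i, j). ip (kv i) (kv j))"
 have Gc: "G \<in> carrier_mat k k" by (simp add: G_def)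
 have "det G \<in> \<int>" unfolding det_def'[OF Gc]
 proof (intro Ints_sum Ints_mult Ints_prod)
  fix p i assume p: "p \<in> {p. p permutes {0..<k}}" and i: "i \<in> {0..<k}"
  hence pk: "p i < k" using permutes_in_image[of p "{0..<k}" i] by auto
  have "ip (kv i) (kv (p i)) \<in> \<int>" unfolding ip_def using kz by (intro Ints_sum Ints_mult) auto
  thus "G $$ (i, p i) \<in> \<int>" using i pk by (simp add: G_def)
 qed (auto simp: sign_def)
 thus ?thesis using gram[OF nz] by (simp add: G_def)
qed

text \<open>Gram determinants are partial products of the norms, so a prime at which a norm has
  residue 0 divides one of them. Their product \<open>G\<close> collects all harmful primes; each
  norm has at most \<open>e = b + 2 n J + 2 K\<close> bits, which limits \<open>G\<close> to
  \<open>n * n * e\<close> bits.\<close>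

lemma (in lanczos) bad_numbers:
 fixes d J K b :: nat
 assumes mm: "!!i j. i < n ==> j < n ==> mm i j \<in> \<int>" and u: "!!i. i < n ==> u i \<in> \<int>"
  and nz: "!!i. i < d ==> h (Suc i) ~= 0" and dn: "d <= n" and nb: "n <= 2 ^ b"
  and mmb: "!!i. i < n ==> (\<Sum>j<n. \<bar>mm i j\<bar>) <= 2 ^ J" and ub: "!!i. i < n ==> \<bar>u i\<bar> <= 2 ^ K"
 shows "\<exists>G :: nat. G > 0 & G <= 2 ^ (n * n * (b + 2 * n * J + 2 * K)) &
  (\<forall>p k r. prime p --> ~ p dvd G --> k < d --> rl (int p) (h (Suc k)) r --> ~ int p dvd r)"
proof -
 define e where "e = b + 2 * n * J + 2 * K"
 define g where "g k = (\<Prod>j<k. h (Suc j))" for k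
 have gz: "g k \<in> \<int>" if "k <= d" for k
  unfolding g_def by (rule gram_integer[OF mm u]) (use nz that in auto)
 have hpos: "h (Suc j) > 0" if "j < d" for j
  using nz[OF that] ip_nonneg[of "w (Suc j)"] by (simp add: h_def)
 have gpos: "g k > 0" if "k <= d" for k unfolding g_def using hpos that by (intro prod_pos) auto
 have hb: "h (Suc j) <= 2 ^ e" if j: "j < d" for j
 proof -
  have "h (Suc j) <= ip (kv j) (kv j)" by (rule h_le_kv) (use nz j in auto)
  also have "... <= (\<Sum>i<n. ((2 ^ J) ^ j * 2 ^ K)\<^sup>2)" unfolding ip_def
  proof (rule sum_mono)
   fix i assume "i \<in> {..<n}"
   hence "\<bar>kv j i\<bar> <= (2 ^ J) ^ j * 2 ^ K" using kv_bound[OF mmb ub] by simp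
   thus "kv j i * kv j i <= ((2 ^ J) ^ j * 2 ^ K)\<^sup>2"
    by (metis abs_le_square_iff abs_of_nonneg power2_eq_square abs_ge_zero order_trans)
  qed
  also have "... = real n * 2 ^ (2 * (J * j + K))" by (simp add: power_mult[symmetric] power_add[symmetric] mult.commute)
  also have "... <= 2 ^ b * 2 ^ (2 * n * J + 2 * K)"
  proof (rule mult_mono)
   show "real n <= 2 ^ b" 
   proof -
    have "real n <= real (2 ^ b)" using nb by (simp only: of_nat_le_iff)
    thus ?thesis by simp
   qed
   have "J * j <= n * J" using j dn by (metis less_imp_le_nat mult.commute mult_le_mono1 order_trans)
   thus "(2::real) ^ (2 * (J * j + K)) <= 2 ^ (2 * n * J + 2 * K)"
    by (intro power_increasing) auto
  qed auto
  also have "... = 2 ^ e" by (simp add: e_def power_add)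
  finally show ?thesis .
 qed
 have gb: "g k <= 2 ^ (n * e)" if "k <= d" for k
 proof -
  have "g k <= (\<Prod>j<k. 2 ^ e)" unfolding g_def using hb hpos that
   by (intro prod_mono) (auto intro: less_imp_le)
  also have "... = 2 ^ (k * e)" by (simp add: power_mult[symmetric] mult.commute)
  also have "... <= 2 ^ (n * e)" using that dn by (intro power_increasing) auto
  finally show ?thesis .
 qed
 define gn where "gn k = nat \<lfloor>g k\<rfloor>" for k
 have gn: "real (gn k) = g k" "gn k > 0" if kd: "k <= d" for k
 proof -
  obtain z where z: "g k = of_int z" using gz[OF kd] by (auto elim: Ints_cases)
  thus "real (gn k) = g k" "gn k > 0" using gpos[OF kd] by (auto simp: gn_def)
 qed
 define G where "G = (\<Prod>k\<in>{1..d}. gn k)"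
 have "real G <= (\<Prod>k\<in>{1..d}. 2 ^ (n * e))" unfolding G_def of_nat_prod
  using gn gb gpos by (intro prod_mono) (auto intro: less_imp_le)
 also have "... = 2 ^ (d * (n * e))" by (simp add: power_mult[symmetric] mult.commute)
 also have "... <= 2 ^ (n * n * e)" using dn by (intro power_increasing) (auto simp: mult.assoc)
 finally have "real G <= real (2 ^ (n * n * e))" by simp
 hence Gb: "G <= 2 ^ (n * n * e)" by (simp only: of_nat_le_iff)
 have G0: "G > 0" unfolding G_def using gn by (intro prod_pos) auto
 have "~ int p dvd r" if p: "prime p" "~ p dvd G" and k: "k < d" and r: "rl (int p) (h (Suc k)) r" for p k r
 proof
  assume pr: "int p dvd r"
  obtain a c where ac: "cop c (int p)" "c ~= 0" "of_int c * h (Suc k) = of_int a" "int p dvd c * r - a"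
   using r by (auto simp: rl_def)
  have "int p dvd c * r - (c * r - a)" using ac(4) pr by (metis dvd_diff dvd_mult)
  hence pa: "int p dvd a" by simp
  \<comment> \<open>For \<open>h (Suc k) = a / c\<close> this becomes an identity of integers,
    \<open>c * g (Suc k) = a * g k\<close>, in which \<open>p\<close> divides \<open>a\<close> but
    not \<open>c\<close>.\<close>
  have "g (Suc k) = g k * h (Suc k)" by (simp add: g_def)
  hence "of_int c * real (gn (Suc k)) = of_int a * real (gn k)"
   using gn[of k] gn[of "Suc k"] k ac(3) by (simp add: mult.left_commute mult.commute)
  hence "real_of_int (c * int (gn (Suc k))) = real_of_int (a * int (gn k))" by simp
  hence "c * int (gn (Suc k)) = a * int (gn k)" by (simp only: of_int_eq_iff)
  hence "int p dvd c * int (gn (Suc k))" using pa by simp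
  moreover have "~ int p dvd c"
   using ac(1) p by (metis coprime_common_divisor dvd_refl not_prime_unit prime_nat_int_transfer)
  ultimately have "int p dvd int (gn (Suc k))" using p by (simp add: prime_dvd_mult_iff)
  hence "p dvd gn (Suc k)" by simp
  moreover have "gn (Suc k) dvd G" unfolding G_def using k by (intro dvd_prodI) auto
  ultimately show False using p dvd_trans by blast
 qed
 thus ?thesis using G0 Gb unfolding e_def by blast
qed

section \<open>Abundance of good primes and of generic start vectors\<close>

lemma card_prime_divisors:
 fixes N :: nat
 assumes "N > 0" "N <= 2 ^ g"
 shows "card {p. prime p & p dvd N} <= g" "finite {p. prime p & p dvd N}"
proof -
 have eq: "{p. prime p & p dvd N} = prime_factors N" using assms by (auto simp: prime_factors_dvd)
 show "finite {p. prime p & p dvd N}" unfolding eq by simp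
 have "2 ^ card (prime_factors N) = (\<Prod>p\<in>prime_factors N. 2::nat)" by simp
 also have "... <= (\<Prod>p\<in>prime_factors N. p ^ multiplicity p N)"
 proof (rule prod_mono)
  fix p assume p: "p \<in> prime_factors N"
  hence "prime p" "multiplicity p N >= 1" using assms
   by (auto simp: prime_factors_multiplicity)
  hence "p <= p ^ multiplicity p N" "2 <= p"
   using self_le_power[of p "multiplicity p N"] prime_ge_1_nat prime_ge_2_nat by auto
  thus "0 <= (2::nat) & 2 <= p ^ multiplicity p N" by simp
 qed
 also have "... = N" using assms by (simp add: prime_factorization_nat[symmetric])
 also have "... <= 2 ^ g" by fact
 finally show "card {p. prime p & p dvd N} <= g" unfolding eq by simp
qed

text \<open>There are at least \<open>2 ^ B / (2 B)\<close> primes up to \<open>2 ^ B\<close>, while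
  \<open>G\<close> and \<open>M\<close> together have at most \<open>g + k\<close> prime divisors;
  the last hypothesis makes these at most half of that lower bound.\<close>

lemma good_prime_count:
 fixes G M :: nat
 assumes "B >= 1" "G > 0" "G <= 2 ^ g" "M > 0" "M <= 2 ^ k" "4 * B * (g + k) <= 2 ^ B"
 shows "2 ^ B / (4 * real B) <= real (card {p. prime p & p <= 2 ^ B & ~ p dvd G & ~ p dvd M})"
proof -
 let ?P = "{p::nat. prime p & p <= 2 ^ B}"
 let ?X = "{p. prime p & p dvd G}" and ?Y = "{p. prime p & p dvd M}"
 have fin: "finite ?P" by (rule finite_subset[of _ "{..2 ^ B}"]) auto
 have "card ?P <= card ({p. prime p & p <= 2 ^ B & ~ p dvd G & ~ p dvd M} \<union> (?X \<union> ?Y))"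
  by (rule card_mono) (use card_prime_divisors(2) assms in \<open>auto intro: finite_subset[OF _ fin]\<close>)
 also have "... <= card {p. prime p & p <= 2 ^ B & ~ p dvd G & ~ p dvd M} + (card ?X + card ?Y)"
  by (meson add_left_mono card_Un_le order_trans)
 also have "card ?X + card ?Y <= g + k" using card_prime_divisors(1) assms by (intro add_mono) auto
 finally have "real (card ?P) <= real (card {p. prime p & p <= 2 ^ B & ~ p dvd G & ~ p dvd M}) + real (g + k)"
  by linarith
 moreover have "2 ^ B / (2 * real B) <= real (card ?P)" by (rule prime_count_lower_bound[OF assms(1)])
 moreover have "real (g + k) <= 2 ^ B / (4 * real B)"
 proof -
  have "real (4 * B * (g + k)) <= real (2 ^ B)" using assms(6) by (simp only: of_nat_le_iff)
  thus ?thesis using assms(1) by (simp add: field_simps)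
 qed
 moreover have "2 ^ B / (2 * real B) = 2 * (2 ^ B / (4 * real B))" by simp
 ultimately show ?thesis by linarith
qed

text \<open>The linear case of the Schwartz-Zippel bound: once the other coordinates are fixed, a
  nonzero coefficient leaves at most one value for its own coordinate.\<close>

lemma orthogonal_count:
 fixes x :: "nat => real"
 assumes "i < n" "x i ~= 0"
 shows "card {us :: nat list. length us = n & set us \<subseteq> {..<R} & (\<Sum>j<n. x j * real (us ! j)) = c} * R <= R ^ n"
 using assms
proof (induction n arbitrary: x i c)
 case (Suc n)
 let ?F = "%n (x :: nat => real) c. {us :: nat list. length us = n & set us \<subseteq> {..<R} & (\<Sum>j<n. x j * real (us ! j)) = c}"
 define y where "y j = x (Suc j)" for j
 have fin: "finite (?F m z c)" for m z c
  by (rule finite_subset[OF _ finite_lists_length_eq[of "{..<R}" m]]) auto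
 have eq: "?F (Suc n) x c = (\<Union>v<R. (#) v ` ?F n y (c - x 0 * real v))"
 proof (intro equalityI subsetI)
  fix us assume us: "us \<in> ?F (Suc n) x c"
  then obtain v vs where v: "us = v # vs" by (cases us) auto
  thus "us \<in> (\<Union>v<R. (#) v ` ?F n y (c - x 0 * real v))"
   using us by (intro UN_I[of v] image_eqI[of _ _ vs])
    (auto simp: sum.lessThan_Suc_shift y_def simp del: sum.lessThan_Suc)
 next
  fix us assume "us \<in> (\<Union>v<R. (#) v ` ?F n y (c - x 0 * real v))"
  thus "us \<in> ?F (Suc n) x c" by (auto simp: sum.lessThan_Suc_shift y_def simp del: sum.lessThan_Suc)
 qed
 show ?case
 proof (cases "\<exists>j<n. y j ~= 0")
  case True
  then obtain j where j: "j < n" "y j ~= 0" by auto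
  have "card (?F (Suc n) x c) <= (\<Sum>v<R. card ((#) v ` ?F n y (c - x 0 * real v)))"
   unfolding eq by (rule card_UN_le) simp
  also have "... = (\<Sum>v<R. card (?F n y (c - x 0 * real v)))" by (simp add: card_image)
  finally have "card (?F (Suc n) x c) * R <= (\<Sum>v<R. card (?F n y (c - x 0 * real v)) * R)"
   by (simp add: sum_distrib_right[symmetric])
  also have "... <= (\<Sum>v<R. R ^ n)" by (rule sum_mono) (rule Suc.IH[where x = y and i = j, OF j])
  finally show ?thesis by simp
 next
  case False
  hence y0: "!!j. j < n ==> y j = 0" by auto
  have x0: "x 0 ~= 0" using Suc.prems False unfolding y_def by (cases i) auto
  have sub: "?F (Suc n) x c \<subseteq> (\<Union>v\<in>{v. x 0 * real v = c}. (#) v ` {us. set us \<subseteq> {..<R} & length us = n})"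
   unfolding eq using y0 by (auto simp: image_iff)
  have c1: "card {v :: nat. x 0 * real v = c} <= 1 & finite {v :: nat. x 0 * real v = c}"
  proof (cases "\<exists>v :: nat. x 0 * real v = c")
   case True
   then obtain v :: nat where "x 0 * real v = c" by auto
   hence "{v :: nat. x 0 * real v = c} = {v}" using x0 by auto
   thus ?thesis by simp
  next
   case False
   hence "{v :: nat. x 0 * real v = c} = {}" by auto
   thus ?thesis by simp
  qed
  have "card (?F (Suc n) x c) <= card (\<Union>v\<in>{v. x 0 * real v = c}. (#) v ` {us. set us \<subseteq> {..<R} & length us = n})"
   by (rule card_mono[OF _ sub]) (use c1 in \<open>auto intro: finite_lists_length_eq\<close>)
  also have "... <= (\<Sum>v\<in>{v. x 0 * real v = c}. card ((#) v ` {us. set us \<subseteq> {..<R} & length us = n}))"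
   by (rule card_UN_le) (use c1 in simp)
  also have "... = card {v :: nat. x 0 * real v = c} * R ^ n" by (simp add: card_image card_lists_length_eq)
  also have "... <= 1 * R ^ n" using c1 by (intro mult_right_mono) auto
  finally show ?thesis by (simp add: mult.commute)
 qed
qed simp

section \<open>The scaled square of the matrix\<close>

locale symmat =
 fixes n :: nat and A :: "real mat" and ls :: "real list" and sc :: int
 assumes n1: "1 <= n" and A: "A \<in> carrier_mat n n" and At: "transpose_mat A = A"
  and Aint: "!!i j. i < n ==> j < n ==> A $$ (i, j) \<in> \<int>"
  and cp: "char_poly A = (\<Prod>l\<leftarrow>ls. [:- l, 1:])" and sc: "0 < sc"
begin

definition az :: "nat => nat => int" where "az i j = \<lfloor>A $$ (i, j)\<rfloor>"
definition mz :: "nat => nat => int" where "mz i j = sc * (\<Sum>l<n. az i l * az l j)"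
definition mr :: "nat => nat => real" where "mr i j = real_of_int (mz i j)"
definition S :: "real set" where "S = (%l. real_of_int sc * l\<^sup>2) ` set ls"
definition Mm :: "real mat" where "Mm = real_of_int sc \<cdot>\<^sub>m (A * A)"

lemma azr: "i < n ==> j < n ==> real_of_int (az i j) = A $$ (i, j)"
 using Aint[of i j] by (auto simp: az_def elim!: Ints_cases)

lemma az_sym: "i < n ==> j < n ==> az i j = az j i"
 unfolding az_def using A At by (metis carrier_matD index_transpose_mat(1))

lemma mz_sym: "i < n ==> j < n ==> mz i j = mz j i"
proof -
 assume ij: "i < n" "j < n"
 have "az i l * az l j = az j l * az l i" if "l < n" for l
  using az_sym[OF ij(1) that] az_sym[OF that ij(2)] by simp
 thus ?thesis by (simp add: mz_def)
qed

lemma lz: "lanczos n mr"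
 by unfold_locales (simp add: mr_def mz_sym)

lemma len: "length ls = n"
proof -
 have "degree (char_poly A) = n" using degree_monic_char_poly[OF A] by simp
 moreover have "degree (\<Prod>l\<leftarrow>xs. [:- l, 1:]) = length xs & (\<Prod>l\<leftarrow>xs. [:- l, 1:]) ~= 0" for xs :: "real list"
  by (induction xs) (auto simp: degree_mult_eq simp del: mult_pCons_left)
 ultimately show ?thesis using cp by simp
qed

lemma S_fin: "finite S" "S ~= {}" "card S <= n" "!!\<mu>. \<mu> \<in> S ==> 0 <= \<mu>"
proof -
 show "finite S" by (simp add: S_def)
 show "S ~= {}" using n1 len by (auto simp: S_def)
 have "card S <= card (set ls)" unfolding S_def by (rule card_image_le) simp
 also have "... <= n" using card_length[of ls] len by simp
 finally show "card S <= n" .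
 show "!!\<mu>. \<mu> \<in> S ==> 0 <= \<mu>" using sc by (auto simp: S_def)
qed

lemma Mm_carrier: "Mm \<in> carrier_mat n n" using A by (simp add: Mm_def)

lemma Mm_index: "i < n ==> j < n ==> Mm $$ (i, j) = mr i j"
 using A by (auto simp: Mm_def mr_def mz_def scalar_prod_def azr atLeast0LessThan)

lemma Mm_sym: "transpose_mat Mm = Mm"
 by (rule eq_matI) (use Mm_carrier in \<open>auto simp: Mm_index mr_def mz_sym\<close>)

lemma Mm_mv: "y \<in> carrier_vec n ==> i < n ==> (Mm *\<^sub>v y) $ i = lanczos.mv n mr (%j. y $ j) i"
 using Mm_carrier by (auto simp: lanczos.mv_def[OF lz] scalar_prod_def Mm_index atLeast0LessThan)

lemma mv_cong: "(!!j. j < n ==> x j = y j) ==> lanczos.mv n mr x i = lanczos.mv n mr y i"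
 by (simp add: lanczos.mv_def[OF lz])

lemma eigenvector_exists:
 assumes "\<mu> \<in> S"
 shows "\<exists>y. y \<in> carrier_vec n & y ~= 0\<^sub>v n & Mm *\<^sub>v y = \<mu> \<cdot>\<^sub>v y"
proof -
 obtain l where l: "l \<in> set ls" "\<mu> = real_of_int sc * l\<^sup>2" using assms by (auto simp: S_def)
 have "poly (char_poly A) l = 0" unfolding cp using l(1) by (induction ls) auto
 hence "eigenvalue A l" using eigenvalue_root_char_poly[OF A] by simp
 then obtain y where y: "y \<in> carrier_vec n" "y ~= 0\<^sub>v n" "A *\<^sub>v y = l \<cdot>\<^sub>v y"
  using A by (auto simp: eigenvalue_def eigenvector_def)
 have "(real_of_int sc \<cdot>\<^sub>m C) *\<^sub>v y = real_of_int sc \<cdot>\<^sub>v (C *\<^sub>v y)" if "C \<in> carrier_mat n n" for C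
  using that y by (intro eq_vecI) (auto simp: scalar_prod_def sum_distrib_left mult.assoc)
 from this[of "A * A"] have "Mm *\<^sub>v y = real_of_int sc \<cdot>\<^sub>v ((A * A) *\<^sub>v y)" using A by (simp add: Mm_def)
 also have "(A * A) *\<^sub>v y = A *\<^sub>v (A *\<^sub>v y)" by (rule assoc_mult_mat_vec[OF A A y(1)])
 also have "... = l \<cdot>\<^sub>v (l \<cdot>\<^sub>v y)" using y A by (simp add: mult_mat_vec[of A n n])
 finally have "Mm *\<^sub>v y = \<mu> \<cdot>\<^sub>v y" using y by (auto simp: l(2) power2_eq_square smult_smult_assoc)
 thus ?thesis using y by blast
qed

text \<open>One eigenvector per eigenvalue is enough: a start vector that is not orthogonal to it
  has a component in the eigenspace.\<close>

definition xe :: "real => nat => real" where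
 "xe \<mu> = (SOME x. (\<exists>i<n. x i ~= 0) & (\<forall>i<n. lanczos.mv n mr x i = \<mu> * x i))"

lemma xe: assumes "\<mu> \<in> S" shows "\<exists>i<n. xe \<mu> i ~= 0" "!!i. i < n ==> lanczos.mv n mr (xe \<mu>) i = \<mu> * xe \<mu> i"
proof -
 obtain y where y: "y \<in> carrier_vec n" "y ~= 0\<^sub>v n" "Mm *\<^sub>v y = \<mu> \<cdot>\<^sub>v y" using eigenvector_exists[OF assms] by auto
 have "\<exists>i<n. y $ i ~= 0"
 proof (rule ccontr)
  assume "~ ?thesis"
  hence "y = 0\<^sub>v n" using y by (intro eq_vecI) auto
  thus False using y by simp
 qed
 moreover have "\<forall>i<n. lanczos.mv n mr (%j. y $ j) i = \<mu> * y $ i"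
  using Mm_mv[OF y(1)] y by auto
 ultimately have "(\<exists>i<n. xe \<mu> i ~= 0) & (\<forall>i<n. lanczos.mv n mr (xe \<mu>) i = \<mu> * xe \<mu> i)"
  unfolding xe_def by (intro someI_ex[of "%x. (\<exists>i<n. x i ~= 0) & (\<forall>i<n. lanczos.mv n mr x i = \<mu> * x i)"]) blast
 thus "\<exists>i<n. xe \<mu> i ~= 0" "!!i. i < n ==> lanczos.mv n mr (xe \<mu>) i = \<mu> * xe \<mu> i" by auto
qed

lemma annihilate:
 fixes u :: "nat => real"
 defines "\<mu>s \<equiv> sorted_list_of_set S"
 assumes i: "i < n"
 shows "lanczos.yv n mr u (%j. \<mu>s ! j) (card S) i = 0"
proof -
 interpret lanczos n mr u by (rule lz)
 have v: "j <= length \<mu>s ==> vec n (yv ((!) \<mu>s) j) = ap Mm (take j \<mu>s) (vec n u)" for j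
 proof (induction j)
  case (Suc j)
  have "ap Mm (take (Suc j) \<mu>s) (vec n u) = TT Mm (\<mu>s ! j) (vec n (yv ((!) \<mu>s) j))"
   using Suc by (simp add: take_Suc_conv_app_nth ap_append)
  also have "... = vec n (yv ((!) \<mu>s) (Suc j))"
  proof (rule eq_vecI)
   fix i assume "i < dim_vec (vec n (yv ((!) \<mu>s) (Suc j)))"
   hence i: "i < n" by simp
   have "(Mm *\<^sub>v vec n (yv ((!) \<mu>s) j)) $ i = mv (yv ((!) \<mu>s) j) i"
    by (subst Mm_mv) (use i in \<open>auto intro: mv_cong\<close>)
   thus "TT Mm (\<mu>s ! j) (vec n (yv ((!) \<mu>s) j)) $ i = vec n (yv ((!) \<mu>s) (Suc j)) $ i"
    using i Mm_carrier by (simp add: TT_def)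
  qed (use Mm_carrier in \<open>simp add: TT_def\<close>)
  finally show ?case by simp
 qed simp
 have uc: "vec n u \<in> carrier_vec n" by simp
 have "ap Mm (map (%l. real_of_int sc * l\<^sup>2) ls) (vec n u) = 0\<^sub>v n"
  by (rule ap_square[OF A Mm_def uc]) (rule ap_char_poly[OF A cp uc])
 hence "ap Mm \<mu>s (vec n u) = 0\<^sub>v n"
  by (rule ap_remove_duplicates[OF Mm_carrier Mm_sym uc]) (use S_fin in \<open>auto simp: \<mu>s_def S_def\<close>)
 hence "vec n (yv ((!) \<mu>s) (length \<mu>s)) = 0\<^sub>v n" using v[of "length \<mu>s"] by simp
 moreover have "length \<mu>s = card S" using S_fin by (simp add: \<mu>s_def)
 ultimately show ?thesis using i by (metis index_vec index_zero_vec(1))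
qed

definition generic :: "(nat => real) => bool" where
 "generic u \<longleftrightarrow> (\<forall>\<mu>\<in>S. (\<Sum>i<n. xe \<mu> i * u i) ~= 0)"

lemma generic_krylov:
 assumes g: "generic u"
 shows "!!k. k < card S ==> lanczos.h n mr u (Suc k) ~= 0" "lanczos.h n mr u (Suc (card S)) = 0"
  "!!z. poly (lanczos.rp n mr u (Suc (card S))) z = (\<Prod>\<mu>\<in>S. \<mu> - z)"
proof -
 interpret lanczos n mr u by (rule lz)
 have eig: "\<exists>x. (\<forall>i<n. mv x i = \<mu> * x i) & ip x u ~= 0" if "\<mu> \<in> S" for \<mu>
  using xe(2)[OF that] g that by (intro exI[of _ "xe \<mu>"]) (auto simp: generic_def ip_def)
 note k = krylov[OF S_fin(1,2) eig annihilate]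
 show "!!k. k < card S ==> h (Suc k) ~= 0" "h (Suc (card S)) = 0"
  "!!z. poly (rp (Suc (card S))) z = (\<Prod>\<mu>\<in>S. \<mu> - z)" using k by auto
qed

definition Qz :: "int => real" where "Qz z = (\<Prod>\<mu>\<in>S. \<mu> - real_of_int z)"

text \<open>The product over distinct roots need not be a characteristic polynomial. Its
  coefficients are rational because it is a Lanczos polynomial, and it divides the monic integer
  characteristic polynomial of the scaled square, so Gauss' lemma applies.\<close>

lemma Qz_int:
 assumes g: "generic u" and u: "!!i. i < n ==> u i \<in> \<int>"
 shows "Qz z \<in> \<int>"
proof -
 interpret lanczos n mr u by (rule lz)
 define f where "f = rp (Suc (card S))"
 have fe: "f = (\<Prod>\<mu>\<in>S. [:\<mu>, -1:])"
  by (rule iffD1[OF poly_eq_poly_eq_iff])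
   (auto simp: fun_eq_iff f_def generic_krylov(3)[OF g] poly_prod)
 have rat: "poly.coeff f l \<in> \<rat>" for l
  unfolding f_def by (rule rational) (use u Ints_subset_Rats in \<open>auto simp: mr_def\<close>)
 define C where "C = mat n n (%(i, j). mz i j)"
 have Cc: "C \<in> carrier_mat n n" by (simp add: C_def)
 have "Mm = map_mat real_of_int C"
  by (rule eq_matI) (use Mm_carrier in \<open>auto simp: C_def Mm_index mr_def\<close>)
 hence cpM: "char_poly Mm = map_poly real_of_int (char_poly C)"
  using of_int_hom.char_poly_hom[OF Cc, where ?'a = real] by simp
 have mon: "monic (char_poly C)" using degree_monic_char_poly[OF Cc] by simp
 have "f dvd map_poly real_of_int (char_poly C)"
  unfolding fe
 proof (rule prod_linear_dvd[OF S_fin(1)])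
  fix \<mu> assume "\<mu> \<in> S"
  then obtain y where "y \<in> carrier_vec n" "y ~= 0\<^sub>v n" "Mm *\<^sub>v y = \<mu> \<cdot>\<^sub>v y" using eigenvector_exists by blast
  hence "eigenvalue Mm \<mu>" using Mm_carrier by (auto simp: eigenvalue_def eigenvector_def)
  thus "poly (map_poly real_of_int (char_poly C)) \<mu> = 0"
   using eigenvalue_root_char_poly[OF Mm_carrier] cpM by simp
 qed
 moreover have "lead_coeff f = 1 \<or> lead_coeff f = - 1"
  unfolding f_def degree_rp(2) by (cases "even (card S)") auto
 ultimately obtain gz where gz: "f = map_poly real_of_int gz"
  using int_poly_of_rational_factor[OF rat mon] by blast
 have "Qz z = poly f (real_of_int z)" using generic_krylov(3)[OF g] by (simp add: Qz_def f_def)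
 also have "... = real_of_int (poly gz z)" unfolding gz by (simp add: of_int_hom.poly_map_poly)
 finally show ?thesis by simp
qed

lemma mr_bound:
 assumes W: "(\<Sum>i<n. \<Sum>j<n. \<bar>az i j\<bar>) <= W" and i: "i < n"
 shows "(\<Sum>j<n. \<bar>mr i j\<bar>) <= real_of_int (sc * (W * W))"
proof -
 have row: "(\<Sum>j<n. \<bar>az l j\<bar>) <= W" if "l < n" for l
  by (rule order_trans[OF _ W], rule member_le_sum[of l "{..<n}" "%i. \<Sum>j<n. \<bar>az i j\<bar>"]) (use that in \<open>auto intro: sum_nonneg\<close>)
 have W0: "0 <= W" using row[OF i] sum_nonneg[of "{..<n}" "%j. \<bar>az i j\<bar>"] by linarith
 have "(\<Sum>j<n. \<bar>mz i j\<bar>) <= (\<Sum>j<n. sc * (\<Sum>l<n. \<bar>az i l\<bar> * \<bar>az l j\<bar>))"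
  unfolding mz_def using sc by (intro sum_mono) (auto simp: abs_mult intro!: mult_left_mono order_trans[OF sum_abs])
 also have "... = sc * (\<Sum>l<n. \<bar>az i l\<bar> * (\<Sum>j<n. \<bar>az l j\<bar>))"
  unfolding sum_distrib_left by (subst sum.swap) simp
 also have "... <= sc * (\<Sum>l<n. \<bar>az i l\<bar> * W)"
  using sc row by (intro mult_left_mono sum_mono) auto
 also have "... <= sc * (W * W)"
  unfolding sum_distrib_right[symmetric] using sc row[OF i] W0 by (intro mult_left_mono mult_right_mono) auto
 finally have "real_of_int (\<Sum>j<n. \<bar>mz i j\<bar>) <= real_of_int (sc * (W * W))" by (simp only: of_int_le_iff)
 thus ?thesis by (simp add: mr_def)
qed

text \<open>The eigenvector equation, read in a coordinate of largest modulus.\<close>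

lemma S_bound:
 assumes c: "!!i. i < n ==> (\<Sum>j<n. \<bar>mr i j\<bar>) <= c" and m: "\<mu> \<in> S"
 shows "\<mu> <= c"
proof -
 define x where "x = xe \<mu>"
 define a where "a = Max ((%i. \<bar>x i\<bar>) ` {..<n})"
 have fin: "finite ((%i. \<bar>x i\<bar>) ` {..<n})" "(%i. \<bar>x i\<bar>) ` {..<n} ~= {}" using n1 by (auto simp: lessThan_empty_iff)
 have le: "\<bar>x i\<bar> <= a" if "i < n" for i unfolding a_def by (rule Max_ge[OF fin(1)]) (use that in auto)
 have "a \<in> (%i. \<bar>x i\<bar>) ` {..<n}" unfolding a_def by (rule Max_in[OF fin])
 then obtain i where i: "i < n" "a = \<bar>x i\<bar>" by auto
 obtain k where k: "k < n" "x k ~= 0" using xe(1)[OF m] by (auto simp: x_def)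
 have a0: "a > 0" using le[OF k(1)] k(2) by linarith
 have "\<mu> * a = \<bar>\<mu> * x i\<bar>" using S_fin(4)[OF m] i by (simp add: abs_mult)
 also have "... = \<bar>\<Sum>j<n. mr i j * x j\<bar>" using xe(2)[OF m i(1)] by (simp add: x_def lanczos.mv_def[OF lz])
 also have "... <= (\<Sum>j<n. \<bar>mr i j\<bar> * a)"
  by (rule order_trans[OF sum_abs]) (use le in \<open>auto simp: abs_mult intro!: sum_mono mult_left_mono\<close>)
 also have "... = (\<Sum>j<n. \<bar>mr i j\<bar>) * a" by (simp add: sum_distrib_right)
 also have "... <= c * a" using c[OF i(1)] a0 by (intro mult_right_mono) auto
 finally show ?thesis using a0 by simp
qed

lemma generic_count:
 fixes R :: nat
 shows "card {us :: nat list. length us = n & set us \<subseteq> {..<R} & ~ generic (%i. real (us ! i))} * R <= n * R ^ n"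
proof -
 let ?F = "%\<mu>. {us :: nat list. length us = n & set us \<subseteq> {..<R} & (\<Sum>i<n. xe \<mu> i * real (us ! i)) = 0}"
 have fin: "finite (?F \<mu>)" for \<mu>
  by (rule finite_subset[OF _ finite_lists_length_eq[of "{..<R}" n]]) auto
 have "card {us :: nat list. length us = n & set us \<subseteq> {..<R} & ~ generic (%i. real (us ! i))} <= card (\<Union>\<mu>\<in>S. ?F \<mu>)"
  by (rule card_mono) (use S_fin fin in \<open>auto simp: generic_def\<close>)
 also have "... <= (\<Sum>\<mu>\<in>S. card (?F \<mu>))" by (rule card_UN_le[OF S_fin(1)])
 finally have "card {us :: nat list. length us = n & set us \<subseteq> {..<R} & ~ generic (%i. real (us ! i))} * R
   <= (\<Sum>\<mu>\<in>S. card (?F \<mu>)) * R" by simp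
 also have "... = (\<Sum>\<mu>\<in>S. card (?F \<mu>) * R)" by (rule sum_distrib_right)
 also have "... <= (\<Sum>\<mu>\<in>S. R ^ n)"
 proof (rule sum_mono)
  fix \<mu> assume "\<mu> \<in> S"
  then obtain i where "i < n" "xe \<mu> i ~= 0" using xe(1) by blast
  thus "card (?F \<mu>) * R <= R ^ n" by (rule orthogonal_count[where x = "xe \<mu>" and i = i])
 qed
 also have "... <= n * R ^ n" using S_fin(3) by simp
 finally show ?thesis .
qed

end

section \<open>Lanczos modulo a random integer\<close>

lemma mul_pow2: "0 <= x ==> x <= 2 ^ a ==> 0 <= y ==> y <= 2 ^ c ==> x * y <= (2::int) ^ (a + c)"
 unfolding power_add by (rule mult_mono) auto

lemma pow2_lt: "(x::int) <= 2 ^ e ==> e < k ==> x < 2 ^ k"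
 by (rule le_less_trans[of _ "2 ^ e"]) (auto intro: power_strict_increasing)

lemma add_pow2: "(x::int) <= 2 ^ e ==> y <= 2 ^ e ==> x + y <= 2 ^ Suc e"
 by simp

lemma eqx_tr:
 "eqx S A m m1 ==> eqx S' A' m1 m2 ==> S' \<subseteq> S ==> A' \<subseteq> A ==> eqx S A m m2"
 by (rule eqx_trans) (auto intro: eqx_mono)

text \<open>The condition \<open>sbits\<close> leaves room for the product of a residue with another
  residue, a matrix entry, an evaluation point or the scaling factor, so that every value awaiting
  reduction in these vector operations is a short integer.\<close>

locale alg = ram X SB BB n gd + symmat n A ls sc
 for X SB BB n gd A ls sc +
 fixes z b B ZB sg K :: nat
 assumes rows: "!!e. e < z ==> 0 <= X 1 e & X 1 e < int n"
  and cols: "!!e. e < z ==> 0 <= X 2 e & X 2 e < int n"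
  and vals: "!!e. e < z ==> \<bar>X 3 e\<bar> <= 2 ^ b"
  and sparse: "!!i x. i < n ==> (\<Sum>e<z. if X 1 e = int i then real_of_int (X 3 e) * x (nat (X 2 e)) else 0) =
    (\<Sum>j<n. A $$ (i, j) * x j)"
  and sbits: "4 * B + 2 * ZB + 2 * sg + 60 * b + K + 10 <= SB"
  and scv: "sc = 2 ^ (2 * sg)"
begin

text \<open>Fermat's power \<open>a ^ (M - 2)\<close> by repeated squaring, then verified by
  multiplication, so that a composite \<open>M\<close> leads at worst to a detected failure. The
  final value is \<open>1 - (t - 1) * (t - 1)\<close> for the product \<open>t\<close>; it is
  positive exactly if \<open>t = 1\<close>, which expresses equality by a sign test.\<close>

definition Inv :: com where
 "Inv = Ops [OC 34 1, OC 51 2, OSub 52 8 51, OC 51 0, OAdd 51 51 50] ;;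
  While 52 (Ops [OC 57 2, OQuot 58 52 57, OMul 57 58 57, OSub 57 52 57] ;;
   If 57 (Ops [OMul 34 34 51, OMod 34 34]) (Ops []) ;;
   Ops [OMul 51 51 51, OMod 51 51, OC 52 0, OAdd 52 52 58]) ;;
  Ops [OMul 51 50 34, OMod 51 51, OC 52 1, OSub 51 51 52, OMul 51 51 51, OSub 58 52 51]"

lemma Inv_spec:
 assumes M: "0 < m 8" "m 8 <= 2 ^ B" and a: "0 <= m 50" "m 50 < m 8"
 shows "hoare Inv m ((B + 4) * (30 * qS)) p (%m' q. q = p & eqx {34, 51, 52, 57, 58, 59, 63} {} m m' &
  0 <= m' 34 & m' 34 <= m 8 & (m' 58 > 0 \<longleftrightarrow> m 50 * m' 34 mod m 8 = 1) & m' 58 <= 1 &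
  (prime (m 8) & m 50 ~= 0 --> m' 58 > 0))" (is "hoare _ _ _ _ ?Q")
proof -
 let ?W = "Ops [OC 57 2, OQuot 58 52 57, OMul 57 58 57, OSub 57 52 57] ;; If 57 (Ops [OMul 34 34 51, OMod 34 34]) (Ops []) ;; Ops [OMul 51 51 51, OMod 51 51, OC 52 0, OAdd 52 52 58]"
 let ?L = "[OMul 51 50 34, OMod 51 51, OC 52 1, OSub 51 51 52, OMul 51 51 51, OSub 58 52 51]" and ?A = "[OC 34 1, OC 51 2, OSub 52 8 51, OC 51 0, OAdd 51 51 50]" and ?B = "[OC 57 2, OQuot 58 52 57, OMul 57 58 57, OSub 57 52 57]" and ?C = "[OMul 34 34 51, OMod 34 34]" and ?D = "[OMul 51 51 51, OMod 51 51, OC 52 0, OAdd 52 52 58]"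
 define M where "M = m 8"
 define a where "a = m 50"
 have M0: "0 < M" "M <= 2 ^ B" and a0: "0 <= a" "a < M" using assms by (auto simp: M_def a_def)
 have big: "2 * B + 1 < SB" using sbits by linarith
 have MM: "x * y + M < 2 ^ SB" if "0 <= x" "x <= M" "0 <= y" "y <= M" for x y
 proof -
  have "x * y <= 2 ^ (B + B)" by (rule mul_pow2) (use that M0 in auto)
  moreover have "M <= 2 ^ (B + B)" by (rule order_trans[OF M0(2)]) (auto intro: power_increasing)
  ultimately have "x * y + M <= 2 ^ Suc (B + B)" by (rule add_pow2)
  thus ?thesis by (rule pow2_lt) (use big in simp)
 qed
 have Ml: "M < 2 ^ SB" by (rule pow2_lt[OF M0(2)]) (use big in simp)
 \<comment> \<open>For \<open>M = 1\<close> the exponent starts at -1 and register 34 keeps the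
   value 1, hence the bounds \<open>-1 <= m' 52\<close> and \<open>m' 34 <= M\<close>.\<close>
 define I where "I = (%j m' q. q = p & eqx {34, 51, 52, 57, 58, 59, 63} {} m m' & 0 <= m' 34 & m' 34 <= M &
  0 <= m' 51 & m' 51 < M & m' 52 < 2 ^ j & m' 52 < M & -1 <= m' 52 &
  (m' 34 * m' 51 ^ nat (m' 52)) mod M = a ^ nat (M - 2) mod M)"
 have reg: "m' 8 = M" "m' 50 = a" if "I j m' q" for j m' q
 proof -
  have "eqx {34, 51, 52, 57, 58, 59, 63} {} m m'" using that by (simp add: I_def)
  note R = eqx_reg[OF this]
  show "m' 8 = M" "m' 50 = a" by (simp_all add: R M_def a_def)
 qed
 have "hoare Inv m (5 * qS + ((B * ((4 * qS + ((3 * qS + 4 * qS) + 6 * qS)) + qS) + 3 * qS) + 8 * qS)) p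
  ?Q"
  unfolding Inv_def
 proof (rule hoare_seq[where Q = "%m' q. I B m' q"])
  show "hoare (Ops ?A) m (5 * qS) p (%m' q. I B m' q)"
  proof (rule hoare_ops)
   show "ochks ?A m"
    using M0 a0 Ml by (simp add: wok_def M_def[symmetric] a_def[symmetric])
   show "I B (osems ?A m) p"
    using M0 a0 by (simp add: I_def M_def[symmetric] a_def[symmetric])
  qed (simp add: rq2_def)
 next
  fix m1 q1 assume b1: "bok m1" and I1: "I B m1 q1"
  show "hoare (While 52 (?W) ;;
  Ops ?L) m1
   ((B * ((4 * qS + ((3 * qS + 4 * qS) + 6 * qS)) + qS) + 3 * qS) + 8 * qS) q1
   ?Q"
  proof (rule hoare_seq[where Q = "%m' q. \<exists>j. I j m' q & m' 52 <= 0"])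
   show "hoare (While 52 (?W)) m1
   (B * ((4 * qS + ((3 * qS + 4 * qS) + 6 * qS)) + qS) + 3 * qS) q1 (%m' q. \<exists>j. I j m' q & m' 52 <= 0)"
   proof (rule hoare_while[where I = I])
    fix j m2 q2 assume b2: "bok m2" and I2: "I (Suc j) m2 q2" and pos: "m2 52 > 0"
    define e where "e = m2 52"
    define v where "v = m2 34"
    define w where "w = m2 51"
    have I2': "q2 = p" "eqx {34, 51, 52, 57, 58, 59, 63} {} m m2" "0 <= v" "v <= M" "0 <= w" "w < M"
     "e < 2 ^ Suc j" "e < M" "(v * w ^ nat e) mod M = a ^ nat (M - 2) mod M" "e > 0"
     using I2 pos by (simp_all add: I_def e_def v_def w_def)
    have m8: "m2 8 = M" using reg[OF I2] by simp
    have bit: "e - e div 2 * 2 = e mod 2" by (simp add: minus_div_mult_eq_mod)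
    have half: "x div 2 < k" if "x < 2 * k" for x k :: int using that by presburger
    have eh: "e div 2 < 2 ^ j" "e div 2 < M" "-1 <= e div 2"
     using half[of e "2 ^ j"] half[of e M] I2'(7,8,10) by (simp_all add: pos_imp_zdiv_nonneg_iff order_trans[of "-1" 0])
    have el: "e < 2 ^ SB" "e div 2 < 2 ^ SB" "e mod 2 < 2 ^ SB" using I2' Ml by auto
    \<comment> \<open>Square-and-multiply: modulo \<open>M\<close>, the product of the accumulator
      with the pending power does not change.\<close>
    have key: "((if e mod 2 > 0 then v * w mod M else v) * (w * w mod M) ^ nat (e div 2)) mod M = a ^ nat (M - 2) mod M"
    proof -
     have en: "nat e = 2 * nat (e div 2) + nat (e mod 2)" 
     proof -
      have "nat (e div 2) = nat e div 2" "nat (e mod 2) = nat e mod 2"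
       using I2'(10) by (simp_all add: nat_div_distrib nat_mod_distrib)
      thus ?thesis by simp
     qed
     have "((if e mod 2 > 0 then v * w mod M else v) * (w * w mod M) ^ nat (e div 2)) mod M =
      ((if e mod 2 > 0 then v * w else v) * (w * w) ^ nat (e div 2)) mod M"
     proof -
      have "(x mod M * (w * w mod M) ^ k) mod M = (x * (w * w) ^ k) mod M"
       "(x * (w * w mod M) ^ k) mod M = (x * (w * w) ^ k) mod M" for x k
       by (simp_all add: mod_mult_left_eq power_mod mod_mult_cong[OF refl power_mod])
      thus ?thesis by simp
     qed
     also have "(if e mod 2 > 0 then v * w else v) * (w * w) ^ nat (e div 2) = v * w ^ nat e"
     proof (cases "e mod 2 > 0")
      case True
      hence "e mod 2 = 1" by linarith
      thus ?thesis unfolding en by (simp add: power_add power_mult power2_eq_square mult_ac)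
     next
      case False
      hence "e mod 2 = 0" by (simp add: order_antisym)
      thus ?thesis unfolding en by (simp add: power_add power_mult power2_eq_square)
     qed
     finally show ?thesis using I2' by simp
    qed
    show "hoare (?W) m2
     (4 * qS + ((3 * qS + 4 * qS) + 6 * qS)) q2 (I j)"
    proof (rule hoare_seq[where Q = "%m' q. m' = m2(57 := e mod 2, 58 := e div 2) & q = p"])
     show "hoare (Ops ?B) m2 (4 * qS) q2
      (%m' q. m' = m2(57 := e mod 2, 58 := e div 2) & q = p)"
     proof (rule hoare_ops)
      show "ochks ?B m2"
       using el I2' bit by (simp add: wok_def e_def[symmetric])
      show "osems ?B m2 = m2(57 := e mod 2, 58 := e div 2) & q2 = p"
       using I2' bit by (auto simp: e_def[symmetric] fun_eq_iff)
     qed (simp add: rq2_def)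
    next
     fix m3 q3 assume b3: "bok m3" and h3: "m3 = m2(57 := e mod 2, 58 := e div 2) & q3 = p"
     show "hoare (If 57 (Ops ?C) (Ops []) ;;
      Ops ?D) m3 ((3 * qS + 4 * qS) + 6 * qS) q3 (I j)"
     proof (rule hoare_seq[where Q = "%m' q. q = p & eqx {34, 59, 63} {} m3 m' &
       m' 34 = (if e mod 2 > 0 then v * w mod M else v)"])
      have "hoare (If 57 (Ops ?C) (Ops [])) m3 (rq 57 + 2 * qS + 4 * qS) q3
       (%m' q. q = p & eqx {34, 59, 63} {} m3 m' & m' 34 = (if e mod 2 > 0 then v * w mod M else v))"
      proof (rule hoare_if)
       assume c: "m3 57 > 0"
       show "hoare (Ops ?C) m3 (4 * qS) q3
        (%m' q. q = p & eqx {34, 59, 63} {} m3 m' & m' 34 = (if e mod 2 > 0 then v * w mod M else v))"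
       proof (rule hoare_ops)
        have "v * w + M < 2 ^ SB" using MM[of v w] I2' by simp
        moreover have "0 <= v * w" using I2' by simp
        ultimately have vw: "\<bar>v * w\<bar> < 2 ^ SB" "\<bar>v * w\<bar> + M < 2 ^ SB" using M0 by auto
        show "ochks ?C m3"
         using h3 vw M0 by (simp add: wok_def v_def[symmetric] w_def[symmetric] m8)
        show "q3 = p & eqx {34, 59, 63} {} m3 (osems ?C m3) &
         osems ?C m3 34 = (if e mod 2 > 0 then v * w mod M else v)"
         using h3 c by (simp add: tmp_def v_def[symmetric] w_def[symmetric] m8)
       qed (simp add: rq2_def rq_def)
      next
       assume c: "m3 57 <= 0"
       show "hoare (Ops []) m3 (4 * qS) q3 (%m' q. q = p & eqx {34, 59, 63} {} m3 (m'(59 := 1)) &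
        (m'(59 := 1)) 34 = (if e mod 2 > 0 then v * w mod M else v))"
        by (rule hoare_ops) (use h3 c in \<open>simp_all add: v_def\<close>)
      qed
      thus "hoare (If 57 (Ops ?C) (Ops [])) m3 (3 * qS + 4 * qS) q3
       (%m' q. q = p & eqx {34, 59, 63} {} m3 m' & m' 34 = (if e mod 2 > 0 then v * w mod M else v))"
       by (simp add: rq_def)
     next
      fix m4 q4 assume b4: "bok m4" and h4: "q4 = p & eqx {34, 59, 63} {} m3 m4 &
       m4 34 = (if e mod 2 > 0 then v * w mod M else v)"
      have r4: "m4 51 = w" "m4 8 = M" "m4 58 = e div 2"
      proof -
       note R = eqx_reg[OF conjunct1[OF conjunct2[OF h4]]]
       show "m4 51 = w" "m4 8 = M" "m4 58 = e div 2" using h3 m8 by (simp_all add: R w_def)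
      qed
      have vv: "0 <= m4 34" "m4 34 <= M" using h4 I2' M0 by (auto intro: order.strict_implies_order)
      have ex4: "eqx {34, 51, 52, 57, 58, 59, 63} {} m m4"
       by (rule eqx_tr[OF _ conjunct1[OF conjunct2[OF h4]]]) (use h3 I2'(2) in simp_all)
      show "hoare (Ops ?D) m4 (6 * qS) q4 (I j)"
      proof (rule hoare_ops)
       have "w * w + M < 2 ^ SB" using MM[of w w] I2' by simp
       moreover have "0 <= w * w" by simp
       ultimately have ww: "\<bar>w * w\<bar> < 2 ^ SB" "\<bar>w * w\<bar> + M < 2 ^ SB" using M0 by auto
       show "ochks ?D m4"
        using r4 ww M0 el I2' by (simp add: wok_def tmp_def)
       show "I j (osems ?D m4) q4"
        using r4 vv ex4 M0(1) I2'(1) key conjunct1[OF h4] conjunct2[OF conjunct2[OF h4]] eh I2'(5,6) by (simp add: I_def tmp_def)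
      qed (simp add: rq2_def rq_def)
     qed
    qed
   next
    fix m2 q2 assume "bok m2" "I 0 m2 q2"
    thus "m2 52 <= 0" by (simp add: I_def)
   next
    show "I B (m1(59 := 1)) q1" using I1 by (simp add: I_def)
   next
    fix j m2 q2 assume "bok m2" "I j m2 q2" "m2 52 <= 0"
    thus "\<exists>j. I j m2 q2 & m2 52 <= 0" by blast
   qed auto
  next
   fix m2 q2 assume b2: "bok m2" and "\<exists>j. I j m2 q2 & m2 52 <= 0"
   then obtain j where I2: "I j m2 q2" and e0: "m2 52 <= 0" by blast
   define v where "v = m2 34"
   have I2': "q2 = p" "eqx {34, 51, 52, 57, 58, 59, 63} {} m m2" "0 <= v" "v <= M" "v mod M = a ^ nat (M - 2) mod M"
    using I2 e0 by (auto simp: I_def v_def)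
   note r = reg[OF I2]
   define t where "t = a * v mod M"
   have t: "0 <= t" "t < M" using M0 by (auto simp: t_def)
   have av: "\<bar>a * v\<bar> < 2 ^ SB" "\<bar>a * v\<bar> + M < 2 ^ SB"
    using MM[of a v] a0 I2' M0 by (auto simp: abs_mult)
   have tt: "\<bar>(t - 1) * (t - 1)\<bar> < 2 ^ SB" "\<bar>t - 1\<bar> < 2 ^ SB" "\<bar>1 - (t - 1) * (t - 1)\<bar> < 2 ^ SB"
   proof -
    have "\<bar>t - 1\<bar> <= M" using t by auto
    hence *: "\<bar>t - 1\<bar> * \<bar>t - 1\<bar> + M < 2 ^ SB" by (intro MM) auto
    thus "\<bar>(t - 1) * (t - 1)\<bar> < 2 ^ SB" using M0 by (simp add: abs_mult)
    show "\<bar>t - 1\<bar> < 2 ^ SB" using t Ml by linarith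
    have "0 <= (t - 1) * (t - 1)" by simp
    moreover have "(t - 1) * (t - 1) + M < 2 ^ SB" using * by (simp add: abs_mult_self_eq)
    ultimately show "\<bar>1 - (t - 1) * (t - 1)\<bar> < 2 ^ SB" using M0 unfolding abs_less_iff by linarith
   qed
   have sq: "1 - (t - 1) * (t - 1) > 0 \<longleftrightarrow> t = 1"
   proof
    assume "1 - (t - 1) * (t - 1) > 0"
    hence "(t - 1)\<^sup>2 < 1" by (simp add: power2_eq_square)
    hence "\<bar>t - 1\<bar> < 1" by (simp add: abs_square_less_1)
    thus "t = 1" by simp
   qed simp
   have fl: "t = 1" if "prime M" "a ~= 0"
   proof -
    have M2: "M >= 2" using that(1) by (simp add: prime_ge_2_int)
    have nd: "~ M dvd a" using a0 that(2) by (auto dest: zdvd_imp_le)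
    have "[a ^ nat (M - 1) = 1] (mod M)"
    proof -
     have "prime (nat M)" using that(1) prime_int_nat_transfer[of M] by blast
     moreover have "~ nat M dvd nat a" using nd M0 a0 by (simp add: nat_dvd_iff)
     ultimately have "[nat a ^ (nat M - 1) = 1] (mod nat M)" by (rule fermat_theorem)
     hence "[int (nat a ^ (nat M - 1)) = int 1] (mod int (nat M))" by (simp only: cong_int_iff)
     moreover have "nat M - 1 = nat (M - 1)" using M0 by simp
     ultimately show ?thesis using M0 a0 by simp
    qed
    moreover have "nat (M - 1) = Suc (nat (M - 2))" using M2 by simp
    ultimately have "a * a ^ nat (M - 2) mod M = 1 mod M" by (simp add: cong_def)
    moreover have "a * v mod M = a * a ^ nat (M - 2) mod M" using I2'(5) by (metis mod_mult_right_eq)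
    ultimately show ?thesis using M2 by (simp add: t_def)
   qed
   show "hoare (Ops ?L) m2 (8 * qS) q2
    ?Q"
   proof (rule hoare_ops)
    show "ochks ?L m2"
     using r av tt M0 by (simp add: wok_def tmp_def v_def[symmetric] t_def[symmetric])
    have e58: "osems ?L m2 58 = 1 - (t - 1) * (t - 1)"
     "osems ?L m2 34 = v"
     using r by (simp_all add: tmp_def v_def[symmetric] t_def)
    have ee: "eqx {34, 51, 52, 57, 58, 59, 63} {} m (osems ?L m2)"
     using I2'(2) by (simp add: tmp_def)
    show "q2 = p & eqx {34, 51, 52, 57, 58, 59, 63} {} m (osems ?L m2) &
     0 <= osems ?L m2 34 &
     osems ?L m2 34 <= m 8 &
     (osems ?L m2 58 > 0 \<longleftrightarrow>
      m 50 * osems ?L m2 34 mod m 8 = 1) &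
     osems ?L m2 58 <= 1 &
     (prime (m 8) & m 50 ~= 0 --> osems ?L m2 58 > 0)"
     unfolding e58 sq using ee I2' fl unfolding M_def[symmetric] a_def[symmetric] t_def[symmetric] by simp
   qed (simp add: rq2_def rq_def)
  qed
 qed
 thus ?thesis by (rule hoare_mono) (auto simp: algebra_simps)
qed

end

context alg
begin

section \<open>Vector operations on residues\<close>

definition in_arr :: "memory => nat => int => bool" where
 "in_arr m a M \<longleftrightarrow> (\<forall>i<n. 0 <= ar m a i & ar m a i < M)"

abbreviation "TMP \<equiv> {48, 49, 50, 51, 52, 57, 58, 59, 60, 61, 62, 63}"

definition Dot :: "nat => nat => nat => com" where
 "Dot r a c = Ops [OC r 0] ;; For 48 49 9 (Ops [OLd 50 a 48, OLd 51 c 48, OMul 50 50 51, OAdd r r 50, OMod r r])"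

lemma mod_bounds:
 fixes M :: int
 assumes "0 < M" "M <= 2 ^ B" "0 <= x" "x <= M" "0 <= y" "y <= M" "0 <= v" "v <= M"
 shows "x * y < 2 ^ SB" "v + x * y < 2 ^ SB" "v + x * y + M < 2 ^ SB" "0 <= x * y"
proof -
 have "x * y <= 2 ^ (B + B)" by (rule mul_pow2) (use assms in auto)
 moreover have "M <= 2 ^ (B + B)" by (rule order_trans[OF assms(2)]) (auto intro: power_increasing)
 ultimately have "v + x * y + M <= 2 ^ (B + B + 2)" using assms by (simp add: power_add)
 hence *: "v + x * y + M < 2 ^ SB" by (rule pow2_lt) (use sbits in simp)
 show 0: "0 <= x * y" using assms by simp
 show "x * y < 2 ^ SB" "v + x * y < 2 ^ SB" "v + x * y + M < 2 ^ SB" using * 0 assms by linarith+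
qed

lemma Dot_spec:
 assumes r: "10 <= r" "r < 48" and ac: "a < 8" "c < 8"
  and M: "0 < m 8" "m 8 <= 2 ^ B" and N: "m 9 = int n" and V: "in_arr m a (m 8)" "in_arr m c (m 8)"
 shows "hoare (Dot r a c) m (n * (30 * qS) + 10 * qS) p (%m' q. q = p & eqx (insert r TMP) {} m m' &
  m' r = (\<Sum>i<n. ar m a i * ar m c i) mod m 8)"
proof -
 define M where "M = m 8"
 have M0: "0 < M" "M <= 2 ^ B" using M by (auto simp: M_def)
 define I where "I = (%k m' q. q = p & eqx (insert r TMP) {} m m' & m' r = (\<Sum>i<k. ar m a i * ar m c i) mod M)"
 have "hoare (Dot r a c) m (qS + (n * (15 * qS + 4 * qS) + 5 * qS)) p (I n)"
  unfolding Dot_def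
 proof (rule hoare_seq[where Q = "I 0"], goal_cases)
  case 1
  show ?case by (rule hoare_ops) (use r in \<open>simp_all add: wok_def I_def\<close>)
 next
  case (2 m1 q1)
  show ?case
  proof (rule hoare_for[where I = I], goal_cases)
   case (10 k m' q v w x y)
   thus ?case using r by (simp add: I_def)
  next
   case (11 k m' q)
   hence "eqx (insert r TMP) {} m m'" by (simp add: I_def)
   from eqx_reg[OF this, of 9] show ?case using N r by simp
  next
   case (13 k m' q)
   hence e: "eqx (insert r TMP) {} m m'" and q: "q = p" and v: "m' r = (\<Sum>i<k. ar m a i * ar m c i) mod M"
    by (simp_all add: I_def)
   note R = eqx_reg[OF e] eqx_ar[OF e]
   have m8: "m' 8 = M" using r by (simp add: R M_def)
   have xa: "ar m' a k = ar m a k" "ar m' c k = ar m c k" using ac by (simp_all add: R)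
   have xb: "0 <= ar m a k" "ar m a k <= M" "0 <= ar m c k" "ar m c k <= M"
    using V 13 by (auto simp: in_arr_def M_def intro: less_imp_le)
   have vb: "0 <= m' r" "m' r <= M" unfolding v using M0 by (auto intro: less_imp_le)
   note bd = mod_bounds[OF M0 xb vb]
   have nx: "(m' r + ar m a k * ar m c k) mod M = (\<Sum>i<Suc k. ar m a i * ar m c i) mod M"
    unfolding v by (simp add: mod_add_left_eq)
   show ?case
   proof (rule hoare_ops, goal_cases)
    case 1
    show ?case using r ac bd vb xb 13 M0 by (simp add: wok_def tmp_def xa m8)
   next
    case 2
    show ?case using r by (simp add: rq2_def rq_def)
   next
    case 3
    show ?case using r ac e q 13 nx by (simp add: I_def xa m8 tmp_def)
   qed
  qed (use r 2 in simp_all)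
 qed
 thus ?thesis by (rule hoare_mono) (auto simp: I_def M_def algebra_simps)
qed

definition Fill :: "nat => com" where
 "Fill a = For 48 49 9 (Ops [OC 50 0, OSt a 48 50])"

lemma Fill_spec:
 assumes a: "a < 8" and N: "m 9 = int n"
 shows "hoare (Fill a) m (n * (10 * qS) + 5 * qS) p (%m' q. q = p & eqx TMP {a} m m' & (\<forall>i<n. ar m' a i = 0))"
proof -
 define I where "I = (%k m' q. q = p & eqx TMP {a} m m' & (\<forall>i<k. ar m' a i = 0))"
 have "hoare (Fill a) m (n * (6 * qS + 4 * qS) + 5 * qS) p (I n)"
  unfolding Fill_def
 proof (rule hoare_for[where I = I], goal_cases)
  case (11 k m' q)
  hence "eqx TMP {a} m m'" by (simp add: I_def)
  from eqx_reg[OF this, of 9] show ?case using N by simp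
 next
  case (13 k m' q)
  show ?case
  proof (rule hoare_ops, goal_cases)
   case 3
   show ?case using a 13 by (auto simp: I_def less_Suc_eq)
  qed (use a 13 in \<open>simp_all add: wok_def\<close>)
 qed (auto simp: I_def)
 thus ?thesis by (rule hoare_mono) (auto simp: I_def algebra_simps)
qed

text \<open>One pass over the coordinate list, in whatever order: each entry is added into its row.
  The target is therefore cleared first, and the number of operations is linear in
  \<open>n + z\<close>.\<close>

definition MatVec :: "nat => nat => com" where
 "MatVec a c = Fill c ;; For 48 49 10 (Ops [OIn 50 1 48, OIn 51 2 48, OIn 52 3 48, OLd 51 a 51, OMul 51 51 52,
  OLd 52 c 50, OAdd 51 51 52, OMod 51 51, OSt c 50 51])"

definition spmv :: "(nat => int) => nat => nat => int" where
 "spmv x k i = (\<Sum>e<k. if X 1 e = int i then X 3 e * x (nat (X 2 e)) else 0)"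

lemma MatVec_spec:
 assumes ac: "a < 8" "c < 8" "a ~= c"
  and M: "0 < m 8" "m 8 <= 2 ^ B" and N: "m 9 = int n" and Z: "m 10 = int z" and V: "in_arr m a (m 8)"
 shows "hoare (MatVec a c) m ((n + z) * (40 * qS) + 10 * qS) p (%m' q. q = p & eqx TMP {c} m m' &
  (\<forall>i<n. ar m' c i = spmv (ar m a) z i mod m 8))"
proof -
 define M where "M = m 8"
 have M0: "0 < M" "M <= 2 ^ B" using M by (auto simp: M_def)
 define I where "I = (%k m' q. q = p & eqx TMP {c} m m' & (\<forall>i<n. ar m' c i = spmv (ar m a) k i mod M))"
 have "hoare (MatVec a c) m ((n * (10 * qS) + 5 * qS) + (z * (24 * qS + 4 * qS) + 5 * qS)) p (I z)"
  unfolding MatVec_def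
 proof (rule hoare_seq[where Q = "I 0"], goal_cases)
  case 1
  show ?case by (rule hoare_mono[OF Fill_spec[where a = c and m = m and p = p, OF ac(2) N]]) (auto simp: I_def spmv_def)
 next
  case (2 m1 q1)
  show ?case
  proof (rule hoare_for[where I = I], goal_cases)
   case (11 k m' q)
   hence "eqx TMP {c} m m'" by (simp add: I_def)
   from eqx_reg[OF this, of 10] show ?case using Z by simp
  next
   case (13 k m' q)
   hence e: "eqx TMP {c} m m'" and q: "q = p" and v: "!!i. i < n ==> ar m' c i = spmv (ar m a) k i mod M"
    by (simp_all add: I_def)
   note R = eqx_reg[OF e] eqx_ar[OF e]
   have m8: "m' 8 = M" by (simp add: R M_def)
   have kz: "k < z" using 13 by simp
   obtain i j where ij: "X 1 k = int i" "i < n" "X 2 k = int j" "j < n"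
    using rows[OF kz] cols[OF kz] by (metis nonneg_int_cases of_nat_less_iff)
   have xa: "ar m' a j = ar m a j" using ac by (simp add: R)
   define x where "x = ar m a j"
   define v0 where "v0 = ar m' c i"
   define s where "s = X 3 k"
   have xb: "0 <= x" "x <= M" using V ij by (auto simp: in_arr_def M_def x_def intro: less_imp_le)
   have sb: "\<bar>s\<bar> <= 2 ^ b" using vals[OF kz] by (simp add: s_def)
   have vb: "0 <= v0" "v0 < M" unfolding v0_def v[OF ij(2)] using M0 by auto
   have bnd: "\<bar>x * s\<bar> < 2 ^ SB" "\<bar>x * s + v0\<bar> < 2 ^ SB" "\<bar>x * s + v0\<bar> + M < 2 ^ SB" "\<bar>s\<bar> < 2 ^ SB"
   proof -
    have 1: "\<bar>x * s\<bar> <= 2 ^ (B + b)" unfolding abs_mult by (rule mul_pow2) (use xb sb M0 in auto)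
    have "M <= 2 ^ (B + b)" by (rule order_trans[OF M0(2)]) (auto intro: power_increasing)
    hence "\<bar>x * s\<bar> + v0 + M <= 2 ^ (B + b + 2)" using 1 vb by (simp add: power_add)
    hence *: "\<bar>x * s\<bar> + v0 + M < 2 ^ SB" by (rule pow2_lt) (use sbits in simp)
    show "\<bar>x * s\<bar> < 2 ^ SB" "\<bar>x * s + v0\<bar> < 2 ^ SB" "\<bar>x * s + v0\<bar> + M < 2 ^ SB" using * vb M0 by linarith+
    show "\<bar>s\<bar> < 2 ^ SB" by (rule pow2_lt[OF sb]) (use sbits in simp)
   qed
   have nS: "int n < 2 ^ SB" using SB(3) by linarith
   have ijS: "int i < 2 ^ SB" "int j < 2 ^ SB" using nS ij by linarith+
   have new: "(x * s + v0) mod M = spmv (ar m a) (Suc k) i mod M"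
    unfolding v0_def v[OF ij(2)] spmv_def by (simp add: ij ij(1)[unfolded One_nat_def] x_def s_def mod_add_right_eq add.commute mult.commute)
   have old: "spmv (ar m a) (Suc k) i' = spmv (ar m a) k i'" if "i' ~= i" for i'
    using that by (simp add: spmv_def ij ij(1)[unfolded One_nat_def])
   show ?case
   proof (rule hoare_ops, goal_cases)
    case 1
    show ?case using ac bnd 13 M0 ij ijS by (simp add: wok_def tmp_def m8 xa x_def[symmetric] s_def[symmetric] v0_def[symmetric])
   next
    case 2
    show ?case by (simp add: rq2_def rq_def)
   next
    case 3
    have *: "eqx TMP {c} m (osems [OIn 50 1 48, OIn 51 2 48, OIn 52 3 48, OLd 51 a 51, OMul 51 51 52,
     OLd 52 c 50, OAdd 51 51 52, OMod 51 51, OSt c 50 51] m')" using ac e by (simp add: tmp_def)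
    have **: "ar (osems [OIn 50 1 48, OIn 51 2 48, OIn 52 3 48, OLd 51 a 51, OMul 51 51 52,
     OLd 52 c 50, OAdd 51 51 52, OMod 51 51, OSt c 50 51] m') c i' = (if i' = i then (x * s + v0) mod M else ar m' c i')" for i'
     using ac 13 ij by (simp add: tmp_def m8 xa x_def[symmetric] s_def[symmetric] v0_def[symmetric])
    show ?case using q * new old v 13 unfolding I_def ** by (auto simp: tmp_def)
   qed
  qed (use 2 ac in \<open>simp_all add: I_def\<close>)
 qed
 thus ?thesis by (rule hoare_mono) (auto simp: I_def M_def algebra_simps)
qed

definition Scale :: com where
 "Scale = For 48 49 9 (Ops [OLd 50 4 48, OMul 50 50 13, OMod 50 50, OSt 4 48 50])"

lemma Scale_spec:
 assumes M: "0 < m 8" "m 8 <= 2 ^ B" and N: "m 9 = int n" and S: "m 13 = sc" and V: "in_arr m 4 (m 8)"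
 shows "hoare Scale m (n * (20 * qS) + 5 * qS) p (%m' q. q = p & eqx TMP {4} m m' &
  (\<forall>i<n. ar m' 4 i = sc * ar m 4 i mod m 8))"
proof -
 define M where "M = m 8"
 have M0: "0 < M" "M <= 2 ^ B" using M by (auto simp: M_def)
 define I where "I = (%k m' q. q = p & eqx TMP {4} m m' & (\<forall>i. ar m' 4 i = (if i < k then sc * ar m 4 i mod M else ar m 4 i)))"
 have "hoare Scale m (n * (14 * qS + 4 * qS) + 5 * qS) p (I n)"
  unfolding Scale_def
 proof (rule hoare_for[where I = I], goal_cases)
  case (11 k m' q)
  hence "eqx TMP {4} m m'" by (simp add: I_def)
  from eqx_reg[OF this, of 9] show ?case using N by simp
 next
  case (13 k m' q)
  hence e: "eqx TMP {4} m m'" and q: "q = p" and v: "!!i. ar m' 4 i = (if i < k then sc * ar m 4 i mod M else ar m 4 i)"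
   by (simp_all add: I_def)
  note R = eqx_reg[OF e]
  have m8: "m' 8 = M" "m' 13 = sc" using S by (simp_all add: R M_def)
  define x where "x = ar m 4 k"
  have xb: "0 <= x" "x <= M" using V 13 by (auto simp: in_arr_def M_def x_def intro: less_imp_le)
  have bnd: "x * sc < 2 ^ SB" "x * sc + M < 2 ^ SB" "0 <= x * sc"
  proof -
   have 1: "x * sc <= 2 ^ (B + 2 * sg)" by (rule mul_pow2) (use xb M0 scv in auto)
   have "M <= 2 ^ (B + 2 * sg)" by (rule order_trans[OF M0(2)]) (auto intro: power_increasing)
   hence "x * sc + M <= 2 ^ Suc (B + 2 * sg)" using 1 by simp
   hence *: "x * sc + M < 2 ^ SB" by (rule pow2_lt) (use sbits in simp)
   show 0: "0 <= x * sc" using xb sc by simp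
   show "x * sc < 2 ^ SB" "x * sc + M < 2 ^ SB" using * M0 by linarith+
  qed
  have vk: "ar m' 4 k = x" by (simp add: v x_def)
  show ?case
  proof (rule hoare_ops, goal_cases)
   case 1
   show ?case using bnd 13 M0 by (simp add: wok_def tmp_def m8 vk)
  next
   case 2
   show ?case by (simp add: rq2_def rq_def)
  next
   case 3
   have c: "x * sc mod M = sc * ar m 4 k mod M" by (simp add: x_def mult.commute)
   show ?case using e q 13 v by (auto simp: I_def tmp_def m8 vk c mult.commute)
  qed
 qed (auto simp: I_def)
 thus ?thesis by (rule hoare_mono) (auto simp: I_def M_def algebra_simps)
qed

text \<open>The recurrence is shifted in place: array 2 receives the current vector before array 5
  is overwritten with the next one.\<close>

definition Upd :: com where
 "Upd = For 48 49 9 (Ops [OLd 50 4 48, OLd 51 5 48, OLd 52 2 48, OSt 2 48 51, OMul 51 51 36, OMul 52 52 37,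
  OSub 51 51 50, OSub 51 51 52, OMod 51 51, OSt 5 48 51])"

lemma Upd_spec:
 assumes M: "0 < m 8" "m 8 <= 2 ^ B" and N: "m 9 = int n"
  and V: "in_arr m 4 (m 8)" "in_arr m 5 (m 8)" "in_arr m 2 (m 8)"
  and ab: "0 <= m 36" "m 36 <= m 8" "0 <= m 37" "m 37 <= m 8"
 shows "hoare Upd m (n * (50 * qS) + 5 * qS) p (%m' q. q = p & eqx TMP {2, 5} m m' &
  (\<forall>i<n. ar m' 2 i = ar m 5 i & ar m' 5 i = (m 36 * ar m 5 i - ar m 4 i - m 37 * ar m 2 i) mod m 8))"
proof -
 define M where "M = m 8"
 define al where "al = m 36"
 define be where "be = m 37"
 have M0: "0 < M" "M <= 2 ^ B" using M by (auto simp: M_def)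
 define I where "I = (%k m' q. q = p & eqx TMP {2, 5} m m' &
  (\<forall>i. ar m' 2 i = (if i < k then ar m 5 i else ar m 2 i) &
    ar m' 5 i = (if i < k then (al * ar m 5 i - ar m 4 i - be * ar m 2 i) mod M else ar m 5 i)))"
 have "hoare Upd m (n * (40 * qS + 4 * qS) + 5 * qS) p (I n)"
  unfolding Upd_def
 proof (rule hoare_for[where I = I], goal_cases)
  case (11 k m' q)
  hence "eqx TMP {2, 5} m m'" by (simp add: I_def)
  from eqx_reg[OF this, of 9] show ?case using N by simp
 next
  case (13 k m' q)
  hence e: "eqx TMP {2, 5} m m'" and q: "q = p" and v: "!!i. ar m' 2 i = (if i < k then ar m 5 i else ar m 2 i)"
   "!!i. ar m' 5 i = (if i < k then (al * ar m 5 i - ar m 4 i - be * ar m 2 i) mod M else ar m 5 i)"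
   by (simp_all add: I_def)
  note R = eqx_reg[OF e] eqx_ar[OF e]
  have m8: "m' 8 = M" "m' 36 = al" "m' 37 = be" by (simp_all add: R M_def al_def be_def)
  define x where "x = ar m 5 k"
  define y where "y = ar m 2 k"
  define w where "w = ar m 4 k"
  have vk: "ar m' 5 k = x" "ar m' 2 k = y" "ar m' 4 k = w" by (simp_all add: v x_def y_def w_def R)
  have xb: "0 <= x" "x <= M" "0 <= y" "y <= M" "0 <= w" "w <= M"
   using V 13 by (auto simp: in_arr_def M_def x_def y_def w_def intro: less_imp_le)
  have abb: "0 <= al" "al <= M" "0 <= be" "be <= M" using ab by (auto simp: M_def al_def be_def)
  have bnd: "x * al < 2 ^ SB" "y * be < 2 ^ SB" "\<bar>x * al - w\<bar> < 2 ^ SB" "\<bar>x * al - w - y * be\<bar> < 2 ^ SB"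
   "\<bar>x * al - w - y * be\<bar> + M < 2 ^ SB" "0 <= x * al" "0 <= y * be"
  proof -
   have 1: "x * al <= 2 ^ (B + B)" "y * be <= 2 ^ (B + B)" by (rule mul_pow2; use xb abb M0 in auto)+
   have "M <= 2 ^ (B + B)" by (rule order_trans[OF M0(2)]) (auto intro: power_increasing)
   hence "x * al + y * be + w + M <= 2 ^ (B + B + 2)" using 1 xb by (simp add: power_add)
   hence *: "x * al + y * be + w + M < 2 ^ SB" by (rule pow2_lt) (use sbits in simp)
   show 0: "0 <= x * al" "0 <= y * be" using xb abb by simp_all
   show "x * al < 2 ^ SB" "y * be < 2 ^ SB" "\<bar>x * al - w\<bar> < 2 ^ SB" "\<bar>x * al - w - y * be\<bar> < 2 ^ SB"
    "\<bar>x * al - w - y * be\<bar> + M < 2 ^ SB" using * 0 M0 xb by linarith+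
  qed
  have c: "(x * al - w - y * be) mod M = (al * ar m 5 k - ar m 4 k - be * ar m 2 k) mod M"
   by (simp add: x_def y_def w_def mult.commute)
  show ?case
  proof (rule hoare_ops, goal_cases)
   case 1
   show ?case using bnd 13 M0 by (simp add: wok_def tmp_def m8 vk)
  next
   case 2
   show ?case by (simp add: rq2_def rq_def)
  next
   case 3
   show ?case using e q 13 v by (auto simp: I_def tmp_def m8 vk c) (simp_all add: x_def w_def mult.commute)
  qed
 qed (auto simp: I_def)
 thus ?thesis by (rule hoare_mono) (auto simp: I_def M_def al_def be_def algebra_simps)
qed

definition Start :: com where
 "Start = For 48 49 9 (Ops [OLd 50 0 48, OMod 50 50, OSt 5 48 50, OC 50 0, OSt 2 48 50])"

lemma Start_spec:
 assumes M: "0 < m 8" "m 8 <= 2 ^ B" and N: "m 9 = int n" and U: "in_arr m 0 (2 ^ K)"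
 shows "hoare Start m (n * (30 * qS) + 5 * qS) p (%m' q. q = p & eqx TMP {2, 5} m m' &
  (\<forall>i<n. ar m' 2 i = 0 & ar m' 5 i = ar m 0 i mod m 8))"
proof -
 define M where "M = m 8"
 have M0: "0 < M" "M <= 2 ^ B" using M by (auto simp: M_def)
 define I where "I = (%k m' q. q = p & eqx TMP {2, 5} m m' &
  (\<forall>i<k. ar m' 2 i = 0 & ar m' 5 i = ar m 0 i mod M))"
 have "hoare Start m (n * (20 * qS + 4 * qS) + 5 * qS) p (I n)"
  unfolding Start_def
 proof (rule hoare_for[where I = I], goal_cases)
  case (11 k m' q)
  hence "eqx TMP {2, 5} m m'" by (simp add: I_def)
  from eqx_reg[OF this, of 9] show ?case using N by simp
 next
  case (13 k m' q)
  hence e: "eqx TMP {2, 5} m m'" and q: "q = p" and v: "!!i. i < k ==> ar m' 2 i = 0 & ar m' 5 i = ar m 0 i mod M"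
   by (simp_all add: I_def)
  note R = eqx_reg[OF e] eqx_ar[OF e]
  have m8: "m' 8 = M" by (simp add: R M_def)
  define x where "x = ar m 0 k"
  have vk: "ar m' 0 k = x" by (simp add: x_def R)
  have bnd: "x + M < 2 ^ SB" "0 <= x"
  proof -
   have x: "0 <= x" "x <= 2 ^ K" using U 13 by (auto simp: in_arr_def x_def intro: less_imp_le)
   have "x <= 2 ^ (K + B)" by (rule order_trans[OF x(2)]) (auto intro: power_increasing)
   moreover have "M <= 2 ^ (K + B)" by (rule order_trans[OF M0(2)]) (auto intro: power_increasing)
   ultimately have "x + M <= 2 ^ Suc (K + B)" by simp
   thus "x + M < 2 ^ SB" by (rule pow2_lt) (use sbits in simp)
   show "0 <= x" by (rule x)
  qed
  show ?case
  proof (rule hoare_ops, goal_cases)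
   case 1
   show ?case using bnd 13 M0 by (simp add: wok_def tmp_def m8 vk)
  next
   case 2
   show ?case by (simp add: rq2_def rq_def)
  next
   case 3
   show ?case using e q 13 v by (auto simp: I_def tmp_def m8 vk x_def less_Suc_eq)
  qed
 qed (auto simp: I_def)
 thus ?thesis by (rule hoare_mono) (auto simp: I_def M_def algebra_simps)
qed

end

section \<open>One step of the recurrence modulo \<open>M\<close>\<close>

context alg
begin

lemma spmv_cong: "(!!j. j < n ==> x j = y j) ==> spmv x z i = spmv y z i"
proof -
 assume h: "!!j. j < n ==> x j = y j"
 have "x (nat (X 2 e)) = y (nat (X 2 e))" if "e < z" for e using h cols[OF that] by auto
 thus ?thesis unfolding spmv_def by (intro sum.cong) auto
qed

lemma rl_spmv:
 assumes "!!j. j < n ==> rl M (x j) (v j)" "i < n"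
 shows "rl M (\<Sum>j<n. A $$ (i, j) * x j) (spmv v z i)"
 unfolding sparse[OF assms(2), symmetric] spmv_def
proof (rule rl_sum)
 fix e assume e: "e < z"
 have "nat (X 2 e) < n" using cols[OF e] by auto
 hence r: "rl M (real_of_int (X 3 e) * x (nat (X 2 e))) (X 3 e * v (nat (X 2 e)))"
  using assms(1) by (intro rl_mult rl_of_int) auto
 show "rl M (if X 1 e = int i then real_of_int (X 3 e) * x (nat (X 2 e)) else 0)
  (if X 1 e = int i then X 3 e * v (nat (X 2 e)) else 0)"
  using r rl_of_int[of M 0] by auto
qed

text \<open>Two sparse products and a scaling replace the square of the matrix, which may be dense
  and is never formed.\<close>

lemma mv_double:
 assumes "i < n"
 shows "lanczos.mv n mr x i = real_of_int sc * (\<Sum>l<n. A $$ (i, l) * (\<Sum>j<n. A $$ (l, j) * x j))"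
proof -
 have "lanczos.mv n mr x i = (\<Sum>j<n. \<Sum>l<n. real_of_int sc * (A $$ (i, l) * A $$ (l, j)) * x j)"
  unfolding lanczos.mv_def[OF lz] using assms
  by (intro sum.cong refl) (simp add: mr_def mz_def azr sum_distrib_left sum_distrib_right)
 also have "... = (\<Sum>l<n. \<Sum>j<n. real_of_int sc * (A $$ (i, l) * A $$ (l, j)) * x j)" by (rule sum.swap)
 also have "... = real_of_int sc * (\<Sum>l<n. A $$ (i, l) * (\<Sum>j<n. A $$ (l, j) * x j))"
  by (simp add: sum_distrib_left mult_ac)
 finally show ?thesis .
qed

text \<open>Correctness of the residues after \<open>j\<close> steps. Register 33 carries the
  inverse of the previous norm, which at the start is 0 by the convention on division. The last
  conjunct records what the successful inversions have certified.\<close>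

definition sem :: "int => (nat => real) => int => nat => memory => bool" where
 "sem M u zz j m \<longleftrightarrow> (\<forall>i<n. rl M (lanczos.w n mr u (Suc j) i) (ar m 5 i)) &
  (\<forall>i<n. rl M (lanczos.w n mr u j i) (ar m 2 i)) &
  rl M (poly (lanczos.rp n mr u (Suc j)) (real_of_int zz)) (m 31) &
  rl M (poly (lanczos.rp n mr u j) (real_of_int zz)) (m 32) &
  rl M (1 / lanczos.h n mr u j) (m 33) & (\<forall>i<j. lanczos.h n mr u (Suc i) ~= 0)"

text \<open>Separate from \<open>sem\<close> because it must survive failed inversions: a trial
  whose flag 30 is cleared runs on with meaningless but bounded numbers.\<close>

definition strc :: "int => memory => bool" where
 "strc M m \<longleftrightarrow> m 8 = M & m 9 = int n & m 10 = int z & m 13 = sc & \<bar>m 27\<bar> <= 2 ^ ZB & in_arr m 5 M & in_arr m 2 M &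
  0 <= m 31 & m 31 <= M & 0 <= m 32 & m 32 <= M & 0 <= m 33 & m 33 <= M & (m 30 = 0 \<or> m 30 = 1)"

text \<open>Arrays 2 and 5 hold the previous and the current vector, 3 and 4 the sparse products.
  Registers 34, 36 and 37 hold the inverse norm and the coefficients \<open>al\<close> and
  \<open>be\<close>, 31 and 32 the two latest polynomial values, 28 the step count.\<close>

definition Body :: com where
 "Body = Ops [OC 50 0, OAdd 50 50 35] ;; Inv ;; If 58 (Ops []) (Ops [OC 30 0]) ;; MatVec 5 3 ;; MatVec 3 4 ;; Scale ;;
  Dot 36 5 4 ;; Ops [OMul 36 36 34, OMod 36 36, OMul 37 35 33, OMod 37 37] ;; Upd ;;
  Ops [OSub 50 36 27, OMul 50 50 31, OMul 51 37 32, OSub 50 50 51, OMod 50 50, OC 32 0, OAdd 32 32 31, OC 31 0,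
   OAdd 31 31 50, OC 33 0, OAdd 33 33 34, OC 51 1, OAdd 28 28 51]"

abbreviation "BS \<equiv> {28, 30, 31, 32, 33, 34, 36, 37} \<union> TMP"

text \<open>The flag can only drop from 1 to 0, namely when the norm residue in register 35 has no
  inverse; modulo a prime a nonzero residue always has one.\<close>

lemma Body_spec:
 assumes st: "strc (m 8) m" and M: "0 < m 8" "m 8 <= 2 ^ B"
  and h: "m 35 = (\<Sum>i<n. ar m 5 i * ar m 5 i) mod m 8" "0 < m 35"
  and j: "m 28 = int j" "j < n"
  and sem: "m 30 = 1 ==> sem (m 8) u (m 27) j m"
 shows "hoare Body m ((n + z + B) * (300 * qS) + 300 * qS) p (%m' q. q = p & eqx BS {2, 3, 4, 5} m m' &
  strc (m 8) m' & m' 28 = int (Suc j) & (m' 30 = 1 --> m 30 = 1 & sem (m 8) u (m 27) (Suc j) m') &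
  (prime (m 8) & m 30 = 1 --> m' 30 = 1))"
proof -
 interpret L: lanczos n mr u by (rule lz)
 define M where "M = m 8"
 define hh where "hh = m 35"
 define W1 where "W1 i = spmv (ar m 5) z i mod M" for i
 define W2 where "W2 i = sc * (spmv W1 z i mod M) mod M" for i
 define dot where "dot = (\<Sum>i<n. ar m 5 i * W2 i) mod M"
 have M0: "0 < M" "M <= 2 ^ B" using M by (auto simp: M_def)
 have hb: "0 < hh" "hh < M" using h M by (auto simp: hh_def M_def)
 have mc: "m 8 = M" "m 9 = int n" "m 10 = int z" "m 13 = sc" "\<bar>m 27\<bar> <= 2 ^ ZB" "in_arr m 5 M" "in_arr m 2 M"
  "0 <= m 31" "m 31 <= M" "0 <= m 32" "m 32 <= M" "0 <= m 33" "m 33 <= M" "m 30 = 0 \<or> m 30 = 1" "m 35 = hh"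
  using st by (auto simp: strc_def M_def hh_def)
 \<comment> \<open>What later stages need from the inversion. It involves registers 30 and 34 alone
   and therefore passes through the vector operations unchanged.\<close>
 define G where "G m' \<longleftrightarrow> 0 <= m' 34 & m' 34 <= M & (m' 30 = 0 \<or> m' 30 = 1) &
   (m' 30 = 1 --> m 30 = 1 & hh * m' 34 mod M = 1) & (prime M & m 30 = 1 --> m' 30 = 1)" for m' :: memory
 define al where "al iv = dot * iv mod M" for iv
 define be where "be = hh * m 33 mod M"
 have W1b: "0 <= W1 i" "W1 i < M" and W2b: "0 <= W2 i" "W2 i < M" for i using M0 by (auto simp: W1_def W2_def)
 have dotb: "0 <= dot" "dot < M" and alb: "0 <= al iv" "al iv < M" and beb: "0 <= be" "be < M" for iv
  using M0 by (auto simp: dot_def al_def be_def)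
 have jS: "int j + 1 < 2 ^ SB" using SB(3) j by linarith
 \<comment> \<open>Exact and modular recurrence advance side by side; the verified inverse supplies
   both \<open>h (Suc j) ~= 0\<close> and the residue of its reciprocal.\<close>
 have seml: "sem M u (m 27) (Suc j) m'"
  if "m 30 = 1" and iv: "hh * iv mod M = 1" and new: "!!i. i < n ==> ar m' 2 i = ar m 5 i"
   "!!i. i < n ==> ar m' 5 i = (al iv * ar m 5 i - W2 i - be * ar m 2 i) mod M"
   "m' 31 = ((al iv - m 27) * m 31 - be * m 32) mod M" "m' 32 = m 31" "m' 33 = iv" for m' iv
 proof -
  have s: "sem M u (m 27) j m" using sem that(1) by (simp add: M_def)
  have rv: "!!i. i < n ==> rl M (L.w (Suc j) i) (ar m 5 i)" and rvp: "!!i. i < n ==> rl M (L.w j i) (ar m 2 i)"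
   and rR: "rl M (poly (L.rp (Suc j)) (real_of_int (m 27))) (m 31)" and rRP: "rl M (poly (L.rp j) (real_of_int (m 27))) (m 32)"
   and rH: "rl M (1 / L.h j) (m 33)" and nz: "\<forall>i<j. L.h (Suc i) ~= 0"
   using s by (auto simp: sem_def)
  have rh: "rl M (L.h (Suc j)) hh"
   unfolding L.h_def L.ip_def hh_def h(1) M_def[symmetric] using rv by (intro rl_mod rl_sum rl_mult) auto
  have dv: "M dvd hh * iv - 1" using iv M0 by (metis dvd_minus_mod)
  have M1: "1 < M" using hb by simp
  note inv = rl_inverse[OF rh dv M1]
  have r1: "rl M (\<Sum>l<n. A $$ (i, l) * L.w (Suc j) l) (W1 i)" if "i < n" for i
   unfolding W1_def by (rule rl_mod, rule rl_spmv) (use rv that in auto)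
  have r2: "rl M (L.mv (L.w (Suc j)) i) (W2 i)" if "i < n" for i
   unfolding W2_def mv_double[OF that]
   by (rule rl_mod, rule rl_mult[OF rl_of_int], rule rl_mod, rule rl_spmv) (use r1 that in auto)
  have r3: "rl M (L.al (Suc j)) (al iv)"
  proof -
   have "rl M (L.ip (L.w (Suc j)) (L.mv (L.w (Suc j)))) dot"
    unfolding L.ip_def dot_def by (rule rl_mod, rule rl_sum, rule rl_mult) (use rv r2 in auto)
   from rl_mod[OF rl_mult[OF this inv(2)]] show ?thesis by (simp add: L.al_def al_def)
  qed
  have r4: "rl M (L.be j) be"
   using rl_mod[OF rl_mult[OF rh rH]] by (simp add: L.be_def be_def)
  have r5: "rl M (L.w (Suc (Suc j)) i) (ar m' 5 i)" if "i < n" for i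
   unfolding L.w_rec new(2)[OF that] by (intro rl_mod rl_diff rl_mult r2 r3 r4 rv rvp that)
  have r6: "rl M (poly (L.rp (Suc (Suc j))) (real_of_int (m 27))) (m' 31)"
  proof -
   have "rl M ((L.al (Suc j) - real_of_int (m 27)) * poly (L.rp (Suc j)) (real_of_int (m 27)) -
    L.be j * poly (L.rp j) (real_of_int (m 27))) (m' 31)"
    unfolding new(3) by (intro rl_mod rl_diff rl_mult r3 r4 rl_of_int rR rRP)
   thus ?thesis by (simp add: L.rp.simps(3) algebra_simps)
  qed
  show ?thesis unfolding sem_def
   using r5 r6 rv rR inv nz new by (auto simp: less_Suc_eq)
 qed
 have "hoare Body m (2 * qS + ((B + 4) * (30 * qS) + ((3 * qS + qS) + (((n + z) * (40 * qS) + 10 * qS) +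
  (((n + z) * (40 * qS) + 10 * qS) + ((n * (20 * qS) + 5 * qS) + ((n * (30 * qS) + 10 * qS) +
   (8 * qS + ((n * (50 * qS) + 5 * qS) + 15 * qS))))))))) p
  (%m' q. q = p & eqx BS {2, 3, 4, 5} m m' &
  strc M m' & m' 28 = int (Suc j) & (m' 30 = 1 --> m 30 = 1 & sem M u (m 27) (Suc j) m') &
  (prime M & m 30 = 1 --> m' 30 = 1))"
  unfolding Body_def
 proof (rule hoare_seq[where Q = "%m' q. q = p & m' = m(50 := hh)"], goal_cases)
  case 1
  show ?case by (rule hoare_ops) (use hb mc M0 pow2_lt[OF M0(2), of SB] sbits in \<open>simp_all add: wok_def rq2_def\<close>)
 next
  case (2 m1 q1)
  hence m1: "q1 = p" "m1 = m(50 := hh)" by auto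
  show ?case
  proof (rule hoare_seq[where Q = "%m' q. q = p & eqx (insert 50 {34, 51, 52, 57, 58, 59, 63}) {} m m' &
    0 <= m' 34 & m' 34 <= M & (m' 58 > 0 \<longleftrightarrow> hh * m' 34 mod M = 1) & (prime M --> m' 58 > 0)"], goal_cases)
   case 1
   show ?case
    by (rule hoare_mono[OF Inv_spec[where p = q1 and m = m1]])
     (use m1 M0 hb mc in \<open>auto simp: intro: eqx_mono elim!: eqx_tr[rotated]\<close>)
  next
   case (2 m2 q2)
   hence m2: "q2 = p" "eqx (insert 50 {34, 51, 52, 57, 58, 59, 63}) {} m m2" "0 <= m2 34" "m2 34 <= M"
    "m2 58 > 0 \<longleftrightarrow> hh * m2 34 mod M = 1" "prime M --> m2 58 > 0" by auto
   have m30: "m2 30 = m 30" using eqx_reg[OF m2(2), of 30] by simp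
   show ?case
   proof (rule hoare_seq[where Q = "%m' q. q = p & eqx BS {2, 3, 4, 5} m m' & eqx (insert 30 (insert 34 TMP)) {} m m' & G m'"], goal_cases)
    case 1
    have "hoare (If 58 (Ops []) (Ops [OC 30 0])) m2 (rq 58 + 2 * qS + qS) q2
     (%m' q. q = p & eqx BS {2, 3, 4, 5} m m' & eqx (insert 30 (insert 34 TMP)) {} m m' & G m')"
    proof (rule hoare_if, goal_cases)
     case 1
     show ?case by (rule hoare_ops) (use m2 1 mc m30 in \<open>auto simp: G_def intro: eqx_mono[OF m2(2)]\<close>)
    next
     case c: 2
     have e: "eqx BS {2, 3, 4, 5} m (m2(30 := 0, 59 := 1))" "eqx (insert 30 (insert 34 TMP)) {} m (m2(30 := 0, 59 := 1))"
      using m2(2) by (simp_all) (auto intro: eqx_mono[OF m2(2)])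
     show ?case
      by (rule hoare_ops) (use m2 c m30 e in \<open>auto simp: G_def wok_def\<close>)
    qed
    thus ?case by (simp add: rq_def)
   next
    case (2 m3 q3)
    hence m3: "q3 = p" "eqx BS {2, 3, 4, 5} m m3" "eqx (insert 30 (insert 34 TMP)) {} m m3" "G m3" by auto
    note R3 = eqx_reg[OF m3(3)] eqx_ar[OF m3(3)]
    have c3: "m3 8 = M" "m3 9 = int n" "m3 10 = int z" "in_arr m3 5 M" "ar m3 5 = ar m 5"
     using mc by (simp_all add: R3 in_arr_def fun_eq_iff)
    show ?case
    proof (rule hoare_seq[where Q = "%m' q. q = p & eqx (insert 30 (insert 34 TMP)) {3} m m' & G m' &
      (\<forall>i<n. ar m' 3 i = W1 i)"], goal_cases)
     case 1
     show ?case
     proof (rule hoare_mono[OF MatVec_spec[where p = q3 and m = m3 and a = 5 and c = 3]], goal_cases)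
      case (11 m' q)
      hence e: "eqx TMP {3} m3 m'" by simp
      note R = eqx_reg[OF e]
      have "eqx (insert 30 (insert 34 TMP)) {3} m m'"
       by (rule eqx_tr[OF eqx_mono[OF m3(3)] e]) auto
      moreover have "G m'" using m3(4) by (simp add: G_def R)
      ultimately show ?case using 11 m3 c3 by (simp add: W1_def)
     qed (use c3 M0 in auto)
    next
     case (2 m4 q4)
     hence m4: "q4 = p" "eqx (insert 30 (insert 34 TMP)) {3} m m4" "G m4" "!!i. i < n ==> ar m4 3 i = W1 i" by auto
     note R4 = eqx_reg[OF m4(2)]
     have c4: "m4 8 = M" "m4 9 = int n" "m4 10 = int z" "in_arr m4 3 M"
      using mc m4 W1b by (simp_all add: R4 in_arr_def)
     have sp: "spmv (ar m4 3) z i = spmv W1 z i" for i by (rule spmv_cong) (use m4 in auto)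
     show ?case
     proof (rule hoare_seq[where Q = "%m' q. q = p & eqx (insert 30 (insert 34 TMP)) {3, 4} m m' & G m' &
       (\<forall>i<n. ar m' 4 i = spmv W1 z i mod M)"], goal_cases)
      case 1
      show ?case
      proof (rule hoare_mono[OF MatVec_spec[where p = q4 and m = m4 and a = 3 and c = 4]], goal_cases)
       case (11 m' q)
       hence e: "eqx TMP {4} m4 m'" by simp
       note R = eqx_reg[OF e]
       have "eqx (insert 30 (insert 34 TMP)) {3, 4} m m'"
        by (rule eqx_tr[OF eqx_mono[OF m4(2)] e]) auto
       moreover have "G m'" using m4(3) by (simp add: G_def R)
       ultimately show ?case using 11 m4 c4 sp by simp
      qed (use c4 M0 in auto)
     next
      case (2 m5 q5)
      hence m5: "q5 = p" "eqx (insert 30 (insert 34 TMP)) {3, 4} m m5" "G m5" "!!i. i < n ==> ar m5 4 i = spmv W1 z i mod M" by auto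
      note R5 = eqx_reg[OF m5(2)]
      have c5: "m5 8 = M" "m5 9 = int n" "m5 13 = sc" "in_arr m5 4 M"
       using mc m5 M0 by (simp_all add: R5 in_arr_def)
      show ?case
      proof (rule hoare_seq[where Q = "%m' q. q = p & eqx (insert 30 (insert 34 TMP)) {3, 4} m m' & G m' &
        (\<forall>i<n. ar m' 4 i = W2 i)"], goal_cases)
       case 1
       show ?case
       proof (rule hoare_mono[OF Scale_spec[where p = q5 and m = m5]], goal_cases)
        case (8 m' q)
        hence e: "eqx TMP {4} m5 m'" by simp
        note R = eqx_reg[OF e]
        have "eqx (insert 30 (insert 34 TMP)) {3, 4} m m'"
         by (rule eqx_tr[OF m5(2) e]) auto
        moreover have "G m'" using m5(3) by (simp add: G_def R)
        ultimately show ?case using 8 m5 c5 by (simp add: W2_def)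
       qed (use c5 M0 in auto)
      next
       case (2 m6 q6)
       hence m6: "q6 = p" "eqx (insert 30 (insert 34 TMP)) {3, 4} m m6" "G m6" "!!i. i < n ==> ar m6 4 i = W2 i" by auto
       note R6 = eqx_reg[OF m6(2)] eqx_ar[OF m6(2)]
       have c6: "m6 8 = M" "m6 9 = int n" "in_arr m6 4 M" "in_arr m6 5 M" "ar m6 5 = ar m 5"
        using mc m6 W2b by (simp_all add: R6 in_arr_def fun_eq_iff)
       show ?case
       proof (rule hoare_seq[where Q = "%m' q. q = p & eqx (insert 36 (insert 30 (insert 34 TMP))) {3, 4} m m' & G m' &
         (\<forall>i<n. ar m' 4 i = W2 i) & m' 36 = dot"], goal_cases)
        case 1
        show ?case
        proof (rule hoare_mono[OF Dot_spec[where p = q6 and m = m6 and r = 36 and a = 5 and c = 4]], goal_cases)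
         case (12 m' q)
         hence e: "eqx (insert 36 TMP) {} m6 m'" by simp
         note R = eqx_reg[OF e] eqx_ar[OF e]
         have "eqx (insert 36 (insert 30 (insert 34 TMP))) {3, 4} m m'"
          by (rule eqx_tr[OF eqx_mono[OF m6(2)] e]) auto
         moreover have "G m'" using m6(3) by (simp add: G_def R)
         ultimately show ?case using 12 m6 c6 by (simp add: dot_def R)
        qed (use c6 M0 in auto)
       next
        case (2 m7 q7)
        hence m7: "q7 = p" "eqx (insert 36 (insert 30 (insert 34 TMP))) {3, 4} m m7" "G m7" "!!i. i < n ==> ar m7 4 i = W2 i" "m7 36 = dot" by auto
        note R7 = eqx_reg[OF m7(2)]
        define iv where "iv = m7 34"
        have ivb: "0 <= iv" "iv <= M" using m7(3) by (auto simp: G_def iv_def)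
        have c7: "m7 8 = M" "m7 35 = hh" "m7 33 = m 33" using mc by (simp_all add: R7)
        show ?case
        proof (rule hoare_seq[where Q = "%m' q. q = p & eqx (insert 37 (insert 36 (insert 30 (insert 34 TMP)))) {3, 4} m m' & G m' &
          (\<forall>i<n. ar m' 4 i = W2 i) & m' 36 = al iv & m' 37 = be & m' 34 = iv"], goal_cases)
         case 1
         note d1 = mod_bounds[OF M0 dotb(1) less_imp_le[OF dotb(2)] ivb order_refl less_imp_le[OF M0(1)]]
         note d2 = mod_bounds[OF M0 less_imp_le[OF hb(1)] less_imp_le[OF hb(2)] mc(12,13) order_refl less_imp_le[OF M0(1)]]
         have G': "G (m7(36 := x, 37 := y, 63 := w))" for x y w using m7(3) by (simp add: G_def)
         have "eqx (insert 37 (insert 36 (insert 30 (insert 34 TMP)))) {3, 4} m m7" by (rule eqx_mono[OF m7(2)]) auto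
         thus ?case
          by (intro hoare_ops) (use d1 d2 c7 m7 M0 m7(3) in \<open>simp_all add: wok_def tmp_def rq2_def rq_def iv_def[symmetric] al_def be_def G_def\<close>)
        next
         case (2 m8 q8)
         hence m8: "q8 = p" "eqx (insert 37 (insert 36 (insert 30 (insert 34 TMP)))) {3, 4} m m8" "G m8" "!!i. i < n ==> ar m8 4 i = W2 i"
          "m8 36 = al iv" "m8 37 = be" "m8 34 = iv" by auto
         note R8 = eqx_reg[OF m8(2)] eqx_ar[OF m8(2)]
         have c8: "m8 8 = M" "m8 9 = int n" "in_arr m8 4 M" "in_arr m8 5 M" "in_arr m8 2 M"
          "0 <= m8 36" "m8 36 <= M" "0 <= m8 37" "m8 37 <= M" "ar m8 5 = ar m 5" "ar m8 2 = ar m 2"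
          using mc m8 W2b alb[of iv] beb by (simp_all add: R8 in_arr_def fun_eq_iff)
         show ?case
         proof (rule hoare_seq[where Q = "%m' q. q = p & eqx (insert 37 (insert 36 (insert 30 (insert 34 TMP)))) {2, 3, 4, 5} m m' & G m' &
          (\<forall>i<n. ar m' 2 i = ar m 5 i & ar m' 5 i = (al iv * ar m 5 i - W2 i - be * ar m 2 i) mod M) & m' 36 = al iv & m' 37 = be & m' 34 = iv"], goal_cases)
          case 1
          show ?case
          proof (rule hoare_mono[OF Upd_spec[where p = q8 and m = m8]], goal_cases)
           case (13 m' q)
           hence e: "eqx TMP {2, 5} m8 m'" by simp
           note R = eqx_reg[OF e]
           have "eqx (insert 37 (insert 36 (insert 30 (insert 34 TMP)))) {2, 3, 4, 5} m m'"
            by (rule eqx_tr[OF eqx_mono[OF m8(2)] e]) auto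
           moreover have "G m'" using m8(3) by (simp add: G_def R)
           ultimately show ?case using 13 m8 c8 by (simp add: R)
          qed (use c8 M0 in auto)
         next
          case (2 m9 q9)
          hence m9: "q9 = p" "eqx (insert 37 (insert 36 (insert 30 (insert 34 TMP)))) {2, 3, 4, 5} m m9" "G m9"
           "!!i. i < n ==> ar m9 2 i = ar m 5 i" "!!i. i < n ==> ar m9 5 i = (al iv * ar m 5 i - W2 i - be * ar m 2 i) mod M"
           "m9 36 = al iv" "m9 37 = be" "m9 34 = iv" by auto
          note R9 = eqx_reg[OF m9(2)]
          have c9: "m9 8 = M" "m9 9 = int n" "m9 10 = int z" "m9 13 = sc" "m9 27 = m 27" "m9 31 = m 31" "m9 32 = m 32" "m9 28 = int j"
           using mc j by (simp_all add: R9)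
          define R where "R = ((al iv - m 27) * m 31 - be * m 32) mod M"
          have Rb: "0 <= R" "R < M" using M0 by (auto simp: R_def)
          have bnd: "\<bar>al iv - m 27\<bar> < 2 ^ SB" "\<bar>(al iv - m 27) * m 31\<bar> < 2 ^ SB" "be * m 32 < 2 ^ SB" "0 <= be * m 32"
           "\<bar>(al iv - m 27) * m 31 - be * m 32\<bar> < 2 ^ SB" "\<bar>(al iv - m 27) * m 31 - be * m 32\<bar> + M < 2 ^ SB" "M < 2 ^ SB"
          proof -
           have "M <= 2 ^ (B + ZB)" by (rule order_trans[OF M0(2)]) (auto intro: power_increasing)
           moreover have "\<bar>m 27\<bar> <= 2 ^ (B + ZB)" by (rule order_trans[OF mc(5)]) (auto intro: power_increasing)
           ultimately have a1: "\<bar>al iv - m 27\<bar> <= 2 ^ Suc (B + ZB)" using alb[of iv] by simp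
           have a2: "\<bar>(al iv - m 27) * m 31\<bar> <= 2 ^ (Suc (B + ZB) + B)"
            unfolding abs_mult by (rule mul_pow2) (use a1 mc M0 in auto)
           have a3: "be * m 32 <= 2 ^ (B + B)" by (rule mul_pow2) (use beb mc M0 in auto)
           have a4: "(2::int) ^ (B + B) <= 2 ^ (Suc (B + ZB) + B)" "(2::int) ^ B <= 2 ^ (Suc (B + ZB) + B)"
            "(2::int) ^ Suc (B + ZB) <= 2 ^ (Suc (B + ZB) + B)" by (rule power_increasing; simp)+
           have a0: "0 <= be * m 32" using beb mc by simp
           have "\<bar>(al iv - m 27) * m 31\<bar> + be * m 32 + \<bar>al iv - m 27\<bar> + M <= 2 ^ (Suc (B + ZB) + B + 2)"
           proof -
            have "(2::int) ^ (Suc (B + ZB) + B + 2) = 4 * 2 ^ (Suc (B + ZB) + B)"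
             by (simp only: power_add[of 2 "Suc (B + ZB) + B" 2]) simp
            thus ?thesis using a1 a2 a3 a4 M0(2) by linarith
           qed
           hence *: "\<bar>(al iv - m 27) * m 31\<bar> + be * m 32 + \<bar>al iv - m 27\<bar> + M < 2 ^ SB"
            by (rule pow2_lt) (use sbits in simp)
           show "0 <= be * m 32" by (rule a0)
           show "\<bar>al iv - m 27\<bar> < 2 ^ SB" "\<bar>(al iv - m 27) * m 31\<bar> < 2 ^ SB" "be * m 32 < 2 ^ SB"
            "\<bar>(al iv - m 27) * m 31 - be * m 32\<bar> < 2 ^ SB" "\<bar>(al iv - m 27) * m 31 - be * m 32\<bar> + M < 2 ^ SB" "M < 2 ^ SB"
            using * a0 M0 by linarith+
          qed
          have smalls: "m 31 < 2 ^ SB" "R < 2 ^ SB" "iv < 2 ^ SB" using mc Rb ivb bnd(7) by linarith+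
          have ee: "eqx BS {2, 3, 4, 5} m m9" by (rule eqx_mono[OF m9(2)]) auto
          show ?case
          proof (rule hoare_ops, goal_cases)
           case 1
           show ?case using bnd smalls c9 m9(6-8) M0 mc(8,9) Rb ivb jS
            by (simp add: wok_def tmp_def R_def[symmetric])
          next
           case 2
           show ?case by (simp add: rq2_def rq_def)
          next
           case 3
           define mf where "mf = osems [OSub 50 36 27, OMul 50 50 31, OMul 51 37 32, OSub 50 50 51, OMod 50 50, OC 32 0, OAdd 32 32 31, OC 31 0,
            OAdd 31 31 50, OC 33 0, OAdd 33 33 34, OC 51 1, OAdd 28 28 51] m9"
           have f: "mf 31 = R" "mf 32 = m 31" "mf 33 = iv" "mf 28 = int (Suc j)" "mf 30 = m9 30" "mf 34 = iv" "mf 8 = M" "mf 9 = int n"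
            "mf 10 = int z" "mf 13 = sc" "mf 27 = m 27" "!!a i. ar mf a i = ar m9 a i"
            unfolding mf_def using c9 m9(6-8) by (simp_all add: tmp_def R_def)
           have e: "eqx BS {2, 3, 4, 5} m mf" unfolding mf_def using ee by (simp add: tmp_def)
           have s: "strc M mf"
            using f M0 mc(5,8,9) Rb ivb m9(3,4,5) mc(6) unfolding strc_def in_arr_def by (auto simp: G_def)
           have "m9 30 = 1 --> m 30 = 1 & sem M u (m 27) (Suc j) mf"
            using m9(3) seml[of iv mf] f m9(4,5,8) unfolding R_def by (auto simp: G_def)
           moreover have "prime M & m 30 = 1 --> m9 30 = 1" using m9(3) by (simp add: G_def)
           ultimately show ?case unfolding mf_def[symmetric] using e s f m9(1) by simp
          qed
         qed
        qed
       qed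
      qed
     qed
    qed
   qed
  qed
 qed
 thus ?thesis by (rule hoare_mono) (auto simp: M_def algebra_simps)
qed

end

section \<open>A complete trial with one modulus\<close>

context alg
begin

text \<open>A zero norm residue ends the recurrence: from then on the vectors do not change, the
  remaining iterations find 0 again, and register 28 keeps the number of steps made.\<close>

definition Trial :: com where
 "Trial = Start ;; Ops [OC 31 1, OC 32 0, OC 33 0, OC 28 0, OC 30 1] ;;
  For 46 47 9 (Dot 35 5 5 ;; If 35 Body (Ops []))"

abbreviation "TS \<equiv> {28, 30, 31, 32, 33, 34, 35, 36, 37, 46, 47} \<union> TMP"

text \<open>Under these conditions no inversion fails and no norm vanishes too early, so a generic
  start vector leads to the full Krylov dimension.\<close>

definition gm :: "int => (nat => real) => bool" where
 "gm M u \<longleftrightarrow> prime M & (\<forall>k<card S. \<forall>r. rl M (lanczos.h n mr u (Suc k)) r --> ~ M dvd r)"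

text \<open>For a generic start vector, a run of full length with all inversions successful is
  correct for every modulus; a good modulus only matters for reaching that length.\<close>

lemma Trial_spec:
 fixes m :: memory
 defines "u \<equiv> (%i. real_of_int (ar m 0 i))"
 assumes M: "0 < m 8" "m 8 <= 2 ^ B" and c: "m 9 = int n" "m 10 = int z" "m 13 = sc" "\<bar>m 27\<bar> <= 2 ^ ZB"
  and U: "in_arr m 0 (2 ^ K)"
 shows "hoare Trial m ((n + 1) * ((n + z + B + 2) * (400 * qS))) p (%m' q. q = p & eqx TS {2, 3, 4, 5} m m' &
  0 <= m' 31 & m' 31 <= m 8 & (\<exists>j\<le>n. m' 28 = int j) & (m' 30 = 0 \<or> m' 30 = 1) &
  (generic u --> (m' 30 = 1 --> m' 28 <= int (card S) & (m' 28 = int (card S) --> m 8 dvd m' 31 - \<lfloor>Qz (m 27)\<rfloor>)) &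
    (gm (m 8) u --> m' 30 = 1 & m' 28 = int (card S))))"
proof -
 interpret L: lanczos n mr u by (rule lz)
 define M where "M = m 8"
 have M0: "0 < M" "M <= 2 ^ B" using M by (auto simp: M_def)
 define I where "I = (%k m' q. q = p & eqx TS {2, 3, 4, 5} m m' & strc M m' & (\<exists>j\<le>k. m' 28 = int j &
  (m' 30 = 1 --> sem M u (m 27) j m') & (j < k --> (\<Sum>i<n. ar m' 5 i * ar m' 5 i) mod M = 0) &
  (generic u & gm M u --> m' 30 = 1 & (j < k --> j = card S))))"
 \<comment> \<open>Each completed step has certified a nonzero exact norm, but the norm with index
   \<open>Suc (card S)\<close> is 0. Such a run can stop short of the Krylov dimension but never
   pass it.\<close>
 have le_d: "j <= card S" if "generic u" "sem M u (m 27) j m'" for j m'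
 proof (rule ccontr)
  assume "~ ?thesis"
  hence "card S < j" by simp
  hence "L.h (Suc (card S)) ~= 0" using that(2) by (simp add: sem_def)
  thus False using generic_krylov(2)[OF that(1)] by simp
 qed
 have fin: "(generic u --> (m' 30 = 1 --> m' 28 <= int (card S) & (m' 28 = int (card S) --> M dvd m' 31 - \<lfloor>Qz (m 27)\<rfloor>)) &
    (gm M u --> m' 30 = 1 & m' 28 = int (card S)))" if I: "I n m' q" for m' q
 proof
  assume g: "generic u"
  obtain j where j: "j <= n" "m' 28 = int j" "m' 30 = 1 --> sem M u (m 27) j m'"
   "gm M u --> m' 30 = 1 & (j < n --> j = card S)" using I g by (auto simp: I_def)
  have 1: "m' 28 <= int (card S)" if "m' 30 = 1" using le_d[OF g] j that by simp
  have 2: "M dvd m' 31 - \<lfloor>Qz (m 27)\<rfloor>" if "m' 30 = 1" "m' 28 = int (card S)"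
  proof -
   have "rl M (poly (L.rp (Suc (card S))) (real_of_int (m 27))) (m' 31)" using j that by (simp add: sem_def)
   moreover have "Qz (m 27) \<in> \<int>" by (rule Qz_int[OF g]) (simp add: u_def)
   hence "Qz (m 27) = real_of_int \<lfloor>Qz (m 27)\<rfloor>" by (auto elim!: Ints_cases)
   ultimately show ?thesis using rl_int generic_krylov(3)[OF g, of "real_of_int (m 27)"] by (simp add: Qz_def)
  qed
  have 3: "m' 30 = 1 & m' 28 = int (card S)" if "gm M u"
  proof -
   have ok: "m' 30 = 1" "j < n --> j = card S" using j that by auto
   have "j = card S"
   proof (cases "j < n")
    case False
    thus ?thesis using le_d[OF g] j ok S_fin(3) by fastforce
   qed (use ok in simp)
   thus ?thesis using ok j by simp
  qed
  show "(m' 30 = 1 --> m' 28 <= int (card S) & (m' 28 = int (card S) --> M dvd m' 31 - \<lfloor>Qz (m 27)\<rfloor>)) &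
    (gm M u --> m' 30 = 1 & m' 28 = int (card S))" using 1 2 3 by blast
 qed
 have "hoare Trial m ((n * (30 * qS) + 5 * qS) + (5 * qS + (n * (((n * (30 * qS) + 10 * qS) + (3 * qS +
   ((n + z + B) * (300 * qS) + 300 * qS))) + 4 * qS) + 5 * qS))) p (I n)"
  unfolding Trial_def
 proof (rule hoare_seq[where Q = "%m' q. q = p & eqx TMP {2, 5} m m' &
  (\<forall>i<n. ar m' 2 i = 0 & ar m' 5 i = ar m 0 i mod M)"], goal_cases)
  case 1
  show ?case by (rule hoare_mono[OF Start_spec[where m = m and p = p]]) (use M c U in \<open>auto simp: M_def\<close>)
 next
  case (2 m1 q1)
  hence m1: "q1 = p" "eqx TMP {2, 5} m m1" "!!i. i < n ==> ar m1 2 i = 0" "!!i. i < n ==> ar m1 5 i = ar m 0 i mod M" by auto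
  note R1 = eqx_reg[OF m1(2)]
  show ?case
  proof (rule hoare_seq[where Q = "I 0"], goal_cases)
   case 1
   have e: "eqx TS {2, 3, 4, 5} m m1" by (rule eqx_mono[OF m1(2)]) auto
   have s0: "rl M 0 0" "rl M 1 1" using rl_of_int[of M 0] rl_of_int[of M 1] by simp_all
   have su: "rl M (u i) (ar m 0 i mod M)" for i unfolding u_def by (rule rl_mod, rule rl_of_int)
   define mf where "mf = osems [OC 31 1, OC 32 0, OC 33 0, OC 28 0, OC 30 1] m1"
   have f: "mf 31 = 1" "mf 32 = 0" "mf 33 = 0" "mf 28 = 0" "mf 30 = 1" "mf 8 = M" "mf 9 = int n" "mf 10 = int z" "mf 13 = sc"
    "mf 27 = m 27" "!!a i. ar mf a i = ar m1 a i"
    using c by (simp_all add: mf_def R1 M_def)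
   have st: "strc M mf" using f c M0 m1 by (auto simp: strc_def in_arr_def)
   have sm: "sem M u (m 27) 0 mf"
    using f m1 s0 su L.h_def[of 0] by (simp add: sem_def)
   have "eqx TS {2, 3, 4, 5} m mf" using e by (simp add: mf_def)
   hence "I 0 mf p" using st sm f by (simp add: I_def)
   thus ?case by (intro hoare_ops) (simp_all add: wok_def m1 mf_def)
  next
   case (2 m2 q2)
   show ?case
   proof (rule hoare_for[where I = I], goal_cases)
    case (10 k m' q v w x y)
    thus ?case by (simp add: I_def strc_def sem_def in_arr_def)
   next
    case (11 k m' q)
    thus ?case by (simp add: I_def strc_def)
   next
    case (13 k m3 q3)
    hence I3: "I k m3 q3" and k: "k < n" "m3 46 = int k" by auto
    note I3' = I3[unfolded I_def]
    note e3 = conjunct1[OF I3'] conjunct1[OF conjunct2[OF I3']] conjunct1[OF conjunct2[OF conjunct2[OF I3']]]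
    from conjunct2[OF conjunct2[OF conjunct2[OF I3']]] obtain j where J: "j <= k & m3 28 = int j &
     (m3 30 = 1 --> sem M u (m 27) j m3) & (j < k --> (\<Sum>i<n. ar m3 5 i * ar m3 5 i) mod M = 0) &
     (generic u & gm M u --> m3 30 = 1 & (j < k --> j = card S))" by (rule exE)
    note j = conjunct1[OF J] conjunct1[OF conjunct2[OF J]] conjunct1[OF conjunct2[OF conjunct2[OF J]]]
     conjunct1[OF conjunct2[OF conjunct2[OF conjunct2[OF J]]]] conjunct2[OF conjunct2[OF conjunct2[OF conjunct2[OF J]]]]
    define hv where "hv = (\<Sum>i<n. ar m3 5 i * ar m3 5 i) mod M"
    have c3: "m3 8 = M" "m3 9 = int n" "in_arr m3 5 M" using e3 by (auto simp: strc_def)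
    have z3: "m3 27 = m 27" using eqx_reg[OF e3(2), of 27] by simp
    show ?case
    proof (rule hoare_seq[where Q = "%m' q. q = p & eqx (insert 35 TMP) {} m3 m' & m' 35 = hv"], goal_cases)
     case 1
     show ?case by (rule hoare_mono[OF Dot_spec[where m = m3 and p = q3 and r = 35 and a = 5 and c = 5]])
      (use c3 M0 e3 in \<open>auto simp: hv_def\<close>)
    next
     case (2 m4 q4)
     hence m4: "q4 = p" "eqx (insert 35 TMP) {} m3 m4" "m4 35 = hv" by auto
     note R4 = eqx_reg[OF m4(2)] eqx_ar[OF m4(2)]
     have e4: "eqx TS {2, 3, 4, 5} m m4" by (rule eqx_tr[OF e3(2) m4(2)]) auto
     have st4: "strc M m4" using e3(3) by (simp add: strc_def in_arr_def R4)
     have sm4: "m4 30 = 1 --> sem M u (m 27) j m4" using j(3) by (simp add: sem_def R4)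
     have r4: "m4 28 = int j" "m4 30 = m3 30" "m4 46 = int k" "m4 8 = M" "m4 27 = m 27" "ar m4 5 = ar m3 5"
      using j k c3 z3 by (simp_all add: R4 fun_eq_iff)
     have "hoare (If 35 Body (Ops [])) m4 (rq 35 + 2 * qS + ((n + z + B) * (300 * qS) + 300 * qS)) q4
      (%m' q. m' 46 = int k & I (Suc k) m' q)"
     proof (rule hoare_if, goal_cases)
      case 1
      hence hp: "0 < hv" using m4 by simp
      hence jk: "j = k" using j(1,4) by (auto simp: hv_def)
      show ?case
      proof (rule hoare_mono[OF Body_spec[where m = m4 and p = q4 and j = j and u = u]], goal_cases)
       case (11 m' q)
       hence b: "q = p" "eqx BS {2, 3, 4, 5} m4 m'" "strc M m'" "m' 28 = int (Suc j)"
        "m' 30 = 1 --> m4 30 = 1 & sem M u (m 27) (Suc j) m'" "prime M & m4 30 = 1 --> m' 30 = 1"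
        using m4 r4 by auto
       have "eqx TS {2, 3, 4, 5} m m'" by (rule eqx_tr[OF e4 b(2)]) auto
       moreover have "m' 46 = int k" using eqx_reg[OF b(2), of 46] r4 by simp
       ultimately show ?case using b jk j(5) r4 by (auto simp: I_def gm_def)
      qed (use st4 M0 r4 m4 hp sm4 jk k in \<open>auto simp: hv_def\<close>)
     next
      case c: 2
      have "0 <= hv" using M0 by (simp add: hv_def)
      hence h0: "hv = 0" using c m4 by simp
      have "j = card S" if g: "generic u" "gm M u"
      proof (rule ccontr)
       assume "j ~= card S"
       have s: "sem M u (m 27) j m3" using j g by auto
       hence "j < card S" using le_d[OF g(1) s] \<open>j ~= card S\<close> by simp
       moreover have "rl M (L.h (Suc j)) hv"
        unfolding L.h_def L.ip_def hv_def using s by (intro rl_mod rl_sum rl_mult) (auto simp: sem_def)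
       ultimately have "~ M dvd hv" using g(2) by (auto simp: gm_def)
       thus False using h0 by simp
      qed
      moreover have "eqx TS {2, 3, 4, 5} m (m4(59 := 1))" using e4 by simp
      moreover have "strc M (m4(59 := 1))" using st4 by (simp add: strc_def in_arr_def)
      moreover have "m4 30 = 1 --> sem M u (m 27) j (m4(59 := 1))" using sm4 by (simp add: sem_def)
      ultimately have "I (Suc k) (m4(59 := 1)) p"
       using j r4 h0 by (auto simp: I_def hv_def intro!: exI[of _ j])
      thus ?case by (intro hoare_ops) (use m4 r4 in simp_all)
     qed
     thus ?case by (simp add: rq_def)
    qed
   qed (use 2 in simp_all)
  qed
 qed
 thus ?thesis
 proof (rule hoare_mono, goal_cases)
  case (3 m' q)
  thus ?case using fin[OF 3(2)] unfolding M_def[symmetric] by (auto simp: I_def strc_def)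
 qed (simp_all add: algebra_simps)
qed

end

section \<open>Exact evaluation by Chinese remaindering\<close>

text \<open>\<open>NB\<close> is the length of the values to be reconstructed and \<open>T\<close>
  the number of trials. The condition \<open>bb\<close> allows for a modulus that overshoots
  \<open>2 ^ NB\<close> by one factor, for a further product with it, and for a shift by
  \<open>24 b\<close> fractional bits.\<close>

locale alg2 = alg +
 fixes NB T :: nat
 assumes bb: "NB + 2 * B + 24 * b + 10 <= BB" and NB1: "1 <= NB" and B1: "1 <= B"
begin

text \<open>Inverting the accumulated modulus modulo the new one doubles as the test for
  coprimality: moduli that pass, prime or not, are combined by the usual formula, the others are
  skipped.\<close>

definition Crt2 :: com where
 "Crt2 = Ops [OSub 6 4 3] ;; If 6 (Ops [OMod 50 3] ;; Inv ;;
   If 58 (Ops [OSub 5 31 2, OMod 50 5, OMul 50 50 34, OMod 50 50, OMul 5 3 50, OAdd 2 2 5, OMul 3 3 8]) (Ops []))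
  (Ops [])"

abbreviation "CS \<equiv> {2, 3, 5, 6, 7, 34, 50, 51, 52, 57, 58, 59, 63}"

lemma bigI: "\<bar>x\<bar> <= 2 ^ e ==> e < BB ==> \<bar>x\<bar> < (2::int) ^ BB"
 by (rule pow2_lt)

lemma Crt2_spec:
 assumes M: "0 < m 8" "m 8 <= 2 ^ B" and L: "m 4 = 2 ^ NB" and R: "0 <= m 31" "m 31 <= m 8"
  and X: "0 <= m 2" "m 2 < m 3" "m 3 <= 2 ^ (NB + B)"
 shows "hoare Crt2 m ((B + 4) * (30 * qS) + 30 * qB) p (%m' q. q = p & eqx CS {} m m' &
  ((m' 2 = m 2 & m' 3 = m 3) \<or> (m 3 < 2 ^ NB & m' 3 = m 3 * m 8 & cop (m 3) (m 8) &
   0 <= m' 2 & m' 2 < m' 3 & m 3 dvd m' 2 - m 2 & m 8 dvd m' 2 - m 31)) &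
  (prime (m 8) & m 3 < 2 ^ NB & ~ m 8 dvd m 3 --> m' 3 = m 3 * m 8))"
proof -
 define M where "M = m 8"
 define Y where "Y = m 3"
 define x where "x = m 2"
 define r where "r = m 31"
 have M0: "0 < M" "M <= 2 ^ B" and r0: "0 <= r" "r <= M" and x0: "0 <= x" "x < Y" "Y <= 2 ^ (NB + B)"
  using assms by (auto simp: M_def Y_def x_def r_def)
 have pw: "(2::int) ^ B <= 2 ^ (NB + B)" "(2::int) ^ NB <= 2 ^ (NB + B)" "(2::int) ^ Suc (NB + B) <= 2 ^ (NB + B + B + 1)" "(2::int) ^ (NB + B) <= 2 ^ (NB + B + B)"
  by (rule power_increasing; simp)+
 have YM: "Y * M <= 2 ^ (NB + B + B)" by (rule mul_pow2) (use x0 M0 in auto)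
 have sq: "qS <= qB" by (rule qS_qB)
 define P where "P m' \<longleftrightarrow> eqx CS {} m m' &
  ((m' 2 = x & m' 3 = Y) \<or> (Y < 2 ^ NB & m' 3 = Y * M & cop Y M &
   0 <= m' 2 & m' 2 < m' 3 & Y dvd m' 2 - x & M dvd m' 2 - r)) &
  (prime M & Y < 2 ^ NB & ~ M dvd Y --> m' 3 = Y * M)" for m'
 have mr: "m 8 = M" "m 3 = Y" "m 2 = x" "m 31 = r" by (auto simp: M_def Y_def x_def r_def)
 have "hoare Crt2 m (qB + ((qB + 2 * qS) + (3 * qB + ((B + 4) * (30 * qS) + (3 * qS + (10 * qB + 4 * qS)))))) p (%m' q. q = p & P m')"
  unfolding Crt2_def
 proof (rule hoare_seq[where Q = "%m' q. q = p & m' = m(6 := 2 ^ NB - Y)"], goal_cases)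
  case 1
  have "\<bar>2 ^ NB - Y\<bar> <= 2 ^ (NB + B)" using pw x0 unfolding abs_le_iff by (smt (verit) zero_le_power)
  hence "\<bar>2 ^ NB - Y\<bar> < 2 ^ BB" by (rule bigI) (use bb B1 in simp)
  thus ?case by (intro hoare_ops) (use L mr in \<open>simp_all add: wok_def rq2_def\<close>)
 next
  case (2 m1 q1)
  hence m1: "q1 = p" "m1 = m(6 := 2 ^ NB - Y)" by auto
  have "hoare (If 6 (Ops [OMod 50 3] ;; Inv ;;
   If 58 (Ops [OSub 5 31 2, OMod 50 5, OMul 50 50 34, OMod 50 50, OMul 5 3 50, OAdd 2 2 5, OMul 3 3 8]) (Ops []))
   (Ops [])) m1 (rq 6 + 2 * qS + (3 * qB + ((B + 4) * (30 * qS) + (3 * qS + (10 * qB + 4 * qS))))) q1 (%m' q. q = p & P m')"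
  proof (rule hoare_if, goal_cases)
   case c: 1
   hence lt: "Y < 2 ^ NB" using m1 by simp
   define a where "a = Y mod M"
   have a0: "0 <= a" "a < M" using M0 by (auto simp: a_def)
   show ?case
   proof (rule hoare_seq[where Q = "%m' q. q = p & eqx CS {} m m' & m' 50 = a & m' 2 = x & m' 3 = Y"], goal_cases)
    case 1
    have "\<bar>Y\<bar> + M <= 2 ^ Suc (NB + B)" unfolding power_Suc using x0 M0 pw(1) by linarith
    hence "\<bar>Y\<bar> + M < 2 ^ BB" by (rule pow2_lt) (use bb B1 in simp)
    thus ?case by (intro hoare_ops) (use m1 mr M0 in \<open>simp_all add: wok_def tmp_def rq_def a_def\<close>)
   next
    case (2 m2 q2)
    hence m2: "q2 = p" "eqx CS {} m m2" "m2 50 = a" "m2 2 = x" "m2 3 = Y" by auto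
    note R2 = eqx_reg[OF m2(2)]
    have c2: "m2 8 = M" using mr by (simp add: R2)
    show ?case
    proof (rule hoare_seq[where Q = "%m' q. q = p & eqx CS {} m m' & m' 2 = x & m' 3 = Y & 0 <= m' 34 & m' 34 <= M &
      (m' 58 > 0 \<longleftrightarrow> a * m' 34 mod M = 1) & (prime M & a ~= 0 --> m' 58 > 0)"], goal_cases)
     case 1
     show ?case
     proof (rule hoare_mono[OF Inv_spec[where m = m2 and p = q2]], goal_cases)
      case (7 m' q)
      hence e: "eqx {34, 51, 52, 57, 58, 59, 63} {} m2 m'" by simp
      note R = eqx_reg[OF e]
      have "eqx CS {} m m'" by (rule eqx_tr[OF m2(2) e]) auto
      thus ?case using 7 m2 c2 by (auto simp: R)
     qed (use m2 c2 M0 a0 in auto)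
    next
     case (2 m3 q3)
     hence m3: "q3 = p" "eqx CS {} m m3" "m3 2 = x" "m3 3 = Y" "0 <= m3 34" "m3 34 <= M"
      "m3 58 > 0 \<longleftrightarrow> a * m3 34 mod M = 1" "prime M & a ~= 0 --> m3 58 > 0" by auto
     note R3 = eqx_reg[OF m3(2)]
     have c3: "m3 8 = M" "m3 31 = r" using mr by (simp_all add: R3)
     define iv where "iv = m3 34"
     have "hoare (If 58 (Ops [OSub 5 31 2, OMod 50 5, OMul 50 50 34, OMod 50 50, OMul 5 3 50, OAdd 2 2 5, OMul 3 3 8]) (Ops [])) m3
       (rq 58 + 2 * qS + (10 * qB + 4 * qS)) q3 (%m' q. q = p & P m')"
     proof (rule hoare_if, goal_cases)
      case 1
      hence iv1: "a * iv mod M = 1" using m3 by (simp add: iv_def)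
      have M1: "1 < M" using iv1 M0 by (metis mod_by_1 pos_mod_bound zero_neq_one order_le_less zless_imp_add1_zle add_0)
      have Yiv: "Y * iv mod M = 1" using iv1 by (simp add: a_def mod_mult_left_eq)
      have cop: "cop Y M"
      proof (rule algebraic_semidom_class.coprimeI)
       fix g assume g: "g dvd Y" "g dvd M"
       have "M dvd Y * iv - 1" using Yiv by (metis dvd_minus_mod)
       hence "g dvd Y * iv - (Y * iv - 1)" using g by (meson dvd_diff dvd_mult2 dvd_trans)
       thus "is_unit g" by simp
      qed
      define t0 where "t0 = (r - x) mod M"
      define t where "t = t0 * iv mod M"
      have tb: "0 <= t0" "t0 < M" "0 <= t" "t < M" using M0 by (auto simp: t0_def t_def)
      have ivb: "0 <= iv" "iv <= M" using m3 by (auto simp: iv_def)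
      have b1: "\<bar>r - x\<bar> + M < 2 ^ BB" "\<bar>r - x\<bar> < 2 ^ BB"
      proof -
       have "\<bar>r - x\<bar> + M <= 2 ^ (NB + B) + 2 ^ (NB + B)" using r0 x0 M0 pw(1) unfolding abs_le_iff by linarith
       hence "\<bar>r - x\<bar> + M <= 2 ^ Suc (NB + B)" by simp
       thus 1: "\<bar>r - x\<bar> + M < 2 ^ BB" by (rule pow2_lt) (use bb B1 in simp)
       show "\<bar>r - x\<bar> < 2 ^ BB" using 1 M0 by linarith
      qed
      note b2 = mod_bounds[OF M0 tb(1) less_imp_le[OF tb(2)] ivb order_refl less_imp_le[OF M0(1)]]
      have Yt: "0 <= Y * t" "x + Y * t < Y * M"
      proof -
       show "0 <= Y * t" using x0 tb by simp
       have "Y * t <= Y * (M - 1)" using x0 tb by (intro mult_left_mono) auto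
       thus "x + Y * t < Y * M" using x0 by (simp add: algebra_simps)
      qed
      have YMB: "Y * M < 2 ^ BB" by (rule pow2_lt[OF YM]) (use bb in simp)
      have dv1: "Y dvd (x + Y * t) - x" by simp
      have dv2: "M dvd (x + Y * t) - r"
      proof -
       have "Y * t mod M = (Y * iv mod M) * t0 mod M"
        unfolding t_def by (simp add: mod_mult_right_eq mod_mult_left_eq mult_ac)
       also have "... = t0 mod M" using Yiv by simp
       finally have "Y * t mod M = (r - x) mod M" by (simp add: t0_def)
       hence "M dvd Y * t - (r - x)" by (simp add: mod_eq_dvd_iff)
       thus ?thesis by (simp add: algebra_simps)
      qed
      show ?case
      proof (rule hoare_ops, goal_cases)
       case 1
       show ?case using b1 b2 Yt YMB tb M0 x0 m3 c3
        by (simp add: wok_def tmp_def t0_def[symmetric] iv_def[symmetric] t_def[symmetric])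
      next
       case 2
       show ?case using sq by (simp add: rq2_def rq_def)
      next
       case 3
       show ?case using m3 c3 cop lt Yt dv1 dv2 x0 unfolding P_def
        by (simp add: tmp_def t0_def[symmetric] iv_def[symmetric] t_def[symmetric])
      qed
     next
      case c: 2
      have "~ (prime M & ~ M dvd Y)" using m3(8) c by (auto simp: a_def dvd_eq_mod_eq_0)
      hence "P (m3(59 := 1))" using m3 by (auto simp: P_def)
      thus ?case by (intro hoare_ops) (use m3 in simp_all)
     qed
     thus ?case by (simp add: rq_def)
    qed
   qed
  next
   case c: 2
   hence "~ Y < 2 ^ NB" using m1 by simp
   hence "P (m1(59 := 1))" using m1 mr by (simp add: P_def)
   thus ?case by (intro hoare_ops) (use m1 in simp_all)
  qed
  thus ?case by (simp add: rq_def)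
 qed
 thus ?thesis
 proof (rule hoare_mono, goal_cases)
  case 1
  thus ?case using sq by (simp add: algebra_simps)
 next
  case (3 m' q)
  thus ?case unfolding P_def mr by simp
 qed simp
qed

text \<open>The Krylov dimension is unknown, so register 29 keeps the longest run seen. A longer run
  exposes all earlier ones as premature and restarts the remaindering; a shorter one is
  discarded.\<close>

definition Crt :: com where
 "Crt = If 30 (Ops [OSub 50 28 29] ;; If 50 (Ops [OC 2 0, OC 3 1, OC 29 0, OAdd 29 29 28]) (Ops []) ;;
  Ops [OSub 50 28 29, OC 51 1, OAdd 50 50 51] ;; If 50 Crt2 (Ops [])) (Ops [])"

lemma Crt_spec:
 fixes j D :: nat
 assumes M: "0 < m 8" "m 8 <= 2 ^ B" and L: "m 4 = 2 ^ NB" and R: "0 <= m 31" "m 31 <= m 8"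
  and X: "0 <= m 2" "m 2 < m 3" "m 3 <= 2 ^ (NB + B)" and j: "m 28 = int j" "j <= n" "m 29 = int D" "D <= n"
  and o30: "m 30 = 0 \<or> m 30 = 1"
 defines "D1 \<equiv> (if m 30 = 1 & D < j then j else D)" and "M1 \<equiv> (if m 30 = 1 & D < j then 1 else m 3)"
  and "X1 \<equiv> (if m 30 = 1 & D < j then 0 else m 2)"
 shows "hoare Crt m ((B + 4) * (30 * qS) + 60 * qB) p (%m' q. q = p & eqx (insert 29 CS) {} m m' & m' 29 = int D1 &
  ((m' 2 = X1 & m' 3 = M1) \<or> (m 30 = 1 & j = D1 & M1 < 2 ^ NB & m' 3 = M1 * m 8 & cop M1 (m 8) &
   0 <= m' 2 & m' 2 < m' 3 & M1 dvd m' 2 - X1 & m 8 dvd m' 2 - m 31)) &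
  (prime (m 8) & m 30 = 1 & D <= j & M1 < 2 ^ NB & ~ m 8 dvd M1 --> m' 3 = M1 * m 8))"
  (is "hoare _ _ _ _ ?Q")
proof -
 have sq: "qS <= qB" by (rule qS_qB)
 have jS: "int j + 1 < 2 ^ SB" "int D + 1 < 2 ^ SB" "int j < 2 ^ SB" using SB(3) j by linarith+
 have jd: "\<bar>int j - int D\<bar> < 2 ^ SB" "\<bar>int j - int D + 1\<bar> < 2 ^ SB" using jS by linarith+
 have one: "(1::int) < 2 ^ BB" by (rule pow2_lt[of _ 0]) (use bb in auto)
 have "hoare Crt m (rq 30 + 2 * qS + (qS + ((qS + 2 * qS + 4 * qS) + (3 * qS + (qS + 2 * qS + ((B + 4) * (30 * qS) + 30 * qB)))))) p ?Q"
  unfolding Crt_def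
 proof (rule hoare_if, goal_cases)
  case c: 1
  hence ok: "m 30 = 1" using o30 by auto
  show ?case
  proof (rule hoare_seq[where Q = "%m' q. q = p & m' = m(50 := int j - int D)"], goal_cases)
   case 1
   show ?case by (rule hoare_ops) (use j jd in \<open>simp_all add: wok_def rq2_def\<close>)
  next
   case (2 m1 q1)
   hence m1: "q1 = p" "m1 = m(50 := int j - int D)" by auto
   show ?case
   proof (rule hoare_seq[where Q = "%m' q. q = p & eqx (insert 29 CS) {} m m' & m' 29 = int D1 & m' 2 = X1 & m' 3 = M1"], goal_cases)
    case 1
    have "hoare (If 50 (Ops [OC 2 0, OC 3 1, OC 29 0, OAdd 29 29 28]) (Ops [])) m1 (rq 50 + 2 * qS + 4 * qS) q1
     (%m' q. q = p & eqx (insert 29 CS) {} m m' & m' 29 = int D1 & m' 2 = X1 & m' 3 = M1)"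
    proof (rule hoare_if, goal_cases)
     case 1
     hence "D < j" using m1 by simp
     thus ?case by (intro hoare_ops) (use m1 j jS one ok in \<open>simp_all add: wok_def rq2_def D1_def X1_def M1_def\<close>)
    next
     case 2
     hence "~ D < j" using m1 by simp
     thus ?case by (intro hoare_ops) (use m1 j in \<open>simp_all add: D1_def X1_def M1_def\<close>)
    qed
    thus ?case by (simp add: rq_def)
   next
    case (2 m2 q2)
    hence m2: "q2 = p" "eqx (insert 29 CS) {} m m2" "m2 29 = int D1" "m2 2 = X1" "m2 3 = M1" by auto
    note R2 = eqx_reg[OF m2(2)]
    have c2: "m2 28 = int j" "m2 8 = m 8" "m2 4 = 2 ^ NB" "m2 31 = m 31" using j L by (simp_all add: R2)
    have D1b: "\<bar>int j - int D1\<bar> < 2 ^ SB" "\<bar>int j - int D1 + 1\<bar> < 2 ^ SB" using jd by (auto simp: D1_def)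
    show ?case
    proof (rule hoare_seq[where Q = "%m' q. q = p & eqx (insert 29 CS) {} m m' & m' 29 = int D1 & m' 2 = X1 & m' 3 = M1 &
      m' 50 = int j - int D1 + 1"], goal_cases)
     case 1
     show ?case by (rule hoare_ops) (use m2 c2 D1b in \<open>simp_all add: wok_def rq2_def\<close>)
    next
     case (2 m3 q3)
     hence m3: "q3 = p" "eqx (insert 29 CS) {} m m3" "m3 29 = int D1" "m3 2 = X1" "m3 3 = M1" "m3 50 = int j - int D1 + 1" by auto
     note R3 = eqx_reg[OF m3(2)]
     have c3: "m3 8 = m 8" "m3 4 = 2 ^ NB" "m3 31 = m 31" using L by (simp_all add: R3)
     have X1b: "0 <= X1" "X1 < M1" "M1 <= 2 ^ (NB + B)" using X by (auto simp: X1_def M1_def)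
     have "hoare (If 50 Crt2 (Ops [])) m3 (rq 50 + 2 * qS + ((B + 4) * (30 * qS) + 30 * qB)) q3 ?Q"
     proof (rule hoare_if, goal_cases)
      case 1
      hence jD: "j = D1" using m3 ok by (auto simp: D1_def split: if_splits)
      show ?case
      proof (rule hoare_mono[OF Crt2_spec[where m = m3 and p = q3]], goal_cases)
       case (11 m' q)
       hence e: "eqx CS {} m3 m'" by simp
       have e1: "eqx (insert 29 CS) {} m m'" by (rule eqx_tr[OF m3(2) e]) auto
       have d: "m' 29 = int D1" using eqx_reg[OF e, of 29] m3 by simp
       from 11(2) have P: "((m' 2 = X1 & m' 3 = M1) \<or> (M1 < 2 ^ NB & m' 3 = M1 * m 8 & cop M1 (m 8) &
        0 <= m' 2 & m' 2 < m' 3 & M1 dvd m' 2 - X1 & m 8 dvd m' 2 - m 31))"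
        "(prime (m 8) & M1 < 2 ^ NB & ~ m 8 dvd M1 --> m' 3 = M1 * m 8)" "q = p"
        unfolding m3 c3 by simp_all
       show ?case using P e1 d jD ok by blast
      qed (use M R X1b m3 c3 in auto)
     next
      case 2
      hence "~ D <= j" using m3 by (auto simp: D1_def split: if_splits)
      thus ?case by (intro hoare_ops) (use m3 in simp_all)
     qed
     thus ?case by (simp add: rq_def)
    qed
   qed
  qed
 next
  case 2
  hence "m 30 ~= 1" by simp
  thus ?case by (intro hoare_ops) (use j in \<open>simp_all add: D1_def X1_def M1_def\<close>)
 qed
 thus ?thesis by (rule hoare_mono) (use sq in \<open>auto simp: rq_def algebra_simps\<close>)
qed

end

section \<open>Progress of the remaindering, measured by a potential\<close>

context alg2
begin

abbreviation "ES \<equiv> {8, 29, 44, 45} \<union> TS \<union> CS"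

text \<open>The part of the accumulated modulus that counts: residues gathered at too small a
  dimension are worthless and enter as 1.\<close>

definition Me :: "memory => int" where "Me m = (if m 29 = int (card S) then m 3 else 1)"

definition est :: "memory => bool" where
 "est m \<longleftrightarrow> 0 <= m 2 & m 2 < m 3 & m 3 <= 2 ^ (NB + B) & (\<exists>D\<le>n. m 29 = int D)"

definition esem :: "int => memory => bool" where
 "esem x m \<longleftrightarrow> m 29 <= int (card S) & (m 29 = int (card S) --> m 3 dvd m 2 - \<lfloor>Qz x\<rfloor>)"

definition econ :: "memory => bool" where
 "econ m \<longleftrightarrow> m 9 = int n & m 10 = int z & m 13 = sc & \<bar>m 27\<bar> <= 2 ^ ZB & in_arr m 0 (2 ^ K) &
  m 4 = 2 ^ NB & m 14 = int B & m 15 = int T"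

text \<open>For a generic start vector, a good modulus that does not divide \<open>Me\<close> is
  multiplied into it as long as \<open>Me\<close> is below the target; any other modulus does not
  decrease \<open>Me\<close> and leaves the residue correct.\<close>

lemma Trial_Crt_spec:
 fixes m :: memory
 defines "u \<equiv> (%i. real_of_int (ar m 0 i))"
 assumes M: "0 < m 8" "m 8 <= 2 ^ B" and c: "econ m" and e: "est m"
 shows "hoare (Trial ;; Crt) m ((n + 1) * ((n + z + B + 2) * (400 * qS)) + ((B + 4) * (30 * qS) + 60 * qB)) p
  (%m' q. q = p & eqx ({29} \<union> TS \<union> CS) {2, 3, 4, 5} m m' & est m' &
  (generic u & esem (m 27) m --> esem (m 27) m' & (m 29 = int (card S) --> m' 29 = int (card S)) &
   Me m <= Me m' & (m 29 = int (card S) & 2 ^ NB <= m 3 --> m' 3 = m 3) &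
   (gm (m 8) u & Me m < 2 ^ NB & ~ m 8 dvd Me m --> m' 29 = int (card S) & m' 3 = Me m * m 8)))"
proof -
 define d where "d = int (card S)"
 define Qx where "Qx = \<lfloor>Qz (m 27)\<rfloor>"
 define M where "M = m 8"
 have M0: "0 < M" "M <= 2 ^ B" using M by (auto simp: M_def)
 from e obtain D where D: "D <= n" "m 29 = int D" by (auto simp: est_def)
 have e1: "0 <= m 2" "m 2 < m 3" "m 3 <= 2 ^ (NB + B)" using e by (auto simp: est_def)
 note cc = c[unfolded econ_def]
 show ?thesis
 proof (rule hoare_seq[where Q = "%m' q. q = p & eqx TS {2, 3, 4, 5} m m' &
  0 <= m' 31 & m' 31 <= M & (\<exists>j\<le>n. m' 28 = int j) & (m' 30 = 0 \<or> m' 30 = 1) &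
  (generic u --> (m' 30 = 1 --> m' 28 <= d & (m' 28 = d --> M dvd m' 31 - Qx)) &
    (gm M u --> m' 30 = 1 & m' 28 = d))"], goal_cases)
  case 1
  show ?case
   by (rule hoare_mono[OF Trial_spec[where m = m and p = p]])
    (use M cc in \<open>simp_all add: u_def M_def d_def Qx_def\<close>)
 next
  case (2 m1 q1)
  then obtain j where j: "j <= n" "m1 28 = int j" by blast
  have m1: "q1 = p" "eqx TS {2, 3, 4, 5} m m1" "0 <= m1 31" "m1 31 <= M" "m1 30 = 0 \<or> m1 30 = 1"
   "generic u ==> m1 30 = 1 ==> int j <= d" "generic u ==> m1 30 = 1 ==> int j = d ==> M dvd m1 31 - Qx"
   "generic u ==> gm M u ==> m1 30 = 1 & int j = d" using 2(2) j by auto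
  note R1 = eqx_reg[OF m1(2)]
  have c1: "m1 8 = M" "m1 2 = m 2" "m1 3 = m 3" "m1 4 = 2 ^ NB" "m1 29 = int D" using cc D by (simp_all add: R1 M_def)
  define D1 where "D1 = (if m1 30 = 1 & D < j then j else D)"
  define M1 where "M1 = (if m1 30 = 1 & D < j then 1 else m 3)"
  define X1 where "X1 = (if m1 30 = 1 & D < j then 0 else m 2)"
  show ?case
  proof (rule hoare_mono[OF Crt_spec[where m = m1 and p = q1 and j = j and D = D]], goal_cases)
   case (16 m' q)
   hence m': "q = p" "eqx (insert 29 CS) {} m1 m'" "m' 29 = int D1"
   "((m' 2 = X1 & m' 3 = M1) \<or> (m1 30 = 1 & j = D1 & M1 < 2 ^ NB & m' 3 = M1 * M & cop M1 M &
    0 <= m' 2 & m' 2 < m' 3 & M1 dvd m' 2 - X1 & M dvd m' 2 - m1 31))"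
   "prime M ==> m1 30 = 1 ==> D <= j ==> M1 < 2 ^ NB ==> ~ M dvd M1 ==> m' 3 = M1 * M"
    unfolding c1 D1_def M1_def X1_def using m1(1) by auto
   have ex: "eqx ({29} \<union> TS \<union> CS) {2, 3, 4, 5} m m'"
    by (rule eqx_tr[OF eqx_mono[OF m1(2)] m'(2)]) auto
   have b1: "0 <= X1" "X1 < M1" "M1 <= 2 ^ (NB + B)" "0 < M1" using e1 by (auto simp: X1_def M1_def)
   have D1n: "D1 <= n" using D j by (simp add: D1_def)
   have st: "est m'"
   proof -
    have "M1 * M <= 2 ^ (NB + B)" if "M1 < 2 ^ NB" by (rule mul_pow2) (use that b1 M0 in auto)
    thus ?thesis using m'(3,4) b1 D1n unfolding est_def by auto
   qed
   have sm: "esem (m 27) m' & (m 29 = d --> m' 29 = d) &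
    Me m <= Me m' & (m 29 = d & 2 ^ NB <= m 3 --> m' 3 = m 3) &
    (gm M u & Me m < 2 ^ NB & ~ M dvd Me m --> m' 29 = d & m' 3 = Me m * M)"
    if g: "generic u" and es: "esem (m 27) m"
   proof -
    have Dd: "int D <= d" "int D = d --> m 3 dvd m 2 - Qx" using es D by (auto simp: esem_def d_def Qx_def)
    have jd: "m1 30 = 1 ==> int j <= d" using m1(6)[OF g] .
    have D1d: "int D1 <= d" using Dd jd by (auto simp: D1_def)
    have keep: "int D = d ==> D1 = D & M1 = m 3 & X1 = m 2" using jd by (auto simp: D1_def M1_def X1_def)
    have M1d: "int D1 = d ==> M1 dvd X1 - Qx" using Dd by (auto simp: D1_def M1_def X1_def)
    have MeM1: "int D1 = d ==> Me m = M1" using Dd keep D by (auto simp: D1_def M1_def Me_def d_def[symmetric])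
    have Mle: "M1 <= m' 3" using m'(4) b1 M0 by (auto simp: mult_le_cancel_left1)
    have dv: "m' 3 dvd m' 2 - Qx" if dd: "int D1 = d"
     using m'(4)
    proof
     assume "m' 2 = X1 & m' 3 = M1" thus ?thesis using M1d[OF dd] by simp
    next
     assume a: "m1 30 = 1 & j = D1 & M1 < 2 ^ NB & m' 3 = M1 * M & cop M1 M &
      0 <= m' 2 & m' 2 < m' 3 & M1 dvd m' 2 - X1 & M dvd m' 2 - m1 31"
     have "M dvd m1 31 - Qx" using m1(7)[OF g] a dd by simp
     hence "M dvd (m' 2 - m1 31) + (m1 31 - Qx)" using a by (intro dvd_add) auto
     moreover have "M1 dvd (m' 2 - X1) + (X1 - Qx)" using a M1d[OF dd] by (intro dvd_add) auto
     ultimately have "M dvd m' 2 - Qx" "M1 dvd m' 2 - Qx" by simp_all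
     hence "M1 * M dvd m' 2 - Qx" using a by (intro divides_mult) auto
     thus ?thesis using a by simp
    qed
    have 1: "esem (m 27) m'" using D1d dv m'(3) by (simp add: esem_def d_def[symmetric] Qx_def[symmetric])
    have 2: "m 29 = d --> m' 29 = d" using keep m'(3) D by simp
    have 3: "Me m <= Me m'"
    proof (cases "int D1 = d")
     case True
     hence "Me m' = m' 3" using m'(3) by (simp add: Me_def d_def)
     thus ?thesis using Mle MeM1[OF True] by simp
    next
     case False
     hence "int D ~= d" using keep by auto
     hence "Me m = 1" using D by (simp add: Me_def d_def)
     moreover have "Me m' = 1" using False m'(3) by (simp add: Me_def d_def)
     ultimately show ?thesis by simp
    qed
    have 4: "m 29 = d & 2 ^ NB <= m 3 --> m' 3 = m 3" using keep D m'(4) by auto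
    have 5: "gm M u & Me m < 2 ^ NB & ~ M dvd Me m --> m' 29 = d & m' 3 = Me m * M"
    proof
     assume a: "gm M u & Me m < 2 ^ NB & ~ M dvd Me m"
     hence b: "m1 30 = 1" "int j = d" using m1(8)[OF g] by auto
     hence dd: "int D1 = d" using Dd by (auto simp: D1_def)
     have "prime M" using a by (simp add: gm_def)
     moreover have "D <= j" using b Dd by linarith
     ultimately show "m' 29 = d & m' 3 = Me m * M" using m'(3,5) a b dd MeM1[OF dd] by simp
    qed
    show ?thesis using 1 2 3 4 5 by blast
   qed
   show ?case using m'(1) ex st sm unfolding M_def[symmetric] d_def[symmetric] by blast
  qed (use M0 m1 c1 e1 j D in simp_all)
 qed
qed

definition Eval :: com where
 "Eval = Ops [OC 2 0, OC 3 1, OC 29 0] ;;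
  For 44 45 15 (RandBits 8 14 50 48 49 ;; Ops [OC 50 1, OAdd 8 8 50] ;; (Trial ;; Crt))"

definition tE :: nat where
 "tE = (T + 1) * ((n + 1) * ((n + z + B + 2) * (500 * qS)) + 60 * qB)"

text \<open>A modulus is good with probability at least \<open>1 / (4 B)\<close> and then at least
  doubles \<open>Me\<close>, so a trial multiplies the expected potential by at most
  \<open>1 - 1 / (4 B) * (1 / 2)\<close>.\<close>

definition rho :: real where "rho = 1 - 1 / (8 * real B)"
definition eta :: real where "eta = 2 ^ NB * rho ^ T"

lemma rho: "0 < rho" "rho <= 1" using B1 by (auto simp: rho_def field_simps)

lemma eta0: "0 < eta" using rho by (simp add: eta_def)

text \<open>Quantified over all \<open>Y\<close> because the modulus collected so far, which the
  next prime must not divide, depends on earlier coins.\<close>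

definition uok :: "(nat => real) => bool" where
 "uok u \<longleftrightarrow> generic u & (\<forall>Y. 1 <= Y & Y < 2 ^ NB -->
  2 ^ B <= 4 * B * card {v. v < (2::nat) ^ B & gm (int v + 1) u & ~ (int v + 1) dvd Y})"

text \<open>A potential for Markov's inequality: it starts at \<open>eta\<close> and is at least 1
  in every unfinished final state.\<close>

definition phi :: "nat => memory => real" where
 "phi t m = (if m 29 = int (card S) & 2 ^ NB <= m 3 then 0 else 2 ^ NB / Me m * rho ^ (T - t))"

lemma Me_pos: "est m ==> 1 <= Me m" by (auto simp: Me_def est_def)

text \<open>A budget of at least 1 stands for a failure already conceded; then only the cost, the
  frame and the size of the result are guaranteed. Otherwise the evaluation spends
  \<open>eta\<close> and returns the exact value, unless it raises the budget to 1.\<close>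

lemma Eval_spec:
 fixes m :: memory
 defines "u \<equiv> (%i. real_of_int (ar m 0 i))"
 assumes c: "econ m" and g: "p < 1 ==> uok u & 0 <= Qz (m 27) & Qz (m 27) < 2 ^ NB & eta <= p"
 shows "hoare Eval m tE p (%m' q. eqx ES {2, 3, 4, 5} m m' & 0 <= m' 2 & m' 2 <= 2 ^ (NB + B) &
  (1 <= q \<or> p < 1 & m' 2 = \<lfloor>Qz (m 27)\<rfloor> & p - eta <= q))" (is "hoare _ _ _ _ ?Q")
proof -
 define q0 where "q0 = p - eta"
 define I where "I = (%t m' q. eqx ES {2, 3, 4, 5} m m' & est m' &
  (1 <= q \<or> (p < 1 & esem (m 27) m' & q0 + phi t m' <= q)))"
 have d1: "1 <= card S" using S_fin(1,2) by (simp add: Suc_le_eq card_gt_0_iff)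
 have Ieq: "eqx ES {2, 3, 4, 5} m m' & est m'" if "I t m' q" for t m' q using that by (simp add: I_def)
 have ec: "econ m'" "(%i. real_of_int (ar m' 0 i)) = u" "m' 27 = m 27" if e: "eqx ES {2, 3, 4, 5} m m'" for m'
 proof -
  note R = eqx_reg[OF e] eqx_ar[OF e]
  show "econ m'" using c by (simp add: econ_def in_arr_def R)
  show "(%i. real_of_int (ar m' 0 i)) = u" by (simp add: u_def R fun_eq_iff)
  show "m' 27 = m 27" by (simp add: R)
 qed
 have BS: "B < SB" "2 ^ B < (2::int) ^ SB" using sbits by (auto intro!: power_strict_increasing)
 have sq: "qS <= qB" by (rule qS_qB)
 have nb1: "(1::int) < 2 ^ NB" using NB1 by (intro one_less_power) auto
 have one: "(1::int) < 2 ^ BB" by (rule pow2_lt[of _ 0]) (use bb in auto)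
 have "hoare Eval m (3 * qS + (T * ((B * (7 * qS) + 6 * qS + (2 * qS + ((n + 1) * ((n + z + B + 2) * (400 * qS)) + ((B + 4) * (30 * qS) + 60 * qB))))
   + 4 * qS) + 5 * qS)) p ?Q"
  unfolding Eval_def
 proof (rule hoare_seq[where Q = "I 0"], goal_cases)
  case 1
  have e0: "est (m(2 := 0, 3 := 1, 29 := 0))" by (auto simp: est_def)
  have "~ p < 1 \<or> (esem (m 27) (m(2 := 0, 3 := 1, 29 := 0)) & q0 + phi 0 (m(2 := 0, 3 := 1, 29 := 0)) <= p)"
   using d1 by (auto simp: esem_def phi_def Me_def q0_def eta_def)
  hence "I 0 (m(2 := 0, 3 := 1, 29 := 0)) p" using e0 by (auto simp: I_def)
  thus ?case by (intro hoare_ops) (use one in \<open>simp_all add: wok_def\<close>)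
 next
  case (2 m1 q1)
  show ?case
  proof (rule hoare_for[where I = I], goal_cases)
   case (10 k m' q v w x y)
   define m'' where "m'' = m'(44 := v, 45 := w, 60 := x, 59 := y)"
   have "phi k m'' = phi k m'" "est m'' = est m'" "esem (m 27) m'' = esem (m 27) m'" "eqx ES {2, 3, 4, 5} m m'' = eqx ES {2, 3, 4, 5} m m'"
    by (simp_all add: m''_def phi_def Me_def est_def esem_def)
   thus ?case using 10 unfolding m''_def[symmetric] by (simp add: I_def)
  next
   case (11 k m' q)
   hence "econ m'" using ec Ieq by blast
   thus ?case by (simp add: econ_def)
  next
   case (13 t m2 q2)
   hence t: "t < T" and I2: "I t m2 q2" and k2: "m2 44 = int t" by auto
   have ex2: "eqx ES {2, 3, 4, 5} m m2" and est2: "est m2" using Ieq[OF I2] by auto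
   note c2 = ec[OF ex2]
   define good where "good v \<longleftrightarrow> gm (int v + 1) u & ~ (int v + 1) dvd Me m2" for v :: nat
   define fin where "fin \<longleftrightarrow> m2 29 = int (card S) & 2 ^ NB <= m2 3"
   define F where "F = 2 ^ NB / Me m2 * rho ^ (T - Suc t)"
   have Mp: "1 <= Me m2" by (rule Me_pos[OF est2])
   have F0: "0 <= F" using Mp rho by (simp add: F_def)
   \<comment> \<open>A good outcome brings the potential down to \<open>F / 2\<close>, any other to
     at most \<open>F\<close>; a finished or failed computation passes its budget on
     unchanged.\<close>
   define qv where "qv v = (if 1 <= q2 \<or> fin then q2 else q0 + (if good v then F / 2 else F))" for v
   have avg: "(\<Sum>v<2 ^ B. qv v) / 2 ^ B <= q2"
   proof (cases "1 <= q2 \<or> fin")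
    case True
    thus ?thesis by (simp add: qv_def)
   next
    case False
    hence p1: "p < 1" and es: "esem (m 27) m2" and ph: "q0 + phi t m2 <= q2" using I2 by (auto simp: I_def)
    have MeL: "Me m2 < 2 ^ NB" using False nb1 by (auto simp: fin_def Me_def)
    have G: "2 ^ B <= 4 * B * card {v. v < (2::nat) ^ B & good v}"
     using g[OF p1] Mp MeL unfolding uok_def good_def by blast
    define G' where "G' = real (card {v. v < (2::nat) ^ B & good v})"
    have "real (2 ^ B) <= real (4 * B * card {v. v < (2::nat) ^ B & good v})" using G by (simp only: of_nat_le_iff)
    hence G1: "2 ^ B <= 4 * real B * G'" by (simp add: G'_def)
    have "(\<Sum>v<2 ^ B. qv v) = (\<Sum>v<2 ^ B. (q0 + F) - F / 2 * (if good v then 1 else 0))"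
     using False by (intro sum.cong) (auto simp: qv_def)
    also have "... = 2 ^ B * (q0 + F) - F / 2 * (\<Sum>v<2 ^ B. if good v then 1 else 0)"
     by (simp add: sum_subtractf sum_distrib_left del: mult_if_delta)
    also have "(\<Sum>v<2 ^ B. if good v then 1 else 0) = G'"
    proof -
     have "{v. v < 2 ^ B & good v} = {..<2 ^ B} \<inter> {v. good v}" by auto
     thus ?thesis by (simp add: G'_def sum.If_cases)
    qed
    finally have s: "(\<Sum>v<2 ^ B. qv v) / 2 ^ B = q0 + F - F / 2 * (G' / 2 ^ B)"
     by (simp add: field_simps)
    have B0: "0 < real B" using B1 by simp
    have "1 / (4 * real B) <= G' / 2 ^ B" using G1 B0 by (simp add: field_simps)
    hence "F / 2 * (1 / (4 * real B)) <= F / 2 * (G' / 2 ^ B)" using F0 by (intro mult_left_mono) auto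
    hence "(\<Sum>v<2 ^ B. qv v) / 2 ^ B <= q0 + F * rho" unfolding s rho_def using B0 by (simp add: field_simps)
    also have "F * rho = phi t m2"
    proof -
     have "rho ^ (T - t) = rho ^ (T - Suc t) * rho" using t by (simp add: Suc_diff_Suc[symmetric])
     thus ?thesis using False by (auto simp: F_def phi_def fin_def)
    qed
    finally show ?thesis using ph by simp
   qed
   show ?case
   proof (rule hoare_seq[where Q = "%m' q. \<exists>v<2 ^ B. q = qv v & eqx {8, 48, 49, 50, 59, 60} {} m2 m' & m' 8 = int v"], goal_cases)
    case 1
    show ?case
     by (rule hoare_rand_bits[where q = qv]) (use BS c2 avg in \<open>auto simp: econ_def insert_commute\<close>)
   next
    case (2 m3 q3)
    then obtain v where v: "v < 2 ^ B" "q3 = qv v" "eqx {8, 48, 49, 50, 59, 60} {} m2 m3" "m3 8 = int v" by blast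
    note R3 = eqx_reg[OF v(3)] eqx_ar[OF v(3)]
    have vB: "int v + 1 <= 2 ^ B"
    proof -
     have "int (Suc v) <= int (2 ^ B)" using v(1) by (simp only: of_nat_le_iff)
     thus ?thesis by simp
    qed
    show ?case
    proof (rule hoare_seq[where Q = "%m' q. q = qv v & eqx {8, 48, 49, 50, 59, 60} {} m2 m' & m' 8 = int v + 1"], goal_cases)
     case 1
     have "int v + 1 < 2 ^ SB" using vB BS(2) by linarith
     thus ?case by (intro hoare_ops) (use v in \<open>simp_all add: wok_def rq2_def\<close>)
    next
     case (2 m4 q4)
     hence m4: "q4 = qv v" "eqx {8, 48, 49, 50, 59, 60} {} m2 m4" "m4 8 = int v + 1" by auto
     note R4 = eqx_reg[OF m4(2)] eqx_ar[OF m4(2)]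
     have ex4: "eqx ES {2, 3, 4, 5} m m4" by (rule eqx_tr[OF ex2 m4(2)]) auto
     note c4 = ec[OF ex4]
     have r4: "m4 29 = m2 29" "m4 3 = m2 3" "m4 2 = m2 2" "m4 44 = int t" using k2 by (simp_all add: R4)
     have est4: "est m4" using est2 r4 by (simp add: est_def)
     have Me4: "Me m4 = Me m2" using r4 by (simp add: Me_def)
     show ?case
     proof (rule hoare_mono[OF Trial_Crt_spec[where m = m4 and p = q4]], goal_cases)
      case (7 m' q)
      hence m': "q = qv v" "eqx ({29} \<union> TS \<union> CS) {2, 3, 4, 5} m4 m'" "est m'"
       and S': "generic u ==> esem (m 27) m4 ==> esem (m 27) m' & (m4 29 = int (card S) --> m' 29 = int (card S)) &
       Me m4 <= Me m' & (m4 29 = int (card S) & 2 ^ NB <= m4 3 --> m' 3 = m4 3) &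
       (gm (int v + 1) u & Me m4 < 2 ^ NB & ~ (int v + 1) dvd Me m4 --> m' 29 = int (card S) & m' 3 = Me m4 * (int v + 1))"
       using m4 c4 by auto
      have ex': "eqx ES {2, 3, 4, 5} m m'" by (rule eqx_tr[OF ex4 m'(2)]) auto
      have k': "m' 44 = int t" using eqx_reg[OF m'(2), of 44] r4 by simp
      have Mp': "1 <= Me m'" by (rule Me_pos[OF m'(3)])
      have "1 <= q \<or> (p < 1 & esem (m 27) m' & q0 + phi (Suc t) m' <= q)"
      proof (cases "1 <= q2")
       case True
       thus ?thesis using m' by (simp add: qv_def)
      next
       case False
       hence p1: "p < 1" and es: "esem (m 27) m2" and ph: "q0 + phi t m2 <= q2" using I2 by (auto simp: I_def)
       have "generic u" using g[OF p1] by (simp add: uok_def)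
       moreover have "esem (m 27) m4" using es r4 by (simp add: esem_def)
       ultimately have S: "esem (m 27) m'" "m2 29 = int (card S) --> m' 29 = int (card S)"
        "Me m2 <= Me m'" "fin --> m' 3 = m2 3"
        "good v & Me m2 < 2 ^ NB --> m' 29 = int (card S) & m' 3 = Me m2 * (int v + 1)"
        using S' unfolding r4 Me4 by (auto simp: fin_def good_def)
       have "q0 + phi (Suc t) m' <= q"
       proof (cases fin)
        case True
        hence "phi (Suc t) m' = 0" "phi t m2 = 0" using S by (auto simp: phi_def fin_def)
        thus ?thesis using ph m' True by (simp add: qv_def)
       next
        case nf: False
        have MeL: "Me m2 < 2 ^ NB" using nf nb1 by (auto simp: fin_def Me_def)
        have rT: "0 <= rho ^ (T - Suc t)" using rho by simp
        have le: "phi (Suc t) m' <= 2 ^ NB / Me m' * rho ^ (T - Suc t)" using Mp' rT by (auto simp: phi_def)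
        have le1: "2 ^ NB / Me m' * rho ^ (T - Suc t) <= F"
         unfolding F_def using S(3) Mp Mp' rT by (intro mult_right_mono divide_left_mono) auto
        have q: "q = q0 + (if good v then F / 2 else F)" using m' False nf by (simp add: qv_def)
        show ?thesis
        proof (cases "good v")
         case True
         hence "prime (int v + 1)" by (simp add: good_def gm_def)
         hence v2: "2 <= int v + 1" by (rule prime_ge_2_int)
         have "Me m' = Me m2 * (int v + 1)" using S(5) True MeL by (simp add: Me_def)
         moreover have "Me m2 * 2 <= Me m2 * (int v + 1)" using v2 Mp by (intro mult_left_mono) auto
         ultimately have "2 * real_of_int (Me m2) <= real_of_int (Me m')" by linarith
         hence "2 ^ NB / real_of_int (Me m') <= 2 ^ NB / (2 * real_of_int (Me m2))" using Mp Mp' by (intro divide_left_mono) auto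
         hence "2 ^ NB / real_of_int (Me m') * rho ^ (T - Suc t) <= 2 ^ NB / (2 * real_of_int (Me m2)) * rho ^ (T - Suc t)"
          using rT by (rule mult_right_mono)
         hence "phi (Suc t) m' <= F / 2" using le unfolding F_def by (simp add: field_simps)
         thus ?thesis using q True by simp
        next
         case False
         thus ?thesis using q le le1 by simp
        qed
       qed
       thus ?thesis using p1 S by blast
      qed
      thus ?case using k' ex' m' by (simp add: I_def)
     qed (use m4 c4 est4 vB in auto)
    qed
   qed
  next
   case (14 m' q)
   hence ex: "eqx ES {2, 3, 4, 5} m m'" and es: "est m'"
    and q: "1 <= q \<or> (p < 1 & esem (m 27) m' & q0 + phi T m' <= q)" by (auto simp: I_def)
   have "1 <= q \<or> p < 1 & m' 2 = \<lfloor>Qz (m 27)\<rfloor> & p - eta <= q"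
   proof (rule disjCI)
    assume "~ (p < 1 & m' 2 = \<lfloor>Qz (m 27)\<rfloor> & p - eta <= q)"
    show "1 <= q"
    proof (rule ccontr)
     assume nq: "~ 1 <= q"
     hence p1: "p < 1" "esem (m 27) m'" "q0 + phi T m' <= q" using q by auto
     note g1 = g[OF p1(1)]
     \<comment> \<open>An unfinished state would have potential at least 1, and as
       \<open>p - eta\<close> is nonnegative the budget would reach 1.\<close>
     have fin: "m' 29 = int (card S) & 2 ^ NB <= m' 3"
     proof (rule ccontr)
      assume nf: "~ ?thesis"
      hence "Me m' <= 2 ^ NB" using nb1 by (auto simp: Me_def)
      hence "real_of_int (Me m') <= 2 ^ NB" by (simp flip: of_int_le_iff)
      moreover have "0 < real_of_int (Me m')" using Me_pos[OF es] by simp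
      ultimately have "1 <= 2 ^ NB / real_of_int (Me m')" by (simp add: field_simps)
      hence "1 <= phi T m'" using nf by (auto simp: phi_def)
      thus False using p1(3) g1 nq by (simp add: q0_def)
     qed
     hence ph: "phi T m' = 0" by (simp add: phi_def)
     have dv: "m' 3 dvd m' 2 - \<lfloor>Qz (m 27)\<rfloor>" using p1(2) fin by (simp add: esem_def)
     have "0 <= \<lfloor>Qz (m 27)\<rfloor>" "\<lfloor>Qz (m 27)\<rfloor> < 2 ^ NB" using g1 by (auto simp: floor_less_iff)
     \<comment> \<open>Both numbers lie between 0 and the modulus, so their congruence is
       equality.\<close>
     hence "\<bar>m' 2 - \<lfloor>Qz (m 27)\<rfloor>\<bar> < m' 3" using es fin unfolding est_def by linarith
     hence "m' 2 = \<lfloor>Qz (m 27)\<rfloor>" using dvd_imp_le_int[OF _ dv] by (cases "m' 2 = \<lfloor>Qz (m 27)\<rfloor>") auto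
     thus False using \<open>~ (p < 1 & m' 2 = \<lfloor>Qz (m 27)\<rfloor> & p - eta <= q)\<close> p1(1,3) ph by (simp add: q0_def)
    qed
   qed
   thus ?case using ex es by (auto simp: est_def)
  qed (use 2 in simp_all)
 qed
 thus ?thesis
 proof (rule hoare_mono, goal_cases)
  case 1
  have "B * (7 * qS) + 6 * qS + (2 * qS + (B + 4) * (30 * qS)) + 4 * qS <= 1 * ((n + z + B + 2) * (100 * qS))"
   by (simp add: algebra_simps)
  also have "... <= (n + 1) * ((n + z + B + 2) * (100 * qS))" by (rule mult_right_mono) auto
  finally have a: "(B * (7 * qS) + 6 * qS + (2 * qS + ((n + 1) * ((n + z + B + 2) * (400 * qS)) + ((B + 4) * (30 * qS) + 60 * qB)))) + 4 * qS
   <= (n + 1) * ((n + z + B + 2) * (500 * qS)) + 60 * qB" (is "?a <= ?b") by (simp add: algebra_simps)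
  have "3 * qS + (T * ?a + 5 * qS) <= T * ?b + 8 * qS" using mult_left_mono[OF a, of T] by simp
  also have "... <= T * ?b + ?b" using sq by simp
  finally show ?case by (simp add: tE_def)
 qed simp_all
qed

end

section \<open>Binary logarithms\<close>

lemma log2_diff_le:
 fixes x y :: real
 assumes "1 <= y" "y <= x"
 shows "0 <= log 2 x - log 2 y" "log 2 x - log 2 y <= 2 * (x - y)"
proof -
 show "0 <= log 2 x - log 2 y" using assms by simp
 have "ln (x / y) <= x / y - 1" using assms by (intro ln_le_minus_one) auto
 also have "... = (x - y) / y" using assms by (simp add: field_simps)
 also have "... <= (x - y) / 1" using assms by (intro divide_left_mono) auto
 finally have l: "ln x - ln y <= x - y" using assms by (simp add: ln_div)
 have l2: "1 / 2 <= ln (2::real)" using ln2_ge_two_thirds by simp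
 have "log 2 x - log 2 y = (ln x - ln y) / ln 2" by (simp add: log_def diff_divide_distrib)
 also have "... <= (x - y) / ln 2" using l by (intro divide_right_mono) auto
 also have "... <= (x - y) / (1 / 2)" using l2 assms by (intro divide_left_mono) auto
 finally show "log 2 x - log 2 y <= 2 * (x - y)" by simp
qed

lemma div_less_int: "(a::int) < c * k ==> 0 < c ==> a div c < k"
proof -
 assume a: "a < c * k" "0 < c"
 have "c * (a div c) + a mod c = a" "0 <= a mod c" using a by simp_all
 hence "c * (a div c) < c * k" using a by linarith
 thus ?thesis using a(2) by simp
qed

lemma le_div_int: "c * k <= (a::int) ==> 0 < c ==> k <= a div c"
 using zdiv_mono1[of "c * k" a c] by simp

text \<open>Truncating a quotient changes it by less than 1, hence its \<open>F\<close>-th part by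
  less than \<open>1 / F\<close>; above 1 the slope of \<open>log 2\<close> is at most 2.\<close>

lemma log2_div_le:
 fixes a c F :: int
 assumes F: "0 < F" and c: "0 < c" and q: "F <= a div c"
 shows "0 <= log 2 (real_of_int a / (c * F)) - log 2 (real_of_int (a div c) / F)"
  "log 2 (real_of_int a / (c * F)) - log 2 (real_of_int (a div c) / F) <= 2 / F"
proof -
 have 1: "1 <= real_of_int (a div c) / F" using q F by simp
 have "real_of_int (a div c) <= real_of_int a / real_of_int c"
  using of_int_floor_le[of "real_of_int a / real_of_int c"] by (simp add: floor_divide_of_int_eq)
 hence 2: "real_of_int (a div c) / F <= real_of_int a / (c * F)" using F c by (simp add: field_simps)
 have "real_of_int a / real_of_int c < real_of_int (a div c) + 1"
  using floor_correct[of "real_of_int a / real_of_int c"] by (simp add: floor_divide_of_int_eq)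
 hence "(real_of_int a / real_of_int c - real_of_int (a div c)) / F <= 1 / F" using F by (intro divide_right_mono) auto
 hence 3: "real_of_int a / (c * F) - real_of_int (a div c) / F <= 1 / F" by (simp add: diff_divide_distrib)
 show "0 <= log 2 (real_of_int a / (c * F)) - log 2 (real_of_int (a div c) / F)" using log2_diff_le(1)[OF 1 2] .
 show "log 2 (real_of_int a / (c * F)) - log 2 (real_of_int (a div c) / F) <= 2 / F"
  using log2_diff_le(2)[OF 1 2] 3 by simp
qed

text \<open>One binary digit of a logarithm: the mantissa \<open>Y / F\<close> between 1 and 2 is
  squared and halved on overflow. Both truncations round down, so their errors have the same sign,
  and each is at most \<open>2 / F\<close>.\<close>

lemma log2_square_step:
 fixes Y F :: int
 assumes F: "0 < F" and Y: "F <= Y" "Y < 2 * F"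
 defines "Y1 \<equiv> Y * Y div F"
 defines "h \<equiv> (if 2 * F <= Y1 then 1 else 0 :: int)"
 defines "Y2 \<equiv> (if 2 * F <= Y1 then Y1 div 2 else Y1)"
 shows "F <= Y2" "Y2 < 2 * F" "0 <= 2 * log 2 (Y / F) - h - log 2 (Y2 / F)" "2 * log 2 (Y / F) - h - log 2 (Y2 / F) <= 4 / F"
proof -
 have "F * F <= Y * Y" using F Y by (intro mult_mono) auto
 hence Y1F: "F <= Y1" unfolding Y1_def using F by (intro le_div_int)
 have "Y * Y < (2 * F) * (2 * F)" using F Y by (intro mult_strict_mono) auto
 hence "Y * Y < F * (4 * F)" by (simp add: algebra_simps)
 hence Y14: "Y1 < 4 * F" unfolding Y1_def using F by (intro div_less_int)
 show Y2F: "F <= Y2" "Y2 < 2 * F" using Y1F Y14 F unfolding Y2_def by auto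
 have a: "log 2 (real_of_int (Y * Y) / (F * F)) = 2 * log 2 (Y / F)"
 proof -
  have "real_of_int (Y * Y) / (F * F) = (Y / F) ^ 2" by (simp add: power2_eq_square)
  moreover have "0 < real_of_int Y / F" using F Y by simp
  ultimately show ?thesis by (simp add: log_nat_power)
 qed
 note s1 = log2_div_le[OF F F Y1F[unfolded Y1_def], unfolded a, folded Y1_def]
 have s2: "0 <= log 2 (Y1 / F) - h - log 2 (Y2 / F) & log 2 (Y1 / F) - h - log 2 (Y2 / F) <= 2 / F"
 proof (cases "2 * F <= Y1")
  case True
  hence "F <= Y1 div 2" by auto
  note s = log2_div_le[OF F _ this]
  have "real_of_int Y1 / (2 * F) = Y1 / F / 2" by simp
  hence "log 2 (real_of_int Y1 / (2 * F)) = log 2 (Y1 / F) - 1" using F Y1F by (simp only: log_divide) (simp add: log_divide)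
  thus ?thesis using s True by (simp add: h_def Y2_def)
 next
  case False
  thus ?thesis using F by (simp add: h_def Y2_def)
 qed
 show "0 <= 2 * log 2 (Y / F) - h - log 2 (Y2 / F)" "2 * log 2 (Y / F) - h - log 2 (Y2 / F) <= 4 / F"
  using s1 s2 by linarith+
qed

section \<open>Fixed-point logarithm of a long integer\<close>

locale alg3 = alg2 +
 assumes nbB: "NB + B + 4 <= 2 ^ B" and b2: "2 <= b"
begin

text \<open>Doubling yields the integer part; each of the \<open>8 b\<close> fractional digits costs
  one squaring of a mantissa with \<open>24 b\<close> fractional bits. Once the mantissa has been
  extracted, only short registers are involved.\<close>

definition Log :: com where
 "Log = Ops [OC 5 1, OC 55 0, OC 58 1] ;;
 For 48 49 23 (Ops [OAdd 6 5 5, OSub 6 2 6, OAdd 6 6 58] ;; If 6 (Ops [OAdd 5 5 5, OAdd 55 55 58]) (Ops [])) ;;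
 Ops [OMul 6 2 21, OQuot 57 6 5, OC 56 0, OAdd 56 56 55, OC 50 2] ;;
 For 48 49 19 (Ops [OMul 57 57 57, OQuot 57 57 21, OAdd 56 56 56, OAdd 51 21 21, OSub 51 57 51, OAdd 51 51 58] ;;
  If 51 (Ops [OQuot 57 57 50, OAdd 56 56 58]) (Ops []))"

abbreviation "LS \<equiv> {5, 6, 48, 49, 50, 51, 55, 56, 57, 58, 59, 60}"

definition tL :: nat where "tL = (NB + B + 3) * (30 * qB) + (8 * b + 1) * (30 * qS)"

lemma Log_spec:
 assumes X: "0 <= m 2" "m 2 <= 2 ^ (NB + B)" and c: "m 23 = int (NB + B + 2)" "m 19 = int (8 * b)" "m 21 = 2 ^ (24 * b)"
 shows "hoare Log m tL p (%m' q. q = p & eqx LS {} m m' & 0 <= m' 56 & m' 56 <= 2 ^ (8 * b + B) &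
  (1 <= m 2 --> \<bar>real_of_int (m' 56) / 2 ^ (8 * b) - log 2 (m 2)\<bar> <= 2 / 2 ^ (8 * b)))"
proof -
 define x where "x = m 2"
 define F :: int where "F = 2 ^ (24 * b)"
 define N where "N = NB + B + 2"
 have x: "0 <= x" "x <= 2 ^ (NB + B)" "m 2 = x" using X by (auto simp: x_def)
 have F0: "0 < F" by (simp add: F_def)
 have NB2: "int N + 2 <= 2 ^ B"
 proof -
  have "int (NB + B + 4) <= int (2 ^ B)" using nbB by (simp only: of_nat_le_iff)
  thus ?thesis by (simp add: N_def)
 qed
 have BS: "(2::int) ^ B < 2 ^ SB" using sbits B1 by (intro power_strict_increasing) auto
 have FS: "4 * (F * F) < 2 ^ SB" 
 proof -
  have "4 * (F * F) = 2 ^ (2 + 24 * b + 24 * b)" unfolding F_def power_add by simp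
  also have "... < 2 ^ SB" using sbits b2 by (intro power_strict_increasing) auto
  finally show ?thesis .
 qed
 have FFS: "F <= F * F" using F0 by simp
 have xF: "x * F < 2 ^ BB" 
 proof -
  have "x * F <= 2 ^ (NB + B + 24 * b)" by (rule mul_pow2) (use x F0 in \<open>auto simp: F_def\<close>)
  thus ?thesis by (rule pow2_lt) (use bb B1 in simp)
 qed
 have xB: "2 * x + 4 < 2 ^ BB"
 proof -
  have "(2::int) ^ (NB + B + 4) = 16 * 2 ^ (NB + B)" by (simp add: power_add)
  moreover have "(1::int) <= 2 ^ (NB + B)" by simp
  ultimately have "2 * x + 4 <= 2 ^ (NB + B + 4)" using x(2) by linarith
  thus ?thesis by (rule pow2_lt) (use bb B1 b2 in simp)
 qed
 have sq: "qS <= qB" by (rule qS_qB)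
 \<comment> \<open>For \<open>x = 0\<close> the exponent stays at 0 although
   \<open>2 ^ 0 <= x\<close> fails, hence the first disjunction.\<close>
 define Q1 where "Q1 k m' q \<longleftrightarrow> q = p & eqx LS {} m m' & m' 58 = 1 & (\<exists>E\<le>k. m' 55 = int E & m' 5 = 2 ^ E &
  (E = 0 \<or> m' 5 <= x) & (E = k \<or> x < 2 * m' 5))" for k m' q
 \<comment> \<open>The solution of \<open>err (Suc i) = 2 * err i + 4 / F\<close> with
   \<open>err 0 = 2 / F\<close>: squaring doubles the error and adds that of one step.\<close>
 define err where "err i = 2 ^ i * (6 / real_of_int F) - 4 / real_of_int F" for i :: nat
 define Q2 where "Q2 i m' q \<longleftrightarrow> q = p & eqx LS {} m m' & m' 58 = 1 & m' 50 = 2 & 0 <= m' 57 & m' 57 < 2 * F &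
  0 <= m' 56 & m' 56 + 1 <= 2 ^ i * (int N + 2) &
  (1 <= x --> F <= m' 57 & 0 <= 2 ^ i * log 2 x - m' 56 - log 2 (m' 57 / F) &
   2 ^ i * log 2 x - m' 56 - log 2 (m' 57 / F) <= err i)" for i m' q
 have c': "m' 2 = x" "m' 23 = int N" "m' 19 = int (8 * b)" "m' 21 = F" if "eqx LS {} m m'" for m'
 proof -
  note R = eqx_reg[OF that]
  show "m' 2 = x" "m' 23 = int N" "m' 19 = int (8 * b)" "m' 21 = F" using c x by (simp_all add: R F_def N_def)
 qed
 have "hoare Log m (3 * qS + ((N * ((3 * qB + (qB + 2 * qS + 2 * qB)) + 4 * qS) + 5 * qS) +
   (5 * qB + ((8 * b) * ((6 * qS + (3 * qS + 2 * qS)) + 4 * qS) + 5 * qS)))) p (Q2 (8 * b))"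
  unfolding Log_def
 proof (rule hoare_seq[where Q = "Q1 0"], goal_cases)
  case 1
  have "(1::int) < 2 ^ BB" using xB x by linarith
  thus ?case by (intro hoare_ops) (use x in \<open>auto simp: wok_def Q1_def\<close>)
 next
  case (2 m1 q1)
  show ?case
  proof (rule hoare_seq[where Q = "Q1 N"], goal_cases)
   case 1
   show ?case
   proof (rule hoare_for[where I = Q1], goal_cases)
    case (10 k m' q v w xx y)
    thus ?case by (simp add: Q1_def)
   next
    case (11 k m' q)
    thus ?case using c'(2)[of m'] by (simp add: Q1_def)
   next
    case (13 k m2 q2)
    hence k: "k < N" "m2 48 = int k" and I2: "q2 = p" "eqx LS {} m m2" "m2 58 = 1" by (auto simp: Q1_def)
    from 13(3) obtain E where E: "E <= k & m2 55 = int E & m2 5 = 2 ^ E &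
     (E = 0 \<or> m2 5 <= x) & (E = k \<or> x < 2 * m2 5)" unfolding Q1_def by blast
    note c2 = c'[OF I2(2)]
    have E0: "(1::int) <= 2 ^ E" by simp
    have Eb: "2 ^ E <= x \<or> (2::int) ^ E = 1" using E by auto
    have m6: "\<bar>2 ^ E + 2 ^ E\<bar> < (2::int) ^ BB" "\<bar>x - (2 ^ E + 2 ^ E)\<bar> < 2 ^ BB" "\<bar>x - (2 ^ E + 2 ^ E) + 1\<bar> < 2 ^ BB"
     using Eb E0 x xB by linarith+
    have Es: "int E + 1 < 2 ^ SB" using E k NB2 BS by linarith
    show ?case
    proof (rule hoare_seq[where Q = "%m' q. q = p & m' = m2(6 := x - (2 ^ E + 2 ^ E) + 1)"], goal_cases)
     case 1
     show ?case by (rule hoare_ops) (use E c2 m6 I2 in \<open>simp_all add: wok_def rq2_def\<close>)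
    next
     case (2 m3 q3)
     hence m3: "q3 = p" "m3 = m2(6 := x - (2 ^ E + 2 ^ E) + 1)" by auto
     have "hoare (If 6 (Ops [OAdd 5 5 5, OAdd 55 55 58]) (Ops [])) m3 (rq 6 + 2 * qS + 2 * qB) q3 (%m' q. m' 48 = int k & Q1 (Suc k) m' q)"
     proof (rule hoare_if, goal_cases)
      case 1
      hence g: "2 * 2 ^ E <= x" using m3 by simp
      have EE: "E = k" using E g by auto
      show ?case
      proof (rule hoare_ops, goal_cases)
       case 1
       show ?case using m3 E m6 I2 Es by (simp add: wok_def)
      next
       case 2
       show ?case using sq by (simp add: rq2_def)
      next
       case 3
       show ?case using m3 E I2 g EE k by (auto simp: Q1_def intro!: exI[of _ "Suc k"])
      qed
     next
      case c: 2
      hence "x < 2 * 2 ^ E" using m3 by simp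
      hence "Q1 (Suc k) (m3(59 := 1)) p" using m3 E I2 unfolding Q1_def by (auto intro!: exI[of _ E])
      thus ?case by (intro hoare_ops) (use m3 k in simp_all)
     qed
     thus ?case by (simp add: rq_def)
    qed
   qed (use 2 in simp_all)
  next
   case (2 m2 q2)
   hence I2: "q2 = p" "eqx LS {} m m2" "m2 58 = 1" by (auto simp: Q1_def)
   from 2(2) obtain E where E: "E <= N & m2 55 = int E & m2 5 = 2 ^ E &
     (E = 0 \<or> m2 5 <= x) & (E = N \<or> x < 2 * m2 5)" unfolding Q1_def by blast
   have EN: "E < N"
   proof (rule ccontr)
    assume "~ E < N"
    hence "(2::int) ^ (NB + B + 2) <= x" using E by (auto simp: N_def)
    moreover have "(2::int) ^ (NB + B) < 2 ^ (NB + B + 2)" by (rule power_strict_increasing) auto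
    ultimately show False using x by linarith
   qed
   have xE: "x < 2 * 2 ^ E" using E EN by auto
   define Y where "Y = x * F div 2 ^ E"
   have Y: "0 <= Y" "Y < 2 * F"
   proof -
    show "0 <= Y" using x F0 by (simp add: Y_def pos_imp_zdiv_nonneg_iff)
    have "x * F < 2 * 2 ^ E * F" using xE F0 by (intro mult_strict_right_mono) auto
    thus "Y < 2 * F" unfolding Y_def by (intro div_less_int) (simp_all add: mult_ac)
   qed
   note c2 = c'[OF I2(2)]
   show ?case
   proof (rule hoare_seq[where Q = "Q2 0"], goal_cases)
    case 1
    have L: "F <= Y & 0 <= log 2 x - int E - log 2 (Y / F) & log 2 x - int E - log 2 (Y / F) <= err 0" if x1: "1 <= x"
    proof -
     have "2 ^ E <= x" using E x1 by auto
     hence "2 ^ E * F <= x * F" using F0 by (intro mult_right_mono) auto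
     hence FY: "F <= Y" unfolding Y_def by (intro le_div_int) simp_all
     have "log 2 (real_of_int (x * F) / (2 ^ E * F)) = log 2 x - int E"
      using F0 x1 by (simp add: log_divide log_nat_power)
     thus ?thesis using log2_div_le[OF F0 _ FY[unfolded Y_def], folded Y_def] FY by (simp add: err_def)
    qed
    have st: "int E + 1 <= int N + 2" using EN by simp
    show ?case
    proof (rule hoare_ops, goal_cases)
     case 1
     have "2 * F < 2 ^ SB" using FS FFS F0 by linarith
     moreover have "int E < 2 ^ SB" using EN NB2 BS by linarith
     ultimately show ?case using c2 E xF x F0 Y by (simp add: wok_def Y_def[symmetric])
    next
     case 2
     show ?case using sq by (simp add: rq2_def)
    next
     case 3
     show ?case using c2 E Y I2 L st by (simp add: Q2_def Y_def[symmetric])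
    qed
   next
    case (2 m3 q3)
    show ?case
    proof (rule hoare_for[where I = Q2], goal_cases)
     case (10 k m' q v w xx y)
     thus ?case by (simp add: Q2_def)
    next
     case (11 k m' q)
     thus ?case using c'(3)[of m'] by (simp add: Q2_def)
    next
     case (13 k m4 q4)
     hence k: "k < 8 * b" "m4 48 = int k" and I4: "q4 = p" "eqx LS {} m m4" "m4 58 = 1" "m4 50 = 2" "0 <= m4 57" "m4 57 < 2 * F"
      "0 <= m4 56" "m4 56 + 1 <= 2 ^ k * (int N + 2)"
      and S4: "1 <= x ==> F <= m4 57 & 0 <= 2 ^ k * log 2 x - m4 56 - log 2 (m4 57 / F) &
         2 ^ k * log 2 x - m4 56 - log 2 (m4 57 / F) <= err k" by (auto simp: Q2_def)
     note c4 = c'[OF I4(2)]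
     define Y where "Y = m4 57"
     define L where "L = m4 56"
     define Y1 where "Y1 = Y * Y div F"
     have Y: "0 <= Y" "Y < 2 * F" using I4 by (auto simp: Y_def)
     have YY: "0 <= Y * Y" "Y * Y < 4 * (F * F)"
     proof -
      have "Y * Y <= Y * (2 * F)" using Y by (intro mult_left_mono) auto
      also have "... < 2 * F * (2 * F)" using Y F0 by (intro mult_strict_right_mono) auto
      finally show "Y * Y < 4 * (F * F)" by simp
     qed simp
     have Y1: "0 <= Y1" "Y1 < 4 * F"
     proof -
      show "0 <= Y1" using YY F0 by (simp add: Y1_def pos_imp_zdiv_nonneg_iff)
      show "Y1 < 4 * F" unfolding Y1_def using YY F0 by (intro div_less_int) (simp_all add: mult_ac)
     qed
     have Lb: "L + L + 2 <= 2 ^ Suc k * (int N + 2)" "0 <= L" using I4 by (auto simp: L_def)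
     have LS: "2 ^ Suc k * (int N + 2) < 2 ^ SB"
     proof -
      have "2 ^ Suc k * (int N + 2) <= 2 ^ (Suc k + B)" by (rule mul_pow2) (use NB2 in auto)
      thus ?thesis by (rule pow2_lt) (use k sbits b2 in simp)
     qed
     have F4: "4 * F <= 4 * (F * F)" using FFS by simp
     have bs: "\<bar>Y * Y\<bar> < 2 ^ SB" "\<bar>Y1\<bar> < 2 ^ SB" "\<bar>L + L\<bar> < 2 ^ SB" "\<bar>F + F\<bar> < 2 ^ SB" "\<bar>Y1 - (F + F)\<bar> < 2 ^ SB" "\<bar>Y1 - (F + F) + 1\<bar> < 2 ^ SB"
       "\<bar>L + L + 1\<bar> < 2 ^ SB" "\<bar>Y1 div 2\<bar> < 2 ^ SB"
     proof -
      show "\<bar>Y * Y\<bar> < 2 ^ SB" using YY FS by linarith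
      show "\<bar>Y1\<bar> < 2 ^ SB" "\<bar>F + F\<bar> < 2 ^ SB" "\<bar>Y1 - (F + F)\<bar> < 2 ^ SB" "\<bar>Y1 - (F + F) + 1\<bar> < 2 ^ SB" "\<bar>Y1 div 2\<bar> < 2 ^ SB"
       using Y1 F4 FS F0 by linarith+
      show "\<bar>L + L\<bar> < 2 ^ SB" "\<bar>L + L + 1\<bar> < 2 ^ SB" using Lb LS by linarith+
     qed
     define h where "h = (if 2 * F <= Y1 then 1 else 0 :: int)"
     define Y2 where "Y2 = (if 2 * F <= Y1 then Y1 div 2 else Y1)"
     have Y2: "0 <= Y2" "Y2 < 2 * F" using Y1 by (auto simp: Y2_def)
     have Q: "Q2 (Suc k) m' p" if e: "eqx LS {} m m'" "m' 58 = 1" "m' 50 = 2" "m' 57 = Y2" "m' 56 = L + L + h" for m'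
     proof -
      have "F <= Y2 & 0 <= 2 ^ Suc k * log 2 x - (L + L + h) - log 2 (Y2 / F) &
         2 ^ Suc k * log 2 x - (L + L + h) - log 2 (Y2 / F) <= err (Suc k)" if x1: "1 <= x"
      proof -
       have FY: "F <= Y" and s: "0 <= 2 ^ k * log 2 x - L - log 2 (Y / F)" "2 ^ k * log 2 x - L - log 2 (Y / F) <= err k"
        using S4[OF x1] by (auto simp: Y_def L_def)
       note st = log2_square_step[OF F0 FY Y(2), folded Y1_def, folded h_def Y2_def]
       have er: "err (Suc k) = 2 * err k + 4 / F" by (simp add: err_def field_simps)
       have eq: "2 ^ Suc k * log 2 x - (L + L + h) - log 2 (Y2 / F) = 2 * (2 ^ k * log 2 x - L - log 2 (Y / F)) + (2 * log 2 (Y / F) - h - log 2 (Y2 / F))"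
        by (simp add: algebra_simps)
       show ?thesis unfolding eq er using st s by auto
      qed
      moreover have "L + L + h + 1 <= 2 ^ Suc k * (int N + 2)" "0 <= L + L + h" using Lb by (auto simp: h_def)
      ultimately show ?thesis using e Y2 by (simp add: Q2_def)
     qed
     show ?case
     proof (rule hoare_seq[where Q = "%m' q. q = p & m' = m4(57 := Y1, 56 := L + L, 51 := Y1 - (F + F) + 1)"], goal_cases)
      case 1
      show ?case
      proof (rule hoare_ops, goal_cases)
       case 1
       show ?case using c4 I4 bs by (simp add: wok_def Y_def[symmetric] L_def[symmetric] Y1_def[symmetric])
      next
       case 2
       show ?case by (simp add: rq2_def)
      next
       case 3
       show ?case using c4 I4 by (simp add: Y_def[symmetric] L_def[symmetric] Y1_def[symmetric] fun_eq_iff)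
      qed
     next
      case (2 m5 q5)
      hence m5: "q5 = p" "m5 = m4(57 := Y1, 56 := L + L, 51 := Y1 - (F + F) + 1)" by auto
      have "hoare (If 51 (Ops [OQuot 57 57 50, OAdd 56 56 58]) (Ops [])) m5 (rq 51 + 2 * qS + 2 * qS) q5 (%m' q. m' 48 = int k & Q2 (Suc k) m' q)"
      proof (rule hoare_if, goal_cases)
       case 1
       hence g: "2 * F <= Y1" using m5 by simp
       show ?case
       proof (rule hoare_ops, goal_cases)
        case 1
        show ?case using m5 I4 bs by (simp add: wok_def)
       next
        case 2
        show ?case by (simp add: rq2_def)
       next
        case 3
        show ?case unfolding m5(1) by (intro conjI Q) (use m5 I4 g k in \<open>simp_all add: h_def Y2_def\<close>)
       qed
      next
       case 2
       hence g: "~ 2 * F <= Y1" using m5 by simp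
       have "Q2 (Suc k) (m5(59 := 1)) p" by (rule Q) (use m5 I4 g in \<open>simp_all add: h_def Y2_def\<close>)
       thus ?case by (intro hoare_ops) (use m5 k in simp_all)
      qed
      thus ?case by (simp add: rq_def)
     qed
    qed (use 2 in simp_all)
   qed
  qed
 qed
 thus ?thesis
 proof (rule hoare_mono, goal_cases)
  case 1
  have "N * ((3 * qB + (qB + 2 * qS + 2 * qB)) + 4 * qS) <= N * (30 * qB)" using sq by (intro mult_left_mono) auto
  thus ?case using sq by (simp add: tL_def N_def algebra_simps)
 next
  case (3 m' q)
  hence q: "q = p" "eqx LS {} m m'" "0 <= m' 57" "m' 57 < 2 * F" "0 <= m' 56" "m' 56 + 1 <= 2 ^ (8 * b) * (int N + 2)"
   and s: "1 <= x ==> F <= m' 57 & 0 <= 2 ^ (8 * b) * log 2 x - m' 56 - log 2 (m' 57 / F) &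
   2 ^ (8 * b) * log 2 x - m' 56 - log 2 (m' 57 / F) <= err (8 * b)" by (auto simp: Q2_def)
  have "2 ^ (8 * b) * (int N + 2) <= 2 ^ (8 * b + B)" by (rule mul_pow2) (use NB2 in auto)
  hence u: "m' 56 <= 2 ^ (8 * b + B)" using q by linarith
  have "\<bar>real_of_int (m' 56) / 2 ^ (8 * b) - log 2 (m 2)\<bar> <= 2 / 2 ^ (8 * b)" if x1: "1 <= x"
  proof -
   note s1 = s[OF x1]
   have "1 <= real_of_int (m' 57) / F" "real_of_int (m' 57) / F < 2" using s1 q F0 by (auto simp: field_simps)
   hence l: "0 <= log 2 (m' 57 / F)" "log 2 (m' 57 / F) < 1" by auto
   have e: "err (8 * b) <= 1"
   proof -
    have "6 * (2::int) ^ (8 * b) <= 2 ^ 3 * 2 ^ (8 * b)" by simp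
    also have "... = 2 ^ (3 + 8 * b)" by (simp add: power_add)
    also have "... <= F" unfolding F_def using b2 by (intro power_increasing) auto
    finally have "real_of_int (6 * 2 ^ (8 * b)) <= real_of_int F" by (simp only: of_int_le_iff)
    hence "2 ^ (8 * b) * (6 / real_of_int F) <= 1" using F0 by (simp add: field_simps)
    moreover have "0 <= 4 / real_of_int F" using F0 by simp
    ultimately show ?thesis unfolding err_def by linarith
   qed
   \<comment> \<open>One unit stems from the digits cut off, the logarithm of the remaining
     mantissa, and one from the accumulated rounding.\<close>
   have a: "\<bar>real_of_int (m' 56) - 2 ^ (8 * b) * log 2 x\<bar> <= 2" using l e s1 by linarith
   have "\<bar>real_of_int (m' 56) / 2 ^ (8 * b) - log 2 x\<bar> = \<bar>real_of_int (m' 56) - 2 ^ (8 * b) * log 2 x\<bar> / 2 ^ (8 * b)"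
   proof -
    have "real_of_int (m' 56) / 2 ^ (8 * b) - log 2 x = (real_of_int (m' 56) - 2 ^ (8 * b) * log 2 x) / 2 ^ (8 * b)"
     by (simp add: field_simps)
    thus ?thesis by (simp add: abs_divide)
   qed
   also have "... <= 2 / 2 ^ (8 * b)" using a by (intro divide_right_mono) auto
   finally show ?thesis by (simp add: x)
  qed
  thus ?case using q u x by simp
 qed simp
qed

end

section \<open>Initialisation and output\<close>

text \<open>The mean of \<open>f\<close> over all extensions of \<open>us\<close> by
  \<open>r\<close> uniform entries, nested in the order in which a loop of draws spends its
  budget.\<close>

primrec av :: "nat => (nat list => real) => nat => nat list => real" where
 "av R f 0 us = f us"
| "av R f (Suc r) us = (\<Sum>v<R. av R f r (us @ [v])) / R"

lemma av_eq: "av R f r us = (\<Sum>vs | length vs = r & set vs \<subseteq> {..<R}. f (us @ vs)) / R ^ r"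
proof (induction r arbitrary: us)
 case 0
 have "{vs :: nat list. length vs = 0 & set vs \<subseteq> {..<R}} = {[]}" by auto
 thus ?case by simp
next
 case (Suc r)
 let ?L = "%r. {vs :: nat list. length vs = r & set vs \<subseteq> {..<R}}"
 have L: "?L (Suc r) = (%(v, vs). v # vs) ` ({..<R} \<times> ?L r)"
 proof (intro equalityI subsetI)
  fix x assume "x \<in> ?L (Suc r)"
  thus "x \<in> (%(v, vs). v # vs) ` ({..<R} \<times> ?L r)" by (cases x) (auto simp: image_iff)
 qed auto
 have "(\<Sum>vs\<in>?L (Suc r). f (us @ vs)) = (\<Sum>(v, vs)\<in>{..<R} \<times> ?L r. f (us @ v # vs))"
  unfolding L by (subst sum.reindex) (auto simp: inj_on_def intro!: sum.cong)
 also have "... = (\<Sum>v<R. \<Sum>vs\<in>?L r. f (us @ v # vs))" by (simp add: sum.cartesian_product)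
 finally show ?case by (simp add: Suc.IH sum_divide_distrib[symmetric])
qed

text \<open>The budget of a random vector: certain failure on the bad ones, which make up at most a
  fraction \<open>k / R\<close>, and \<open>e\<close> on the others.\<close>

lemma av_indicator:
 fixes P :: "nat list => bool"
 assumes R: "0 < R" and e: "0 <= e"
  and bad: "card {us. length us = n & set us \<subseteq> {..<R} & ~ P us} * R <= k * R ^ n"
 shows "av R (%us. if P us then e else 1) n [] <= e + real k / real R"
proof -
 let ?L = "{us :: nat list. length us = n & set us \<subseteq> {..<R}}"
 have fin: "finite ?L" using finite_lists_length_eq[of "{..<R}" n] by (simp add: conj_commute)
 have card: "card ?L = R ^ n" using card_lists_length_eq[of "{..<R}" n] by (simp add: conj_commute)
 have "(\<Sum>us\<in>?L. if P us then e else 1) <= (\<Sum>us\<in>?L. e + (if P us then 0 else 1))" using e by (intro sum_mono) auto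
 also have "... = e * real (R ^ n) + real (card (?L \<inter> {us. ~ P us}))"
  using fin card by (simp add: sum.distrib sum.If_cases Int_def)
 also have "?L \<inter> {us. ~ P us} = {us. length us = n & set us \<subseteq> {..<R} & ~ P us}" by auto
 finally have s: "(\<Sum>us\<in>?L. if P us then e else 1) <= e * real (R ^ n) + real (card {us. length us = n & set us \<subseteq> {..<R} & ~ P us})" .
 have "real (card {us. length us = n & set us \<subseteq> {..<R} & ~ P us} * R) <= real (k * R ^ n)" using bad by (simp only: of_nat_le_iff)
 hence b: "real (card {us. length us = n & set us \<subseteq> {..<R} & ~ P us}) / real (R ^ n) <= real k / real R"
  using R by (simp add: field_simps)
 have "av R (%us. if P us then e else 1) n [] <= (e * real (R ^ n) + real (card {us. length us = n & set us \<subseteq> {..<R} & ~ P us})) / real (R ^ n)"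
  unfolding av_eq using s by (simp add: divide_right_mono)
 also have "... = e + real (card {us. length us = n & set us \<subseteq> {..<R} & ~ P us}) / real (R ^ n)"
  using R by (simp add: add_divide_distrib)
 finally show ?thesis using b by linarith
qed

section \<open>Powers of two, random vectors, square roots and input parameters\<close>

context ram
begin

lemma rq2_le: "rq2 r s <= qB" "rq r <= qB" "qS <= qB" using qS_qB by (auto simp: rq2_def rq_def)

definition Pow :: "nat => nat => com" where "Pow r cnt = Ops [OC r 1] ;; For 48 49 cnt (Ops [OAdd r r r])"

lemma Pow_spec:
 assumes r: "r < 59" "r ~= 48" "r ~= 49" "r ~= cnt" "8 <= cnt" "cnt < 59" "cnt ~= 48" "cnt ~= 49"
  and N: "m cnt = int N" "N < (if r < 8 then BB else SB)"
 shows "hoare (Pow r cnt) m ((N + 2) * (6 * qB)) p (%m' q. q = p & eqx {r, 48, 49, 59, 60} {} m m' & m' r = 2 ^ N)"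
proof -
 define I where "I k m' q \<longleftrightarrow> q = p & eqx {r, 48, 49, 59, 60} {} m m' & m' r = 2 ^ k" for k :: nat and m' q
 let ?X = "if r < 8 then BB else SB"
 have S0: "0 < SB" "0 < BB" using SB by auto
 have pw: "\<bar>(2::int) ^ k\<bar> < 2 ^ ?X" if "k <= N" for k using N(2) that by (auto intro!: power_strict_increasing)
 have one: "\<bar>1::int\<bar> < 2 ^ ?X" "\<bar>1::int\<bar> < 2 ^ SB" using S0 by auto
 have "hoare (Pow r cnt) m (qB + (N * (qB + 4 * qS) + 5 * qS)) p (I N)"
  unfolding Pow_def
 proof (rule hoare_seq[where Q = "I 0"], goal_cases)
  case 1
  show ?case by (rule hoare_ops) (use r one rq2_le in \<open>simp_all add: wok_def I_def\<close>)
 next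
  case (2 m1 q1)
  show ?case
  proof (rule hoare_for[where I = I], goal_cases)
   case (10 k m' q v w x y)
   thus ?case using r by (simp add: I_def)
  next
   case (11 k m' q)
   hence e: "eqx {r, 48, 49, 59, 60} {} m m'" by (simp add: I_def)
   show ?case using eqx_reg[OF e, of cnt] r N by auto
  next
   case (13 k m' q)
   have "\<bar>2 ^ k + 2 ^ k\<bar> < (2::int) ^ ?X" using pw[of "Suc k"] 13 by simp
   thus ?case using 13 r rq2_le by (intro hoare_ops) (simp_all add: wok_def I_def)
  qed (use 2 r in simp_all)
 qed
 thus ?thesis by (rule hoare_mono) (use rq2_le(3) in \<open>simp_all add: I_def algebra_simps add_mono trans_le_add1\<close>)
qed

definition RandU :: com where "RandU = For 46 47 9 (RandBits 50 16 51 48 49 ;; Ops [OSt 0 46 50])"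

lemma RandU_spec:
 assumes N: "m 9 = int n" "m 16 = int K" "K < SB" and f: "av (2 ^ K) f n [] <= p"
 shows "hoare RandU m ((n + 1) * ((K + 4) * (20 * qS))) p (%m' q. eqx {46, 47, 48, 49, 50, 51, 59, 60, 61, 62} {0} m m' &
  (\<exists>us. length us = n & set us \<subseteq> {..<2 ^ K} & (\<forall>i<n. ar m' 0 i = int (us ! i)) & f us <= q))"
proof -
 let ?E = "{46, 47, 48, 49, 50, 51, 59, 60, 61, 62}"
 define I where "I k m' q \<longleftrightarrow> eqx ?E {0} m m' &
  (\<exists>us. length us = k & set us \<subseteq> {..<2 ^ K} & (\<forall>i<k. ar m' 0 i = int (us ! i)) & av (2 ^ K) f (n - k) us <= q)" for k m' q
 have nS: "int n < 2 ^ SB" using SB(3) by linarith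
 have "hoare RandU m (n * ((K * (7 * qS) + 6 * qS + 5 * qS) + 4 * qS) + 5 * qS) p (I n)"
  unfolding RandU_def
 proof (rule hoare_for[where I = I], goal_cases)
  case (10 k m' q v w x y)
  thus ?case unfolding I_def by simp
 next
  case (11 k m' q)
  hence e: "eqx ?E {0} m m'" unfolding I_def by (rule conjunct1)
  show ?case using eqx_reg[OF e, of 9] N by simp
 next
  case 12
  show ?case unfolding I_def using f by simp
 next
  case (13 k m1 q1)
  hence k: "k < n" "m1 46 = int k" and e1: "eqx ?E {0} m m1" by (auto simp: I_def)
  from 13(3) obtain us where us: "length us = k" "set us \<subseteq> {..<2 ^ K}" "\<forall>i<k. ar m1 0 i = int (us ! i)" "av (2 ^ K) f (n - k) us <= q1"
   unfolding I_def by blast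
  note R1 = eqx_reg[OF e1]
  have nk: "n - k = Suc (n - Suc k)" using k by simp
  show ?case
  proof (rule hoare_seq[where Q = "%m' q. \<exists>v<2 ^ K. q = av (2 ^ K) f (n - Suc k) (us @ [v]) & eqx {48, 49, 50, 51, 59, 60} {} m1 m' & m' 50 = int v"], goal_cases)
   case 1
   show ?case
   proof (rule hoare_rand_bits[where q = "%v. av (2 ^ K) f (n - Suc k) (us @ [v])"], goal_cases)
    case (19 v m')
    thus ?case by (auto simp: insert_commute)
   next
    case 20
    show ?case using us(4) unfolding nk by simp
   qed (use N in \<open>simp_all add: R1\<close>)
  next
   case (2 m2 q2)
   then obtain v where v: "v < 2 ^ K" "q2 = av (2 ^ K) f (n - Suc k) (us @ [v])" "eqx {48, 49, 50, 51, 59, 60} {} m1 m2" "m2 50 = int v" by blast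
   note R2 = eqx_reg[OF v(3)] eqx_ar[OF v(3)]
   have r2: "m2 46 = int k" using k by (simp add: R2)
   have e2: "eqx ?E {0} m m2" by (rule eqx_tr[OF e1 v(3)]) auto
   have a2: "\<forall>i<k. ar m2 0 i = int (us ! i)" using us(3) by (simp add: R2)
   show ?case
   proof (rule hoare_ops, goal_cases)
    case 3
    have "I (Suc k) (osems [OSt 0 46 50] m2) q2" unfolding I_def
     using e2 r2 a2 us v by (auto intro!: exI[of _ "us @ [v]"] simp: nth_append less_Suc_eq)
    thus ?case using r2 by simp
   qed (use r2 k in simp_all)
  qed
 qed (use N in simp_all)
 thus ?thesis
 proof (rule hoare_mono, goal_cases)
  case 1
  show ?case by (simp add: algebra_simps)
 next
  case (3 m' q)
  thus ?case unfolding I_def by simp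
 qed simp
qed

text \<open>Binary digits of the root from the top, register 26 being the candidate digit. Register
  25 may still be -1, the initial value of the search; the root is then 0, whence
  \<open>max 0 (m 25)\<close> in the specification.\<close>

definition Isqrt :: com where
 "Isqrt = Ops [OC 55 0, OC 53 1, OSub 50 17 53] ;; Pow 26 50 ;;
 For 38 39 17 (Ops [OAdd 50 55 26, OMul 51 50 50, OSub 51 25 51, OAdd 51 51 53] ;;
   If 51 (Ops [OC 55 0, OAdd 55 55 50]) (Ops []) ;; Ops [OC 50 2, OQuot 26 26 50])"

lemma Isqrt_spec:
 assumes J: "m 17 = int (J + 1)" "2 * J + 8 < SB" and y: "-1 <= m 25" "m 25 < 2 ^ (2 * J + 2)"
 shows "hoare Isqrt m ((J + 3) * (40 * qB)) p (%m' q. q = p & eqx {26, 38, 39, 48, 49, 50, 51, 53, 55, 59, 60} {} m m' &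
  0 <= m' 55 & m' 55 < 2 ^ (J + 1) & m' 55 * m' 55 <= max 0 (m 25) & m 25 < (m' 55 + 1) * (m' 55 + 1))"
proof -
 let ?E = "{26, 38, 39, 48, 49, 50, 51, 53, 55, 59, 60}"
 define y where "y = m 25"
 have yy: "-1 <= y" "y < 2 ^ (2 * J + 2)" using y by (auto simp: y_def)
 \<comment> \<open>The width of the uncertainty interval after \<open>l\<close> digits; the
   candidate digit is half of it.\<close>
 define t where "t l = (2::int) ^ (J + 1 - l)" for l
 define I where "I l m' q \<longleftrightarrow> q = p & eqx ?E {} m m' & m' 53 = 1 & m' 26 = t l div 2 &
  0 <= m' 55 & m' 55 + t l <= 2 ^ (J + 1) & m' 55 * m' 55 <= max 0 y & y < (m' 55 + t l) * (m' 55 + t l)" for l m' q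
 have half: "t l div 2 = 2 ^ (J - l)" "t l = 2 * 2 ^ (J - l)" if "l <= J" for l
  using that by (simp_all add: t_def Suc_diff_le)
 have tS: "t (Suc l) = 2 ^ (J - l)" for l by (simp add: t_def)
 have c: "m' 17 = int (J + 1)" "m' 25 = y" if "eqx ?E {} m m'" for m'
  using eqx_reg[OF that] J by (simp_all add: y_def)
 have JS: "int J + 1 < 2 ^ SB"
 proof -
  have "J + 1 < 2 ^ (J + 1)" by (rule less_exp)
  hence "int (J + 1) < int (2 ^ (J + 1))" by (simp only: of_nat_less_iff)
  hence "int J + 1 <= 2 ^ (J + 1)" by simp
  thus ?thesis by (rule pow2_lt) (use J in simp)
 qed
 have sqS: "(2::int) ^ (2 * J + 2) + 2 ^ (2 * J + 2) + 2 < 2 ^ SB"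
 proof -
  have "(2::int) ^ (2 * J + 4) = 4 * 2 ^ (2 * J + 2)" by (simp add: power_add)
  moreover have "(1::int) <= 2 ^ (2 * J + 2)" by (rule one_le_power) simp
  ultimately have "(2::int) ^ (2 * J + 2) + 2 ^ (2 * J + 2) + 2 <= 2 ^ (2 * J + 4)" by linarith
  thus ?thesis by (rule pow2_lt) (use J in simp)
 qed
 have JS2: "(2::int) ^ (J + 1) < 2 ^ SB" using J by (intro power_strict_increasing) auto
 have "hoare Isqrt m (3 * qB + ((J + 2) * (6 * qB) + ((J + 1) * ((4 * qB + ((3 * qB + 2 * qB) + 2 * qB)) + 4 * qS) + 5 * qS))) p
  (%m' q. I (J + 1) m' q)"
  unfolding Isqrt_def
 proof (rule hoare_seq[where Q = "%m' q. q = p & eqx ?E {} m m' & m' 55 = 0 & m' 53 = 1 & m' 50 = int J"], goal_cases)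
  case 1
  have "int J < 2 ^ SB" using JS by linarith
  thus ?case by (intro hoare_ops) (use J rq2_le in \<open>simp_all add: wok_def rq2_def\<close>)
 next
  case (2 m1 q1)
  hence m1: "q1 = p" "eqx ?E {} m m1" "m1 55 = 0" "m1 53 = 1" "m1 50 = int J" by auto
  show ?case
  proof (rule hoare_seq[where Q = "I 0"], goal_cases)
   case 1
   show ?case
   proof (rule hoare_mono[OF Pow_spec[where N = J and m = m1 and p = q1]], goal_cases)
    case (13 m' q)
    hence e: "eqx {26, 48, 49, 59, 60} {} m1 m'" by simp
    have e': "eqx ?E {} m m'" by (rule eqx_tr[OF m1(2) e]) auto
    have r: "m' 55 = 0" "m' 53 = 1" using eqx_reg[OF e] m1 by simp_all
    have "(2::int) ^ (2 * J + 2) = 2 ^ (J + 1 + (J + 1))" by (rule arg_cong[of _ _ "%k. 2 ^ k"]) simp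
    hence "y < 2 ^ (J + 1) * 2 ^ (J + 1)" using yy(2) by (simp only: power_add)
    thus ?case using 13 m1 e' r by (simp add: I_def t_def)
   qed (use m1 J in simp_all)
  next
   case (2 m2 q2)
   show ?case
   proof (rule hoare_for[where I = I], goal_cases)
    case (10 k m' q v w x yy)
    thus ?case unfolding I_def by simp
   next
    case (11 k m' q)
    thus ?case using c(1)[of m'] by (simp add: I_def)
   next
    case (13 l m3 q3)
    define R where "R = m3 55"
    define P where "P = (2::int) ^ (J - l)"
    have l: "l <= J" "m3 38 = int l" using 13 by auto
    have I3: "q3 = p" "eqx ?E {} m m3" "m3 53 = 1" "m3 26 = P" "0 <= R" "R + 2 * P <= 2 ^ (J + 1)" "R * R <= max 0 y"
     "y < (R + 2 * P) * (R + 2 * P)" "m3 55 = R" using 13(3) half[OF l(1)] by (auto simp: I_def R_def P_def)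
    have P0: "0 < P" by (simp add: P_def)
    define sq where "sq = (R + P) * (R + P)"
    have sq: "0 <= sq" "sq <= 2 ^ (2 * J + 2)"
    proof -
     show "0 <= sq" by (simp add: sq_def)
     have "sq <= 2 ^ ((J + 1) + (J + 1))" unfolding sq_def by (rule mul_pow2) (use I3 P0 in auto)
     moreover have "(2::int) ^ (2 * J + 2) = 2 ^ (J + 1 + (J + 1))" by (rule arg_cong[of _ _ "%k. 2 ^ k"]) simp
     ultimately show "sq <= 2 ^ (2 * J + 2)" by (simp only:)
    qed
    have bs: "\<bar>R + P\<bar> < 2 ^ SB" "\<bar>sq\<bar> < 2 ^ SB" "\<bar>y - sq\<bar> < 2 ^ SB" "\<bar>y - sq + 1\<bar> < 2 ^ SB" "\<bar>P div 2\<bar> < 2 ^ SB"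
     using I3 P0 sq sqS JS2 yy by linarith+
    note c3 = c[OF I3(2)]
    define R' where "R' = (if sq <= y then R + P else R)"
    show ?case
    proof (rule hoare_seq[where Q = "%m' q. q = p & m' = m3(50 := R + P, 51 := y - sq + 1)"], goal_cases)
     case 1
     show ?case by (rule hoare_ops) (use c3 I3 bs rq2_le in \<open>simp_all add: wok_def sq_def[symmetric] fun_eq_iff rq2_def\<close>)
    next
     case (2 m4 q4)
     hence m4: "q4 = p" "m4 = m3(50 := R + P, 51 := y - sq + 1)" by auto
     show ?case
     proof (rule hoare_seq[where Q = "%m' q. q = p & eqx ?E {} m m' & m' 38 = int l & m' 53 = 1 & m' 26 = P & m' 55 = R'"], goal_cases)
      case 1
      have "hoare (If 51 (Ops [OC 55 0, OAdd 55 55 50]) (Ops [])) m4 (rq 51 + 2 * qS + 2 * qS) q4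
       (%m' q. q = p & eqx ?E {} m m' & m' 38 = int l & m' 53 = 1 & m' 26 = P & m' 55 = R')"
      proof (rule hoare_if, goal_cases)
       case 1
       hence "sq <= y" using m4 by simp
       thus ?case by (intro hoare_ops) (use m4 I3 l bs in \<open>simp_all add: wok_def rq2_def R'_def\<close>)
      next
       case 2
       hence "~ sq <= y" using m4 by simp
       thus ?case by (intro hoare_ops) (use m4 I3 l in \<open>simp_all add: R'_def\<close>)
      qed
      thus ?case by (rule hoare_mono) (use rq2_le in \<open>simp_all add: rq_def\<close>)
     next
      case (2 m5 q5)
      hence m5: "q5 = p" "eqx ?E {} m m5" "m5 38 = int l" "m5 53 = 1" "m5 26 = P" "m5 55 = R'" by auto
      have "0 <= R' & R' + P <= 2 ^ (J + 1) & R' * R' <= max 0 y & y < (R' + P) * (R' + P)"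
      proof (cases "sq <= y")
       case True
       hence R': "R' = R + P" by (simp add: R'_def)
       have e: "R + P + P = R + 2 * P" by simp
       show ?thesis unfolding R' e using True I3(5,6,8) P0 unfolding sq_def by simp
      next
       case False
       hence R': "R' = R" by (simp add: R'_def)
       show ?thesis unfolding R' using False I3(5-7) P0 unfolding sq_def by simp
      qed
      hence "I (Suc l) (m5(50 := 2, 26 := P div 2)) p" unfolding I_def tS P_def[symmetric] using m5 by simp
      thus ?case by (intro hoare_ops) (use m5 bs rq2_le in \<open>simp_all add: wok_def rq2_def\<close>)
     qed
    qed
   qed (use 2 in simp_all)
  qed
 qed
 thus ?thesis
 proof (rule hoare_mono, goal_cases)
  case 1
  have "4 * qS <= 4 * qB" using rq2_le(3) by simp
  hence "(J + 1) * ((4 * qB + ((3 * qB + 2 * qB) + 2 * qB)) + 4 * qS) <= (J + 1) * (15 * qB)" by (intro mult_left_mono) simp_all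
  thus ?case using rq2_le(3) by (simp add: algebra_simps)
 next
  case (3 m' q)
  have "t (J + 1) = 1" by (simp add: t_def)
  thus ?case using 3 by (simp add: I_def y_def)
 qed simp
qed

text \<open>Horner's rule on the binary digits of \<delta>; truncation after \<open>sg\<close>
  fractional digits gives a floor.\<close>

definition Delta :: com where
 "Delta = Ops [OC 50 2, OIn 54 0 50, OC 53 2] ;; For 48 49 12 (Ops [OMul 54 54 53, OIn 50 5 48, OAdd 54 54 50])"

lemma floor_double: "2 * \<lfloor>x\<rfloor> + \<lfloor>x * 2\<rfloor> mod 2 = \<lfloor>x * 2 :: real\<rfloor>"
proof -
 have "\<lfloor>x * 2\<rfloor> div 2 = \<lfloor>x\<rfloor>" using floor_divide_real_eq_div[of 2 "x * 2"] by simp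
 thus ?thesis by (metis mult_div_mod_eq)
qed

lemma Delta_spec:
 fixes dl sg :: nat and \<delta> :: real
 assumes X: "X 0 2 = \<lfloor>\<delta>\<rfloor>" "!!k. X 5 k = frac_bit \<delta> k" and d: "0 <= \<delta>" "\<delta> < 2 ^ dl" and s: "sg + dl + 2 < SB" "m 12 = int sg"
 shows "hoare Delta m ((sg + 1) * (20 * qS)) p (%m' q. q = p & eqx {48, 49, 50, 53, 54, 59, 60} {} m m' & m' 54 = \<lfloor>\<delta> * 2 ^ sg\<rfloor>)"
proof -
 let ?E = "{48, 49, 50, 53, 54, 59, 60}"
 define I where "I k m' q \<longleftrightarrow> q = p & eqx ?E {} m m' & m' 53 = 2 & m' 54 = \<lfloor>\<delta> * 2 ^ k\<rfloor>" for k m' q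
 have fb: "0 <= \<lfloor>\<delta> * 2 ^ k\<rfloor>" "\<lfloor>\<delta> * 2 ^ k\<rfloor> < 2 ^ SB" if "k <= sg" for k
 proof -
  show "0 <= \<lfloor>\<delta> * 2 ^ k\<rfloor>" using d by simp
  have "\<delta> * 2 ^ k < 2 ^ dl * 2 ^ k" using d by (intro mult_strict_right_mono) auto
  also have "... = 2 ^ (dl + k)" by (simp add: power_add)
  also have "... <= 2 ^ SB" using s that by (intro power_increasing) auto
  finally show "\<lfloor>\<delta> * 2 ^ k\<rfloor> < 2 ^ SB" by (simp add: floor_less_iff)
 qed
 have fb': "frac_bit \<delta> k = 0 \<or> frac_bit \<delta> k = 1" for k unfolding frac_bit_def by presburger
 have stp: "2 * \<lfloor>\<delta> * 2 ^ k\<rfloor> + frac_bit \<delta> k = \<lfloor>\<delta> * 2 ^ Suc k\<rfloor>" for k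
  using floor_double[of "\<delta> * 2 ^ k"] by (simp add: frac_bit_def mult_ac)
 have S1: "(1::int) < 2 ^ SB" "(2::int) < 2 ^ SB"
 proof -
  have "(2::int) ^ 1 < 2 ^ SB" by (rule power_strict_increasing) (use SB in auto)
  thus "(1::int) < 2 ^ SB" "(2::int) < 2 ^ SB" by simp_all
 qed
 have "hoare Delta m (3 * qS + (sg * (3 * qS + 4 * qS) + 5 * qS)) p (I sg)"
  unfolding Delta_def
 proof (rule hoare_seq[where Q = "I 0"], goal_cases)
  case 1
  show ?case by (rule hoare_ops) (use X fb[of 0] S1 in \<open>simp_all add: wok_def rq_def I_def\<close>)
 next
  case (2 m1 q1)
  show ?case
  proof (rule hoare_for[where I = I], goal_cases)
   case (10 k m' q v w x y)
   thus ?case unfolding I_def by simp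
  next
   case (11 k m' q)
   hence "eqx ?E {} m m'" by (simp add: I_def)
   from eqx_reg[OF this, of 12] show ?case using s by simp
  next
   case (13 k m2 q2)
   hence k: "k < sg" "m2 48 = int k" "q2 = p" "eqx ?E {} m m2" "m2 53 = 2" "m2 54 = \<lfloor>\<delta> * 2 ^ k\<rfloor>" by (auto simp: I_def)
   define f where "f = \<lfloor>\<delta> * 2 ^ k\<rfloor>"
   define g where "g = frac_bit \<delta> k"
   have fg: "2 * f + g = \<lfloor>\<delta> * 2 ^ Suc k\<rfloor>" using stp by (simp add: f_def g_def)
   have b: "0 <= f" "2 * f + g < 2 ^ SB" "g = 0 \<or> g = 1" using fb[of k] fb[of "Suc k"] k fb'[of k] unfolding fg by (auto simp: f_def g_def)
   have bs: "\<bar>f * 2\<bar> < 2 ^ SB" "\<bar>g\<bar> < 2 ^ SB" "\<bar>f * 2 + g\<bar> < 2 ^ SB" using b S1 by auto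
   show ?case
    by (rule hoare_ops) (use k X bs fg in \<open>simp_all add: wok_def rq_def rq2_def I_def f_def[symmetric] g_def[symmetric] mult.commute\<close>)
  qed (use 2 in simp_all)
 qed
 thus ?thesis by (rule hoare_mono) (simp_all add: I_def algebra_simps)
qed

text \<open>The bound on the entries cannot be read from the input, so the size parameter is derived
  from the sum of squared entries, \<open>n\<close>, and the position of the first nonzero digit of
  \<epsilon>. The result \<open>b\<close> is the bit length of their product
  \<open>W * n * 2 ^ (je + 1)\<close>, but at least 2.\<close>

definition Head :: com where
 "Head = Ops [OC 50 0, OIn 9 0 50, OC 50 1, OIn 10 0 50, OC 51 1] ;;
 For 48 49 10 (Ops [OIn 52 3 48, OMul 52 52 52, OAdd 51 51 52]) ;;
 Ops [OC 53 2, OC 54 0, OC 55 1, OIn 56 4 54, OSub 56 55 56] ;;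
 While 56 (Ops [OAdd 53 53 53, OAdd 54 54 55, OIn 56 4 54, OSub 56 55 56]) ;;
 Ops [OMul 51 51 9, OMul 51 51 53, OC 11 2, OC 54 4, OSub 56 51 54, OAdd 56 56 55] ;;
 While 56 (Ops [OAdd 54 54 54, OAdd 11 11 55, OSub 56 51 54, OAdd 56 56 55])"

lemma Head_spec:
 fixes z je b :: nat
 defines "W \<equiv> 1 + (\<Sum>e<z. X 3 e * X 3 e)"
 assumes X: "X 0 0 = int n" "X 0 (Suc 0) = int z" and bit: "!!k. k < je ==> X 4 k = 0" "X 4 je = 1"
  and b: "2 <= b" "W * int n * 2 ^ (je + 1) < 2 ^ b" "!!k. 2 <= k ==> k < b ==> 2 ^ k <= W * int n * 2 ^ (je + 1)" and bS: "b + 4 < SB" "int z < 2 ^ SB" and n1: "1 <= n"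
 shows "hoare Head m ((z + je + b + 4) * (20 * qS)) p (%m' q. q = p & m' 9 = int n & m' 10 = int z & m' 11 = int b)"
proof -
 define V where "V = W * int n * 2 ^ (je + 1)"
 define Wk where "Wk k = 1 + (\<Sum>e<k. X 3 e * X 3 e)" for k
 have sq0: "0 <= X 3 e * X 3 e" for e by simp
 have Wk1: "1 <= Wk k" for k unfolding Wk_def by (simp add: sum_nonneg)
 have WkW: "Wk k <= W" if "k <= z" for k
  unfolding Wk_def W_def using that by (intro add_left_mono sum_mono2) auto
 have W1: "1 <= W" using Wk1[of z] by (simp add: Wk_def W_def)
 have bb: "(2::int) ^ (b + 2) < 2 ^ SB" "(2::int) ^ (b + 2) = 4 * 2 ^ b" "0 < (2::int) ^ b" using power_strict_increasing[of "b + 2" SB "2::int"] bS by (simp, simp add: power_add, simp)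
 have one: "(1::int) <= 2 ^ (je + 1)" "1 <= int n" using n1 by (rule_tac one_le_power, simp_all)
 have WV: "W <= V" "W * int n <= V" "2 ^ (je + 1) <= V"
 proof -
  have "W * int n * 1 <= W * int n * 2 ^ (je + 1)" using W1 one by (intro mult_left_mono) auto
  thus 1: "W * int n <= V" by (simp add: V_def)
  have "W * 1 <= W * int n" using W1 one by (intro mult_left_mono) auto
  thus "W <= V" using 1 by simp
  have "1 * 1 <= W * int n" using W1 one by (intro mult_mono) auto
  hence "1 * 2 ^ (je + 1) <= W * int n * 2 ^ (je + 1)" by (intro mult_right_mono) auto
  thus "2 ^ (je + 1) <= V" by (simp add: V_def)
 qed
 have Vb: "V < 2 ^ b" using b by (simp add: V_def)
 have V1: "1 <= V" using WV W1 by linarith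
 have VS: "V < 2 ^ SB" using Vb bb by linarith
 have b4: "(4::int) <= 2 ^ b"
 proof -
  have "(2::int) ^ 2 <= 2 ^ b" using b by (intro power_increasing) auto
  thus ?thesis by simp
 qed
 have S4: "(4::int) < 2 ^ SB" "(2::int) < 2 ^ SB" "(1::int) < 2 ^ SB" using b4 bb by linarith+
 have jeS: "int je + 1 < 2 ^ SB"
 proof -
  have "je + 1 < 2 ^ (je + 1)" by (rule less_exp)
  hence "int (je + 1) < int (2 ^ (je + 1))" by (simp only: of_nat_less_iff)
  hence "int je + 1 < 2 ^ (je + 1)" by simp
  thus ?thesis using WV VS by linarith
 qed
 have bSS: "int b + 2 < 2 ^ SB"
 proof -
  have "b < 2 ^ b" by (rule less_exp)
  hence "int b < int (2 ^ b)" by (simp only: of_nat_less_iff)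
  hence "int b < 2 ^ b" by simp
  thus ?thesis using bb b4 by linarith
 qed
 have nS: "int n < 2 ^ SB" using SB(3) by linarith
 have X4: "X 4 k = 0 \<or> X 4 k = 1" if "k <= je" for k using bit that by (cases "k = je") auto
 define I1 where "I1 k m' q \<longleftrightarrow> q = p & m' 9 = int n & m' 10 = int z & m' 51 = Wk k" for k and m' :: memory and q
 define I2 where "I2 k m' q \<longleftrightarrow> q = p & m' 9 = int n & m' 10 = int z & m' 51 = W & m' 55 = 1 &
  (\<exists>i. i + k = je & m' 54 = int i & m' 53 = 2 ^ (i + 1) & m' 56 = 1 - X 4 i)" for k and m' :: memory and q
 define I3 where "I3 k m' q \<longleftrightarrow> q = p & m' 9 = int n & m' 10 = int z & m' 51 = V & m' 55 = 1 &
  (\<exists>i. i + k = b & 2 <= i & m' 11 = int i & m' 54 = 2 ^ i & m' 56 = V - 2 ^ i + 1)" for k and m' :: memory and q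
 have "hoare Head m (5 * qS + ((z * (3 * qS + 4 * qS) + 5 * qS) + (5 * qS + ((je * (4 * qS + qS) + 3 * qS) +
  (6 * qS + ((b - 2) * (4 * qS + qS) + 3 * qS)))))) p (%m' q. q = p & m' 9 = int n & m' 10 = int z & m' 11 = int b)"
  unfolding Head_def
 proof (rule hoare_seq[where Q = "I1 0"], goal_cases)
  case 1
  show ?case by (rule hoare_ops) (use X nS bS S4 in \<open>simp_all add: wok_def rq_def I1_def Wk_def\<close>)
 next
  case (2 m1 q1)
  show ?case
  proof (rule hoare_seq[where Q = "I1 z"], goal_cases)
   case 1
   show ?case
   proof (rule hoare_for[where I = I1], goal_cases)
    case (13 k m' q)
    have s: "Wk (Suc k) = Wk k + X 3 k * X 3 k" by (simp add: Wk_def)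
    have "Wk (Suc k) <= W" using 13 by (intro WkW) simp
    hence w: "Wk k + X 3 k * X 3 k < 2 ^ SB" using s WV VS by linarith
    have q: "X 3 k * X 3 k < 2 ^ SB" using w Wk1[of k] by linarith
    have "\<bar>X 3 k\<bar> <= X 3 k * X 3 k"
    proof (cases "X 3 k = 0")
     case False
     hence "1 * \<bar>X 3 k\<bar> <= \<bar>X 3 k\<bar> * \<bar>X 3 k\<bar>" by (intro mult_right_mono) auto
     thus ?thesis by (simp add: abs_mult_self_eq)
    qed simp
    hence "\<bar>X 3 k\<bar> < 2 ^ SB" using q by linarith
    moreover have "\<bar>X 3 k * X 3 k\<bar> < 2 ^ SB" "\<bar>Wk k + X 3 k * X 3 k\<bar> < 2 ^ SB" using q w sq0[of k] Wk1[of k] by linarith+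
    ultimately show ?case using 13 s by (intro hoare_ops) (simp_all add: wok_def rq_def rq2_def I1_def)
   qed (use 2 in \<open>simp_all add: I1_def\<close>)
  next
   case (2 m2 q2)
   hence m2: "q2 = p" "m2 9 = int n" "m2 10 = int z" "m2 51 = W" by (auto simp: I1_def Wk_def W_def)
   show ?case
   proof (rule hoare_seq[where Q = "I2 je"], goal_cases)
    case 1
    show ?case by (rule hoare_ops) (use m2 S4 X4[of 0] in \<open>auto simp: wok_def rq_def rq2_def I2_def\<close>)
   next
    case (2 m3 q3)
    show ?case
    proof (rule hoare_seq[where Q = "I2 0"], goal_cases)
     case 1
     show ?case
     proof (rule hoare_while[where I = I2], goal_cases)
      case (3 k m' q)
      then obtain i where i: "i + Suc k = je" "m' 54 = int i" "m' 53 = 2 ^ (i + 1)" "m' 56 = 1 - X 4 i" and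
       r: "q = p" "m' 9 = int n" "m' 10 = int z" "m' 51 = W" "m' 55 = 1" unfolding I2_def by blast
      have "(2::int) ^ (Suc i + 1) <= 2 ^ (je + 1)" using i(1) by (intro power_increasing) auto
      hence p: "\<bar>(2::int) ^ (i + 1) + 2 ^ (i + 1)\<bar> < 2 ^ SB" using WV VS by simp
      have x: "X 4 (Suc i) = 0 \<or> X 4 (Suc i) = 1" using X4[of "Suc i"] i by simp
      have iS: "\<bar>int i + 1\<bar> < 2 ^ SB" using i jeS by linarith
      have ni: "nat (int i + 1) = Suc i" by simp
      show ?case
      proof (rule hoare_ops, goal_cases)
       case 1
       show ?case using i r p x iS S4 by (auto simp: wok_def ni)
      next
       case 3
       show ?case unfolding I2_def using i r by (auto simp: ni intro!: exI[of _ "Suc i"])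
      qed (simp add: rq2_def rq_def)
     next
      case (4 m' q)
      thus ?case using bit by (auto simp: I2_def)
     next
      case (5 k m' q)
      then obtain i where i: "i + k = je" "m' 54 = int i" "m' 53 = 2 ^ (i + 1)" "m' 56 = 1 - X 4 i" unfolding I2_def by blast
      have "k = 0"
      proof (rule ccontr)
       assume "k ~= 0"
       hence "X 4 i = 0" using i bit(1) by simp
       thus False using i 5 by simp
      qed
      thus ?case using 5 by simp
     qed (use 2 in \<open>auto simp: I2_def\<close>)
    next
     case (2 m4 q4)
     hence m4: "q4 = p" "m4 9 = int n" "m4 10 = int z" "m4 51 = W" "m4 55 = 1" "m4 53 = 2 ^ (je + 1)" by (auto simp: I2_def)
     have V: "W * int n * 2 ^ (je + 1) = V" by (simp add: V_def)
     have bs: "\<bar>W * int n\<bar> < 2 ^ SB" "\<bar>V\<bar> < 2 ^ SB" "\<bar>V - 4\<bar> < 2 ^ SB" "\<bar>V - 4 + 1\<bar> < 2 ^ SB" "\<bar>V - 3\<bar> < 2 ^ SB"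
      using WV W1 one V1 VS S4 mult_nonneg_nonneg[of W "int n"] by linarith+
     show ?case
     proof (rule hoare_seq[where Q = "I3 (b - 2)"], goal_cases)
      case 1
      show ?case
      proof (rule hoare_ops, goal_cases)
       case 1
       show ?case using m4 V bs S4 by (simp add: wok_def del: power_Suc)
      next
       case 3
       show ?case unfolding I3_def using m4 V b(1) by (auto simp del: power_Suc intro!: exI[of _ 2])
      qed (simp add: rq2_def)
     next
      case (2 m5 q5)
      show ?case
      proof (rule hoare_while[where I = I3], goal_cases)
       case (3 k m' q)
       then obtain i where i: "i + Suc k = b" "2 <= i" "m' 11 = int i" "m' 54 = 2 ^ i" "m' 56 = V - 2 ^ i + 1" and
        r: "q = p" "m' 9 = int n" "m' 10 = int z" "m' 51 = V" "m' 55 = 1" unfolding I3_def by blast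
       have "(2::int) ^ Suc i <= 2 ^ b" using i(1) by (intro power_increasing) auto
       hence p: "2 * (2::int) ^ i <= 2 ^ b" "0 < (2::int) ^ i" by simp_all
       have bs: "\<bar>(2::int) ^ i + 2 ^ i\<bar> < 2 ^ SB" "\<bar>V - (2 ^ i + 2 ^ i)\<bar> < 2 ^ SB" "\<bar>V - (2 ^ i + 2 ^ i) + 1\<bar> < 2 ^ SB" "\<bar>int i + 1\<bar> < 2 ^ SB"
        using p Vb V1 bb i bSS by linarith+
       show ?case
       proof (rule hoare_ops, goal_cases)
        case 1
        show ?case using i r bs by (simp add: wok_def)
       next
        case 3
        show ?case unfolding I3_def using i r by (auto intro!: exI[of _ "Suc i"])
       qed (simp add: rq2_def)
      next
       case (4 m' q)
       thus ?case using Vb by (auto simp: I3_def)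
      next
       case (5 k m' q)
       then obtain i where i: "i + k = b" "2 <= i" "m' 11 = int i" "m' 56 = V - 2 ^ i + 1" unfolding I3_def by blast
       have "k = 0"
       proof (rule ccontr)
        assume "k ~= 0"
        hence "2 ^ i <= V" using i b(3)[of i] by (simp add: V_def)
        thus False using i 5 by simp
       qed
       thus ?case using 5 i by (simp add: I3_def)
      qed (use 2 in \<open>auto simp: I3_def\<close>)
     qed
    qed
   qed
  qed
 qed
 thus ?thesis
 proof (rule hoare_mono, goal_cases)
  case 1
  have "(b - 2) * (4 * qS + qS) <= b * (5 * qS)" by (intro mult_mono) auto
  thus ?case by (simp add: algebra_simps)
 qed simp_all
qed

end

section \<open>Search for the smallest eigenvalue\<close>

text \<open>\<open>2 ^ J\<close> bounds the spectrum, and \<open>ZB\<close> is large enough for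
  \<open>2 ^ (ZB - 1)\<close> to bound each factor \<open>\<mu> - z\<close> at the evaluation
  points; \<open>NB = ZB * n\<close> bits therefore hold every value of \<open>Q\<close> that
  occurs.\<close>

locale alg4 = alg3 +
 fixes J :: nat
 assumes SJ: "!!\<mu>. \<mu> \<in> S ==> \<mu> <= 2 ^ J" and ZBJ: "J + 2 * b + 14 <= ZB" and NBv: "NB = ZB * n" and nb: "n < 2 ^ b"
begin

definition scon :: "memory => bool" where
 "scon m \<longleftrightarrow> m 9 = int n & m 10 = int z & m 13 = sc & in_arr m 0 (2 ^ K) &
  m 4 = 2 ^ NB & m 14 = int B & m 15 = int T & m 23 = int (NB + B + 2) & m 19 = int (8 * b) & m 21 = 2 ^ (24 * b) &
  m 11 = int b & m 24 = int (b + 1) & m 20 = 2 ^ (3 * b)"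

text \<open>Register 53 runs through the signed binomial coefficients, updated by the exact division
  of \<open>binom_step\<close>. The logarithms carry the factor \<open>2 ^ (8 b)\<close>, so the
  threshold \<open>1 / 2 ^ (5 b)\<close> appears as the integer \<open>2 ^ (3 b)\<close> in register
  20.\<close>

definition Test :: com where
 "Test = Ops [OC 54 0, OC 53 (-1)] ;;
  For 42 43 24 (Ops [OMul 27 42 26, OSub 27 25 27] ;; Eval ;; Log ;;
   Ops [OMul 50 53 56, OAdd 54 54 50, OSub 50 42 11, OMul 53 53 50, OC 51 1, OAdd 51 51 42, OQuot 53 53 51]) ;;
  Ops [OSub 58 20 54]"

abbreviation "VS \<equiv> {27, 42, 43, 53, 54} \<union> (ES \<union> LS)"

lemma scon_eqx: 
 assumes e: "eqx ({25, 26, 38, 39, 40, 41} \<union> VS) {2, 3, 4, 5} m m'" and c: "scon m" 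
 shows "scon m'" "(%i. real_of_int (ar m' 0 i)) = (%i. real_of_int (ar m 0 i))"
proof -
 note R = eqx_reg[OF e] eqx_ar[OF e]
 show "scon m'" using c by (simp add: scon_def in_arr_def R)
 show "(%i. real_of_int (ar m' 0 i)) = (%i. real_of_int (ar m 0 i))" by (simp add: R)
qed

lemma Qz_range:
 fixes y s :: int
 assumes y: "-1 <= y" "real_of_int y < Min S" and s: "0 < s" "s <= 2 ^ J" and i: "i <= b"
 shows "0 < Qz (y - int i * s)" "Qz (y - int i * s) < 2 ^ NB"
proof -
 have is0: "0 <= int i * s" using s by simp
 have isb: "int i * s <= int b * 2 ^ J" using s i by (intro mult_mono) auto
 have bb2: "int b + 2 <= 2 ^ (b + 2)"
 proof -
  have "b < 2 ^ b" by (rule less_exp)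
  hence "int b < int (2 ^ b)" by (simp only: of_nat_less_iff)
  hence "int b < 2 ^ b" by simp
  moreover have "(1::int) <= 2 ^ b" "(2::int) ^ (b + 2) = 4 * 2 ^ b" by (simp, simp add: power_add)
  ultimately show ?thesis by linarith
 qed
 have J1: "(1::int) <= 2 ^ J" by simp
 have f: "0 < \<mu> - (y - int i * s)" "\<mu> - (y - int i * s) <= 2 ^ (ZB - 1)" if "\<mu> \<in> S" for \<mu>
 proof -
  have "Min S <= \<mu>" using that S_fin(1) by simp
  hence "y < \<mu>" using y by linarith
  moreover have "0 <= real_of_int (int i * s)" using is0 by (simp only: of_int_0_le_iff)
  ultimately show "0 < \<mu> - (y - int i * s)" by simp
  have "1 + int i * s <= 2 ^ J + int b * 2 ^ J" using isb J1 by linarith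
  hence "2 ^ J + 1 + int i * s <= (int b + 2) * 2 ^ J" by (simp add: algebra_simps)
  also have "... <= 2 ^ (b + 2) * 2 ^ J" using bb2 by (intro mult_right_mono) auto
  also have "... = 2 ^ (b + 2 + J)" by (simp add: power_add)
  also have "... <= 2 ^ (ZB - 1)" using ZBJ by (intro power_increasing) auto
  finally have "real_of_int (2 ^ J + 1 + int i * s) <= real_of_int (2 ^ (ZB - 1))" by (simp only: of_int_le_iff)
  thus "\<mu> - (y - int i * s) <= 2 ^ (ZB - 1)" using SJ[OF that] y by simp
 qed
 show "0 < Qz (y - int i * s)" unfolding Qz_def using f by (intro prod_pos) auto
 have "Qz (y - int i * s) <= (\<Prod>\<mu>\<in>S. 2 ^ (ZB - 1))" unfolding Qz_def using f by (intro prod_mono) (auto intro: less_imp_le)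
 also have "... = 2 ^ ((ZB - 1) * card S)" by (simp add: power_mult)
 also have "... <= 2 ^ ((ZB - 1) * n)" using S_fin(3) by (intro power_increasing) auto
 also have "... < 2 ^ NB" unfolding NBv using n1 ZBJ by (intro power_strict_increasing) auto
 finally show "Qz (y - int i * s) < 2 ^ NB" .
qed

lemma z_range:
 fixes y s :: int
 assumes y: "-1 <= y" "y <= 2 ^ (J + b + 10)" and s: "0 < s" "s <= 2 ^ J" and i: "i <= b"
 shows "\<bar>int i * s\<bar> <= 2 ^ ZB" "\<bar>y - int i * s\<bar> <= 2 ^ ZB"
proof -
 have "b < 2 ^ b" by (rule less_exp)
 hence "int b < int (2 ^ b)" by (simp only: of_nat_less_iff)
 hence "int b < 2 ^ b" by simp
 hence "int i <= 2 ^ b" using i by linarith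
 hence "int i * s <= 2 ^ (b + J)" using s by (intro mul_pow2) auto
 moreover have "(2::int) ^ (b + J) <= 2 ^ (ZB - 1)" "(2::int) ^ (J + b + 10) <= 2 ^ (ZB - 1)" using ZBJ by (auto intro!: power_increasing)
 moreover have "(2::int) ^ ZB = 2 * 2 ^ (ZB - 1)" using ZBJ by (cases ZB) auto
 moreover have "0 <= int i * s" using s by simp
 moreover have "(1::int) <= 2 ^ (ZB - 1)" by simp
 ultimately show "\<bar>int i * s\<bar> <= 2 ^ ZB" "\<bar>y - int i * s\<bar> <= 2 ^ ZB" using y by linarith+
qed

lemma binom_step: 
 assumes "k <= b"
 shows "((-1) ^ Suc k * int (b choose k)) * (int k - int b) div (1 + int k) = (-1) ^ Suc (Suc k) * int (b choose Suc k)"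
proof -
 have "Suc k * (b choose Suc k) = (b choose k) * (b - k)"
 proof (cases "k < b")
  case True
  thus ?thesis using binomial_absorb_comp[of b k] binomial_absorption[of k "b"] by (metis binomial_absorb_comp binomial_absorption mult.commute Suc_diff_Suc diff_Suc_1 times_binomial_minus1_eq Suc_times_binomial_eq Suc_pred)
 qed (use assms in simp)
 hence "int (Suc k * (b choose Suc k)) = int ((b choose k) * (b - k))" by simp
 hence e: "(1 + int k) * int (b choose Suc k) = int (b choose k) * (int b - int k)" using assms by (simp add: of_nat_diff algebra_simps)
 have "((-1) ^ Suc k * int (b choose k)) * (int k - int b) = (-1) ^ Suc (Suc k) * (int (b choose k) * (int b - int k))"
  by (simp add: algebra_simps)
 also have "... = (1 + int k) * ((-1) ^ Suc (Suc k) * int (b choose Suc k))" unfolding e[symmetric] by (simp add: algebra_simps)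
 finally show ?thesis by simp
qed

definition tT :: nat where "tT = (b + 2) * (tE + tL + 30 * qS)"

lemma Test_spec:
 fixes m :: memory
 defines "u \<equiv> (%i. real_of_int (ar m 0 i))"
 assumes c: "scon m" and y: "-1 <= m 25" "m 25 <= 2 ^ (J + b + 10)" and s: "0 < m 26" "m 26 <= 2 ^ J"
  and g: "p < 1 ==> uok u & real_of_int (m 25) < Min S & real (b + 1) * eta <= p"
 shows "hoare Test m tT p (%m' q. eqx VS {2, 3, 4, 5} m m' &
  (1 <= q \<or> p < 1 & p - real (b + 1) * eta <= q &
   (if 0 < m' 58 then real_of_int (m 26) < Min S - m 25 else Min S - m 25 < 256 * real b * m 26)))" (is "hoare _ _ _ _ ?Q")
proof -
 define yy where "yy = m 25"
 define ss where "ss = m 26"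
 have y': "-1 <= yy" "yy <= 2 ^ (J + b + 10)" "0 < ss" "ss <= 2 ^ J" using y s by (auto simp: yy_def ss_def)
 define lt where "lt k Lf q \<longleftrightarrow> (1 <= q \<or> p < 1 & p - real k * eta <= q &
  (\<forall>i<k. \<bar>real_of_int (Lf i) / 2 ^ (8 * b) - log 2 (Qz (yy - int i * ss))\<bar> <= 2 / 2 ^ (8 * b)))" for k and Lf :: "nat => int" and q
 \<comment> \<open>The bounds on the recorded logarithms hold in any case and keep the registers
   short; their accuracy, stated in \<open>lt\<close>, is claimed only while the budget stays below
   1.\<close>
 define I where "I k m' q \<longleftrightarrow> eqx VS {2, 3, 4, 5} m m' & m' 53 = (-1) ^ Suc k * int (b choose k) &
  (\<exists>Lf. (\<forall>i<k. 0 <= Lf i & Lf i <= 2 ^ (8 * b + B)) & m' 54 = (\<Sum>i<k. (-1) ^ Suc i * int (b choose i) * Lf i) & lt k Lf q)" for k m' q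
 have ec: "scon m'" "(%i. real_of_int (ar m' 0 i)) = u" "m' 25 = yy" "m' 26 = ss" if e: "eqx VS {2, 3, 4, 5} m m'" for m'
 proof -
  have e': "eqx ({25, 26, 38, 39, 40, 41} \<union> VS) {2, 3, 4, 5} m m'" by (rule eqx_mono[OF e]) auto
  show "scon m'" "(%i. real_of_int (ar m' 0 i)) = u" using scon_eqx[OF e' c] by (simp_all add: u_def)
  show "m' 25 = yy" "m' 26 = ss" using eqx_reg[OF e] by (simp_all add: yy_def ss_def)
 qed
 have zS: "\<bar>v\<bar> < 2 ^ SB" if "\<bar>v\<bar> <= 2 ^ ZB" for v :: int
  using that by (rule pow2_lt) (use sbits b2 in simp)
 have chb: "int (b choose k) <= 2 ^ b" for k
 proof -
  have "b choose k <= 2 ^ b"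
  proof (cases "k <= b")
   case True
   hence "b choose k <= (\<Sum>i\<le>b. b choose i)" by (intro member_le_sum) auto
   thus ?thesis by (simp add: choose_row_sum)
  qed (simp add: binomial_eq_0)
  hence "int (b choose k) <= int (2 ^ b)" by (simp only: of_nat_le_iff)
  thus ?thesis by simp
 qed
 have accb: "\<bar>\<Sum>i<k. (-1) ^ Suc i * int (b choose i) * Lf i\<bar> <= 2 ^ (9 * b + B)"
  if "!!i. i < k ==> 0 <= Lf i & Lf i <= 2 ^ (8 * b + B)" "k <= Suc b" for k and Lf :: "nat => int"
 proof -
  have "\<bar>\<Sum>i<k. (-1) ^ Suc i * int (b choose i) * Lf i\<bar> <= (\<Sum>i<k. \<bar>(-1) ^ Suc i * int (b choose i) * Lf i\<bar>)" by (rule sum_abs)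
  also have "... <= (\<Sum>i<k. int (b choose i) * 2 ^ (8 * b + B))"
   using that by (intro sum_mono) (auto simp: abs_mult power_abs intro!: mult_left_mono)
  also have "... <= (\<Sum>i\<le>b. int (b choose i) * 2 ^ (8 * b + B))" using that(2) by (intro sum_mono2) auto
  also have "... = int (\<Sum>i\<le>b. b choose i) * 2 ^ (8 * b + B)" by (simp add: sum_distrib_right)
  also have "... = 2 ^ b * 2 ^ (8 * b + B)" unfolding choose_row_sum by simp
  also have "... = 2 ^ (9 * b + B)" by (simp add: power_add[symmetric])
  finally show ?thesis .
 qed
 have pS: "(2::int) ^ (9 * b + B + 2) < 2 ^ SB" using sbits b2 by (intro power_strict_increasing) auto
 have etap: "0 < eta" by (rule eta0)
 have bS: "int b + 2 < 2 ^ SB"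
 proof -
  have "b < 2 ^ b" by (rule less_exp)
  hence "int b < int (2 ^ b)" by (simp only: of_nat_less_iff)
  hence "int b < 2 ^ b" by simp
  moreover have "(1::int) <= 2 ^ b" "(2::int) ^ (b + 2) = 4 * 2 ^ b" by (simp, simp add: power_add)
  ultimately have "int b + 2 <= 2 ^ (b + 2)" by linarith
  thus ?thesis by (rule pow2_lt) (use sbits b2 in simp)
 qed
 have "hoare Test m (2 * qS + (((b + 1) * ((2 * qS + (tE + (tL + 7 * qS))) + 4 * qS) + 5 * qS) + qS)) p ?Q"
  unfolding Test_def
 proof (rule hoare_seq[where Q = "I 0"], goal_cases)
  case 1
  show ?case by (rule hoare_ops) (use b2 in \<open>auto simp: wok_def I_def lt_def\<close>)
 next
  case (2 m1 q1)
  show ?case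
  proof (rule hoare_seq[where Q = "I (b + 1)"], goal_cases)
   case 1
   show ?case
   proof (rule hoare_for[where I = I], goal_cases)
    case (10 k m' q v w xx yy)
    thus ?case unfolding I_def by simp
   next
    case (11 k m' q)
    hence "eqx VS {2, 3, 4, 5} m m'" unfolding I_def by (rule conjunct1)
    from ec(1)[OF this] show ?case by (simp add: scon_def)
   next
    case (13 k m2 q2)
    hence kb: "k <= b" and k2: "m2 42 = int k" and e2: "eqx VS {2, 3, 4, 5} m m2" and b53: "m2 53 = (-1) ^ Suc k * int (b choose k)" by (auto simp: I_def)
    from 13(3) obtain Lf where Lf: "\<forall>i<k. 0 <= Lf i & Lf i <= 2 ^ (8 * b + B)" "m2 54 = (\<Sum>i<k. (-1) ^ Suc i * int (b choose i) * Lf i)" "lt k Lf q2"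
     unfolding I_def by blast
    note c2 = ec[OF e2]
    define zz where "zz = yy - int k * ss"
    note zr = z_range[OF y' kb, folded zz_def]
    show ?case
    proof (rule hoare_seq[where Q = "%m' q. q = q2 & m' = m2(27 := zz)"], goal_cases)
     case 1
     show ?case by (rule hoare_ops) (use c2 k2 zr zS in \<open>simp_all add: wok_def rq2_def zz_def[symmetric]\<close>)
    next
     case (2 m3 q3)
     hence m3: "q3 = q2" "m3 = m2(27 := zz)" by auto
     have e3: "eqx VS {2, 3, 4, 5} m m3" using e2 m3 by simp
     have r3: "m3 27 = zz" "m3 42 = int k" "m3 53 = (-1) ^ Suc k * int (b choose k)" "m3 54 = m2 54" using m3 k2 b53 by auto
     note c3 = ec[OF e3]
     have q3: "q3 < 1 ==> p < 1 & p - real k * eta <= q3" using Lf(3) m3 by (auto simp: lt_def)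
     have kE: "real k * eta + eta <= real (b + 1) * eta"
     proof -
      have "real (k + 1) * eta <= real (b + 1) * eta" using kb etap by (intro mult_right_mono) auto
      thus ?thesis by (simp add: algebra_simps)
     qed
     have ev: "uok u & 0 < Qz zz & Qz zz < 2 ^ NB & eta <= q3" if "q3 < 1"
     proof -
      have p1: "p < 1" "p - real k * eta <= q3" using q3 that by auto
      note g1 = g[OF p1(1)]
      have "eta <= q3" using p1 g1 kE by linarith
      thus ?thesis using Qz_range[of yy ss k] g1 y' kb unfolding zz_def yy_def by auto
     qed
     have eco: "econ m3" using c3(1) r3 zr by (simp add: econ_def scon_def)
     show ?case
     proof (rule hoare_seq[where Q = "%m' q. eqx ES {2, 3, 4, 5} m3 m' & 0 <= m' 2 & m' 2 <= 2 ^ (NB + B) &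
       (1 <= q \<or> q3 < 1 & m' 2 = \<lfloor>Qz zz\<rfloor> & q3 - eta <= q)"], goal_cases)
      case 1
      have gE: "q3 < 1 ==> uok (%i. real_of_int (ar m3 0 i)) & 0 <= Qz (m3 27) & Qz (m3 27) < 2 ^ NB & eta <= q3"
       unfolding c3(2) r3(1) using ev by auto
      show ?case by (rule hoare_mono[OF Eval_spec[OF eco gE]]) (use r3 in auto)
     next
      case (2 m4 q4)
      hence m4: "eqx ES {2, 3, 4, 5} m3 m4" "0 <= m4 2" "m4 2 <= 2 ^ (NB + B)"
       "1 <= q4 \<or> q3 < 1 & m4 2 = \<lfloor>Qz zz\<rfloor> & q3 - eta <= q4" by auto
      have e4: "eqx VS {2, 3, 4, 5} m m4" by (rule eqx_tr[OF e3 m4(1)]) auto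
      note c4 = ec[OF e4]
      have r4: "m4 42 = int k" "m4 53 = (-1) ^ Suc k * int (b choose k)" "m4 54 = m2 54"
       using eqx_reg[OF m4(1)] r3 by simp_all
      show ?case
      proof (rule hoare_seq[where Q = "%m' q. q = q4 & eqx LS {} m4 m' & 0 <= m' 56 & m' 56 <= 2 ^ (8 * b + B) &
        (1 <= m4 2 --> \<bar>real_of_int (m' 56) / 2 ^ (8 * b) - log 2 (m4 2)\<bar> <= 2 / 2 ^ (8 * b))"], goal_cases)
       case 1
       show ?case by (rule Log_spec) (use m4 c4(1) in \<open>simp_all add: scon_def\<close>)
      next
       case (2 m5 q5)
       hence m5: "q5 = q4" "eqx LS {} m4 m5" "0 <= m5 56" "m5 56 <= 2 ^ (8 * b + B)"
        "1 <= m4 2 ==> \<bar>real_of_int (m5 56) / 2 ^ (8 * b) - log 2 (m4 2)\<bar> <= 2 / 2 ^ (8 * b)" by auto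
       have e5: "eqx VS {2, 3, 4, 5} m m5" by (rule eqx_tr[OF e4 m5(2)]) auto
       note c5 = ec[OF e5]
       have r5: "m5 42 = int k" "m5 53 = (-1) ^ Suc k * int (b choose k)" "m5 54 = m2 54"
        using eqx_reg[OF m5(2)] r4 by simp_all
       have b5: "m5 11 = int b" using c5(1) by (simp add: scon_def)
       define L where "L = m5 56"
       define Lf' where "Lf' = Lf(k := L)"
       have Lf'b: "!!i. i < Suc k ==> 0 <= Lf' i & Lf' i <= 2 ^ (8 * b + B)" using Lf(1) m5 by (auto simp: Lf'_def L_def less_Suc_eq)
       have sm: "(\<Sum>i<Suc k. (-1) ^ Suc i * int (b choose i) * Lf' i) = m2 54 + (-1) ^ Suc k * int (b choose k) * L"
        unfolding Lf(2) by (simp add: Lf'_def)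
       have lt': "lt (Suc k) Lf' q5"
       proof (cases "1 <= q5")
        case False
        hence a: "q3 < 1" "m4 2 = \<lfloor>Qz zz\<rfloor>" "q3 - eta <= q5" using m4(4) m5(1) by auto
        have ev': "generic u" "0 < Qz zz" using ev[OF a(1)] by (auto simp: uok_def)
        have "Qz zz \<in> \<int>" by (rule Qz_int[OF ev'(1)]) (simp add: u_def)
        hence Q1: "real_of_int (m4 2) = Qz zz" using a by (auto elim!: Ints_cases)
        hence "1 <= m4 2" using ev' by linarith
        from m5(5)[OF this] have "\<bar>real_of_int L / 2 ^ (8 * b) - log 2 (Qz zz)\<bar> <= 2 / 2 ^ (8 * b)" by (simp add: Q1 L_def)
        moreover have "p < 1" "p - real k * eta <= q3"
         "\<forall>i<k. \<bar>real_of_int (Lf i) / 2 ^ (8 * b) - log 2 (Qz (yy - int i * ss))\<bar> <= 2 / 2 ^ (8 * b)"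
         using Lf(3) a(1) m3 by (auto simp: lt_def)
        moreover have "p - real (Suc k) * eta <= q5" using a(3) \<open>p - real k * eta <= q3\<close> by (simp add: algebra_simps)
        ultimately show ?thesis by (auto simp: lt_def Lf'_def zz_def less_Suc_eq)
       qed (simp add: lt_def)
       have bs: "\<bar>(-1) ^ Suc k * int (b choose k) * L\<bar> < 2 ^ SB" "\<bar>m2 54 + (-1) ^ Suc k * int (b choose k) * L\<bar> < 2 ^ SB"
        "\<bar>int k - int b\<bar> < 2 ^ SB" "\<bar>(-1) ^ Suc k * int (b choose k) * (int k - int b)\<bar> < 2 ^ SB" "\<bar>1 + int k\<bar> < 2 ^ SB" "\<bar>(-1) ^ Suc (Suc k) * int (b choose Suc k)\<bar> < 2 ^ SB"
       proof -
        have ab: "\<bar>(-1) ^ Suc k * int (b choose k) * x\<bar> = int (b choose k) * \<bar>x\<bar>" "\<bar>(-1) ^ Suc (Suc k) * int (b choose Suc k)\<bar> = int (b choose Suc k)" for x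
         by (simp_all add: abs_mult power_abs)
        have "int (b choose k) * \<bar>L\<bar> <= 2 ^ (b + (8 * b + B))" by (rule mul_pow2) (use chb m5 in \<open>auto simp: L_def\<close>)
        thus "\<bar>(-1) ^ Suc k * int (b choose k) * L\<bar> < 2 ^ SB" unfolding ab by (rule pow2_lt) (use sbits b2 in simp)
        show "\<bar>m2 54 + (-1) ^ Suc k * int (b choose k) * L\<bar> < 2 ^ SB" unfolding sm[symmetric]
         by (rule pow2_lt[OF accb[OF Lf'b]]) (use sbits b2 kb in simp_all)
        show "\<bar>int k - int b\<bar> < 2 ^ SB" "\<bar>1 + int k\<bar> < 2 ^ SB" using kb bS by linarith+
        have "b < 2 ^ b" by (rule less_exp)
        hence "int b < int (2 ^ b)" by (simp only: of_nat_less_iff)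
        hence "int b < 2 ^ b" by simp
        hence "\<bar>int k - int b\<bar> <= 2 ^ b" using kb by linarith
        hence "int (b choose k) * \<bar>int k - int b\<bar> <= 2 ^ (b + b)" using chb by (intro mul_pow2) auto
        thus "\<bar>(-1) ^ Suc k * int (b choose k) * (int k - int b)\<bar> < 2 ^ SB" unfolding ab by (rule pow2_lt) (use sbits b2 in simp)
        show "\<bar>(-1) ^ Suc (Suc k) * int (b choose Suc k)\<bar> < 2 ^ SB" unfolding ab by (rule pow2_lt[OF chb]) (use sbits b2 in simp)
       qed
       have I5: "I (Suc k) m' q5" if "eqx VS {2, 3, 4, 5} m m'" "m' 53 = (-1) ^ Suc (Suc k) * int (b choose Suc k)"
        "m' 54 = m2 54 + (-1) ^ Suc k * int (b choose k) * L" for m'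
        unfolding I_def using that lt' Lf'b sm by (intro conjI exI[of _ Lf']) simp_all
       define mf where "mf = osems [OMul 50 53 56, OAdd 54 54 50, OSub 50 42 11, OMul 53 53 50, OC 51 1, OAdd 51 51 42, OQuot 53 53 51] m5"
       have mf: "eqx VS {2, 3, 4, 5} m mf" "mf 53 = (-1) ^ Suc (Suc k) * int (b choose Suc k)"
        "mf 54 = m2 54 + (-1) ^ Suc k * int (b choose k) * L" "mf 42 = int k"
       proof -
        show "eqx VS {2, 3, 4, 5} m mf" unfolding mf_def using e5 by simp
        show "mf 53 = (-1) ^ Suc (Suc k) * int (b choose Suc k)" unfolding binom_step[OF kb, symmetric] mf_def using r5 b5 by simp
        show "mf 54 = m2 54 + (-1) ^ Suc k * int (b choose k) * L" "mf 42 = int k" unfolding mf_def using r5 by (simp_all add: L_def)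
       qed
       show ?case
       proof (rule hoare_ops, goal_cases)
        case 1
        show ?case using bs binom_step[OF kb] r5 b5 by (simp add: wok_def L_def[symmetric] del: power_Suc)
       next
        case 2
        show ?case by (simp add: rq2_def)
       next
        case 3
        show ?case unfolding mf_def[symmetric] using I5[OF mf(1-3)] mf(4) by simp
       qed
      qed
     qed
    qed
   qed (use 2 in simp_all)
  next
   case (2 m2 q2)
   hence e2: "eqx VS {2, 3, 4, 5} m m2" unfolding I_def by simp
   from 2(2) obtain Lf where Lf: "\<forall>i<b + 1. 0 <= Lf i & Lf i <= 2 ^ (8 * b + B)" "m2 54 = (\<Sum>i<b + 1. (-1) ^ Suc i * int (b choose i) * Lf i)" "lt (b + 1) Lf q2"
    unfolding I_def by blast
   note c2 = ec[OF e2]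
   have ac: "\<bar>m2 54\<bar> <= 2 ^ (9 * b + B)" unfolding Lf(2) by (rule accb) (use Lf(1) in auto)
   have t20: "m2 20 = 2 ^ (3 * b)" using c2(1) by (simp add: scon_def)
   have "\<bar>2 ^ (3 * b) - m2 54\<bar> < 2 ^ SB"
   proof -
    have "(2::int) ^ (3 * b) <= 2 ^ (9 * b + B)" by (rule power_increasing) auto
    moreover have "(2::int) ^ (9 * b + B + 2) = 4 * 2 ^ (9 * b + B)" by (simp add: power_add)
    moreover have "(0::int) < 2 ^ (3 * b)" by simp
    ultimately show ?thesis using ac pS by linarith
   qed
   moreover have "1 <= q2 \<or> p < 1 & p - real (b + 1) * eta <= q2 &
    (if 0 < 2 ^ (3 * b) - m2 54 then real_of_int ss < Min S - yy else Min S - yy < 256 * real b * ss)"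
   proof (cases "1 <= q2")
    case False
    hence p1: "p < 1" "p - real (b + 1) * eta <= q2"
     and L: "!!i. i <= b ==> \<bar>real_of_int (Lf i) / 2 ^ (8 * b) - log 2 (Qz (yy - int i * ss))\<bar> <= 2 / 2 ^ (8 * b)"
     using Lf(3) by (auto simp: lt_def)
    have yM: "real_of_int yy < Min S" using g[OF p1(1)] by (simp add: yy_def)
    have L': "\<bar>real_of_int (Lf j) / 2 ^ (8 * b) - log 2 (\<Prod>\<mu>\<in>S. \<mu> - (real_of_int yy - real j * real_of_int ss))\<bar> <= 2 / 2 ^ (8 * b)" if "j <= b" for j
     using L[OF that] by (simp add: Qz_def)
    have cs: "card S < 2 ^ b" using S_fin(3) nb by simp
    define Ac where "Ac = (\<Sum>j\<le>b. (-1) ^ Suc j * real (b choose j) * (real_of_int (Lf j) / 2 ^ (8 * b)))"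
    have "Ac = (\<Sum>j\<le>b. (-1) ^ Suc j * real (b choose j) * real_of_int (Lf j)) / 2 ^ (8 * b)"
     unfolding Ac_def by (simp add: sum_divide_distrib)
    also have "(\<Sum>j\<le>b. (-1) ^ Suc j * real (b choose j) * real_of_int (Lf j)) = real_of_int (m2 54)"
     unfolding Lf(2) by (simp add: lessThan_Suc_atMost)
    finally have Ac: "Ac = real_of_int (m2 54) / 2 ^ (8 * b)" .
    have "Ac < 1 / 2 ^ (5 * b) \<longleftrightarrow> real_of_int (m2 54) < 2 ^ (3 * b)"
    proof -
     have "(2::real) ^ (8 * b) = 2 ^ (5 * b) * 2 ^ (3 * b)" by (simp add: power_add[symmetric])
     thus ?thesis unfolding Ac by (simp add: field_simps)
    qed
    also have "... \<longleftrightarrow> m2 54 < 2 ^ (3 * b)"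
    proof -
     have "real_of_int (m2 54) < real_of_int (2 ^ (3 * b)) \<longleftrightarrow> m2 54 < 2 ^ (3 * b)" by (rule of_int_less_iff)
     thus ?thesis by simp
    qed
    finally have iff: "Ac < 1 / 2 ^ (5 * b) \<longleftrightarrow> m2 54 < 2 ^ (3 * b)" .
    have "real_of_int ss > 0" using y' by simp
    note gt = gap_test[OF S_fin(1,2) cs b2 yM this L', folded Ac_def]
    show ?thesis using p1 gt iff by (cases "m2 54 < 2 ^ (3 * b)") auto
   qed simp
   ultimately show ?case
    by (intro hoare_ops) (use t20 e2 in \<open>auto simp: wok_def rq2_def yy_def[symmetric] ss_def[symmetric] split: if_splits\<close>)
  qed
 qed
 thus ?thesis by (rule hoare_mono) (simp_all add: tT_def algebra_simps)
qed

text \<open>Each step size \<open>s\<close> gets \<open>512 b\<close> tests, starting from a gap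
  below \<open>512 b s\<close>. A positive test advances \<open>y\<close> by \<open>s\<close>
  without reaching the smallest root, a negative one bounds the gap by \<open>256 b s\<close>, and
  \<open>512 b\<close> positive ones would use up the gap. Hence the halved step size starts with
  the same relation.\<close>

definition Search :: com where
 "Search = For 38 39 17 (For 40 41 18 (Test ;; If 58 (Ops [OAdd 25 25 26]) (Ops [])) ;; Ops [OC 50 2, OQuot 26 26 50])"

definition tS :: nat where "tS = (J + 2) * ((512 * b + 2) * (tT + 20 * qS))"

text \<open>The total number of evaluations of \<open>Q\<close>, each of which spends
  \<open>eta\<close>.\<close>

definition NE :: nat where "NE = (J + 1) * (512 * b * (b + 1))"

lemma Search_spec:
 fixes m :: memory
 defines "u \<equiv> (%i. real_of_int (ar m 0 i))"
 assumes c: "scon m" and cs: "m 25 = -1" "m 26 = 2 ^ J" "m 17 = int (J + 1)" "m 18 = int (512 * b)"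
  and g: "p < 1 ==> uok u & real NE * eta <= p"
 shows "hoare Search m tS p (%m' q. eqx ({25, 26, 38, 39, 40, 41} \<union> VS) {2, 3, 4, 5} m m' & -1 <= m' 25 & m' 25 <= 2 ^ (J + b + 10) &
  (1 <= q \<or> p < 1 & p - real NE * eta <= q & real_of_int (m' 25) < Min S & Min S - m' 25 < 256 * real b))" (is "hoare _ _ _ _ ?Q")
proof -
 let ?E = "{25, 26, 38, 39, 40, 41} \<union> VS"
 \<comment> \<open>Twice the step size of round \<open>l\<close>, so that \<open>256 b * t l\<close>
   bounds the gap before the round and \<open>256 b * t (Suc l)\<close> after it.\<close>
 define t where "t l = (2::int) ^ (J + 1 - l)" for l
 define pr where "pr l k = p - (real l * real (512 * b) + real k) * (real (b + 1) * eta)" for l k :: nat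
 define I where "I l m' q \<longleftrightarrow> eqx ?E {2, 3, 4, 5} m m' & m' 26 = t l div 2 & -1 <= m' 25 &
  m' 25 + 1 <= 512 * int b * (2 ^ (J + 1) - t l) &
  (1 <= q \<or> p < 1 & pr l 0 <= q & real_of_int (m' 25) < Min S & Min S - m' 25 < 256 * real b * t l)" for l m' q
 define I2 where "I2 l k m' q \<longleftrightarrow> eqx ?E {2, 3, 4, 5} m m' & m' 38 = int l & m' 26 = 2 ^ (J - l) & -1 <= m' 25 &
  m' 25 + 1 <= 512 * int b * (2 ^ (J + 1) - 2 * 2 ^ (J - l)) + int k * 2 ^ (J - l) &
  (1 <= q \<or> p < 1 & pr l k <= q & real_of_int (m' 25) < Min S &
   (Min S - m' 25 < 256 * real b * 2 ^ (J - l) \<or> Min S - m' 25 < (512 * real b - real k) * 2 ^ (J - l)))" for l k m' q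
 have ec: "scon m'" "(%i. real_of_int (ar m' 0 i)) = u" "m' 17 = int (J + 1)" "m' 18 = int (512 * b)" if e: "eqx ?E {2, 3, 4, 5} m m'" for m'
 proof -
  show "scon m'" "(%i. real_of_int (ar m' 0 i)) = u" using scon_eqx[OF e c] by (simp_all add: u_def)
  note R = eqx_reg[OF e]
  show "m' 17 = int (J + 1)" "m' 18 = int (512 * b)" using cs by (simp_all add: R)
 qed
 have etap: "0 < eta" by (rule eta0)
 have bp: "512 * int b * 2 ^ (J + 1) <= 2 ^ (J + b + 10)"
 proof -
  have "b < 2 ^ b" by (rule less_exp)
  hence "int b < int (2 ^ b)" by (simp only: of_nat_less_iff)
  hence "512 * int b * 2 ^ (J + 1) <= 512 * 2 ^ b * 2 ^ (J + 1)" by (intro mult_right_mono) auto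
  also have "... = 2 ^ (J + b + 10)" by (simp add: power_add)
  finally show ?thesis .
 qed
 have JS: "(2::int) ^ (J + b + 10) + 2 ^ J < 2 ^ SB"
 proof -
  have "(2::int) ^ J <= 2 ^ (J + b + 10)" by (rule power_increasing) auto
  hence "(2::int) ^ (J + b + 10) + 2 ^ J <= 2 ^ (J + b + 11)" by (simp add: power_add)
  thus ?thesis by (rule pow2_lt) (use ZBJ sbits b2 in simp)
 qed
 have half: "t l div 2 = 2 ^ (J - l)" "t l = 2 * 2 ^ (J - l)" if "l <= J" for l
  using that by (simp_all add: t_def Suc_diff_le)
 have tS: "t (Suc l) = 2 ^ (J - l)" for l by (simp add: t_def)
 have "hoare Search m ((J + 1) * ((((512 * b) * ((tT + (3 * qS + qS)) + 4 * qS) + 5 * qS) + 2 * qS) + 4 * qS) + 5 * qS) p ?Q"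
  unfolding Search_def
 proof (rule hoare_for[where I = I], goal_cases)
  case (10 k m' q v w xx yy)
  thus ?case unfolding I_def by simp
 next
  case (11 l m' q)
  hence "eqx ?E {2, 3, 4, 5} m m'" unfolding I_def by (rule conjunct1)
  thus ?case using ec(3) by blast
 next
  case 12
  have "1 <= p \<or> p < 1 & pr 0 0 <= p & real_of_int (m 25) < Min S & Min S - m 25 < 256 * real b * t 0"
  proof (cases "1 <= p")
   case False
   have M: "0 <= Min S" "Min S <= 2 ^ J" using S_fin SJ by simp_all
   have tt: "real_of_int (t 0) = 2 * 2 ^ J" by (simp add: t_def)
   have "(1::real) <= 2 ^ J" by simp
   moreover have "1 * (2 * 2 ^ J) < (256 * real b) * (2 * (2::real) ^ J)" using b2 by (intro mult_strict_right_mono) auto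
   ultimately have "Min S + 1 < 256 * real b * t 0" unfolding tt using M by linarith
   thus ?thesis using False M cs by (simp add: pr_def)
  qed simp
  thus ?case unfolding I_def using cs by (simp add: t_def)
 next
  case (13 l m1 q1)
  hence l: "l <= J" "m1 38 = int l" and I1: "I l m1 q1" by auto
  have st1: "I2 l 0 m1 q1" using I1 l half[OF l(1)] unfolding I_def I2_def by auto
  show ?case
  proof (rule hoare_seq[where Q = "I2 l (512 * b)"], goal_cases)
   case 1
   show ?case
   proof (rule hoare_for[where I = "I2 l"], goal_cases)
    case (10 k m' q v w xx yy)
    thus ?case unfolding I2_def by simp
   next
    case (11 k m' q)
    hence "eqx ?E {2, 3, 4, 5} m m'" unfolding I2_def by (rule conjunct1)
    thus ?case using ec(4) by blast
   next
    case (13 k m2 q2)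
    define s where "s = (2::int) ^ (J - l)"
    define y where "y = m2 25"
    have kk: "k < 512 * b" "m2 40 = int k" using 13 by auto
    have e2: "eqx ?E {2, 3, 4, 5} m m2" and r2: "m2 38 = int l" "m2 26 = s" "-1 <= y" "m2 25 = y"
     "y + 1 <= 512 * int b * (2 ^ (J + 1) - 2 * s) + int k * s"
     and P2: "1 <= q2 \<or> p < 1 & pr l k <= q2 & real_of_int y < Min S &
   (Min S - y < 256 * real b * s \<or> Min S - y < (512 * real b - real k) * s)"
     using 13(3) unfolding I2_def s_def y_def by auto
    have s: "0 < s" "s <= 2 ^ J" by (auto simp: s_def intro: power_increasing)
    have yb: "y <= 2 ^ (J + b + 10)"
    proof -
     have "int k * s <= 512 * int b * s" using kk s by (intro mult_right_mono) auto
     moreover have "512 * int b * (2 ^ (J + 1) - 2 * s) = 512 * int b * 2 ^ (J + 1) - 2 * (512 * int b * s)" by (simp add: algebra_simps)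
     ultimately have "y <= 512 * int b * 2 ^ (J + 1) - 512 * int b * s" using r2(5) by linarith
     moreover have "0 <= 512 * int b * s" using s by simp
     ultimately show ?thesis using bp by linarith
    qed
    have NEb: "(real l * real (512 * b) + real k) * (real (b + 1) * eta) + real (b + 1) * eta <= real NE * eta"
    proof -
     have "l * (512 * b) <= J * (512 * b)" using l by (intro mult_right_mono) auto
     hence "l * (512 * b) + k + 1 <= J * (512 * b) + 512 * b" using kk by linarith
     hence "l * (512 * b) + k + 1 <= (J + 1) * (512 * b)" by simp
     hence "real (l * (512 * b) + k + 1) <= real ((J + 1) * (512 * b))" by (simp only: of_nat_le_iff)
     hence "real (l * (512 * b) + k + 1) * (real (b + 1) * eta) <= real ((J + 1) * (512 * b)) * (real (b + 1) * eta)"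
      using etap by (intro mult_right_mono) auto
     thus ?thesis by (simp add: NE_def algebra_simps)
    qed
    note c2 = ec[OF e2]
    have gT: "uok (%i. real_of_int (ar m2 0 i)) & real_of_int (m2 25) < Min S & real (b + 1) * eta <= q2" if "q2 < 1"
    proof -
     have a: "p < 1" "pr l k <= q2" "real_of_int y < Min S" using P2 that by auto
     show ?thesis unfolding c2(2) r2 using g[OF a(1)] a NEb by (auto simp: pr_def)
    qed
    show ?case
    proof (rule hoare_seq[where Q = "%m' q. eqx VS {2, 3, 4, 5} m2 m' &
     (1 <= q \<or> q2 < 1 & q2 - real (b + 1) * eta <= q &
      (if 0 < m' 58 then real_of_int s < Min S - y else Min S - y < 256 * real b * s))"], goal_cases)
     case 1
     show ?case by (rule hoare_mono[OF Test_spec[OF c2(1) _ _ _ _ gT]]) (use r2 s yb in auto)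
    next
     case (2 m3 q3)
     hence e3: "eqx VS {2, 3, 4, 5} m2 m3" and P3: "1 <= q3 \<or> q2 < 1 & q2 - real (b + 1) * eta <= q3 &
      (if 0 < m3 58 then real_of_int s < Min S - y else Min S - y < 256 * real b * s)" by auto
     have e3': "eqx ?E {2, 3, 4, 5} m m3" by (rule eqx_tr[OF e2 e3]) auto
     note R3 = eqx_reg[OF e3]
     have r3: "m3 38 = int l" "m3 26 = s" "m3 25 = y" "m3 40 = int k" using r2 kk by (simp_all add: R3)
     have prS: "pr l (Suc k) = pr l k - real (b + 1) * eta" by (simp add: pr_def algebra_simps)
     have P4: "p < 1 & pr l (Suc k) <= q3 & real_of_int y < Min S &
      (Min S - y < 256 * real b * s \<or> Min S - y < (512 * real b - real k) * s) &
      (if 0 < m3 58 then real_of_int s < Min S - y else Min S - y < 256 * real b * s)" if "~ 1 <= q3"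
      using P2 P3 that prS by auto
     have fin: "I2 l (Suc k) m' q3" if h: "eqx ?E {2, 3, 4, 5} m m'" "m' 38 = int l" "m' 26 = s" "m' 25 = (if 0 < m3 58 then y + s else y)" for m'
     proof -
      have 1: "m' 25 + 1 <= 512 * int b * (2 ^ (J + 1) - 2 * s) + int (Suc k) * s" "-1 <= m' 25"
       using h(4) r2 s by (auto simp: algebra_simps)
      have 2: "1 <= q3 \<or> p < 1 & pr l (Suc k) <= q3 & real_of_int (m' 25) < Min S &
       (Min S - m' 25 < 256 * real b * s \<or> Min S - m' 25 < (512 * real b - real (Suc k)) * s)"
      proof (cases "1 <= q3")
       case False
       note P = P4[OF False]
       have sp: "0 < real_of_int s" using s by simp
       show ?thesis
       proof (cases "0 < m3 58")
        case True
        thus ?thesis using P h(4) sp by (auto simp: algebra_simps)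
       next
        case F: False
        thus ?thesis using P h(4) by auto
       qed
      qed simp
      show ?thesis unfolding I2_def using h 1 2 unfolding s_def by simp
     qed
     have "hoare (If 58 (Ops [OAdd 25 25 26]) (Ops [])) m3 (rq 58 + 2 * qS + qS) q3 (%m' q. m' 40 = int k & I2 l (Suc k) m' q)"
     proof (rule hoare_if, goal_cases)
      case 1
      have "\<bar>y + s\<bar> < 2 ^ SB" using yb r2 s JS by linarith
      moreover have "I2 l (Suc k) (m3(25 := y + s)) q3" by (rule fin) (use e3' r3 1 in simp_all)
      ultimately show ?case by (intro hoare_ops) (use r3 in \<open>simp_all add: wok_def rq2_def\<close>)
     next
      case 2
      have "I2 l (Suc k) (m3(59 := 1)) q3" by (rule fin) (use e3' r3 2 in simp_all)
      thus ?case by (intro hoare_ops) (use r3 in simp_all)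
     qed
     thus ?case by (simp add: rq_def)
    qed
   qed (use st1 in simp_all)
  next
   case (2 m2 q2)
   define s where "s = (2::int) ^ (J - l)"
   have e2: "eqx ?E {2, 3, 4, 5} m m2" and r2: "m2 38 = int l" "m2 26 = s" "-1 <= m2 25"
     "m2 25 + 1 <= 512 * int b * (2 ^ (J + 1) - 2 * s) + int (512 * b) * s"
    and P2: "1 <= q2 \<or> p < 1 & pr l (512 * b) <= q2 & real_of_int (m2 25) < Min S &
     (Min S - m2 25 < 256 * real b * s \<or> Min S - m2 25 < (512 * real b - real (512 * b)) * s)"
    using 2(2) unfolding I2_def s_def by auto
   have s: "0 < s" "s <= 2 ^ J" by (auto simp: s_def intro: power_increasing)
   have "(2::int) ^ J < 2 ^ SB" using JS by (smt (verit) zero_le_power)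
   hence sS: "\<bar>s div 2\<bar> < 2 ^ SB" using s by linarith
   have prS: "pr (Suc l) 0 = pr l (512 * b)" by (simp add: pr_def algebra_simps)
   have "I (Suc l) (m2(50 := 2, 26 := s div 2)) q2"
    unfolding I_def tS prS s_def[symmetric] using e2 r2 P2 by (auto simp: algebra_simps)
   thus ?case by (intro hoare_ops) (use sS r2 in \<open>simp_all add: wok_def rq2_def\<close>)
  qed
 next
  case (14 m' q)
  have t1: "t (J + 1) = 1" by (simp add: t_def)
  have NEe: "pr (J + 1) 0 = p - real NE * eta" by (simp add: pr_def NE_def algebra_simps)
  have "m' 25 + 1 <= 512 * int b * 2 ^ (J + 1)" using 14(2) unfolding I_def t1 by (auto simp: algebra_simps)
  hence "m' 25 <= 2 ^ (J + b + 10)" using bp by linarith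
  thus ?case using 14(2) unfolding I_def t1 NEe by auto
 qed (use cs in simp_all)
 thus ?thesis
 proof (rule hoare_mono, goal_cases)
  case 1
  have "(512 * b) * ((tT + (3 * qS + qS)) + 4 * qS) + 5 * qS + 2 * qS + 4 * qS <= (512 * b + 2) * (tT + 20 * qS)"
   by (simp add: algebra_simps)
  hence "(J + 1) * ((((512 * b) * ((tT + (3 * qS + qS)) + 4 * qS) + 5 * qS) + 2 * qS) + 4 * qS) <= (J + 1) * ((512 * b + 2) * (tT + 20 * qS))"
   by (rule mult_left_mono) simp
  moreover have "5 * qS <= (512 * b + 2) * (tT + 20 * qS)" by (simp add: algebra_simps)
  ultimately show ?case by (simp add: tS_def algebra_simps)
 qed simp_all
qed

end

section \<open>The program\<close>

text \<open>With \<open>P = 2 ^ s\<close>, the square of \<open>P l\<close> exceeds \<open>y\<close>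
  by less than \<open>256 b\<close>, so the integer root misses \<open>P l\<close> by less than
  \<open>256 b + 1\<close>, and truncating \<delta> costs less than 1. All errors point downwards,
  and \<open>s\<close> is chosen so that \<open>257 b / P\<close> is at most
  \<open>\<epsilon> / 2\<close> times the maximum, which is at least
  \<open>1 / 2 ^ (b cc)\<close>.\<close>

lemma output_accuracy:
 fixes b s cc :: nat and \<epsilon> \<delta> l :: real and R y :: int
 assumes b: "2 <= b" and s: "s = (cc + 20) * b" and e: "0 < \<epsilon>" "\<epsilon> < 1" "1 <= \<epsilon> * 2 ^ b"
  and d: "1 / 2 ^ (b * cc) <= \<delta>" and l: "0 <= l" and R: "0 <= R" "R * R <= max 0 y" "y < (R + 1) * (R + 1)"
  and y: "real_of_int y < (2 ^ s * l)\<^sup>2" "(2 ^ s * l)\<^sup>2 - y < 256 * real b"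
 shows "approx_eps \<epsilon> (real_of_int (max R \<lfloor>\<delta> * 2 ^ s\<rfloor>) / 2 ^ s) (max \<delta> l)"
proof -
 define P :: real where "P = 2 ^ s"
 define D where "D = \<lfloor>\<delta> * P\<rfloor>"
 define v where "v = real_of_int (max R D) / P"
 define M where "M = max \<delta> l"
 have P0: "0 < P" by (simp add: P_def)
 have d0: "0 < \<delta>" using d by (rule less_le_trans[rotated]) simp
 have M0: "0 < M" "1 / 2 ^ (b * cc) <= M" using d d0 by (auto simp: M_def)
 have RP: "real_of_int R <= P * l"
 proof -
  have "real_of_int (R * R) <= real_of_int (max 0 y)" using R by (simp only: of_int_le_iff)
  also have "... <= (P * l)\<^sup>2" using y unfolding P_def by (simp add: max_def)
  finally have "(real_of_int R)\<^sup>2 <= (P * l)\<^sup>2" by (simp add: power2_eq_square)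
  thus ?thesis by (rule power2_le_imp_le) (use P0 l in simp)
 qed
 have D1: "real_of_int D <= \<delta> * P" "\<delta> * P < real_of_int D + 1" unfolding D_def by linarith+
 have up: "v <= M"
 proof -
  have "real_of_int (max R D) <= M * P"
  proof (cases "R <= D")
   case True
   have "\<delta> * P <= M * P" using P0 by (intro mult_right_mono) (auto simp: M_def)
   thus ?thesis using True D1 by (simp add: max_def)
  next
   case False
   have "l * P <= M * P" using P0 by (intro mult_right_mono) (auto simp: M_def)
   thus ?thesis using False RP by (simp add: max_def mult.commute)
  qed
  thus ?thesis using P0 by (simp add: v_def field_simps)
 qed
 \<comment> \<open>Otherwise the square of \<open>R + 1 + 256 b\<close> would be below that of
   \<open>R + 1\<close> plus \<open>256 b\<close>, although the cross term alone is at least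
   \<open>256 b\<close>.\<close>
 have Rl: "P * l < real_of_int R + 1 + 256 * real b"
 proof (rule ccontr)
  assume "~ ?thesis"
  hence "real_of_int R + 1 + 256 * real b <= P * l" by simp
  hence "(real_of_int R + 1 + 256 * real b)\<^sup>2 <= (P * l)\<^sup>2" using R by (intro power_mono) auto
  also have "... < y + 256 * real b" using y(2) unfolding P_def by linarith
  also have "real_of_int y <= (real_of_int R + 1)\<^sup>2"
  proof -
   have "real_of_int y <= real_of_int ((R + 1) * (R + 1))" using R by (simp only: of_int_le_iff)
   thus ?thesis by (simp add: power2_eq_square)
  qed
  finally have "(real_of_int R + 1 + 256 * real b)\<^sup>2 < (real_of_int R + 1)\<^sup>2 + 256 * real b" by simp
  moreover have "(real_of_int R + 1 + 256 * real b)\<^sup>2 = (real_of_int R + 1)\<^sup>2 + 2 * (real_of_int R + 1) * (256 * real b) + (256 * real b)\<^sup>2"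
   by (simp add: power2_eq_square algebra_simps)
  moreover have "256 * real b <= 2 * (real_of_int R + 1) * (256 * real b)"
  proof -
   have "1 * (256 * real b) <= 2 * (real_of_int R + 1) * (256 * real b)" using R by (intro mult_right_mono) auto
   thus ?thesis by simp
  qed
  moreover have "0 <= (256 * real b)\<^sup>2" by simp
  ultimately show False by linarith
 qed
 have "M * P < real_of_int (max R D) + 257 * real b"
 proof -
  have "1 <= real b" using b by simp
  moreover have "real_of_int R <= real_of_int (max R D)" "real_of_int D <= real_of_int (max R D)" by simp_all
  ultimately have "\<delta> * P < real_of_int (max R D) + 257 * real b" "P * l < real_of_int (max R D) + 257 * real b" using D1 Rl by linarith+
  thus ?thesis by (simp add: M_def max_def mult.commute)
 qed
 hence lo: "M - 257 * real b / P <= v" using P0 by (simp add: v_def field_simps)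
 have sm: "257 * real b / P <= M * (\<epsilon> / 2)"
 proof -
  have "b < 2 ^ b" by (rule less_exp)
  hence "real b < real (2 ^ b)" by (simp only: of_nat_less_iff)
  hence "real b < 2 ^ b" by simp
  hence "257 * real b <= 512 * 2 ^ b" using zero_less_power[of "2::real" b] by linarith
  also have "... = 2 ^ (9 + b)" by (simp add: power_add)
  finally have 1: "257 * real b <= 2 ^ (9 + b)" .
  \<comment> \<open>The summands account for \<open>257 b\<close>, the lower bound of \<delta>, the
    accuracy \<epsilon>, and the factor \<open>1 / 2\<close>.\<close>
  have "(9 + b) + b * cc + b + 1 <= s" using b unfolding s by (simp add: algebra_simps)
  hence "(2::real) ^ ((9 + b) + b * cc + b + 1) <= P" unfolding P_def by (intro power_increasing) auto
  hence 2: "2 ^ (9 + b) * 2 ^ (b * cc) * 2 ^ b * 2 <= P" by (simp only: power_add power_one_right)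
  have "257 * real b / P <= 2 ^ (9 + b) / (2 ^ (9 + b) * 2 ^ (b * cc) * 2 ^ b * 2)" using 1 2 P0 by (intro frac_le) auto
  also have "... = 1 / 2 ^ (b * cc) * (1 / 2 ^ b / 2)" by simp
  also have "... <= M * (\<epsilon> / 2)" using M0 e by (intro mult_mono) (auto simp: field_simps)
  finally show ?thesis .
 qed
 have ex: "exp (- \<epsilon>) <= 1 - \<epsilon> / 2"
 proof -
  have "exp (- \<epsilon>) = 1 / exp \<epsilon>" by (simp add: exp_minus inverse_eq_divide)
  also have "... <= 1 / (1 + \<epsilon>)" using exp_ge_add_one_self[of \<epsilon>] e by (intro divide_left_mono) auto
  also have "... <= 1 - \<epsilon> / 2"
  proof -
   have "\<epsilon> * \<epsilon> <= \<epsilon> * 1" using e by (intro mult_left_mono) auto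
   hence "1 <= (1 - \<epsilon> / 2) * (1 + \<epsilon>)" by (simp add: algebra_simps)
   thus ?thesis using e by (simp add: field_simps)
  qed
  finally show ?thesis .
 qed
 have lo2: "exp (- \<epsilon>) * M <= v"
 proof -
  have "exp (- \<epsilon>) * M <= (1 - \<epsilon> / 2) * M" using ex M0 by (intro mult_right_mono) auto
  also have "... = M - M * (\<epsilon> / 2)" by (simp add: algebra_simps)
  finally show ?thesis using lo sm by linarith
 qed
 have "0 < exp (- \<epsilon>) * M" using M0 by simp
 hence v0: "0 < v" using lo2 by linarith
 have "1 * M <= exp \<epsilon> * M" using e M0 by (intro mult_right_mono) auto
 hence "v <= exp \<epsilon> * M" using up by simp
 thus ?thesis using v0 M0 lo2 unfolding approx_eps_def P_def[symmetric] D_def[symmetric] v_def[symmetric] M_def[symmetric] by simp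
qed

section \<open>Failure probability of one evaluation\<close>

context alg2
begin

text \<open>As \<open>rho ^ (8 B) <= exp (-1) <= 1 / 2\<close>, every \<open>8 B\<close> trials gain
  a bit: \<open>NB\<close> bits pay for the initial potential and \<open>x\<close> bits
  remain.\<close>

lemma eta_le:
 assumes "T = 8 * B * (NB + x)"
 shows "eta <= 1 / 2 ^ x"
proof -
 have B0: "0 < real B" using B1 by simp
 have r: "rho ^ (8 * B) <= 1 / 2"
 proof -
  have "rho <= exp (- (1 / (8 * real B)))" unfolding rho_def using exp_ge_add_one_self[of "- (1 / (8 * real B))"] by simp
  hence "rho ^ (8 * B) <= exp (- (1 / (8 * real B))) ^ (8 * B)" using rho by (intro power_mono) auto
  also have "... = exp (- 1)" using B0 by (simp add: exp_of_nat_mult[symmetric])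
  also have "... <= 1 / 2"
  proof -
   have "2 <= exp (1::real)" using exp_ge_add_one_self[of 1] by simp
   thus ?thesis by (simp add: exp_minus field_simps)
  qed
  finally show ?thesis .
 qed
 have "rho ^ T = (rho ^ (8 * B)) ^ (NB + x)" unfolding assms by (simp add: power_mult)
 also have "... <= (1 / 2) ^ (NB + x)" using r rho by (intro power_mono) auto
 finally have "eta <= 2 ^ NB * (1 / 2) ^ (NB + x)" unfolding eta_def by (intro mult_left_mono) auto
 also have "... = 1 / 2 ^ x" by (simp add: power_add power_one_over)
 finally show ?thesis .
qed

text \<open>The modulus drawn is \<open>v + 1\<close>, so a good prime \<open>p\<close> corresponds
  to the draw \<open>p - 1\<close>; the hypothesis \<open>cap\<close> keeps enough primes outside
  the divisors of \<open>G\<close> and of \<open>Y\<close>.\<close>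

lemma uok_generic:
 assumes g: "generic u" and u: "!!i. i < n ==> u i \<in> \<int> & \<bar>u i\<bar> <= 2 ^ K"
  and J: "!!i. i < n ==> (\<Sum>j<n. \<bar>mr i j\<bar>) <= 2 ^ J" and nb: "n <= 2 ^ b"
  and cap: "4 * B * (n * n * (b + 2 * n * J + 2 * K) + NB) <= 2 ^ B"
 shows "uok u"
proof -
 interpret L: lanczos n mr u by (rule lz)
 obtain G :: nat where G: "G > 0" "G <= 2 ^ (n * n * (b + 2 * n * J + 2 * K))"
  "!!p k r. prime p ==> ~ p dvd G ==> k < card S ==> rl (int p) (L.h (Suc k)) r ==> ~ int p dvd r"
  using L.bad_numbers[where d = "card S" and J = J and K = K and b = b] u J nb S_fin(3) generic_krylov(1)[OF g]
  by (auto simp: mr_def)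
 have "2 ^ B <= 4 * B * card {v. v < (2::nat) ^ B & gm (int v + 1) u & ~ (int v + 1) dvd Y}" if Y: "1 <= Y" "Y < 2 ^ NB" for Y :: int
 proof -
  define M where "M = nat Y"
  have M: "0 < M" "M <= 2 ^ NB" "int M = Y" using Y by (auto simp: M_def nat_le_iff)
  let ?P = "{p. prime p & p <= 2 ^ B & ~ p dvd G & ~ p dvd M}"
  let ?V = "{v. v < (2::nat) ^ B & gm (int v + 1) u & ~ (int v + 1) dvd Y}"
  have 1: "2 ^ B / (4 * real B) <= real (card ?P)"
   by (rule good_prime_count[OF B1 G(1,2) M(1,2) cap])
  have "card ?P <= card ?V"
  proof (rule card_inj_on_le[where f = "%p. p - 1"])
   show "inj_on (%p. p - 1) ?P"
   proof (rule inj_onI)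
    fix p q :: nat assume "p \<in> ?P" "q \<in> ?P" "p - 1 = q - 1"
    moreover have "1 <= p" "1 <= q" using calculation prime_ge_1_nat by auto
    ultimately show "p = q" by linarith
   qed
   show "(%p. p - 1) ` ?P \<subseteq> ?V"
   proof
    fix v assume "v \<in> (%p. p - 1) ` ?P"
    then obtain p where p: "prime p" "p <= 2 ^ B" "~ p dvd G" "~ p dvd M" "v = p - 1" by auto
    have p1: "1 <= p" using p prime_ge_1_nat by blast
    hence ip: "int v + 1 = int p" using p by (simp add: of_nat_diff)
    have "gm (int p) u" unfolding gm_def using p(1) G(3)[OF p(1,3)] by auto
    moreover have "~ int p dvd Y" using p(4) unfolding M(3)[symmetric] by (simp only: int_dvd_int_iff not_False_eq_True)
    ultimately show "v \<in> ?V" using p p1 ip by auto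
   qed
   show "finite ?V" by simp
  qed
  hence "2 ^ B / (4 * real B) <= real (card ?V)" using 1 by linarith
  hence "real (2 ^ B) <= real (4 * B * card ?V)" using B1 by (simp add: field_simps)
  thus ?thesis by (simp only: of_nat_le_iff)
 qed
 thus ?thesis using g by (auto simp: uok_def)
qed

end

section \<open>Parameter computation and output\<close>

context ram
begin

lemma stage:
 assumes ops: "hoare (Ops os) m t p (%m' q. q = p & eqx {50, 51} {} m m' & m' 50 = int N)" and N: "N < SB" and r: "8 <= r" "r < 48"
 shows "hoare (Ops os ;; Pow r 50) m (t + (N + 2) * (6 * qB)) p
  (%m' q. q = p & eqx {r, 48, 49, 50, 51, 59, 60} {} m m' & m' r = 2 ^ N)"
proof (rule hoare_seq[OF ops], goal_cases)
 case (1 m1 q1)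
 show ?case
 proof (rule hoare_mono[OF Pow_spec[where N = N and m = m1 and p = q1]], goal_cases)
  case (13 m' q)
  thus ?case using 1 by (auto intro: eqx_tr[OF eqx_mono[of "{50, 51}" "{}" m m1]])
 qed (use 1 N r in auto)
qed

text \<open>All parameters are computed from \<open>b\<close> and \<open>n\<close> with coefficients
  fixed by \<open>cc\<close>, so that a single program serves every input.\<close>

definition Consts :: "nat => op list" where
 "Consts cc = [OC 50 (int cc + 20), OMul 12 50 11, OC 50 (2 * int cc + 40), OMul 14 50 11, OC 50 (int cc + 3), OMul 16 50 11,
  OC 50 (2 * int cc + 42), OMul 17 50 11, OC 51 1, OAdd 17 17 51, OC 50 512, OMul 18 50 11, OC 50 8, OMul 19 50 11, OAdd 24 11 51,
  OC 50 (2 * int cc + 60), OMul 52 50 11, OMul 52 52 9, OC 51 2, OAdd 23 52 14, OAdd 23 23 51,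
  OC 50 (3 * int cc + 40), OMul 50 50 11, OAdd 50 50 52, OC 51 8, OMul 15 14 51, OMul 15 15 50, OC 25 (-1)]"

definition Setup :: "nat => com" where
 "Setup cc = Ops (Consts cc) ;; Pow 4 52 ;; (Ops [OC 50 3, OMul 50 50 11] ;; Pow 20 50) ;; (Ops [OC 50 24, OMul 50 50 11] ;; Pow 21 50) ;;
  (Ops [OAdd 50 12 12] ;; Pow 13 50) ;; (Ops [OC 51 1, OSub 50 17 51] ;; Pow 26 50)"

definition Out :: com where
 "Out = Isqrt ;; Delta ;; Pow 52 12 ;; Ops [OSub 50 55 54] ;; If 50 (Ops [OC 0 0, OAdd 0 0 55]) (Ops [OC 0 0, OAdd 0 0 54]) ;;
  Ops [OC 1 0, OAdd 1 1 52]"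

lemma Out_spec:
 fixes dl sg J :: nat and \<delta> :: real
 assumes X: "X 0 2 = \<lfloor>\<delta>\<rfloor>" "!!k. X 5 k = frac_bit \<delta> k" and d: "0 <= \<delta>" "\<delta> < 2 ^ dl" and s: "sg + dl + 2 < SB" "m 12 = int sg"
  and J: "m 17 = int (J + 1)" "2 * J + 8 < SB" and y: "-1 <= m 25" "m 25 < 2 ^ (2 * J + 2)"
 shows "hoare Out m ((J + sg + 6) * (60 * qB)) p (%m' q. q = p & (\<exists>R. 0 <= R & R * R <= max 0 (m 25) & m 25 < (R + 1) * (R + 1) &
  m' 0 = max R \<lfloor>\<delta> * 2 ^ sg\<rfloor> & m' 1 = 2 ^ sg))"
proof -
 define D where "D = \<lfloor>\<delta> * 2 ^ sg\<rfloor>"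
 have D: "0 <= D" "D < 2 ^ (SB - 1)"
 proof -
  show "0 <= D" using d by (simp add: D_def)
  have "\<delta> * 2 ^ sg < 2 ^ dl * 2 ^ sg" using d by (intro mult_strict_right_mono) auto
  also have "... = 2 ^ (dl + sg)" by (simp add: power_add)
  also have "... <= 2 ^ (SB - 1)" using s by (intro power_increasing) auto
  finally show "D < 2 ^ (SB - 1)" unfolding D_def by (simp add: floor_less_iff)
 qed
 have SBs: "(2::int) ^ SB = 2 * 2 ^ (SB - 1)" using s by (cases SB) auto
 have BBs: "(2::int) ^ SB <= 2 ^ BB" using SB by (intro power_increasing) auto
 have sgB: "(2::int) ^ sg < 2 ^ SB" using s by (intro power_strict_increasing) auto
 have Js: "(2::int) ^ (J + 1) <= 2 ^ (SB - 1)" using J by (intro power_increasing) auto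
 have "hoare Out m ((J + 3) * (40 * qB) + ((sg + 1) * (20 * qS) + ((sg + 2) * (6 * qB) + (qB + ((qB + 2 * qB + 2 * qB) + 2 * qB))))) p
  (%m' q. q = p & (\<exists>R. 0 <= R & R * R <= max 0 (m 25) & m 25 < (R + 1) * (R + 1) &
  m' 0 = max R D & m' 1 = 2 ^ sg))"
  unfolding Out_def
 proof (rule hoare_seq[OF Isqrt_spec[OF J y]], goal_cases)
  case (1 m1 q1)
  define R where "R = m1 55"
  have m1: "q1 = p" "0 <= R" "R < 2 ^ (J + 1)" "R * R <= max 0 (m 25)" "m 25 < (R + 1) * (R + 1)"
   and e1: "eqx {26, 38, 39, 48, 49, 50, 51, 53, 55, 59, 60} {} m m1" using 1 by (auto simp: R_def)
  have s1: "m1 12 = int sg" using eqx_reg[OF e1, of 12] s by simp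
  have hD: "hoare Delta m1 ((sg + 1) * (20 * qS)) q1 (%m' q. q = q1 & eqx {48, 49, 50, 53, 54, 59, 60} {} m1 m' & m' 54 = \<lfloor>\<delta> * 2 ^ sg\<rfloor>)"
   by (rule Delta_spec[where dl = dl]) (use X d s s1 in auto)
  show ?case
  proof (rule hoare_seq[OF hD], goal_cases)
   case (1 m2 q2)
   hence e2: "eqx {48, 49, 50, 53, 54, 59, 60} {} m1 m2" and m2: "q2 = p" "m2 54 = D" using m1 by (auto simp: D_def)
   note R2 = eqx_reg[OF e2]
   have r2: "m2 12 = int sg" "m2 55 = R" using s1 by (simp_all add: R2 R_def)
   show ?case
   proof (rule hoare_seq[where Q = "%m' q. q = p & m' 52 = 2 ^ sg & m' 55 = R & m' 54 = D"], goal_cases)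
    case 1
    show ?case
    proof (rule hoare_mono[OF Pow_spec[where N = sg and m = m2 and p = q2]], goal_cases)
     case (13 m' q)
     hence e: "eqx {52, 48, 49, 59, 60} {} m2 m'" by simp
     show ?case using 13 m2 r2 eqx_reg[OF e] by simp
    qed (use r2 s in simp_all)
   next
    case (2 m3 q3)
    hence m3: "q3 = p" "m3 52 = 2 ^ sg" "m3 55 = R" "m3 54 = D" by auto
    have bs: "\<bar>R - D\<bar> < 2 ^ SB" "\<bar>R\<bar> < 2 ^ BB" "\<bar>D\<bar> < 2 ^ BB" "\<bar>(2::int) ^ sg\<bar> < 2 ^ BB" "(0::int) < 2 ^ BB"
    proof -
     show "\<bar>R - D\<bar> < 2 ^ SB" "\<bar>R\<bar> < 2 ^ BB" "\<bar>D\<bar> < 2 ^ BB" using m1 D Js SBs BBs by linarith+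
     show "\<bar>(2::int) ^ sg\<bar> < 2 ^ BB" using sgB BBs by simp
    qed simp
    show ?case
    proof (rule hoare_seq[where Q = "%m' q. q = p & m' 52 = 2 ^ sg & m' 55 = R & m' 54 = D & m' 50 = R - D"], goal_cases)
     case 1
     show ?case by (rule hoare_ops) (use m3 bs rq2_le in \<open>simp_all add: wok_def\<close>)
    next
     case (2 m4 q4)
     hence m4: "q4 = p" "m4 52 = 2 ^ sg" "m4 55 = R" "m4 54 = D" "m4 50 = R - D" by auto
     show ?case
     proof (rule hoare_seq[where Q = "%m' q. q = p & m' 52 = 2 ^ sg & m' 0 = max R D"], goal_cases)
      case 1
      have "hoare (If 50 (Ops [OC 0 0, OAdd 0 0 55]) (Ops [OC 0 0, OAdd 0 0 54])) m4 (rq 50 + 2 * qS + 2 * qB) q4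
       (%m' q. q = p & m' 52 = 2 ^ sg & m' 0 = max R D)"
      proof (rule hoare_if, goal_cases)
       case 1
       hence "max R D = R" using m4 by simp
       thus ?case by (intro hoare_ops) (use m4 bs rq2_le in \<open>simp_all add: wok_def rq2_def\<close>)
      next
       case 2
       hence "max R D = D" using m4 by simp
       thus ?case by (intro hoare_ops) (use m4 bs rq2_le in \<open>simp_all add: wok_def rq2_def\<close>)
      qed
      thus ?case by (rule hoare_mono) (use rq2_le in \<open>simp_all add: rq_def\<close>)
     next
      case (2 m5 q5)
      hence m5: "q5 = p" "m5 52 = 2 ^ sg" "m5 0 = max R D" by auto
      show ?case
      proof (rule hoare_ops, goal_cases)
       case 1
       show ?case using m5 bs by (simp add: wok_def)
      next
       case 2
       show ?case using rq2_le by (simp add: rq2_def)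
      next
       case 3
       show ?case using m5 m1 by (auto intro!: exI[of _ R])
      qed
     qed
    qed
   qed
  qed
 qed
 thus ?thesis
 proof (rule hoare_mono, goal_cases)
  case 1
  have "(sg + 1) * (20 * qS) <= (sg + 1) * (20 * qB)" using rq2_le(3) by (intro mult_left_mono) auto
  thus ?case using rq2_le(3) by (simp add: algebra_simps)
 next
  case (3 m' q)
  thus ?case unfolding D_def by simp
 qed simp
qed

end

section \<open>Composition of the program and division of its budget\<close>

context alg4
begin

lemma Setup_spec:
 fixes cc dl :: nat
 assumes par: "sg = (cc + 20) * b" "B = (2 * cc + 40) * b" "K = (cc + 3) * b" "J = (2 * cc + 42) * b" "ZB = (2 * cc + 60) * b"
  "T = 8 * B * (NB + (3 * cc + 40) * b)" and Hb: "(20 * cc + 600) * b <= SB" and cap: "4 * B * NB <= 2 ^ B"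
  and m: "m 9 = int n" "m 10 = int z" "m 11 = int b"
 shows "hoare (Setup cc) m ((NB + 4 * SB + 50) * (8 * qB)) p (%m' q. q = p & m' 9 = int n & m' 10 = int z & m' 13 = sc &
  m' 4 = 2 ^ NB & m' 14 = int B & m' 15 = int T & m' 23 = int (NB + B + 2) & m' 19 = int (8 * b) & m' 21 = 2 ^ (24 * b) &
  m' 11 = int b & m' 24 = int (b + 1) & m' 20 = 2 ^ (3 * b) & m' 25 = -1 & m' 26 = 2 ^ J & m' 17 = int (J + 1) & m' 18 = int (512 * b) &
  m' 16 = int K & m' 12 = int sg)"
proof -
 define k0 where "k0 m' \<longleftrightarrow> m' 9 = int n & m' 10 = int z & m' 14 = int B & m' 15 = int T & m' 23 = int (NB + B + 2) & m' 19 = int (8 * b) &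
  m' 11 = int b & m' 24 = int (b + 1) & m' 25 = -1 & m' 17 = int (J + 1) & m' 18 = int (512 * b) & m' 16 = int K & m' 12 = int sg" for m' :: memory
 have k0e: "k0 m'" if "eqx {4, 13, 20, 21, 26, 48, 49, 50, 51, 59, 60} {} m1 m'" "k0 m1" for m1 m'
  using that(2) by (simp add: k0_def eqx_reg[OF that(1)])
 have SBp: "x < 2 ^ SB" if "x <= SB" for x :: nat by (rule le_less_trans[OF that less_exp])
 have SBi: "int x < 2 ^ SB" if "x <= SB" for x :: nat
 proof -
  have "int x < int (2 ^ SB)" using SBp[OF that] by (simp only: of_nat_less_iff)
  thus ?thesis by simp
 qed
 have b1: "k * 1 <= k * b" for k :: nat using b2 by (intro mult_left_mono) auto
 have lin: "k * b <= SB" "k <= SB" if "k <= 20 * cc + 600" for k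
 proof -
  have "k * b <= (20 * cc + 600) * b" using that by (intro mult_right_mono) auto
  thus kb: "k * b <= SB" by (rule order_trans[OF _ Hb])
  have "k * 1 <= SB" by (rule order_trans[OF b1 kb])
  thus "k <= SB" by simp
 qed
 have bigN: "NB + B + 4 <= 2 ^ B" by (rule nbB)
 have BSB: "(2::nat) ^ B < 2 ^ SB" using sbits b2 by (intro power_strict_increasing) auto
 \<comment> \<open>The hypothesis \<open>cap\<close> bounds \<open>B * NB\<close> by a power of two,
   which makes even the number of trials a short integer.\<close>
 have Tb: "T < 2 ^ SB" "NB + (3 * cc + 40) * b < 2 ^ SB" "8 * B < 2 ^ SB" "NB + B + 2 < 2 ^ SB"
 proof -
  have "(3 * cc + 40) * b <= 2 * B" unfolding par(2) by (simp add: algebra_simps)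
  hence "8 * B * (NB + (3 * cc + 40) * b) <= 8 * B * (NB + 2 * B)" by (intro mult_left_mono) auto
  also have "... = 2 * (4 * B * NB) + 16 * (B * B)" by (simp add: algebra_simps)
  also have "... <= 2 * 2 ^ B + 16 * (2 ^ B * 2 ^ B)" using cap less_exp[of B] by (intro add_mono mult_mono) auto
  also have "... <= 2 * (2 ^ B * 2 ^ B) + 16 * (2 ^ B * 2 ^ B)" by (intro add_right_mono mult_left_mono) auto
  also have "... <= 32 * (2 ^ B * 2 ^ B)" by simp
  also have "... = 2 ^ (5 + B + B)" unfolding power_add by simp
  also have "... < 2 ^ SB" using sbits b2 by (intro power_strict_increasing) auto
  finally show TT: "T < 2 ^ SB" unfolding par(6) .
  define y where "y = NB + (3 * cc + 40) * b"
  have TT': "8 * B * y < 2 ^ SB" using TT unfolding par(6) y_def .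
  have y1: "1 <= y" using NB1 by (simp add: y_def)
  have "1 * y <= 8 * B * y" using B1 by (intro mult_right_mono) auto
  hence "y < 2 ^ SB" using TT' by linarith
  thus "NB + (3 * cc + 40) * b < 2 ^ SB" unfolding y_def .
  have "8 * B * 1 <= 8 * B * y" using y1 by (intro mult_left_mono) auto
  thus "8 * B < 2 ^ SB" using TT' by linarith
  show "NB + B + 2 < 2 ^ SB" using bigN BSB by linarith
 qed
 have Zi: "int k < 2 ^ SB" if "k < 2 ^ SB" for k :: nat
 proof -
  have "int k < int (2 ^ SB)" using that by (simp only: of_nat_less_iff)
  thus ?thesis by simp
 qed
 have NBx: "int (2 * cc + 60) * int b * int n = int NB" unfolding NBv par(5) by simp
 have eqs: "(int cc + 20) * int b = int sg" "(2 * int cc + 40) * int b = int B" "(int cc + 3) * int b = int K" "(2 * int cc + 42) * int b = int J"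
  "(2 * int cc + 60) * int b = int ZB" "int ZB * int n = int NB" "int B * 8 * ((3 * int cc + 40) * int b + int NB) = int T"
  by (simp_all add: par(1-5) NBv par(6))
 have bnd: "int sg < 2 ^ SB" "int B < 2 ^ SB" "int K < 2 ^ SB" "int J + 1 < 2 ^ SB" "int J < 2 ^ SB" "512 * int b < 2 ^ SB" "8 * int b < 2 ^ SB" "int b + 1 < 2 ^ SB"
  "int ZB < 2 ^ SB" "int NB < 2 ^ SB" "int NB + int B < 2 ^ SB" "int NB + int B + 2 < 2 ^ SB" "(3 * int cc + 40) * int b < 2 ^ SB"
  "(3 * int cc + 40) * int b + int NB < 2 ^ SB" "int B * 8 < 2 ^ SB" "int T < 2 ^ SB"
  "int cc + 20 < 2 ^ SB" "2 * int cc + 40 < 2 ^ SB" "int cc + 3 < 2 ^ SB" "2 * int cc + 42 < 2 ^ SB" "2 * int cc + 60 < 2 ^ SB" "3 * int cc + 40 < 2 ^ SB"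
  "(512::int) < 2 ^ SB" "(8::int) < 2 ^ SB" "(2::int) < 2 ^ SB" "(1::int) < 2 ^ SB"
 proof -
  show "int sg < 2 ^ SB" "int B < 2 ^ SB" "int K < 2 ^ SB" "int J < 2 ^ SB" "int ZB < 2 ^ SB" unfolding par(1-5) by (intro SBi lin; simp)+
  have "J + 1 <= (2 * cc + 43) * b" using b2 unfolding par(4) by (simp add: algebra_simps)
  also have "... <= SB" by (intro lin) simp
  finally have "int (J + 1) < 2 ^ SB" by (rule SBi)
  thus "int J + 1 < 2 ^ SB" by simp
  have "int (512 * b) < 2 ^ SB" "int (8 * b) < 2 ^ SB" "int (2 * b) < 2 ^ SB" by (intro SBi lin; simp)+
  thus "512 * int b < 2 ^ SB" "8 * int b < 2 ^ SB" "int b + 1 < 2 ^ SB" using b2 by simp_all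
  have "int (NB + B + 2) < 2 ^ SB" by (rule Zi[OF Tb(4)])
  hence nb2: "int NB + int B + 2 < 2 ^ SB" by simp
  show "int NB < 2 ^ SB" "int NB + int B < 2 ^ SB" "int NB + int B + 2 < 2 ^ SB" using nb2 by linarith+
  have "int (NB + (3 * cc + 40) * b) < 2 ^ SB" by (rule Zi[OF Tb(2)])
  hence "int NB + (3 * int cc + 40) * int b < 2 ^ SB" by simp
  moreover have "0 <= (3 * int cc + 40) * int b" by simp
  ultimately show "(3 * int cc + 40) * int b < 2 ^ SB" "(3 * int cc + 40) * int b + int NB < 2 ^ SB" by linarith+
  have "int (8 * B) < 2 ^ SB" by (rule Zi[OF Tb(3)])
  thus "int B * 8 < 2 ^ SB" by simp
  show "int T < 2 ^ SB" by (rule Zi[OF Tb(1)])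
  have "int (cc + 20) < 2 ^ SB" "int (2 * cc + 40) < 2 ^ SB" "int (cc + 3) < 2 ^ SB" "int (2 * cc + 42) < 2 ^ SB" "int (2 * cc + 60) < 2 ^ SB" "int (3 * cc + 40) < 2 ^ SB"
   "int 512 < 2 ^ SB" "int 8 < 2 ^ SB" "int 2 < 2 ^ SB" "int 1 < 2 ^ SB" by (intro SBi lin(2); simp)+
  thus "int cc + 20 < 2 ^ SB" "2 * int cc + 40 < 2 ^ SB" "int cc + 3 < 2 ^ SB" "2 * int cc + 42 < 2 ^ SB" "2 * int cc + 60 < 2 ^ SB" "3 * int cc + 40 < 2 ^ SB"
   "(512::int) < 2 ^ SB" "(8::int) < 2 ^ SB" "(2::int) < 2 ^ SB" "(1::int) < 2 ^ SB" by simp_all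
 qed
 have sc': "sc = 2 ^ (2 * sg)" by (rule scv)
 have "hoare (Setup cc) m (28 * qB + ((NB + 2) * (6 * qB) + ((2 * qB + (3 * b + 2) * (6 * qB)) + ((2 * qB + (24 * b + 2) * (6 * qB)) +
  ((qB + (2 * sg + 2) * (6 * qB)) + (2 * qB + (J + 2) * (6 * qB))))))) p
  (%m' q. q = p & k0 m' & m' 4 = 2 ^ NB & m' 20 = 2 ^ (3 * b) & m' 21 = 2 ^ (24 * b) & m' 13 = sc & m' 26 = 2 ^ J)"
  unfolding Setup_def
 proof (rule hoare_seq[where Q = "%m' q. q = p & k0 m' & m' 52 = int NB"], goal_cases)
  case 1
  show ?case
  proof (rule hoare_ops, goal_cases)
   case 1
   show ?case unfolding Consts_def using m bnd by (simp add: wok_def eqs abs_of_nonneg)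
  next
   case 2
   show ?case unfolding Consts_def using rq2_le by (simp add: rq2_def)
  next
   case 3
   show ?case unfolding Consts_def k0_def using m by (simp add: eqs)
  qed
 next
  case (2 m1 q1)
  hence m1: "q1 = p" "k0 m1" "m1 52 = int NB" by auto
  show ?case
  proof (rule hoare_seq[where Q = "%m' q. q = p & k0 m' & m' 4 = 2 ^ NB"], goal_cases)
   case 1
   show ?case
   proof (rule hoare_mono[OF Pow_spec[where N = NB and m = m1 and p = q1]], goal_cases)
    case (13 m' q)
    hence e: "eqx {4, 48, 49, 59, 60} {} m1 m'" by simp
    show ?case using 13 m1 k0e[OF eqx_mono[OF e] m1(2)] by auto
   qed (use m1 bb B1 in simp_all)
  next
   case (2 m2 q2)
   hence m2: "q2 = p" "k0 m2" "m2 4 = 2 ^ NB" by auto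
   show ?case
   proof (rule hoare_seq[where Q = "%m' q. q = p & k0 m' & m' 4 = 2 ^ NB & m' 20 = 2 ^ (3 * b)"], goal_cases)
    case 1
    have o: "hoare (Ops [OC 50 3, OMul 50 50 11]) m2 (2 * qB) q2 (%m' q. q = q2 & eqx {50, 51} {} m2 m' & m' 50 = int (3 * b))"
     by (rule hoare_ops) (use m2 bnd rq2_le in \<open>simp_all add: wok_def k0_def rq2_def\<close>)
    show ?case
    proof (rule hoare_mono[OF stage[OF o]], goal_cases)
     case (6 m' q)
     hence e: "eqx {20, 48, 49, 50, 51, 59, 60} {} m2 m'" by simp
     show ?case using 6 m2 k0e[OF eqx_mono[OF e] m2(2)] eqx_reg[OF e, of 4] by auto
    qed (use sbits b2 in simp_all)
   next
    case (2 m3 q3)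
    hence m3: "q3 = p" "k0 m3" "m3 4 = 2 ^ NB" "m3 20 = 2 ^ (3 * b)" by auto
    show ?case
    proof (rule hoare_seq[where Q = "%m' q. q = p & k0 m' & m' 4 = 2 ^ NB & m' 20 = 2 ^ (3 * b) & m' 21 = 2 ^ (24 * b)"], goal_cases)
     case 1
     have o: "hoare (Ops [OC 50 24, OMul 50 50 11]) m3 (2 * qB) q3 (%m' q. q = q3 & eqx {50, 51} {} m3 m' & m' 50 = int (24 * b))"
      by (rule hoare_ops) (use m3 bnd rq2_le in \<open>simp_all add: wok_def k0_def rq2_def\<close>)
     show ?case
     proof (rule hoare_mono[OF stage[OF o]], goal_cases)
      case (6 m' q)
      hence e: "eqx {21, 48, 49, 50, 51, 59, 60} {} m3 m'" by simp
      show ?case using 6 m3 k0e[OF eqx_mono[OF e] m3(2)] eqx_reg[OF e, of 4] eqx_reg[OF e, of 20] by auto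
     qed (use sbits b2 in simp_all)
    next
     case (2 m4 q4)
     hence m4: "q4 = p" "k0 m4" "m4 4 = 2 ^ NB" "m4 20 = 2 ^ (3 * b)" "m4 21 = 2 ^ (24 * b)" by auto
     show ?case
     proof (rule hoare_seq[where Q = "%m' q. q = p & k0 m' & m' 4 = 2 ^ NB & m' 20 = 2 ^ (3 * b) & m' 21 = 2 ^ (24 * b) & m' 13 = sc"], goal_cases)
      case 1
      have "2 * sg <= SB" using sbits by simp
      hence "int (2 * sg) < 2 ^ SB" by (rule SBi)
      hence o: "hoare (Ops [OAdd 50 12 12]) m4 qB q4 (%m' q. q = q4 & eqx {50, 51} {} m4 m' & m' 50 = int (2 * sg))"
       by (intro hoare_ops) (use m4 rq2_le in \<open>simp_all add: wok_def k0_def rq2_def\<close>)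
      show ?case
      proof (rule hoare_mono[OF stage[OF o]], goal_cases)
       case (6 m' q)
       hence e: "eqx {13, 48, 49, 50, 51, 59, 60} {} m4 m'" by simp
       show ?case using 6 m4 sc' k0e[OF eqx_mono[OF e] m4(2)] eqx_reg[OF e, of 4] eqx_reg[OF e, of 20] eqx_reg[OF e, of 21] by auto
      qed (use sbits b2 in simp_all)
     next
      case (2 m5 q5)
      hence m5: "q5 = p" "k0 m5" "m5 4 = 2 ^ NB" "m5 20 = 2 ^ (3 * b)" "m5 21 = 2 ^ (24 * b)" "m5 13 = sc" by auto
      have o: "hoare (Ops [OC 51 1, OSub 50 17 51]) m5 (2 * qB) q5 (%m' q. q = q5 & eqx {50, 51} {} m5 m' & m' 50 = int J)"
       by (rule hoare_ops) (use m5 bnd rq2_le in \<open>simp_all add: wok_def k0_def rq2_def\<close>)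
      show ?case
      proof (rule hoare_mono[OF stage[OF o]], goal_cases)
       case (6 m' q)
       hence e: "eqx {26, 48, 49, 50, 51, 59, 60} {} m5 m'" by simp
       show ?case using 6 m5 k0e[OF eqx_mono[OF e] m5(2)] eqx_reg[OF e, of 4] eqx_reg[OF e, of 20] eqx_reg[OF e, of 21] eqx_reg[OF e, of 13] by auto
      qed (use sbits b2 ZBJ in simp_all)
     qed
    qed
   qed
  qed
 qed
 thus ?thesis
 proof (rule hoare_mono, goal_cases)
  case 1
  have "3 * b + 24 * b + 2 * sg + J <= 4 * SB" using sbits ZBJ b2 by linarith
  hence "(3 * b + 24 * b + 2 * sg + J) * (6 * qB) <= 4 * SB * (6 * qB)" by (intro mult_right_mono) auto
  thus ?case by (simp add: algebra_simps)
 next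
  case (3 m' q)
  thus ?case by (simp add: k0_def)
 qed simp
qed

definition Prog :: "nat => com" where "Prog cc = Head ;; Setup cc ;; RandU ;; Search ;; Out"

definition tP :: "nat => nat" where
 "tP je = (z + je + b + 4) * (20 * qS) + ((NB + 4 * SB + 50) * (8 * qB) + ((n + 1) * ((K + 4) * (20 * qS)) + (tS + (J + sg + 6) * (60 * qB))))"

text \<open>The budget pays \<open>n / 2 ^ K\<close> for a start vector orthogonal to one of the
  chosen eigenvectors and \<open>eta\<close> for each of the \<open>NE\<close> evaluations. A start
  vector that is not generic receives the budget 1. Nonnegativity of the final budget is what the
  leaves of the decision tree demand.\<close>

lemma Prog_spec:
 fixes cc dl je :: nat and \<delta> :: real
 defines "W \<equiv> 1 + (\<Sum>e<z. X 3 e * X 3 e)"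
 assumes par: "sg = (cc + 20) * b" "B = (2 * cc + 40) * b" "K = (cc + 3) * b" "J = (2 * cc + 42) * b" "ZB = (2 * cc + 60) * b"
  "T = 8 * B * (NB + (3 * cc + 40) * b)" and Hb: "(20 * cc + 600) * (b + dl) <= SB"
  and cap: "4 * B * (n * n * (b + 2 * n * J + 2 * K) + NB) <= 2 ^ B"
  and X: "X 0 0 = int n" "X 0 (Suc 0) = int z" "X 0 2 = \<lfloor>\<delta>\<rfloor>" "!!k. X 5 k = frac_bit \<delta> k" and bit: "!!k. k < je ==> X 4 k = 0" "X 4 je = 1"
  and bv: "W * int n * 2 ^ (je + 1) < 2 ^ b" "!!k. 2 <= k ==> k < b ==> 2 ^ k <= W * int n * 2 ^ (je + 1)" and zS: "int z < 2 ^ SB"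
  and d: "0 <= \<delta>" "\<delta> < 2 ^ dl" and rows: "!!i. i < n ==> (\<Sum>j<n. \<bar>mr i j\<bar>) <= 2 ^ J"
  and gdI: "!!m R y. 0 <= R ==> R * R <= max 0 y ==> y < (R + 1) * (R + 1) ==> real_of_int y < Min S ==> Min S - y < 256 * real b ==>
   m 0 = max R \<lfloor>\<delta> * 2 ^ sg\<rfloor> ==> m 1 = 2 ^ sg ==> gd m"
  and p: "real NE * eta + real n / 2 ^ K <= p"
 shows "hoare (Prog cc) m (tP je) p (%m' q. 0 <= q & (gd m' \<or> 1 <= q))"
proof -
 have Hb1: "(20 * cc + 600) * b <= SB" "(20 * cc + 600) * dl <= SB" and Hb2: "(20 * cc + 600) * b + (20 * cc + 600) * dl <= SB"
  using Hb by (simp_all add: distrib_left)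
 have "(20 * cc + 600) * b = 20 * cc * b + 600 * b" "(20 * cc + 600) * dl = 20 * cc * dl + 600 * dl" by (simp_all add: algebra_simps)
 hence Hb3: "20 * cc * b + 600 * b + 600 * dl <= SB" using Hb2 by linarith
 have cap1: "4 * B * NB <= 2 ^ B"
 proof -
  have "4 * B * NB <= 4 * B * (n * n * (b + 2 * n * J + 2 * K) + NB)" by (intro mult_left_mono) auto
  thus ?thesis using cap by linarith
 qed
 have e0: "0 < eta" by (rule eta0)
 define P where "P us \<longleftrightarrow> generic (%i. real (us ! i))" for us :: "nat list"
 have av: "av (2 ^ K) (%us. if P us then real NE * eta else 1) n [] <= p"
 proof -
  have "av (2 ^ K) (%us. if P us then real NE * eta else 1) n [] <= real NE * eta + real n / real (2 ^ K)"
   by (rule av_indicator) (use generic_count[of "2 ^ K"] e0 in \<open>auto simp: P_def\<close>)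
  thus ?thesis using p by simp
 qed
 have KS: "K < SB" using sbits b2 by simp
 have bS: "b + 4 < SB" using sbits b2 by simp
 have hH: "hoare Head m ((z + je + b + 4) * (20 * qS)) p (%m' q. q = p & m' 9 = int n & m' 10 = int z & m' 11 = int b)"
  by (rule Head_spec) (use X bit b2 bv[unfolded W_def] bS zS n1 in auto)
 show ?thesis
  unfolding Prog_def tP_def
 proof (rule hoare_seq[OF hH], goal_cases)
  case (1 m1 q1)
  hence m1: "q1 = p" "m1 9 = int n" "m1 10 = int z" "m1 11 = int b" by auto
  show ?case
  proof (rule hoare_seq[OF Setup_spec[OF par Hb1(1) cap1 m1(2-4)]], goal_cases)
   case (1 m2 q2)
   have q2: "q2 = p" using 1(2) m1 by simp
   note c2 = conjunct2[OF 1(2)]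
   have m29: "m2 9 = int n" "m2 16 = int K" using c2 by auto
   show ?case
   proof (rule hoare_seq[OF RandU_spec[OF m29 KS av[folded q2]]], goal_cases)
    case (1 m3 q3)
    hence e3: "eqx {46, 47, 48, 49, 50, 51, 59, 60, 61, 62} {0} m2 m3" by simp
    from 1(2) obtain us where us: "length us = n" "set us \<subseteq> {..<2 ^ K}" "\<forall>i<n. ar m3 0 i = int (us ! i)"
     "(if P us then real NE * eta else 1) <= q3" by blast
    note R3 = eqx_reg[OF e3]
    have usK: "us ! i < 2 ^ K" if "i < n" for i using us that nth_mem by blast
    have usI: "int (us ! i) < 2 ^ K" if "i < n" for i
    proof -
     have "int (us ! i) < int (2 ^ K)" using usK[OF that] by (simp only: of_nat_less_iff)
     thus ?thesis by simp
    qed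
    have ia: "in_arr m3 0 (2 ^ K)" using us(3) usI by (simp add: in_arr_def)
    have sc3: "scon m3" using c2 ia by (simp add: scon_def R3)
    have r3: "m3 25 = -1" "m3 26 = 2 ^ J" "m3 17 = int (J + 1)" "m3 18 = int (512 * b)" using c2 by (simp_all add: R3)
    have s3: "m3 12 = int sg" using c2 by (simp add: R3)
    have g3: "uok (%i. real_of_int (ar m3 0 i)) & real NE * eta <= q3" if "q3 < 1"
    proof -
     have P: "P us" "real NE * eta <= q3" using us(4) that by (auto split: if_splits)
     have gg: "generic (%i. real_of_int (ar m3 0 i))" using P(1) us(3) unfolding P_def generic_def by simp
     have "uok (%i. real_of_int (ar m3 0 i))"
     proof (rule uok_generic[OF gg _ rows _ cap])
      fix i assume i: "i < n"
      have "real_of_int (int (us ! i)) <= real_of_int (2 ^ K)" using usI[OF i] by (simp only: of_int_le_iff less_imp_le)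
      thus "real_of_int (ar m3 0 i) \<in> \<int> & \<bar>real_of_int (ar m3 0 i)\<bar> <= 2 ^ K" using us(3) i by simp
     qed (use nb in auto)
     thus ?thesis using P by simp
    qed
    have q30: "0 <= q3"
    proof (cases "q3 < 1")
     case True
     have "0 <= real NE * eta" using e0 by simp
     thus ?thesis using g3[OF True] by linarith
    qed simp
    show ?case
    proof (rule hoare_seq[OF Search_spec[OF sc3 r3 g3]], goal_cases)
     case 1 thus ?case .
    next
     case (2 m4 q4)
     hence e4: "eqx ({25, 26, 38, 39, 40, 41} \<union> VS) {2, 3, 4, 5} m3 m4" and y4: "-1 <= m4 25" "m4 25 <= 2 ^ (J + b + 10)"
      and P4: "1 <= q4 \<or> q3 < 1 & q3 - real NE * eta <= q4 & real_of_int (m4 25) < Min S & Min S - m4 25 < 256 * real b" by auto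
     have q40: "0 <= q4"
     proof (cases "1 <= q4")
      case False
      hence "q3 < 1" "q3 - real NE * eta <= q4" using P4 by auto
      thus ?thesis using g3 by auto
     qed simp
     note R4 = eqx_reg[OF e4]
     have r4: "m4 12 = int sg" "m4 17 = int (J + 1)" using s3 r3 by (simp_all add: R4)
     have y4': "m4 25 < 2 ^ (2 * J + 2)"
     proof -
      have "b + 10 <= J" using b2 unfolding par(4) by (simp add: algebra_simps)
      hence "(2::int) ^ (J + b + 10) < 2 ^ (2 * J + 2)" by (intro power_strict_increasing) auto
      thus ?thesis using y4 by linarith
     qed
     have sS: "sg + dl + 2 < SB" "2 * J + 8 < SB" using Hb3 b2 sbits ZBJ by linarith+
     have hO: "hoare Out m4 ((J + sg + 6) * (60 * qB)) q4 (%m' q. q = q4 & (\<exists>R. 0 <= R & R * R <= max 0 (m4 25) &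
       m4 25 < (R + 1) * (R + 1) & m' 0 = max R \<lfloor>\<delta> * 2 ^ sg\<rfloor> & m' 1 = 2 ^ sg))"
      by (rule Out_spec[where dl = dl]) (use X d sS r4 y4 y4' in auto)
     show ?case
     proof (rule hoare_mono[OF hO], goal_cases)
      case (3 m5 q5)
      then obtain R where R: "q5 = q4" "0 <= R" "R * R <= max 0 (m4 25)" "m4 25 < (R + 1) * (R + 1)"
       "m5 0 = max R \<lfloor>\<delta> * 2 ^ sg\<rfloor>" "m5 1 = 2 ^ sg" by blast
      show ?case using P4 gdI[OF R(2-4) _ _ R(5,6)] R(1) q40 by blast
     qed simp_all
    qed
   qed
  qed
 qed
qed

end

section \<open>Choice of the parameters\<close>

lemma (in ram) memory_bits_le:
 assumes "bok m"
 shows "memory_bits m <= (64 + 8 * n) * (2 * SB + 2) + 8 * (BB + 1)"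
proof -
 have sub: "{r. m r ~= 0} \<subseteq> {..<64 + 8 * n}" using assms by (auto simp: bok_def not_less[symmetric])
 have br: "bits (int r) <= Suc SB" if "r < 64 + 8 * n" for r
 proof (rule bits_le)
  have "int r < 64 + 8 * int n" using that by linarith
  thus "\<bar>int r\<bar> < 2 ^ SB" using SB(3) by linarith
 qed
 have "memory_bits m <= (\<Sum>r<64 + 8 * n. bits (int r) + bits (m r))"
  unfolding memory_bits_def by (rule sum_mono2) (use sub in auto)
 also have "... <= (\<Sum>r<64 + 8 * n. (2 * SB + 2) + (if r < 8 then BB + 1 else 0))"
 proof (rule sum_mono)
  fix r assume "r \<in> {..<64 + 8 * n}"
  thus "bits (int r) + bits (m r) <= (2 * SB + 2) + (if r < 8 then BB + 1 else 0)"
   using br[of r] bok_bits[OF assms, of r] by (cases "r < 8") auto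
 qed
 also have "... = (64 + 8 * n) * (2 * SB + 2) + (\<Sum>r<64 + 8 * n. if r < 8 then BB + 1 else 0)"
  by (simp only: sum.distrib sum_constant card_lessThan of_nat_id distrib_left)
 also have "(\<Sum>r<64 + 8 * n. if r < 8 then BB + 1 else 0) = 8 * (BB + 1)"
 proof -
  have "{..<64 + 8 * n} \<inter> {r. r < 8} = {..<8}" by auto
  thus ?thesis by (simp add: sum.If_cases)
 qed
 finally show ?thesis .
qed

text \<open>The eighth power of \<open>SB\<close> comes from the search: two factors from the number
  of trials, one from the modular inversions, two from the cost of an instruction, and three from
  the loops over step sizes, tests and evaluation points. The factors \<open>n\<close>,
  \<open>n\<close> and \<open>z + n\<close> come from the trials, the recurrence steps and the
  sparse products.\<close>

lemma (in alg4) tP_le: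
 assumes BBv: "BB = n * SB" and NBn: "NB <= n * SB" and Tn: "T <= 16 * (n * (SB * SB))"
  and le: "B <= SB" "b <= SB" "J <= SB" "sg <= SB" "K <= SB" "je <= SB"
 shows "tP je <= 12000000000 * (n * n * (z + n) * (SB * SB * SB * SB * SB * SB * SB * SB))"
proof -
 define h where "h = SB"
 define N where "N = n * n * (z + n)"
 have h1: "1 <= h" using SB by (simp add: h_def)
 have qS': "qS <= 36 * (h * h)"
 proof -
  have "2 * h + 4 <= 6 * h" using h1 by simp
  hence "(2 * h + 4) * (2 * h + 4) <= (6 * h) * (6 * h)" by - (assumption | rule mult_le_mono)+
  thus ?thesis by (simp add: qS_def h_def power2_eq_square)
 qed
 have nh1: "1 <= n * h" using n1 h1 by simp
 have qB': "qB <= 36 * (n * n * (h * h))"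
 proof -
  have "2 * (n * h) + 4 <= 6 * (n * h)" using nh1 by linarith
  hence "(2 * (n * h) + 4) * (2 * (n * h) + 4) <= (6 * (n * h)) * (6 * (n * h))" by - (assumption | rule mult_le_mono)+
  thus ?thesis unfolding qB_def unfolding power2_eq_square BBv h_def by (simp add: algebra_simps)
 qed
 have n2: "1 <= n * n" "n <= n * n" using n1 by simp_all
 have zn: "1 <= z + n" "n <= z + n" using n1 by simp_all
 have hm: "x <= x * h" for x :: nat using h1 by simp
 have Nn: "n * n * n <= N" "z + n <= N" "n * n <= N" "n <= N" "1 <= N"
 proof -
  show "n * n * n <= N" unfolding N_def by (rule mult_le_mono2) simp
  have "1 * (z + n) <= n * n * (z + n)" using n2 by (intro mult_le_mono1)
  thus 1: "z + n <= N" by (simp add: N_def)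
  have "n * n * 1 <= n * n * (z + n)" using zn by (intro mult_le_mono2)
  thus "n * n <= N" by (simp add: N_def)
  show "n <= N" "1 <= N" using 1 zn by linarith+
 qed
 define H2 where "H2 = h * h"
 define H3 where "H3 = h * h * h"
 define H5 where "H5 = h * h * h * h * h"
 define H6 where "H6 = h * h * h * h * h * h"
 define H8 where "H8 = h * h * h * h * h * h * h * h"
 have mon: "H2 <= H3" "H3 <= H5" "H5 <= H6" "H6 <= H8" "h <= H2"
 proof -
  show "H2 <= H3" unfolding H2_def H3_def by (rule hm)
  show "H3 <= H5" unfolding H3_def H5_def using hm[of "h * h * h"] hm[of "h * h * h * h"] by linarith
  show "H5 <= H6" unfolding H6_def H5_def by (rule hm)
  show "H6 <= H8" unfolding H6_def H8_def using hm[of "h * h * h * h * h * h"] hm[of "h * h * h * h * h * h * h"] by linarith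
  show "h <= H2" unfolding H2_def by (rule hm)
 qed
 have up: "a * x <= N * y" if "a <= N" "x <= y" for a x y using that by (rule mult_le_mono)
 have E: "tE <= 2484720 * (N * H5)"
 proof -
  have "1 <= n * (h * h)" using n1 h1 by simp
  hence a: "T + 1 <= 17 * (n * (h * h))" using Tn unfolding h_def by linarith
  have b: "n + 1 <= 2 * n" using n1 by simp
  have c: "n + z + B + 2 <= 4 * ((z + n) * h)"
  proof -
   have "h * 1 <= h * (z + n)" using zn by (intro mult_le_mono2)
   hence "h <= (z + n) * h" by (simp add: mult.commute)
   thus ?thesis using hm[of "z + n"] le(1) h1 unfolding h_def[symmetric] by linarith
  qed
  have "500 * qS <= 18000 * (h * h)" using qS' by linarith
  hence "(n + z + B + 2) * (500 * qS) <= (4 * ((z + n) * h)) * (18000 * (h * h))" using c by - (assumption | rule mult_le_mono)+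
  hence "(n + 1) * ((n + z + B + 2) * (500 * qS)) <= (2 * n) * ((4 * ((z + n) * h)) * (18000 * (h * h)))" using b by - (assumption | rule mult_le_mono)+
  also have "... = 144000 * (n * (z + n) * H3)" by (simp add: H3_def algebra_simps)
  finally have 1: "(n + 1) * ((n + z + B + 2) * (500 * qS)) <= 144000 * (n * (z + n) * H3)" .
  have "n * n * (h * h) <= n * (z + n) * H3" unfolding H2_def[symmetric] using mon(1) zn by (intro mult_le_mono) auto
  hence "60 * qB <= 2160 * (n * (z + n) * H3)" using qB' by linarith
  hence "(n + 1) * ((n + z + B + 2) * (500 * qS)) + 60 * qB <= 146160 * (n * (z + n) * H3)" using 1 by linarith
  hence "tE <= (17 * (n * (h * h))) * (146160 * (n * (z + n) * H3))" unfolding tE_def using a by - (assumption | rule mult_le_mono)+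
  also have "... = 2484720 * (N * H5)" by (simp add: N_def H3_def H5_def algebra_simps)
  finally show ?thesis .
 qed
 have L: "tL <= 15120 * (N * H5)"
 proof -
  have "h <= n * h" using n1 by simp
  hence a: "NB + B + 3 <= 5 * (n * h)" using NBn le(1) nh1 unfolding h_def[symmetric] by linarith
  have "30 * qB <= 1080 * (n * n * (h * h))" using qB' by linarith
  hence "(NB + B + 3) * (30 * qB) <= (5 * (n * h)) * (1080 * (n * n * (h * h)))" using a by - (assumption | rule mult_le_mono)+
  also have "... = 5400 * (n * n * n * H3)" by (simp add: H3_def algebra_simps)
  also have "n * n * n * H3 <= N * H5" by (rule up[OF Nn(1) mon(2)])
  finally have 1: "(NB + B + 3) * (30 * qB) <= 5400 * (N * H5)" by simp
  have "8 * b + 1 <= 9 * h" using le(2) h1 unfolding h_def[symmetric] by linarith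
  moreover have "30 * qS <= 1080 * (h * h)" using qS' by linarith
  ultimately have "(8 * b + 1) * (30 * qS) <= (9 * h) * (1080 * (h * h))" by - (assumption | rule mult_le_mono)+
  also have "... = 9720 * (1 * H3)" by (simp add: H3_def)
  also have "1 * H3 <= N * H5" by (rule up[OF Nn(5) mon(2)])
  finally show ?thesis unfolding tL_def using 1 by linarith
 qed
 have q5: "qS <= 36 * (N * H5)"
 proof -
  have "1 * (h * h) <= N * H5" by (rule up[OF Nn(5)]) (use mon in \<open>simp add: H2_def\<close>)
  thus ?thesis using qS' by linarith
 qed
 have Tt: "tT <= 7502760 * (N * H6)"
 proof -
  have "b + 2 <= 3 * h" using le(2) h1 unfolding h_def[symmetric] by linarith
  moreover have "tE + tL + 30 * qS <= 2500920 * (N * H5)" using E L q5 by linarith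
  ultimately have "tT <= (3 * h) * (2500920 * (N * H5))" unfolding tT_def by - (assumption | rule mult_le_mono)+
  thus ?thesis by (simp add: H5_def H6_def algebra_simps)
 qed
 have St: "tS <= 11570366160 * (N * H8)"
 proof -
  have a: "J + 2 <= 3 * h" "512 * b + 2 <= 514 * h" using le h1 unfolding h_def[symmetric] by linarith+
  have "N * H5 <= N * H6" using mon by simp
  hence "tT + 20 * qS <= 7503480 * (N * H6)" using Tt q5 by linarith
  hence "(512 * b + 2) * (tT + 20 * qS) <= (514 * h) * (7503480 * (N * H6))" using a by - (assumption | rule mult_le_mono)+
  hence "tS <= (3 * h) * ((514 * h) * (7503480 * (N * H6)))" unfolding tS_def using a by - (assumption | rule mult_le_mono)+
  thus ?thesis by (simp add: H6_def H8_def algebra_simps)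
 qed
 have H38: "H3 <= H8" using mon by linarith
 have R1: "(z + je + b + 4) * (20 * qS) <= 5040 * (N * H8)"
 proof -
  have "h * 1 <= h * (z + n)" using zn by (intro mult_le_mono2)
  hence "h <= (z + n) * h" by (simp add: mult.commute)
  moreover have "z <= z + n" by simp
  ultimately have "z + je + b + 4 <= 7 * ((z + n) * h)" using hm[of "z + n"] le h1 unfolding h_def[symmetric] by linarith
  moreover have "20 * qS <= 720 * (h * h)" using qS' by linarith
  ultimately have "(z + je + b + 4) * (20 * qS) <= (7 * ((z + n) * h)) * (720 * (h * h))" by - (assumption | rule mult_le_mono)+
  also have "... = 5040 * ((z + n) * H3)" by (simp add: H3_def algebra_simps)
  also have "(z + n) * H3 <= N * H8" by (rule up[OF Nn(2) H38])
  finally show ?thesis by simp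
 qed
 have R2: "(NB + 4 * SB + 50) * (8 * qB) <= 15840 * (N * H8)"
 proof -
  have "h <= n * h" using n1 by simp
  hence "NB + 4 * SB + 50 <= 55 * (n * h)" using NBn nh1 unfolding h_def[symmetric] by linarith
  moreover have "8 * qB <= 288 * (n * n * (h * h))" using qB' by linarith
  ultimately have "(NB + 4 * SB + 50) * (8 * qB) <= (55 * (n * h)) * (288 * (n * n * (h * h)))" by - (assumption | rule mult_le_mono)+
  also have "... = 15840 * (n * n * n * H3)" by (simp add: H3_def algebra_simps)
  also have "n * n * n * H3 <= N * H8" by (rule up[OF Nn(1) H38])
  finally show ?thesis by simp
 qed
 have R3: "(n + 1) * ((K + 4) * (20 * qS)) <= 7200 * (N * H8)"
 proof -
  have "K + 4 <= 5 * h" "n + 1 <= 2 * n" using le h1 n1 unfolding h_def[symmetric] by linarith+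
  moreover have "20 * qS <= 720 * (h * h)" using qS' by linarith
  ultimately have "(n + 1) * ((K + 4) * (20 * qS)) <= (2 * n) * ((5 * h) * (720 * (h * h)))" by - (assumption | rule mult_le_mono)+
  also have "... = 7200 * (n * H3)" by (simp add: H3_def algebra_simps)
  also have "n * H3 <= N * H8" by (rule up[OF Nn(4) H38])
  finally show ?thesis by simp
 qed
 have R4: "(J + sg + 6) * (60 * qB) <= 17280 * (N * H8)"
 proof -
  have "J + sg + 6 <= 8 * h" using le h1 unfolding h_def[symmetric] by linarith
  moreover have "60 * qB <= 2160 * (n * n * (h * h))" using qB' by linarith
  ultimately have "(J + sg + 6) * (60 * qB) <= (8 * h) * (2160 * (n * n * (h * h)))" by - (assumption | rule mult_le_mono)+
  also have "... = 17280 * (n * n * H3)" by (simp add: H3_def algebra_simps)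
  also have "n * n * H3 <= N * H8" by (rule up[OF Nn(3) H38])
  finally show ?thesis by simp
 qed
 have "tP je <= 12000000000 * (N * H8)" unfolding tP_def using R1 R2 R3 R4 St by linarith
 thus ?thesis by (simp add: N_def H8_def h_def)
qed

section \<open>Instantiation for a given input\<close>

locale inst =
 fixes c \<epsilon> \<delta> U :: real and n :: nat and A :: "real mat" and es :: "(nat \<times> nat \<times> int) list" and ls :: "real list"
 assumes c0: "0 < c" and n0: "1 <= n" and U1: "1 <= U" and eps: "0 < \<epsilon>" "\<epsilon> < 1" and del: "real n powr (- c) <= \<delta>"
  and cA: "A \<in> carrier_mat n n" and tA: "transpose_mat A = A"
  and ent: "!!i j. i < n ==> j < n ==> A $$ (i, j) \<in> \<int> & - U <= A $$ (i, j) & A $$ (i, j) <= U"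
  and sp: "sparse_rep A es" and ev: "eigenvalues_by_modulus A ls"
begin

definition X :: input where "X = encode_input n \<epsilon> \<delta> es"
definition z :: nat where "z = length es"
definition W :: int where "W = 1 + (\<Sum>e<z. X 3 e * X 3 e)"
text \<open>The number of leading zero digits of \<epsilon>, so that
  \<open>1 <= \<epsilon> * 2 ^ (je + 1) < 2\<close>.\<close>

definition je :: nat where "je = (LEAST j. 1 <= \<epsilon> * 2 ^ (j + 1))"
definition V :: int where "V = W * int n * 2 ^ (je + 1)"
definition b :: nat where "b = (LEAST k. 2 <= k & V < 2 ^ k)"
definition cc :: nat where "cc = nat \<lceil>c\<rceil>"
definition dl :: nat where "dl = nat \<lceil>log 2 (\<delta> + 2)\<rceil>"
text \<open>Lengths are multiples of \<open>b\<close> because \<open>2 ^ b\<close> dominates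
  \<open>n\<close>, the entries and \<open>1 / \<epsilon>\<close>, and \<open>2 ^ (cc * b)\<close>
  dominates \<open>1 / \<delta>\<close>. \<open>J\<close> equals \<open>2 * sg + 2 * b\<close>, the
  size of the scaled square; \<open>B\<close> is large enough for \<open>cap\<close>, and
  \<open>K\<close> makes start vectors that are not generic rare.\<close>

definition sg :: nat where "sg = (cc + 20) * b"
definition B :: nat where "B = (2 * cc + 40) * b"
definition K :: nat where "K = (cc + 3) * b"
definition J :: nat where "J = (2 * cc + 42) * b"
definition ZB :: nat where "ZB = (2 * cc + 60) * b"
definition NB :: nat where "NB = ZB * n"
definition T :: nat where "T = 8 * B * (NB + (3 * cc + 40) * b)"
text \<open>The summand \<open>dl\<close>, a bit length for \<delta>, brings \<delta> into the
  logarithm of the resource bounds: short registers must hold the scaled \<delta>.\<close>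

definition H :: nat where "H = (20 * cc + 600) * (b + dl)"
definition gd :: "memory => bool" where
 "gd m \<longleftrightarrow> 0 < m 1 & 0 <= real_of_int (m 0) / real_of_int (m 1) & approx_eps \<epsilon> (real_of_int (m 0) / real_of_int (m 1)) (max \<delta> \<bar>ls ! 0\<bar>)"

lemma X0: "X 0 0 = int n" "X 0 (Suc 0) = int z" "X 0 2 = \<lfloor>\<delta>\<rfloor>" "X 4 k = frac_bit \<epsilon> k" "X 5 k = frac_bit \<delta> k"
 by (simp_all add: X_def encode_input_def z_def)

lemma Xe: "e < z ==> X 1 e = int (fst (es ! e))" "e < z ==> X 2 e = int (fst (snd (es ! e)))" "e < z ==> X 3 e = snd (snd (es ! e))"
 by (simp_all add: X_def encode_input_def z_def)

lemma nzp: "finite (nonzero_positions A)" "nonzero_positions A \<subseteq> {..<n} \<times> {..<n}"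
proof -
 show s: "nonzero_positions A \<subseteq> {..<n} \<times> {..<n}" using cA by (auto simp: nonzero_positions_def)
 show "finite (nonzero_positions A)" by (rule finite_subset[OF s]) simp
qed

lemma floor_ent: "i < n ==> j < n ==> real_of_int \<lfloor>A $$ (i, j)\<rfloor> = A $$ (i, j)"
 using ent[of i j] by (auto elim!: Ints_cases)

lemma set_es: "set es = (%(i, j). (i, j, \<lfloor>A $$ (i, j)\<rfloor>)) ` nonzero_positions A"
proof -
 have s: "set es = {(i, j, a). (i, j) \<in> nonzero_positions A & A $$ (i, j) = of_int a}" using sp by (simp add: sparse_rep_def)
 show ?thesis
 proof (intro equalityI subsetI)
  fix x assume "x \<in> set es"
  then obtain i j a where x: "x = (i, j, a)" "(i, j) \<in> nonzero_positions A" "A $$ (i, j) = of_int a" unfolding s by auto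
  thus "x \<in> (%(i, j). (i, j, \<lfloor>A $$ (i, j)\<rfloor>)) ` nonzero_positions A" by (intro image_eqI[of _ _ "(i, j)"]) auto
 next
  fix x assume "x \<in> (%(i, j). (i, j, \<lfloor>A $$ (i, j)\<rfloor>)) ` nonzero_positions A"
  then obtain i j where ij: "(i, j) \<in> nonzero_positions A" "x = (i, j, \<lfloor>A $$ (i, j)\<rfloor>)" by auto
  hence "i < n" "j < n" using nzp by auto
  thus "x \<in> set es" unfolding s using ij by (simp add: floor_ent)
 qed
qed

lemma es_sum: "(\<Sum>e<z. g (es ! e)) = (\<Sum>(i, j)\<in>nonzero_positions A. g (i, j, \<lfloor>A $$ (i, j)\<rfloor>))"
proof -
 have d: "distinct es" using sp by (simp add: sparse_rep_def)
 have "(\<Sum>e<z. g (es ! e)) = sum g (set es)"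
  by (rule sum.reindex_bij_betw[OF bij_betw_nth[OF d]]) (simp_all add: z_def)
 also have "... = (\<Sum>(i, j)\<in>nonzero_positions A. g (i, j, \<lfloor>A $$ (i, j)\<rfloor>))"
  unfolding set_es by (subst sum.reindex) (auto simp: inj_on_def case_prod_beta)
 finally show ?thesis .
qed

lemma nz_sum:
 assumes "!!i j. i < n ==> j < n ==> A $$ (i, j) = 0 ==> f i j = 0"
 shows "(\<Sum>(i, j)\<in>nonzero_positions A. f i j) = (\<Sum>i<n. \<Sum>j<n. f i j)"
proof -
 have "(\<Sum>(i, j)\<in>nonzero_positions A. f i j) = (\<Sum>(i, j)\<in>{..<n} \<times> {..<n}. f i j)"
  by (rule sum.mono_neutral_left) (use nzp assms cA in \<open>auto simp: nonzero_positions_def\<close>)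
 thus ?thesis by (simp add: sum.cartesian_product)
qed

lemma z_nnz: "z <= nnz A"
proof -
 have d: "distinct es" using sp by (simp add: sparse_rep_def)
 have "z = card (set es)" using distinct_card[OF d] by (simp add: z_def)
 also have "... <= nnz A" unfolding set_es nnz_def by (rule card_image_le[OF nzp(1)])
 finally show ?thesis .
qed

lemma es_mem: "e < z ==> fst (es ! e) < n & fst (snd (es ! e)) < n"
proof -
 assume "e < z"
 hence "es ! e \<in> set es" by (simp add: z_def)
 thus ?thesis unfolding set_es using nzp(2) by auto
qed

lemma W_eq: "W = 1 + (\<Sum>i<n. \<Sum>j<n. \<lfloor>A $$ (i, j)\<rfloor> * \<lfloor>A $$ (i, j)\<rfloor>)"
proof -
 have "(\<Sum>e<z. X 3 e * X 3 e) = (\<Sum>e<z. (%(i, j, a). a * a) (es ! e))" by (rule sum.cong) (auto simp: Xe case_prod_beta)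
 also have "... = (\<Sum>i<n. \<Sum>j<n. \<lfloor>A $$ (i, j)\<rfloor> * \<lfloor>A $$ (i, j)\<rfloor>)" 
  by (simp only: es_sum prod.case) (rule nz_sum, simp)
 finally show ?thesis by (simp add: W_def)
qed

text \<open>An integer is in modulus at most its square, so the sum of squares, computable without
  comparisons, dominates single entries and row sums alike.\<close>

lemma W_bounds: "1 <= W" "real_of_int W <= 1 + (real n * U)\<^sup>2" "(\<Sum>i<n. \<Sum>j<n. \<bar>\<lfloor>A $$ (i, j)\<rfloor>\<bar>) <= W" "e < z ==> \<bar>X 3 e\<bar> <= W"
proof -
 show "1 <= W" unfolding W_eq by (simp add: sum_nonneg)
 have sqa: "\<bar>a\<bar> <= a * a" for a :: int
 proof (cases "a = 0")
  case False
  hence "1 * \<bar>a\<bar> <= \<bar>a\<bar> * \<bar>a\<bar>" by (intro mult_right_mono) auto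
  thus ?thesis by (simp add: abs_mult_self_eq)
 qed simp
 have "(\<Sum>i<n. \<Sum>j<n. \<bar>\<lfloor>A $$ (i, j)\<rfloor>\<bar>) <= (\<Sum>i<n. \<Sum>j<n. \<lfloor>A $$ (i, j)\<rfloor> * \<lfloor>A $$ (i, j)\<rfloor>)" by (intro sum_mono sqa)
 thus "(\<Sum>i<n. \<Sum>j<n. \<bar>\<lfloor>A $$ (i, j)\<rfloor>\<bar>) <= W" unfolding W_eq by simp
 have "real_of_int W = 1 + (\<Sum>i<n. \<Sum>j<n. A $$ (i, j) * A $$ (i, j))" unfolding W_eq by (simp add: floor_ent)
 also have "(\<Sum>i<n. \<Sum>j<n. A $$ (i, j) * A $$ (i, j)) <= (\<Sum>i<n. \<Sum>j<n. U * U)"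
 proof (intro sum_mono)
  fix i j assume "i \<in> {..<n}" "j \<in> {..<n}"
  hence "\<bar>A $$ (i, j)\<bar> <= U" using ent[of i j] by auto
  hence "\<bar>A $$ (i, j)\<bar> * \<bar>A $$ (i, j)\<bar> <= U * U" by (intro mult_mono) (use U1 in auto)
  thus "A $$ (i, j) * A $$ (i, j) <= U * U" by (simp add: abs_mult_self_eq)
 qed
 finally show "real_of_int W <= 1 + (real n * U)\<^sup>2" by (simp add: power2_eq_square algebra_simps)
 show "\<bar>X 3 e\<bar> <= W" if "e < z"
 proof -
  have "X 3 e * X 3 e <= (\<Sum>e<z. X 3 e * X 3 e)" using that by (intro member_le_sum) auto
  thus ?thesis using sqa[of "X 3 e"] by (simp add: W_def)
 qed
qed

lemma je_facts: "1 <= \<epsilon> * 2 ^ (je + 1)" "\<epsilon> * 2 ^ je < 1" "k < je ==> X 4 k = 0" "X 4 je = 1"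
proof -
 obtain j0 where "1 / \<epsilon> < 2 ^ j0" using real_arch_pow[of 2 "1 / \<epsilon>"] by auto
 hence "1 < \<epsilon> * 2 ^ j0" using eps by (simp add: field_simps)
 hence "1 <= \<epsilon> * 2 ^ (j0 + 1)" using eps by simp
 thus 1: "1 <= \<epsilon> * 2 ^ (je + 1)" unfolding je_def by (rule LeastI)
 have lt: "\<epsilon> * 2 ^ (k + 1) < 1" if "k < je" for k using not_less_Least[OF that[unfolded je_def]] by simp
 show 2: "\<epsilon> * 2 ^ je < 1"
 proof (cases je)
  case (Suc k)
  thus ?thesis using lt[of k] by simp
 qed (use eps in simp)
 show "X 4 k = 0" if "k < je"
 proof -
  have "\<lfloor>\<epsilon> * 2 ^ Suc k\<rfloor> = 0" using lt[OF that] eps by (simp add: floor_eq_iff)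
  thus ?thesis by (simp add: X0 frac_bit_def)
 qed
 have "\<lfloor>\<epsilon> * 2 ^ Suc je\<rfloor> = 1" using 1 2 by (simp add: floor_eq_iff)
 thus "X 4 je = 1" by (simp add: X0 frac_bit_def)
qed

lemma b_facts: "2 <= b" "V < 2 ^ b" "2 <= k ==> k < b ==> 2 ^ k <= V" "2 ^ b <= 2 * V" "W < 2 ^ b" "n < 2 ^ b" "je + 1 < b" "2 <= V"
proof -
 have W1: "1 <= W" by (rule W_bounds)
 have n1: "1 <= int n" using n0 by simp
 have Wn: "1 <= W * int n" "W <= W * int n" "int n <= W * int n"
 proof -
  have "1 * 1 <= W * int n" using W1 n1 by (intro mult_mono) auto
  thus "1 <= W * int n" by simp
  have "W * 1 <= W * int n" using W1 n1 by (intro mult_left_mono) auto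
  thus "W <= W * int n" by simp
  have "1 * int n <= W * int n" using W1 n1 by (intro mult_right_mono) auto
  thus "int n <= W * int n" by simp
 qed
 have j1: "(2::int) <= 2 ^ (je + 1)" using one_le_power[of "2::int" je] by simp
 have VW: "W * int n <= V" "2 ^ (je + 1) <= V"
 proof -
  have "W * int n * 1 <= W * int n * 2 ^ (je + 1)" by (intro mult_left_mono) (use Wn j1 in linarith)+
  thus "W * int n <= V" by (simp add: V_def)
  have "1 * 2 ^ (je + 1) <= W * int n * 2 ^ (je + 1)" using Wn by (intro mult_right_mono) auto
  thus "2 ^ (je + 1) <= V" by (simp add: V_def)
 qed
 show V2: "2 <= V" using VW j1 by linarith
 have "V < 2 ^ (nat V + 2)"
 proof -
  have "nat V < 2 ^ (nat V)" by (rule less_exp)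
  hence "int (nat V) < int (2 ^ (nat V))" by (simp only: of_nat_less_iff)
  hence "V < 2 ^ nat V" using V2 by simp
  also have "... <= 2 ^ (nat V + 2)" by (intro power_increasing) auto
  finally show ?thesis .
 qed
 hence "2 <= nat V + 2 & V < 2 ^ (nat V + 2)" by simp
 hence "2 <= b & V < 2 ^ b" unfolding b_def by (rule LeastI)
 thus b2: "2 <= b" and Vb: "V < 2 ^ b" by auto
 show mn: "2 ^ k <= V" if "2 <= k" "k < b" for k using not_less_Least[OF that(2)[unfolded b_def]] that(1) by auto
 \<comment> \<open>At the smallest admissible \<open>b = 2\<close> minimality says nothing, but
   \<open>V >= 2\<close> suffices; otherwise \<open>2 ^ (b - 1)\<close> does not exceed
   \<open>V\<close>.\<close>
 show "2 ^ b <= 2 * V"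
 proof (cases "b = 2")
  case True
  thus ?thesis using V2 by simp
 next
  case False
  hence "2 ^ (b - 1) <= V" using b2 by (intro mn) auto
  moreover have "(2::int) ^ b = 2 * 2 ^ (b - 1)" using b2 by (cases b) auto
  ultimately show ?thesis by linarith
 qed
 show "W < 2 ^ b" using Wn VW Vb by linarith
 have "int n < 2 ^ b" using Wn VW Vb by linarith
 hence "int n < int (2 ^ b)" by simp
 thus "n < 2 ^ b" by (simp only: of_nat_less_iff)
 have "(2::int) ^ (je + 1) < 2 ^ b" using VW Vb by linarith
 thus "je + 1 < b" by (rule power_less_imp_less_exp[rotated]) simp
qed

lemma eps_b: "1 <= \<epsilon> * 2 ^ b"
proof -
 have "(2::real) ^ (je + 1) <= 2 ^ b" using b_facts(7) by (intro power_increasing) auto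
 hence "\<epsilon> * 2 ^ (je + 1) <= \<epsilon> * 2 ^ b" using eps by (intro mult_left_mono) auto
 thus ?thesis using je_facts(1) by linarith
qed

lemma low: "1 / 2 ^ (b * cc) <= real n powr (- c)"
proof -
 have n1: "1 <= real n" using n0 by simp
 have "real n < real (2 ^ b)" using b_facts(6) by (simp only: of_nat_less_iff)
 hence nb: "real n <= 2 ^ b" by simp
 have cc: "c <= real cc" using c0 by (simp add: cc_def of_nat_ceiling)
 have "real n ^ cc <= (2 ^ b) ^ cc" using nb by (intro power_mono) auto
 hence "real n ^ cc <= 2 ^ (b * cc)" by (simp add: power_mult)
 hence "1 / 2 ^ (b * cc) <= 1 / real n ^ cc" using n1 by (intro divide_left_mono) auto
 also have "... = real n powr (- real cc)" using n1 by (simp add: powr_minus powr_realpow inverse_eq_divide)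
 also have "... <= real n powr (- c)" using n1 cc by (intro powr_mono) auto
 finally show ?thesis .
qed

lemma delta_pos: "0 < \<delta>"
proof -
 have "0 < 1 / (2::real) ^ (b * cc)" by simp
 thus ?thesis using low del by linarith
qed

lemma dl_facts: "\<delta> < 2 ^ dl" "1 <= dl" "real dl <= log 2 (\<delta> + 2) + 1"
proof -
 have l1: "1 <= log 2 (\<delta> + 2)" using delta_pos by (simp add: le_log_iff)
 have "log 2 (\<delta> + 2) <= real dl" by (simp add: dl_def of_nat_ceiling)
 hence "\<delta> + 2 <= 2 powr real dl" using delta_pos by (simp add: log_le_iff)
 thus "\<delta> < 2 ^ dl" by (simp add: powr_realpow)
 show "1 <= dl" using l1 \<open>log 2 (\<delta> + 2) <= real dl\<close> by linarith
 show "real dl <= log 2 (\<delta> + 2) + 1" unfolding dl_def using l1 by linarith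
qed

lemma H_parts: "20 * (cc * b) + 600 * b + 600 <= H" "b <= H"
proof -
 have "H = 20 * (cc * b) + 600 * b + (20 * (cc * dl) + 600 * dl)" by (simp add: H_def algebra_simps)
 thus "20 * (cc * b) + 600 * b + 600 <= H" "b <= H" using dl_facts(2) by linarith+
qed

lemma par_lin: "sg = cc * b + 20 * b" "B = 2 * (cc * b) + 40 * b" "K = cc * b + 3 * b" "J = 2 * (cc * b) + 42 * b" "ZB = 2 * (cc * b) + 60 * b"
 by (simp_all add: sg_def B_def K_def J_def ZB_def algebra_simps)

text \<open>In terms of \<open>q = 2 ^ b\<close> the left side is at most the fifth power of
  \<open>q\<close> times a power of two depending on \<open>cc\<close> alone; a fixed multiple of
  \<open>b\<close> in the exponent absorbs both.\<close>

lemma cap: "4 * B * (n * n * (b + 2 * n * J + 2 * K) + NB) <= 2 ^ B"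
proof -
 define q :: nat where "q = 2 ^ b"
 have nq: "n <= q" using b_facts(6) by (simp add: q_def)
 have n1: "1 <= n" by (rule n0)
 have q1: "1 <= q" by (simp add: q_def)
 define G where "G = 8 * (cc + 20) * b"
 have s: "b + 2 * J + 2 * K + ZB <= G" unfolding par_lin G_def by (simp add: algebra_simps)
 have "n * n * (b + 2 * n * J + 2 * K) + NB <= n * n * n * (b + 2 * J + 2 * K + ZB)"
 proof -
  have "b + 2 * n * J + 2 * K <= n * (b + 2 * J + 2 * K)" using n1 by (simp add: algebra_simps add_mono)
  hence "n * n * (b + 2 * n * J + 2 * K) <= n * n * (n * (b + 2 * J + 2 * K))" by (rule mult_le_mono2)
  moreover have "1 * ZB * n <= (n * n) * ZB * n" using n1 by (intro mult_le_mono) auto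
  moreover have "n * n * n * (b + 2 * J + 2 * K + ZB) = n * n * (n * (b + 2 * J + 2 * K)) + (n * n) * ZB * n" by (simp add: algebra_simps)
  ultimately show ?thesis by (simp only: NB_def mult_1)
 qed
 also have "... <= q * q * q * G" using nq s by - (assumption | rule mult_le_mono)+
 finally have 1: "n * n * (b + 2 * n * J + 2 * K) + NB <= q * q * q * G" .
 have "4 * B = G" unfolding par_lin G_def by (simp add: algebra_simps)
 hence "4 * B * (n * n * (b + 2 * n * J + 2 * K) + NB) <= G * (q * q * q * G)" using 1 by (intro mult_le_mono) auto
 also have "G <= 8 * 2 ^ (cc + 20) * q"
  unfolding G_def q_def using less_exp[of "cc + 20"] less_exp[of b] by (intro mult_le_mono) auto
 hence "G * (q * q * q * G) <= (8 * 2 ^ (cc + 20) * q) * (q * q * q * (8 * 2 ^ (cc + 20) * q))" by (intro mult_le_mono) auto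
 also have "... = 2 ^ (3 + (cc + 20) + b + (b + b + b + (3 + (cc + 20) + b)))" unfolding q_def by (simp only: power_add) simp
 also have "... <= 2 ^ B"
 proof (rule power_increasing)
  have "2 * cc <= cc * b" "2 <= b" using b_facts(1) by (simp_all add: mult.commute)
  thus "3 + (cc + 20) + b + (b + b + b + (3 + (cc + 20) + b)) <= B" unfolding par_lin distrib_left using le0[of "cc * b"] by linarith
 qed simp
 finally show ?thesis .
qed

lemma symm: "symmat n A ls (2 ^ (2 * sg))"
 by unfold_locales (use n0 cA tA ent ev in \<open>auto simp: eigenvalues_by_modulus_def\<close>)

lemma row_sums: "i < n ==> (\<Sum>j<n. \<bar>symmat.mr n A (2 ^ (2 * sg)) i j\<bar>) <= 2 ^ J"
proof -
 assume i: "i < n"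
 interpret symmat n A ls "2 ^ (2 * sg)" by (rule symm)
 have "(\<Sum>j<n. \<bar>mr i j\<bar>) <= real_of_int (2 ^ (2 * sg) * (W * W))"
  by (rule mr_bound) (use W_bounds(3) i in \<open>simp_all add: az_def\<close>)
 also have "2 ^ (2 * sg) * (W * W) <= 2 ^ (2 * sg) * (2 ^ b * 2 ^ b)"
  using b_facts(5) W_bounds(1) by (intro mult_left_mono mult_mono) auto
 also have "(2::int) ^ (2 * sg) * (2 ^ b * 2 ^ b) = 2 ^ J"
 proof -
  have "J = 2 * sg + (b + b)" unfolding par_lin by simp
  thus ?thesis by (simp only: power_add)
 qed
 finally show "(\<Sum>j<n. \<bar>mr i j\<bar>) <= 2 ^ J" by simp
qed

lemma ram_inst: "ram H (n * H) n"
proof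
 show "8 <= H" using H_parts by linarith
 show "H <= n * H" using n0 by simp
 have "64 + 8 * n < 2 ^ H"
 proof -
  have "64 + 8 * n <= 2 ^ 7 * 2 ^ b" using b_facts(6) one_le_power[of "2::nat" b] by simp
  also have "... = 2 ^ (7 + b)" by (simp add: power_add)
  also have "... < 2 ^ H" using H_parts by (intro power_strict_increasing) auto
  finally show ?thesis .
 qed
 hence "int (64 + 8 * n) < int (2 ^ H)" by (simp only: of_nat_less_iff)
 thus "64 + 8 * int n < 2 ^ H" by simp
qed

lemma alg_inst: "alg4 X H (n * H) n A ls (2 ^ (2 * sg)) z b B ZB sg K NB J"
proof -
 interpret S: symmat n A ls "2 ^ (2 * sg)" by (rule symm)
 interpret R: ram X H "n * H" n gd by (rule ram_inst)
 have sb: "4 * B + 2 * ZB + 2 * sg + 60 * b + K + 10 <= H" using H_parts b_facts(1) unfolding par_lin distrib_left using le0[of "cc * b"] by linarith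
 have capB: "4 * B * NB <= 2 ^ B"
 proof -
  have "4 * B * NB <= 4 * B * (n * n * (b + 2 * n * J + 2 * K) + NB)" by (intro mult_le_mono2) simp
  thus ?thesis using cap by linarith
 qed
 have ZB1: "1 <= ZB" "4 <= B" using b_facts(1) unfolding par_lin distrib_left using le0[of "cc * b"] by linarith+
 hence NB1: "1 <= NB" using n0 by (simp add: NB_def)
 show ?thesis
 proof unfold_locales
  show "0 <= X 1 e & X 1 e < int n" "0 <= X 2 e & X 2 e < int n" if "e < z" for e using es_mem[OF that] Xe[OF that] by simp_all
  show "\<bar>X 3 e\<bar> <= 2 ^ b" if "e < z" for e using W_bounds(4)[OF that] b_facts(5) by linarith
  show "(\<Sum>e<z. if X 1 e = int i then real_of_int (X 3 e) * x (nat (X 2 e)) else 0) = (\<Sum>j<n. A $$ (i, j) * x j)" if i: "i < n" for i x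
  proof -
   have "(\<Sum>e<z. if X 1 e = int i then real_of_int (X 3 e) * x (nat (X 2 e)) else 0) =
    (\<Sum>e<z. (%(r, cl, a). if r = i then real_of_int a * x cl else 0) (es ! e))"
    by (rule sum.cong) (auto simp: Xe Xe[simplified] case_prod_beta)
   also have "... = (\<Sum>(r, cl)\<in>nonzero_positions A. if r = i then real_of_int \<lfloor>A $$ (r, cl)\<rfloor> * x cl else 0)" by (simp only: es_sum prod.case)
   also have "... = (\<Sum>r<n. \<Sum>cl<n. if r = i then real_of_int \<lfloor>A $$ (r, cl)\<rfloor> * x cl else 0)" by (rule nz_sum) auto
   also have "... = (\<Sum>r<n. if r = i then (\<Sum>cl<n. real_of_int \<lfloor>A $$ (r, cl)\<rfloor> * x cl) else 0)" by (intro sum.cong) auto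
   also have "... = (\<Sum>cl<n. A $$ (i, cl) * x cl)" using i by (simp add: sum.delta floor_ent)
   finally show ?thesis .
  qed
  show "4 * B + 2 * ZB + 2 * sg + 60 * b + K + 10 <= H" by (rule sb)
  show "NB + 2 * B + 24 * b + 10 <= n * H"
  proof -
   have "ZB + (2 * B + 24 * b + 10) <= H" using sb b_facts(1) by linarith
   hence "n * (ZB + (2 * B + 24 * b + 10)) <= n * H" by (rule mult_le_mono2)
   moreover have "1 * (2 * B + 24 * b + 10) <= n * (2 * B + 24 * b + 10)" using n0 by (rule mult_le_mono1)
   ultimately show ?thesis by (simp add: NB_def distrib_left mult.commute)
  qed
  show "1 <= NB" by (rule NB1)
  show "1 <= B" using ZB1 by simp
  show "NB + B + 4 <= 2 ^ B"
  proof -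
   have "1 * NB <= B * NB" "B * 1 <= B * NB" "4 * 1 <= B * NB" using ZB1 NB1 by (intro mult_le_mono; simp)+
   hence "NB + B + 4 <= 4 * (B * NB)" unfolding mult_1_left mult_1_right by linarith
   thus ?thesis using capB unfolding mult.assoc by linarith
  qed
  show "2 <= b" by (rule b_facts)
  show "\<mu> <= 2 ^ J" if "\<mu> \<in> S.S" for \<mu> by (rule S.S_bound[OF _ that]) (rule row_sums)
  show "J + 2 * b + 14 <= ZB" using b_facts(1) unfolding par_lin distrib_left using le0[of "cc * b"] by linarith
  show "NB = ZB * n" by (rule NB_def)
  show "n < 2 ^ b" by (rule b_facts)
 qed simp_all
qed

text \<open>Squaring turns the order by modulus into the order by value, so the head of the list
  gives the smallest root.\<close>

lemma Min_S: "Min (symmat.S ls (2 ^ (2 * sg))) = (2 ^ sg * \<bar>ls ! 0\<bar>)\<^sup>2"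
proof -
 interpret symmat n A ls "2 ^ (2 * sg)" by (rule symm)
 have pw: "real_of_int (2 ^ (2 * sg)) * x\<^sup>2 = (2 ^ sg * \<bar>x\<bar>)\<^sup>2" for x :: real
  by (simp add: power_mult_distrib power_mult[symmetric] mult.commute)
 have srt: "sorted (map abs ls)" using ev by (simp add: eigenvalues_by_modulus_def)
 have l0: "0 < length ls" using len n0 by simp
 show ?thesis
 proof (rule Min_eqI)
  show "finite S" by (rule S_fin)
  show "(2 ^ sg * \<bar>ls ! 0\<bar>)\<^sup>2 \<in> S" unfolding S_def pw using l0 by auto
  fix y assume "y \<in> S"
  then obtain i where i: "i < length ls" "y = (2 ^ sg * \<bar>ls ! i\<bar>)\<^sup>2" unfolding S_def pw by (auto simp: in_set_conv_nth)
  have "\<bar>ls ! 0\<bar> <= \<bar>ls ! i\<bar>" using sorted_nth_mono[OF srt, of 0 i] i l0 by simp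
  thus "(2 ^ sg * \<bar>ls ! 0\<bar>)\<^sup>2 <= y" unfolding i by (intro power_mono mult_left_mono) auto
 qed
qed

lemma T_le: "T <= 16 * (n * (H * H))"
proof -
 have "B <= H" using H_parts unfolding par_lin distrib_left using le0[of "cc * b"] by linarith
 have x: "(3 * cc + 40) * b = 3 * (cc * b) + 40 * b" by (simp add: algebra_simps)
 have z: "ZB + (3 * cc + 40) * b <= 2 * H" unfolding par_lin x using H_parts by linarith
 have "NB + (3 * cc + 40) * b <= n * (ZB + (3 * cc + 40) * b)"
 proof -
  have "1 * ((3 * cc + 40) * b) <= n * ((3 * cc + 40) * b)" using n0 by (rule mult_le_mono1)
  thus ?thesis by (simp add: NB_def distrib_left mult.commute)
 qed
 also have "... <= n * (2 * H)" using z by (rule mult_le_mono2)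
 finally have "T <= 8 * H * (n * (2 * H))" unfolding T_def using \<open>B <= H\<close> by (intro mult_le_mono) auto
 thus ?thesis by (simp add: algebra_simps)
qed

text \<open>Half of \<open>1 / 2 ^ (b * cc)\<close> is granted to the evaluations and half to the
  start vector; the whole is at most \<open>n powr (- c)\<close> because \<open>n < 2 ^ b\<close>
  and \<open>c <= cc\<close>.\<close>

lemma failure: "real ((J + 1) * (512 * b * (b + 1))) * (1 / 2 ^ ((3 * cc + 40) * b)) + real n / 2 ^ K <= real n powr (- c)"
proof -
 have b2: "2 <= b" by (rule b_facts)
 have cb: "2 * cc <= cc * b" using b2 by (simp add: mult.commute)
 have "J + 1 <= (2 * cc + 43) * b" unfolding par_lin using b2 by (simp add: algebra_simps)
 also have "... <= 2 ^ (2 * cc + 43) * 2 ^ b" using less_exp[of "2 * cc + 43"] less_exp[of b] by (intro mult_le_mono) auto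
 finally have 1: "J + 1 <= 2 ^ (2 * cc + 43) * 2 ^ b" .
 have b1: "b + 1 <= 2 ^ b" using less_exp[of b] by linarith
 have "512 * b * (b + 1) <= 2 ^ 9 * 2 ^ b * 2 ^ b" by (intro mult_le_mono b1 less_imp_le[OF less_exp]) simp
 hence "(J + 1) * (512 * b * (b + 1)) <= (2 ^ (2 * cc + 43) * 2 ^ b) * (2 ^ 9 * 2 ^ b * 2 ^ b)" using 1 by - (assumption | rule mult_le_mono)+
 also have "... = 2 ^ (2 * cc + 43 + b + (9 + b + b))" by (simp only: power_add)
 finally have "real ((J + 1) * (512 * b * (b + 1))) <= real (2 ^ (2 * cc + 43 + b + (9 + b + b)))" by (simp only: of_nat_le_iff)
 hence "real ((J + 1) * (512 * b * (b + 1))) * (1 / 2 ^ ((3 * cc + 40) * b)) <= 2 ^ (2 * cc + 43 + b + (9 + b + b)) / 2 ^ ((3 * cc + 40) * b)"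
  by (simp add: divide_right_mono)
 also have "... <= 1 / 2 ^ (b * cc + 1)"
 proof -
  have e: "(3 * cc + 40) * b = 3 * (cc * b) + 40 * b" by (simp add: algebra_simps)
  have "2 * cc + 43 + b + (9 + b + b) + (b * cc + 1) <= (3 * cc + 40) * b" unfolding e mult.commute[of b cc] using cb b2 by linarith
  hence "(2::real) ^ (2 * cc + 43 + b + (9 + b + b) + (b * cc + 1)) <= 2 ^ ((3 * cc + 40) * b)" by (intro power_increasing) auto
  thus ?thesis by (simp add: field_simps power_add)
 qed
 finally have A: "real ((J + 1) * (512 * b * (b + 1))) * (1 / 2 ^ ((3 * cc + 40) * b)) <= 1 / 2 ^ (b * cc + 1)" .
 have "real n < real (2 ^ b)" using b_facts(6) by (simp only: of_nat_less_iff)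
 hence "real n / 2 ^ K <= 2 ^ b / 2 ^ K" by (intro divide_right_mono) auto
 also have "... <= 1 / 2 ^ (b * cc + 1)"
 proof -
  have "b + (b * cc + 1) <= K" unfolding par_lin mult.commute[of b cc] using b2 by linarith
  hence "(2::real) ^ (b + (b * cc + 1)) <= 2 ^ K" by (intro power_increasing) auto
  thus ?thesis by (simp add: field_simps power_add)
 qed
 finally have "real n / 2 ^ K <= 1 / 2 ^ (b * cc + 1)" .
 moreover have "1 / 2 ^ (b * cc + 1) + 1 / 2 ^ (b * cc + 1) = 1 / (2::real) ^ (b * cc)" by simp
 ultimately show ?thesis using A low by linarith
qed

text \<open>With \<open>t = n U / \<epsilon>\<close>, the bound \<open>2 ^ b <= (2 + t) ^ 5\<close>
  follows since \<open>W\<close> is at most quadratic in \<open>n U\<close> and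
  \<open>2 ^ je\<close> lies below \<open>1 / \<epsilon>\<close>; minimality of \<open>b\<close>
  enters through \<open>2 ^ b <= 2 V\<close>.\<close>

lemma H_le: "real H <= 7 * (20 * real cc + 600) * log_size n U \<epsilon> \<delta>" "1 <= log_size n U \<epsilon> \<delta>"
proof -
 define t where "t = real n * U / \<epsilon>"
 define L where "L = log_size n U \<epsilon> \<delta>"
 have n1: "1 <= real n" using n0 by simp
 have nU: "real n <= real n * U" using U1 n1 by simp
 have nUt: "real n * U <= t" unfolding t_def using eps nU n1 by (simp add: field_simps)
 have t1: "1 <= t" using nUt nU n1 by linarith
 have Lv: "L = log 2 (2 + t + \<delta>)" by (simp add: L_def log_size_def t_def)
 have L1: "log 2 (2 + t) <= L" "log 2 (\<delta> + 2) <= L" unfolding Lv using t1 delta_pos by (intro log_mono; simp)+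
 have "1 = log 2 (2::real)" by simp
 also have "... <= log 2 (2 + t)" using t1 by (intro log_mono) auto
 finally have L0: "1 <= L" using L1 by linarith
 have je2: "2 ^ (je + 1) <= 2 / \<epsilon>" using je_facts(2) eps by (simp add: field_simps)
 have "real_of_int (2 ^ b) <= real_of_int (2 * V)" using b_facts(4) by (simp only: of_int_le_iff)
 hence "2 ^ b <= 2 * (real_of_int W * real n * 2 ^ (je + 1))" by (simp add: V_def)
 also have "... <= 2 * ((1 + (real n * U)\<^sup>2) * real n * (2 / \<epsilon>))"
  using W_bounds(1,2) je2 by (intro mult_left_mono mult_mono) auto
 also have "... = 4 * (1 + (real n * U)\<^sup>2) * (real n / \<epsilon>)" by simp
 also have "... <= 4 * (1 + t\<^sup>2) * t"
 proof (intro mult_mono add_left_mono power_mono)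
  show "real n / \<epsilon> <= t" unfolding t_def using nU eps by (intro divide_right_mono) auto
 qed (use nUt n1 U1 eps in auto)
 also have "... <= (2 + t)\<^sup>2 * (2 + t)\<^sup>2 * (2 + t)"
  using t1 by (intro mult_mono) (auto simp: power2_eq_square algebra_simps)
 also have "... = (2 + t) ^ 5" by (simp add: power_add[symmetric] flip: power_Suc2)
 finally have "2 ^ b <= (2 + t) ^ 5" .
 hence "log 2 (2 ^ b) <= log 2 ((2 + t) ^ 5)" using t1 by (intro log_mono) auto
 hence "real b <= 5 * log 2 (2 + t)" using t1 by (simp add: log_nat_power)
 hence "real b + real dl <= 7 * L" using L1 L0 dl_facts(3) by linarith
 hence "(20 * real cc + 600) * (real b + real dl) <= (20 * real cc + 600) * (7 * L)" by (intro mult_left_mono) auto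
 thus "real H <= 7 * (20 * real cc + 600) * log_size n U \<epsilon> \<delta>" unfolding H_def L_def[symmetric] by (simp add: algebra_simps)
 show "1 <= log_size n U \<epsilon> \<delta>" using L0 by (simp add: L_def)
qed

lemma main:
 defines "P \<equiv> comp 0 (alg4.Prog cc)" and "\<kappa> \<equiv> 7 * (20 * real cc + 600)"
 shows "measure coins {\<omega>. \<exists>v. outputs P X \<omega> v & v >= 0 & approx_eps \<epsilon> v (max \<delta> \<bar>ls ! 0\<bar>)} >= 1 - real n powr (- c)"
  and "runs_within P X \<omega> (12000000000 * \<kappa> ^ 8 * (real n ^ 2 * (real (nnz A) + real n) / \<epsilon>) * log_size n U \<epsilon> \<delta> ^ 8)
   (12000000000 * \<kappa> ^ 8 * (real n * log_size n U \<epsilon> \<delta>))"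
proof -
 interpret alg4 X H "n * H" n gd A ls "2 ^ (2 * sg)" z b B ZB sg K NB T J by (rule alg_inst)
 have sub: "B <= H" "b <= H" "J <= H" "sg <= H" "K <= H" "je <= H" "ZB <= H"
  using H_parts b_facts(7) unfolding par_lin distrib_left using le0[of "cc * b"] by linarith+
 have "eta <= 1 / 2 ^ ((3 * cc + 40) * b)" by (rule eta_le) (rule T_def)
 hence "real NE * eta <= real NE * (1 / 2 ^ ((3 * cc + 40) * b))" by (intro mult_left_mono) auto
 hence p: "real NE * eta + real n / 2 ^ K <= real n powr (- c)" using failure by (simp add: NE_def)
 have gI: "gd m" if h: "0 <= R" "R * R <= max 0 y" "y < (R + 1) * (R + 1)" "real_of_int y < Min S" "Min S - real_of_int y < 256 * real b"
  "m 0 = max R \<lfloor>\<delta> * 2 ^ sg\<rfloor>" "m 1 = 2 ^ sg" for m :: memory and R y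
 proof -
  have d: "1 / 2 ^ (b * cc) <= \<delta>" using low del by linarith
  have "approx_eps \<epsilon> (real_of_int (max R \<lfloor>\<delta> * 2 ^ sg\<rfloor>) / 2 ^ sg) (max \<delta> \<bar>ls ! 0\<bar>)"
   by (rule output_accuracy[OF b2 sg_def eps eps_b d _ h(1-3)]) (use h(4,5) Min_S in auto)
  thus ?thesis using h unfolding gd_def by simp
 qed
 have zS: "int z < 2 ^ H"
 proof -
  have "z <= card ({..<n} \<times> {..<n})"
   using z_nnz card_mono[OF _ nzp(2)] unfolding nnz_def by (meson finite_SigmaI finite_lessThan le_trans)
  also have "... <= 2 ^ b * 2 ^ b" unfolding card_cartesian_product card_lessThan using nb by (intro mult_le_mono) auto
  also have "... = 2 ^ (b + b)" by (simp add: power_add)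
  also have "... < 2 ^ H" using H_parts b2 by (intro power_strict_increasing) auto
  finally have "int z < int (2 ^ H)" by (simp only: of_nat_less_iff)
  thus ?thesis by simp
 qed
 have ho: "hoare (Prog cc) (%_. 0) (tP je) (real n powr (- c)) (%m' q. 0 <= q & (gd m' \<or> 1 <= q))"
  by (rule Prog_spec[where dl = dl and \<delta> = \<delta>])
   (use sg_def B_def K_def J_def ZB_def T_def H_def cap X0 je_facts b_facts zS delta_pos dl_facts(1) row_sums gI p in
    \<open>auto simp: V_def W_def less_imp_le\<close>)
 have bok0: "bok (%_. 0)" by (simp add: bok_def)
 \<comment> \<open>Nothing follows the compiled program, so every branch closes by halting: success
   goes with any nonnegative budget, a conceded failure with a budget of at least 1.\<close>
 have ok: "ok P X bok gd (0, %_. 0) (0 + tP je) (real n powr (- c))"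
 proof (rule hoareD[OF ho bok0])
  show "loaded P 0 (comp 0 (Prog cc))" by (simp add: loaded_def P_def)
  fix m' and q :: real assume "bok m'" "0 <= q & (gd m' \<or> 1 <= q)"
  thus "ok P X bok gd (0 + length (comp 0 (Prog cc)), m') 0 q" by (intro ok.halt) (auto simp: halted_def P_def)
 qed
 define L where "L = log_size n U \<epsilon> \<delta>"
 have HL: "real H <= \<kappa> * L" "1 <= L" using H_le by (auto simp: \<kappa>_def L_def)
 have k1: "1 <= \<kappa>" by (simp add: \<kappa>_def)
 have NBH: "NB <= n * H" unfolding NB_def using sub(7) by (simp add: mult.commute)
 have "real (tP je) <= real (12000000000 * (n * n * (z + n) * (H * H * H * H * H * H * H * H)))"
  unfolding of_nat_le_iff by (rule tP_le) (use NBH T_le sub in auto)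
 also have "... = 12000000000 * (real n ^ 2 * (real z + real n) * real H ^ 8)"
 proof -
  have "real H ^ 8 = real H * real H * real H * real H * real H * real H * real H * real H" by (simp add: eval_nat_numeral)
  thus ?thesis by (simp add: power2_eq_square)
 qed
 also have "... <= 12000000000 * ((real n ^ 2 * (real (nnz A) + real n) / \<epsilon>) * (\<kappa> * L) ^ 8)"
 proof (intro mult_left_mono mult_mono power_mono)
  have a: "0 <= real n ^ 2 * (real (nnz A) + real n)" by simp
  have "real n ^ 2 * (real z + real n) <= real n ^ 2 * (real (nnz A) + real n)" using z_nnz by (intro mult_left_mono) auto
  also have "... <= real n ^ 2 * (real (nnz A) + real n) / \<epsilon>" using a eps by (simp add: le_divide_eq mult_left_le)
  finally show "real n ^ 2 * (real z + real n) <= real n ^ 2 * (real (nnz A) + real n) / \<epsilon>" .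
 qed (use HL eps in auto)
 finally have tb: "real (0 + tP je) <= 12000000000 * \<kappa> ^ 8 * (real n ^ 2 * (real (nnz A) + real n) / \<epsilon>) * L ^ 8"
  by (simp add: power_mult_distrib mult_ac)
 have mb: "real (memory_bits m) <= 12000000000 * \<kappa> ^ 8 * (real n * L)" if "bok m" for m
 proof -
  have h1: "1 <= H" using H_parts by linarith
  have "memory_bits m <= (64 + 8 * n) * (2 * H + 2) + 8 * (n * H + 1)" by (rule memory_bits_le[OF that])
  also have "... <= (72 * n) * (4 * H) + 16 * (n * H)"
  proof (rule add_mono)
   show "(64 + 8 * n) * (2 * H + 2) <= (72 * n) * (4 * H)" by (rule mult_le_mono) (use n0 h1 in linarith)+
   have "1 <= n * H" using n0 h1 by simp
   thus "8 * (n * H + 1) <= 16 * (n * H)" unfolding distrib_left by linarith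
  qed
  also have "... = 304 * (n * H)" by simp
  finally have "real (memory_bits m) <= real (304 * (n * H))" by (simp only: of_nat_le_iff)
  also have "... = 304 * (real n * real H)" by simp
  also have "... <= 304 * (real n * (\<kappa> * L))" using HL by (intro mult_left_mono) auto
  also have "... = 304 * \<kappa> * (real n * L)" by simp
  also have "... <= 12000000000 * \<kappa> ^ 8 * (real n * L)"
  proof (intro mult_right_mono mult_mono)
   show "\<kappa> <= \<kappa> ^ 8" using power_increasing[of 1 8 \<kappa>] k1 by simp
  qed (use k1 HL in auto)
  finally show ?thesis .
 qed
 note snd = ok_sound[OF ok mb tb]
 show "runs_within P X \<omega> (12000000000 * \<kappa> ^ 8 * (real n ^ 2 * (real (nnz A) + real n) / \<epsilon>) * log_size n U \<epsilon> \<delta> ^ 8)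
   (12000000000 * \<kappa> ^ 8 * (real n * log_size n U \<epsilon> \<delta>))"
  using snd(1)[of \<omega>] unfolding L_def .
 have "{\<omega>. \<exists>v. outputs P X \<omega> v & v >= 0 & approx_eps \<epsilon> v (max \<delta> \<bar>ls ! 0\<bar>)} =
  {\<omega>. \<exists>\<tau>. halted P (run P X \<omega> \<tau>) & gd (snd (run P X \<omega> \<tau>))}"
  unfolding outputs_def gd_def by auto
 thus "measure coins {\<omega>. \<exists>v. outputs P X \<omega> v & v >= 0 & approx_eps \<epsilon> v (max \<delta> \<bar>ls ! 0\<bar>)} >= 1 - real n powr (- c)"
  using snd(2) by simp
qed

end

theorem theorem7p1:
 fixes c :: real
 assumes "c > 0"
 shows "\<exists>(P :: instr list) (C :: real) (k :: nat).
  \<forall>(n :: nat) (U :: real) (\<epsilon> :: real) (\<delta> :: real) (A :: real mat)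
   (es :: (nat \<times> nat \<times> int) list) (ls :: real list).
   n >= 1 & U >= 1 & 0 < \<epsilon> & \<epsilon> < 1 & \<delta> >= real n powr (- c) &
   A \<in> carrier_mat n n & transpose_mat A = A &
   (\<forall>i<n. \<forall>j<n. A $$ (i, j) \<in> \<int> & - U <= A $$ (i, j) & A $$ (i, j) <= U) &
   sparse_rep A es & eigenvalues_by_modulus A ls
   -->
   measure coins {\<omega>. \<exists>v. outputs P (encode_input n \<epsilon> \<delta> es) \<omega> v & v >= 0 &
             approx_eps \<epsilon> v (max \<delta> \<bar>ls ! 0\<bar>)}
    >= 1 - real n powr (- c) &
   (\<forall>\<omega>. runs_within P (encode_input n \<epsilon> \<delta> es) \<omega>
       (C * (real n ^ 2 * (real (nnz A) + real n) / \<epsilon>) * log_size n U \<epsilon> \<delta> ^ k)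
       (C * (real n * log_size n U \<epsilon> \<delta>)))"
proof -
 \<comment> \<open>Only the ceiling of \<open>c\<close> enters the program, which is thereby fixed
   before \<open>n\<close>, \<open>A\<close> and the other data.\<close>
 define k where "k = nat \<lceil>c\<rceil>"
 have main: "measure coins {\<omega>. \<exists>v. outputs (comp 0 (alg4.Prog k)) (encode_input n \<epsilon> \<delta> es) \<omega> v & v >= 0 &
     approx_eps \<epsilon> v (max \<delta> \<bar>ls ! 0\<bar>)} >= 1 - real n powr (- c) &
   (\<forall>\<omega>. runs_within (comp 0 (alg4.Prog k)) (encode_input n \<epsilon> \<delta> es) \<omega>
       (12000000000 * (7 * (20 * real k + 600)) ^ 8 * (real n ^ 2 * (real (nnz A) + real n) / \<epsilon>) * log_size n U \<epsilon> \<delta> ^ 8)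
       (12000000000 * (7 * (20 * real k + 600)) ^ 8 * (real n * log_size n U \<epsilon> \<delta>)))"
  if "n >= 1 & U >= 1 & 0 < \<epsilon> & \<epsilon> < 1 & \<delta> >= real n powr (- c) &
   A \<in> carrier_mat n n & transpose_mat A = A &
   (\<forall>i<n. \<forall>j<n. A $$ (i, j) \<in> \<int> & - U <= A $$ (i, j) & A $$ (i, j) <= U) &
   sparse_rep A es & eigenvalues_by_modulus A ls"
  for n :: nat and U \<epsilon> \<delta> :: real and A :: "real mat" and es ls
 proof -
  interpret inst c \<epsilon> \<delta> U n A es ls by unfold_locales (use that assms in auto)
  have k: "cc = k" by (simp add: cc_def k_def)
  show ?thesis using main unfolding k X_def by blast
 qed
 show ?thesis by (intro exI allI impI) (rule main)
qed

end
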